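(* Let $n\ge 3$, $N=B(0,2)\subset\mathbb R^n$, $N_1=B(0,2)\setminus\overline B(0,1)$, $N_2=B(0,1)$. Let $F_1:B(0,2)\setminus\{0\}\to N_1$, $F_1(x)=\left(\frac{|x|}{2}+1\right)\frac{x}{|x|}$, let $g_0$ be the Euclidean metric and $\widetilde g=(F_1)_*g_0$ on $N_1$. Define the conductivity $\widetilde\sigma$ on $N$ by $\widetilde\sigma^{jk}=|\widetilde g|^{1/2}\widetilde g^{jk}$ on $N_1$ and $\widetilde\sigma^{jk}=a^{jk}$ on $N_2$, where $a=(a^{jk})$ is an arbitrary smooth symmetric matrix function on $\overline{N_2}$ bounded above and below by positive multiples of the identity. Let $\gamma\equiv 1$ (i.e. $\gamma^{jk}=\delta^{jk}$) on $N$. Then $C_1(\widetilde\sigma)=C_1(\gamma)$, i.e. the Dirichlet-to-Neumann data of $\widetilde\sigma$ and of the homogeneous isotropic conductivity coincide on $\partial N$.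
   Context: For a (possibly degenerate) symmetric matrix-valued conductivity $\sigma$ on $N$ that is smooth and positive definite near $\partial N$, the Cauchy data set of $H^1$ solutions is $C_1(\sigma)=\{(u|_{\partial N},\ \nu\cdot\sigma\nabla u|_{\partial N}) : u\in H^1(N),\ \nabla\cdot\sigma\nabla u=0\}$, where $\nabla\cdot\sigma\nabla u=\sum_{j,k}\partial_j(\sigma^{jk}\partial_k u)=0$ is understood in the sense of distributions on $N$ and $\nu$ is the Euclidean unit outer normal to $\partial N$. The push-forward of a metric $g$ by a map $F$ is $(F_*g)_{jk}(y)=\sum_{p,q}\frac{\partial (F^{-1})^p}{\partial y^j}\frac{\partial (F^{-1})^q}{\partial y^k}g_{pq}(F^{-1}(y))$, $|\widetilde g|=\det(\widetilde g_{jk})$ and $(\widetilde g^{jk})$ is the inverse matrix. In spherical coordinates for $n=3$, $\widetilde\sigma$ on $N_1$ equals $\mathrm{diag}(2(r-1)^2\sin\theta,\ 2\sin\theta,\ 2(\sin\theta)^{-1})$; it is not bounded below by a positive multiple of the identity as $r\to1^+$. *)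

theory Defs
  imports "HOL-Analysis.Analysis"
begin

definition partial_deriv :: "(real^'n \<Rightarrow> real) \<Rightarrow> 'n \<Rightarrow> real^'n \<Rightarrow> real" where
  "partial_deriv f i x = frechet_derivative f (at x) (axis i 1)"

definition grad :: "(real^'n \<Rightarrow> real) \<Rightarrow> real^'n \<Rightarrow> real^'n" where
  "grad f x = (\<chi> i. partial_deriv f i x)"

fun Ck_on :: "nat \<Rightarrow> (real^'n) set \<Rightarrow> (real^'n \<Rightarrow> real) \<Rightarrow> bool" where
  "Ck_on 0 S f = continuous_on S f"
| "Ck_on (Suc k) S f = (continuous_on S f \<and> (\<forall>x\<in>S. f differentiable (at x)) \<and>
      (\<forall>i. Ck_on k S (partial_deriv f i)))"

definition smooth_on :: "(real^'n) set \<Rightarrow> (real^'n \<Rightarrow> real) \<Rightarrow> bool" where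
  "smooth_on S f \<longleftrightarrow> (\<forall>k. Ck_on k S f)"

definition test_fun :: "(real^'n) set \<Rightarrow> (real^'n \<Rightarrow> real) \<Rightarrow> bool" where
  "test_fun N \<phi> \<longleftrightarrow> smooth_on UNIV \<phi> \<and> compact (closure {x. \<phi> x \<noteq> 0})
      \<and> closure {x. \<phi> x \<noteq> 0} \<subseteq> N"

definition L2_on :: "(real^'n) set \<Rightarrow> (real^'n \<Rightarrow> real) \<Rightarrow> bool" where
  "L2_on N f \<longleftrightarrow> set_borel_measurable lebesgue N f \<and> set_integrable lebesgue N (\<lambda>x. (f x)\<^sup>2)"

definition is_weak_grad :: "(real^'n) set \<Rightarrow> (real^'n \<Rightarrow> real) \<Rightarrow> (real^'n \<Rightarrow> real^'n) \<Rightarrow> bool" where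
  "is_weak_grad N u G \<longleftrightarrow> (\<forall>i. L2_on N (\<lambda>x. G x $ i)) \<and>
     (\<forall>\<phi>. test_fun N \<phi> \<longrightarrow> (\<forall>i.
        (LINT x:N|lebesgue. u x * partial_deriv \<phi> i x) = - (LINT x:N|lebesgue. G x $ i * \<phi> x)))"

definition H1 :: "(real^'n) set \<Rightarrow> (real^'n \<Rightarrow> real) \<Rightarrow> bool" where
  "H1 N u \<longleftrightarrow> L2_on N u \<and> (\<exists>G. is_weak_grad N u G)"

definition wgrad :: "(real^'n) set \<Rightarrow> (real^'n \<Rightarrow> real) \<Rightarrow> real^'n \<Rightarrow> real^'n" where
  "wgrad N u = (SOME G. is_weak_grad N u G)"

definition H1_0 :: "(real^'n) set \<Rightarrow> (real^'n \<Rightarrow> real) \<Rightarrow> bool" where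
  "H1_0 N u \<longleftrightarrow> H1 N u \<and> (\<exists>\<phi>s. (\<forall>k. test_fun N (\<phi>s k)) \<and>
     (\<lambda>k. LINT x:N|lebesgue. (u x - \<phi>s k x)\<^sup>2 + (norm (wgrad N u x - grad (\<phi>s k) x))\<^sup>2)
        \<longlonglongrightarrow> 0)"

definition weak_sol :: "(real^'n) set \<Rightarrow> (real^'n \<Rightarrow> real^'n^'n) \<Rightarrow> (real^'n \<Rightarrow> real) \<Rightarrow> bool" where
  "weak_sol N \<sigma> u \<longleftrightarrow> H1 N u \<and> (\<forall>\<phi>. test_fun N \<phi> \<longrightarrow>
      set_integrable lebesgue N (\<lambda>x. (\<sigma> x *v wgrad N u x) \<bullet> grad \<phi> x) \<and>
      (LINT x:N|lebesgue. (\<sigma> x *v wgrad N u x) \<bullet> grad \<phi> x) = 0)"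

text \<open>Dirichlet datum \<open>u|\<partial>N\<close>, represented by the class of \<open>u\<close> in \<open>H^1(N)/H^1_0(N)\<close>
  (the trace space; the trace operator has kernel \<open>H^1_0(N)\<close>).\<close>
definition dirichlet_datum :: "(real^'n) set \<Rightarrow> (real^'n \<Rightarrow> real) \<Rightarrow> (real^'n \<Rightarrow> real) set" where
  "dirichlet_datum N u = {w. H1 N w \<and> H1_0 N (\<lambda>x. w x - u x)}"

text \<open>Neumann datum \<open>\<nu>\<cdot>\<sigma>\<nabla>u|\<partial>N\<close>, in the weak (Green's formula) sense: its pairing with the
  boundary values of a function \<open>\<Phi>\<close> smooth up to the boundary is \<open>\<integral>_N \<sigma>\<nabla>u\<cdot>\<nabla>\<Phi>\<close>.\<close>
definition neumann_datum :: "(real^'n) set \<Rightarrow> (real^'n \<Rightarrow> real^'n^'n) \<Rightarrow> (real^'n \<Rightarrow> real)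
    \<Rightarrow> (real^'n \<Rightarrow> real) \<Rightarrow> real" where
  "neumann_datum N \<sigma> u = (\<lambda>\<Phi>. if smooth_on UNIV \<Phi>
      then (LINT x:N|lebesgue. (\<sigma> x *v wgrad N u x) \<bullet> grad \<Phi> x) else 0)"

definition cauchy_data :: "(real^'n) set \<Rightarrow> (real^'n \<Rightarrow> real^'n^'n)
    \<Rightarrow> ((real^'n \<Rightarrow> real) set \<times> ((real^'n \<Rightarrow> real) \<Rightarrow> real)) set" where
  "cauchy_data N \<sigma> = {(dirichlet_datum N u, neumann_datum N \<sigma> u) | u. weak_sol N \<sigma> u}"

definition push_forward :: "(real^'n \<Rightarrow> real^'n) \<Rightarrow> (real^'n \<Rightarrow> real^'n^'n) \<Rightarrow> real^'n \<Rightarrow> real^'n^'n" where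
  "push_forward Finv g y =
     transpose (jacobian Finv (at y)) ** g (Finv y) ** jacobian Finv (at y)"

definition F1 :: "real^'n \<Rightarrow> real^'n" where
  "F1 x = (norm x / 2 + 1) *\<^sub>R (x /\<^sub>R norm x)"

definition g0 :: "real^'n \<Rightarrow> real^'n^'n" where
  "g0 x = mat 1"

definition N1 :: "(real^'n) set" where "N1 = ball 0 2 - cball 0 1"
definition N2 :: "(real^'n) set" where "N2 = ball 0 1"

definition gtilde :: "real^'n \<Rightarrow> real^'n^'n" where
  "gtilde = push_forward (the_inv_into (ball 0 2 - {0}) F1) g0"

text \<open>\<open>\<sigma>~\<close>; its value on the null set \<open>|x| = 1\<close> (and outside \<open>N\<close>) is irrelevant.\<close>
definition sigma_tilde :: "(real^'n \<Rightarrow> real^'n^'n) \<Rightarrow> real^'n \<Rightarrow> real^'n^'n" where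
  "sigma_tilde a x = (if x \<in> N1 then sqrt (det (gtilde x)) *\<^sub>R matrix_inv (gtilde x)
                      else if x \<in> N2 then a x else mat 1)"

end

theory Submission
  imports Defs "HOL-Computational_Algebra.Polynomial"
begin

text \<open>The map \<open>F1\<close> blows the origin up to the unit sphere and fixes the sphere of radius \<open>2\<close>; composition
  with it turns the energy form of the cloaking conductivity on \<open>N1\<close> into the Dirichlet form on the
  punctured ball, so solutions correspond there, and only the origin and the unit sphere need care.
  If \<open>u\<close> solves the cloaking equation, then \<open>u \<circ> F1\<close> is weakly harmonic on the punctured ball with
  finite energy, and a point has zero capacity when \<open>n \<ge> 3\<close>, so it is harmonic on the whole ball.
  Conversely, a harmonic \<open>v\<close> is smooth at the origin by Weyl's lemma, so its transplant to \<open>N1\<close> tends to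
  \<open>v 0\<close> at the unit sphere; extended by this constant to \<open>N2\<close> it is in \<open>H1\<close> and its flux vanishes on
  both sides of the sphere, whatever \<open>a\<close> is. Since \<open>F1\<close> is the identity on the outer boundary,
  corresponding solutions differ by an \<open>H1_0\<close> function, and the flux pairings agree because \<open>\<Phi>\<close> and
  \<open>\<Phi> \<circ> F1\<close> agree on the boundary.\<close>

text \<open>The condition n >= 3 acts at both singular places. At y in \<open>N1\<close>, with s =
  2(|y| - 1), the derivative of \<open>F1\<close> grows like 1/s in tangential directions while the
  inverse Jacobian decays like s^(n-1); since n - 1 >= 2, the conductivity stays bounded and every
  H1 function has finite energy. Likewise cutoffs at the origin, with gradient about k on a ball of
  radius about 1/k, lose their energy in the limit. The converse passage cannot rest on energies:
  the conductivity degenerates radially at the unit sphere, so finite energy does not bound the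
  Euclidean gradient there, and regularity at the origin is what puts the transplant in H1. Boundary
  values are cosets of \<open>H1_0\<close>, so equal Dirichlet data means exhibiting test functions
  that approximate the difference together with its gradient. The definitions use a chosen gradient
  \<open>wgrad\<close> and Lebesgue measurable functions; the analysis runs on Borel functions
  paired with explicit weak gradients, and almost everywhere uniqueness of weak gradients links the
  two levels.\<close>

section \<open>Gradients and k times continuously differentiable functions\<close>

lemma partial_deriv_eq:
  "(f has_derivative f') (at x) \<Longrightarrow> partial_deriv f i x = f' (axis i 1)"
  by (simp add: partial_deriv_def frechet_derivative_at[symmetric])

lemma linear_eq_inner_grad:
  fixes L :: "real^'n \<Rightarrow> real"
  assumes "linear L" shows "L h = h \<bullet> (\<chi> i. L (axis i 1))"
proof -
  have "L h = L (\<Sum>i\<in>UNIV. h$i *\<^sub>R axis i 1)"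
    by (simp add: basis_expansion scalar_mult_eq_scaleR[symmetric])
  also have "\<dots> = (\<Sum>i\<in>UNIV. h$i * L (axis i 1))"
    by (simp add: linear_sum[OF assms] linear_scale[OF assms])
  finally show ?thesis by (simp add: inner_vec_def)
qed

lemma has_derivative_grad:
  "f differentiable (at x) \<Longrightarrow> (f has_derivative (\<lambda>h. h \<bullet> grad f x)) (at x)"
proof -
  assume "f differentiable (at x)"
  then have d: "(f has_derivative frechet_derivative f (at x)) (at x)"
    by (simp add: frechet_derivative_works)
  have "frechet_derivative f (at x) = (\<lambda>h. h \<bullet> grad f x)"
    by (rule ext, subst linear_eq_inner_grad[OF has_derivative_linear[OF d]])
       (simp add: grad_def partial_deriv_def)
  with d show ?thesis by simp
qed

lemma grad_eqI: "(f has_derivative (\<lambda>h. h \<bullet> g)) (at x) \<Longrightarrow> grad f x = g"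
  by (simp add: grad_def vec_eq_iff partial_deriv_eq inner_axis' )

lemma grad_component [simp]: "grad f x $ i = partial_deriv f i x"
  by (simp add: grad_def)

lemma partial_deriv_cong_open:
  assumes "open S" "x \<in> S" "\<And>y. y \<in> S \<Longrightarrow> f y = g y" "f differentiable at x"
  shows "partial_deriv g i x = partial_deriv f i x"
  using frechet_derivative_transform_within_open[OF assms(4,1,2)] assms(3)
  by (metis partial_deriv_def)

lemma differentiable_cong_open:
  assumes "open S" "x \<in> S" "\<And>y. y \<in> S \<Longrightarrow> f y = g y" "f differentiable at x"
  shows "g differentiable at x"
  using assms by (meson differentiable_def has_derivative_transform_within_open)

text \<open>On an open set derivatives at a point depend only on nearby values. The inductions below
  use this to replace a partial derivative, whose values off \<open>S\<close> are arbitrary, by the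
  formula valid on \<open>S\<close>.\<close>

lemma Ck_on_cong_open:
  assumes "open S" "Ck_on k S f" "\<And>y. y \<in> S \<Longrightarrow> f y = g y"
  shows "Ck_on k S g"
  using assms(2,3)
proof (induction k arbitrary: f g)
  case 0
  then show ?case by (auto cong: continuous_on_cong_simp intro: continuous_on_eq)
next
  case (Suc k)
  have c: "continuous_on S g" using Suc.prems by (auto intro: continuous_on_eq)
  have d: "g differentiable (at x)" if "x \<in> S" for x
    using differentiable_cong_open[OF assms(1) that, of f g] Suc.prems that by auto
  have "Ck_on k S (partial_deriv g i)" for i
    by (rule Suc.IH[of "partial_deriv f i"])
       (use Suc.prems partial_deriv_cong_open[OF assms(1), of _ f g] in auto)
  with c d show ?case by auto
qed

lemma Ck_on_Suc_imp: "Ck_on (Suc k) S f \<Longrightarrow> Ck_on k S f"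
  by (induction k arbitrary: f) auto

lemma Ck_on_subset: "Ck_on k S f \<Longrightarrow> T \<subseteq> S \<Longrightarrow> Ck_on k T f"
  by (induction k arbitrary: f) (auto intro: continuous_on_subset)

text \<open>Differentiability is a condition at single points, so only continuity has to be glued,
  and for that both sets must be open.\<close>

lemma Ck_on_Un:
  "open S \<Longrightarrow> open T \<Longrightarrow> Ck_on k S f \<Longrightarrow> Ck_on k T f \<Longrightarrow> Ck_on k (S \<union> T) f"
  by (induction k arbitrary: f) (auto intro: continuous_on_open_Un)

lemma partial_deriv_const [simp]: "partial_deriv (\<lambda>x. c) i = (\<lambda>x. 0)"
  by (rule ext, subst partial_deriv_eq[OF has_derivative_const]) simp

lemma Ck_on_const [simp]: "Ck_on k S (\<lambda>x. c)"
  by (induction k arbitrary: c) auto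

lemma Ck_on_add:
  assumes "open S" "Ck_on k S f" "Ck_on k S g"
  shows "Ck_on k S (\<lambda>x. f x + g x)"
  using assms(2,3)
proof (induction k arbitrary: f g)
  case 0
  then show ?case by (auto intro: continuous_intros)
next
  case (Suc k)
  have "Ck_on k S (partial_deriv (\<lambda>x. f x + g x) i)" for i
  proof (rule Ck_on_cong_open[OF assms(1), of k "\<lambda>x. partial_deriv f i x + partial_deriv g i x"])
    show "Ck_on k S (\<lambda>x. partial_deriv f i x + partial_deriv g i x)"
      using Suc.prems by (intro Suc.IH) auto
    fix y assume "y \<in> S"
    then have "f differentiable at y" "g differentiable at y" using Suc.prems by auto
    note d = has_derivative_add[OF this[THEN has_derivative_grad]]
    show "partial_deriv f i y + partial_deriv g i y = partial_deriv (\<lambda>x. f x + g x) i y"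
      by (simp add: partial_deriv_eq[OF d] inner_axis')
  qed
  with Suc.prems show ?case by (auto intro: continuous_intros)
qed

lemma Ck_on_mult:
  assumes "open S" "Ck_on k S f" "Ck_on k S g"
  shows "Ck_on k S (\<lambda>x. f x * g x)"
  using assms(2,3)
proof (induction k arbitrary: f g)
  case 0
  then show ?case by (auto intro: continuous_intros)
next
  case (Suc k)
  have "Ck_on k S (partial_deriv (\<lambda>x. f x * g x) i)" for i
  proof (rule Ck_on_cong_open[OF assms(1),
        of k "\<lambda>x. f x * partial_deriv g i x + partial_deriv f i x * g x"])
    show "Ck_on k S (\<lambda>x. f x * partial_deriv g i x + partial_deriv f i x * g x)"
      using Suc.prems Suc.prems[THEN Ck_on_Suc_imp]
      by (intro Ck_on_add assms Suc.IH) auto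
    fix y assume "y \<in> S"
    then have "f differentiable at y" "g differentiable at y" using Suc.prems by auto
    note d = has_derivative_mult[OF this[THEN has_derivative_grad]]
    show "f y * partial_deriv g i y + partial_deriv f i y * g y = partial_deriv (\<lambda>x. f x * g x) i y"
      by (simp add: partial_deriv_eq[OF d] inner_axis')
  qed
  with Suc.prems show ?case by (auto intro: continuous_intros)
qed

lemma Ck_on_sum:
  assumes "open S" "\<And>i. i \<in> I \<Longrightarrow> Ck_on k S (f i)"
  shows "Ck_on k S (\<lambda>x. \<Sum>i\<in>I. f i x)"
  using assms(2) by (induction I rule: infinite_finite_induct) (auto intro: Ck_on_add assms(1))

lemma Ck_on_component: "Ck_on k S (\<lambda>x. x $ j)"
proof (cases k)
  case (Suc m)
  have d: "((\<lambda>x. x $ j) has_derivative (\<lambda>h. h $ j)) (at x)" for x :: "real^'a"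
    by (rule bounded_linear.has_derivative[OF bounded_linear_vec_nth has_derivative_ident])
  have "partial_deriv (\<lambda>x. x $ j) i = (\<lambda>x :: real^'a. axis i 1 $ j)" for i
    by (rule ext) (rule partial_deriv_eq[OF d])
  then show ?thesis using Suc d by (auto simp: differentiable_def intro!: continuous_intros)
qed (auto intro: continuous_intros)

lemma has_derivative_vec_components:
  fixes P :: "real^'m \<Rightarrow> real^'n"
  assumes "\<And>j. (\<lambda>x. P x $ j) differentiable (at x)"
  shows "(P has_derivative (\<lambda>h. \<chi> j. h \<bullet> grad (\<lambda>x. P x $ j) x)) (at x)"
  unfolding has_derivative_componentwise_within[of P]
  using has_derivative_grad[OF assms] by (auto simp: Basis_vec_def inner_axis)

lemma has_derivative_compose_grad:
  fixes P :: "real^'m \<Rightarrow> real^'n" and f :: "real^'n \<Rightarrow> real"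
  assumes "\<And>j. (\<lambda>x. P x $ j) differentiable (at x)" "f differentiable (at (P x))"
  shows "((\<lambda>x. f (P x)) has_derivative
           (\<lambda>h. h \<bullet> (\<Sum>j\<in>UNIV. partial_deriv f j (P x) *\<^sub>R grad (\<lambda>x. P x $ j) x))) (at x)"
proof -
  have "((\<lambda>x. f (P x)) has_derivative (\<lambda>h. (\<chi> j. h \<bullet> grad (\<lambda>x. P x $ j) x) \<bullet> grad f (P x))) (at x)"
    using has_derivative_compose[OF has_derivative_vec_components[OF assms(1)] has_derivative_grad[OF assms(2)]] .
  then show ?thesis
    by (simp add: inner_vec_def[of "\<chi> j. _ j"] inner_sum_right mult.commute)
qed

lemma partial_deriv_compose:
  fixes P :: "real^'m \<Rightarrow> real^'n" and f :: "real^'n \<Rightarrow> real"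
  assumes "\<And>j. (\<lambda>x. P x $ j) differentiable (at x)" "f differentiable (at (P x))"
  shows "partial_deriv (\<lambda>x. f (P x)) i x
     = (\<Sum>j\<in>UNIV. partial_deriv f j (P x) * partial_deriv (\<lambda>x. P x $ j) i x)"
  by (simp add: partial_deriv_eq[OF has_derivative_compose_grad[OF assms]] inner_axis')

lemma continuous_on_vec_components:
  fixes P :: "'a::topological_space \<Rightarrow> real^'n"
  shows "(\<And>j. continuous_on S (\<lambda>x. P x $ j)) \<Longrightarrow> continuous_on S P"
  using continuous_on_vec_lambda[of S "\<lambda>j x. P x $ j"] by simp

lemma Ck_on_imp_continuous: "Ck_on k S f \<Longrightarrow> continuous_on S f"
  by (cases k) auto

text \<open>By the chain rule each partial derivative is a sum of products of (partial derivative of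
  \<open>f\<close>) composed with \<open>P\<close> and partial derivatives of \<open>P\<close>; the
  induction hypothesis applies to the former because \<open>f\<close> is arbitrary in it.\<close>

lemma Ck_on_compose:
  fixes P :: "real^'m \<Rightarrow> real^'n"
  assumes S: "open S" and sub: "P ` S \<subseteq> T" 
    and P: "\<And>j. Ck_on k S (\<lambda>x. P x $ j)" and f: "Ck_on k T f"
  shows "Ck_on k S (\<lambda>x. f (P x))"
  using P f
proof (induction k arbitrary: f)
  case 0
  then show ?case
    using sub continuous_on_compose2[of T f S P] continuous_on_vec_components[of S P] by auto
next
  case (Suc k)
  have cP: "continuous_on S P"
    by (rule continuous_on_vec_components) (use Suc.prems(1) Ck_on_imp_continuous in blast)
  have dP: "(\<lambda>x. P x $ j) differentiable (at x)" if "x \<in> S" for x j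
    using Suc.prems(1)[of j] that by auto
  have df: "f differentiable (at (P x))" if "x \<in> S" for x
    using Suc.prems(2) sub that by auto
  have "Ck_on k S (partial_deriv (\<lambda>x. f (P x)) i)" for i
  proof (rule Ck_on_cong_open[OF S,
        of k "\<lambda>x. \<Sum>j\<in>UNIV. partial_deriv f j (P x) * partial_deriv (\<lambda>x. P x $ j) i x"])
    show "Ck_on k S (\<lambda>x. \<Sum>j\<in>UNIV. partial_deriv f j (P x) * partial_deriv (\<lambda>x. P x $ j) i x)"
    proof (intro Ck_on_sum Ck_on_mult S)
      show "Ck_on k S (\<lambda>x. partial_deriv f j (P x))" for j
        by (rule Suc.IH) (use Suc.prems Ck_on_Suc_imp in \<open>simp_all only: Ck_on.simps, blast+\<close>)
      show "Ck_on k S (partial_deriv (\<lambda>x. P x $ j) i)" for j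
        using Suc.prems(1)[of j] by auto
    qed
  qed (use partial_deriv_compose[OF dP df] in simp)
  moreover have "(\<lambda>x. f (P x)) differentiable (at x)" if "x \<in> S" for x
    using has_derivative_compose_grad[OF dP[OF that] df[OF that]] differentiable_def by blast
  moreover have "continuous_on S (\<lambda>x. f (P x))"
    using Suc.prems(2) sub by (intro continuous_on_compose2[OF _ cP]) auto
  ultimately show ?case by auto
qed

text \<open>\<open>Ck_on\<close> concerns functions on real^'n, so a smooth outer function of one
  real variable is supplied as the whole sequence \<open>D\<close> of its successive
  derivatives.\<close>

lemma Ck_on_deriv_seq:
  fixes D :: "nat \<Rightarrow> real \<Rightarrow> real"
  assumes S: "open S" and sub: "q ` S \<subseteq> T" and q: "Ck_on k S q"
    and D: "\<And>m t. t \<in> T \<Longrightarrow> (D m has_real_derivative D (Suc m) t) (at t)"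
  shows "Ck_on k S (\<lambda>x. D m (q x))"
  using q
proof (induction k arbitrary: m)
  case 0
  have "continuous_on T (D m)"
    using D by (meson DERIV_continuous continuous_at_imp_continuous_on)
  then show ?case using 0 sub continuous_on_compose2[of T "D m" S q] by auto
next
  case (Suc k)
  have cD: "continuous_on T (D m)"
    using D by (meson DERIV_continuous continuous_at_imp_continuous_on)
  have d: "((\<lambda>x. D m (q x)) has_derivative (\<lambda>h. (h \<bullet> grad q x) * D (Suc m) (q x))) (at x)"
    if "x \<in> S" for x
    using DERIV_compose_FDERIV[OF D has_derivative_grad] Suc.prems that sub by fastforce
  have "Ck_on k S (partial_deriv (\<lambda>x. D m (q x)) i)" for i
  proof (rule Ck_on_cong_open[OF S, of k "\<lambda>x. partial_deriv q i x * D (Suc m) (q x)"])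
    show "Ck_on k S (\<lambda>x. partial_deriv q i x * D (Suc m) (q x))"
      using Suc.prems Suc.IH[OF Ck_on_Suc_imp[OF Suc.prems]] by (intro Ck_on_mult S) auto
  qed (simp add: partial_deriv_eq[OF d] inner_axis')
  moreover have "continuous_on S (\<lambda>x. D m (q x))"
    using Suc.prems sub continuous_on_compose2[OF cD, of S q] by auto
  ultimately show ?case using d differentiable_def by fastforce
qed

section \<open>Closure properties of smooth functions\<close>

lemma smooth_on_const [simp]: "smooth_on S (\<lambda>x. c)"
  by (simp add: smooth_on_def)

lemma smooth_on_component [simp]: "smooth_on S (\<lambda>x. x $ j)"
  by (simp add: smooth_on_def Ck_on_component)

lemma smooth_on_add: "open S \<Longrightarrow> smooth_on S f \<Longrightarrow> smooth_on S g \<Longrightarrow> smooth_on S (\<lambda>x. f x + g x)"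
  by (simp add: smooth_on_def Ck_on_add)

lemma smooth_on_mult: "open S \<Longrightarrow> smooth_on S f \<Longrightarrow> smooth_on S g \<Longrightarrow> smooth_on S (\<lambda>x. f x * g x)"
  by (simp add: smooth_on_def Ck_on_mult)

lemma smooth_on_cmult: "open S \<Longrightarrow> smooth_on S f \<Longrightarrow> smooth_on S (\<lambda>x. c * f x)"
  by (simp add: smooth_on_mult)

lemma smooth_on_diff: "open S \<Longrightarrow> smooth_on S f \<Longrightarrow> smooth_on S g \<Longrightarrow> smooth_on S (\<lambda>x. f x - g x)"
  using smooth_on_add[of S f "\<lambda>x. (-1) * g x"] smooth_on_cmult[of S g "-1"] by simp

lemma smooth_on_sum:
  "open S \<Longrightarrow> (\<And>i. i \<in> I \<Longrightarrow> smooth_on S (f i)) \<Longrightarrow> smooth_on S (\<lambda>x. \<Sum>i\<in>I. f i x)"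
  by (simp add: smooth_on_def Ck_on_sum)

lemma smooth_on_subset: "smooth_on S f \<Longrightarrow> T \<subseteq> S \<Longrightarrow> smooth_on T f"
  by (meson smooth_on_def Ck_on_subset)

lemma smooth_on_cong_open:
  "open S \<Longrightarrow> smooth_on S f \<Longrightarrow> (\<And>y. y \<in> S \<Longrightarrow> f y = g y) \<Longrightarrow> smooth_on S g"
  by (meson smooth_on_def Ck_on_cong_open)

lemma smooth_on_Un: "open S \<Longrightarrow> open T \<Longrightarrow> smooth_on S f \<Longrightarrow> smooth_on T f \<Longrightarrow> smooth_on (S \<union> T) f"
  by (simp add: smooth_on_def Ck_on_Un)

lemma smooth_on_compose:
  fixes P :: "real^'m \<Rightarrow> real^'n"
  shows "open S \<Longrightarrow> P ` S \<subseteq> T \<Longrightarrow> (\<And>j. smooth_on S (\<lambda>x. P x $ j)) \<Longrightarrow> smooth_on T f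
    \<Longrightarrow> smooth_on S (\<lambda>x. f (P x))"
  by (simp add: smooth_on_def Ck_on_compose)

lemma smooth_on_deriv_seq:
  fixes D :: "nat \<Rightarrow> real \<Rightarrow> real"
  assumes "open S" "smooth_on S q" "\<And>x. x \<in> S \<Longrightarrow> q x \<in> T"
    and "\<And>m t. t \<in> T \<Longrightarrow> (D m has_real_derivative D (Suc m) t) (at t)"
  shows "smooth_on S (\<lambda>x. D m (q x))"
proof -
  have "Ck_on k S (\<lambda>x. D m (q x))" for k
    by (rule Ck_on_deriv_seq[where T = T]) (use assms in \<open>auto simp: smooth_on_def\<close>)
  then show ?thesis by (simp add: smooth_on_def)
qed

lemma smooth_on_partial_deriv: "smooth_on S f \<Longrightarrow> smooth_on S (partial_deriv f i)"
  unfolding smooth_on_def by (metis Ck_on.simps(2))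

lemma smooth_on_differentiable: "smooth_on S f \<Longrightarrow> x \<in> S \<Longrightarrow> f differentiable (at x)"
  unfolding smooth_on_def by (metis Ck_on.simps(2))

lemma smooth_on_continuous: "smooth_on S f \<Longrightarrow> continuous_on S f"
  unfolding smooth_on_def by (metis Ck_on.simps(1))

lemma smooth_on_has_derivative:
  "smooth_on S f \<Longrightarrow> x \<in> S \<Longrightarrow> (f has_derivative (\<lambda>h. h \<bullet> grad f x)) (at x)"
  by (simp add: smooth_on_differentiable has_derivative_grad)

lemma smooth_on_inner_self: "open S \<Longrightarrow> smooth_on S (\<lambda>x. x \<bullet> x)"
  unfolding inner_vec_def by (intro smooth_on_sum) (auto intro: smooth_on_mult)

lemma smooth_on_powr:
  assumes "open S" "smooth_on S q" "\<And>x. x \<in> S \<Longrightarrow> q x > 0"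
  shows "smooth_on S (\<lambda>x. q x powr a)"
proof -
  \<comment> \<open>The k-th derivative of t powr a, with the falling factorial of a as
    coefficient.\<close>
  define D where "D k t = (\<Prod>i<k. a - real i) * t powr (a - real k)" for k t
  have "smooth_on S (\<lambda>x. D 0 (q x))"
  proof (rule smooth_on_deriv_seq[where T = "{0<..}" and D = D and q = q and m = 0])
    fix m t assume "t \<in> {0::real<..}"
    then show "(D m has_real_derivative D (Suc m) t) (at t)"
      unfolding D_def
      by (auto intro!: derivative_eq_intros simp: algebra_simps)
  qed (use assms in auto)
  then show ?thesis by (simp add: D_def)
qed

lemma smooth_on_inverse:
  assumes "open S" "smooth_on S q" "\<And>x. x \<in> S \<Longrightarrow> q x > 0"
  shows "smooth_on S (\<lambda>x. inverse (q x))"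
  by (rule smooth_on_cong_open[OF assms(1) smooth_on_powr[OF assms, of "-1"]])
     (use assms(3) in \<open>auto simp: powr_minus less_imp_le\<close>)

lemma smooth_on_norm:
  assumes "open S" "0 \<notin> S"
  shows "smooth_on S norm"
  by (rule smooth_on_cong_open[OF assms(1) smooth_on_powr[OF assms(1) smooth_on_inner_self, of "1/2"]])
     (use assms in \<open>auto simp: powr_half_sqrt norm_eq_sqrt_inner\<close>)

subsection \<open>Bump and step functions\<close>

text \<open>With s = 1/t the derivative in t is -s^2 times the derivative in s, and p(s) exp(-s) has
  derivative (p' - p) exp(-s) in s; this yields the recursion.\<close>

fun flat_poly :: "nat \<Rightarrow> real poly" where
  "flat_poly 0 = 1"
| "flat_poly (Suc k) = [:0, 0, 1:] * (flat_poly k - pderiv (flat_poly k))"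

text \<open>The \<open>k\<close>-th derivative of \<open>exp (-1/t)\<close>, extended by zero to \<open>t \<le> 0\<close>.\<close>
definition flat :: "nat \<Rightarrow> real \<Rightarrow> real" where
  "flat k t = (if t \<le> 0 then 0 else poly (flat_poly k) (1/t) * exp (- (1/t)))"

lemma poly_times_exp_neg_tendsto_0:
  fixes p :: "real poly"
  shows "((\<lambda>s. poly p s * exp (- s)) \<longlongrightarrow> 0) at_top"
proof -
  have "((\<lambda>s. \<Sum>i\<le>degree p. coeff p i * (s ^ i / exp s)) \<longlongrightarrow> (\<Sum>i\<le>degree p. coeff p i * 0)) at_top"
    by (intro tendsto_sum tendsto_mult tendsto_const tendsto_power_div_exp_0)
  then show ?thesis
    by (simp add: poly_altdef sum_distrib_right sum_divide_distrib exp_minus field_simps)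
qed

lemma flat_has_derivative: "(flat k has_real_derivative flat (Suc k) t) (at t)"
proof -
  consider "t < 0" | "t = 0" | "t > 0" by linarith
  then show ?thesis
  proof cases
    case 1
    have "(flat k has_real_derivative 0) (at t)"
      by (rule has_field_derivative_transform_within_open[of "\<lambda>x. 0" _ _ "{..<0}"]) (use 1 in \<open>auto simp: flat_def\<close>)
    then show ?thesis using 1 by (simp add: flat_def)
  next
    case 3
    have "((\<lambda>t. poly (flat_poly k) (1/t) * exp (- (1/t))) has_real_derivative flat (Suc k) t) (at t)"
      using 3 unfolding flat_def
      by (auto intro!: derivative_eq_intros poly_DERIV[THEN DERIV_chain2]
               simp: power2_eq_square algebra_simps divide_simps)
    then show ?thesis
      by (rule has_field_derivative_transform_within_open[of _ _ _ "{0<..}"]) (use 3 in \<open>auto simp: flat_def\<close>)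
  next
    case 2
    have "((\<lambda>h. flat k h / h) \<longlongrightarrow> 0) (at 0)"
    proof (rule filterlim_split_at_real)
      show "((\<lambda>h. flat k h / h) \<longlongrightarrow> 0) (at_left 0)"
        by (rule tendsto_eventually) (auto simp: eventually_at_filter flat_def)
      \<comment> \<open>From the right the difference quotient at 0 is s p(s) exp(-s) with s = 1/h,
        which tends to 0; from the left it is constantly 0.\<close>
      have "((\<lambda>h. poly ([:0,1:] * flat_poly k) (inverse h) * exp (- inverse h)) \<longlongrightarrow> 0) (at_right 0)"
        by (rule filterlim_compose[OF poly_times_exp_neg_tendsto_0 filterlim_inverse_at_top_right])
      then show "((\<lambda>h. flat k h / h) \<longlongrightarrow> 0) (at_right 0)"
        by (rule tendsto_cong[THEN iffD1, rotated])
           (auto simp: eventually_at_filter flat_def field_simps)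
    qed
    then show ?thesis using 2 by (simp add: has_field_derivative_iff flat_def)
  qed
qed

lemma smooth_on_flat: "open S \<Longrightarrow> smooth_on S q \<Longrightarrow> smooth_on S (\<lambda>x. flat k (q x))"
  by (rule smooth_on_deriv_seq[where T = UNIV and D = flat and q = q and m = k]) (auto intro: flat_has_derivative)

lemma flat_0: "flat 0 t = (if t \<le> 0 then 0 else exp (- (1/t)))"
  by (simp add: flat_def)

lemma flat_1: "flat 1 t = (if t \<le> 0 then 0 else exp (- (1/t)) / t\<^sup>2)"
  by (simp add: flat_def power2_eq_square divide_simps)

definition step :: "real \<Rightarrow> real" where
  "step t = flat 0 t / (flat 0 t + flat 0 (1 - t))"

text \<open>t and 1 - t are never both nonpositive.\<close>

lemma step_denom_pos: "flat 0 t + flat 0 (1 - t) > 0"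
  by (auto simp: flat_0 add_pos_pos)

lemma step_eq_0: "t \<le> 0 \<Longrightarrow> step t = 0"
  by (simp add: step_def flat_0)

lemma step_eq_1: "1 \<le> t \<Longrightarrow> step t = 1"
  by (simp add: step_def flat_0)

lemma step_nonneg: "0 \<le> step t" and step_le_1: "step t \<le> 1"
  using step_denom_pos[of t] by (auto simp: step_def flat_0 divide_simps)

lemma smooth_on_step:
  assumes "open S" "smooth_on S q" shows "smooth_on S (\<lambda>x. step (q x))"
  unfolding step_def divide_inverse
  by (intro smooth_on_mult smooth_on_inverse smooth_on_flat smooth_on_add smooth_on_diff assms
        step_denom_pos smooth_on_const)

text \<open>The derivative is continuous on the compact interval from 0 to 1 and vanishes outside
  it. The three facts are packaged together for the gradient estimates of the cutoffs
  \<open>cut\<close> and \<open>rho\<close>.\<close>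

lemma step_has_derivative_bounded:
  "\<exists>s' C. (\<forall>t. (step has_real_derivative s' t) (at t)) \<and> (\<forall>t. \<bar>s' t\<bar> \<le> C) \<and>
     (\<forall>t. t \<le> 0 \<or> 1 \<le> t \<longrightarrow> s' t = 0)"
proof -
  define s' where "s' t = (flat 1 t * (flat 0 t + flat 0 (1 - t)) - flat 0 t * (flat 1 t - flat 1 (1 - t)))
     / ((flat 0 t + flat 0 (1 - t)) * (flat 0 t + flat 0 (1 - t)))" for t
  have fr: "((\<lambda>z. flat 0 (1 - z)) has_real_derivative - flat 1 (1 - t)) (at t)" for t
  proof -
    have "((\<lambda>z. 1 - z) has_real_derivative - 1) (at t)" by (auto intro!: derivative_eq_intros)
    from DERIV_chain2[OF flat_has_derivative[of 0 "1 - t"] this] show ?thesis by simp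
  qed
  have f0: "(flat 0 has_real_derivative flat 1 t) (at t)" for t
    using flat_has_derivative[of 0 t] by simp
  have d: "(step has_real_derivative s' t) (at t)" for t
    unfolding step_def[abs_def] s'_def using step_denom_pos[of t]
      DERIV_divide[OF f0 DERIV_add[OF f0 fr], of t] by simp
  have cf: "continuous_on X (flat k)" for X k
    by (meson flat_has_derivative DERIV_continuous continuous_at_imp_continuous_on)
  have cf': "continuous_on X (\<lambda>t. flat k (1 - t))" for X k
    by (rule continuous_on_compose2[OF cf[of UNIV]]) (auto intro: continuous_intros)
  have "continuous_on {0..1} s'"
    unfolding s'_def using step_denom_pos
    by (intro continuous_on_divide continuous_on_mult continuous_on_diff continuous_on_add cf cf')
       (auto simp: less_le)
  then have "bounded (s' ` {0..1})" by (intro compact_imp_bounded compact_continuous_image) auto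
  then obtain C where C: "\<And>t. t \<in> {0..1} \<Longrightarrow> \<bar>s' t\<bar> \<le> C"
    by (metis bounded_iff imageI real_norm_def)
  have z: "s' t = 0" if "t \<le> 0 \<or> 1 \<le> t" for t
    using that by (auto simp: s'_def flat_0 flat_1[simplified] )
  have "\<bar>s' t\<bar> \<le> max C 0" for t
    using C[of t] z[of t] by (cases "t \<in> {0..1}") auto
  with d z show ?thesis by blast
qed

subsection \<open>Test functions\<close>

lemma test_funI:
  assumes "smooth_on UNIV \<phi>" "compact K" "K \<subseteq> N" "\<And>x. x \<notin> K \<Longrightarrow> \<phi> x = 0"
  shows "test_fun N \<phi>"
proof -
  have "closure {x. \<phi> x \<noteq> 0} \<subseteq> K"
    using assms by (intro closure_minimal compact_imp_closed) auto
  then show ?thesis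
    using assms(1-3) bounded_subset[OF compact_imp_bounded[OF assms(2)]]
    unfolding test_fun_def compact_eq_bounded_closed by auto
qed

lemma test_funE:
  assumes "test_fun N \<phi>"
  obtains K where "compact K" "K \<subseteq> N" "\<And>x. x \<notin> K \<Longrightarrow> \<phi> x = 0"
proof (rule that[of "closure {x. \<phi> x \<noteq> 0}"])
  show "\<phi> x = 0" if "x \<notin> closure {x. \<phi> x \<noteq> 0}" for x
    using that closure_subset[of "{x. \<phi> x \<noteq> 0}"] by auto
qed (use assms in \<open>auto simp: test_fun_def\<close>)

lemma test_fun_smooth: "test_fun N \<phi> \<Longrightarrow> smooth_on UNIV \<phi>"
  by (simp add: test_fun_def)

lemma test_fun_mono: "test_fun N \<phi> \<Longrightarrow> N \<subseteq> M \<Longrightarrow> test_fun M \<phi>"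
  by (auto simp: test_fun_def)

lemma partial_deriv_zero_open:
  assumes "open S" "x \<in> S" "\<And>y. y \<in> S \<Longrightarrow> f y = 0"
  shows "partial_deriv f i x = 0"
  using partial_deriv_cong_open[of S x "\<lambda>_. 0" f i] assms by simp

lemma test_fun_partial_deriv:
  assumes "test_fun N \<phi>" shows "test_fun N (partial_deriv \<phi> i)"
proof -
  obtain K where K: "compact K" "K \<subseteq> N" "\<And>x. x \<notin> K \<Longrightarrow> \<phi> x = 0"
    using assms by (rule test_funE) blast
  have "partial_deriv \<phi> i x = 0" if "x \<notin> K" for x
    by (rule partial_deriv_zero_open[of "- K"]) (use K that compact_imp_closed in auto)
  then show ?thesis
    using K assms by (intro test_funI[OF _ K(1,2)] smooth_on_partial_deriv test_fun_smooth) auto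
qed

lemma test_fun_mult:
  assumes "test_fun N \<phi>" "smooth_on UNIV g" shows "test_fun N (\<lambda>x. g x * \<phi> x)"
proof -
  obtain K where K: "compact K" "K \<subseteq> N" "\<And>x. x \<notin> K \<Longrightarrow> \<phi> x = 0"
    using assms(1) by (rule test_funE) blast
  then show ?thesis using assms
    by (intro test_funI[OF _ K(1,2)] smooth_on_mult) (auto simp: test_fun_smooth)
qed

text \<open>The open sets \<open>A\<close> and the complement of \<open>K\<close> cover the space,
  and the extension is smooth on each: it is \<open>f\<close> on the one and zero on the
  other.\<close>

lemma test_fun_extend:
  assumes "open A" "smooth_on A f" "compact K" "K \<subseteq> A" "\<And>x. x \<in> A - K \<Longrightarrow> f x = 0"
  shows "test_fun A (\<lambda>x. if x \<in> A then f x else 0)"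
proof -
  let ?g = "\<lambda>x. if x \<in> A then f x else 0"
  have oK: "open (- K)" using assms by (simp add: compact_imp_closed open_Compl)
  have "smooth_on A ?g" by (rule smooth_on_cong_open[OF assms(1,2)]) auto
  moreover have "smooth_on (- K) ?g"
    by (rule smooth_on_cong_open[OF oK smooth_on_const[of _ 0]]) (use assms in auto)
  ultimately have "smooth_on (A \<union> - K) ?g" by (intro smooth_on_Un assms oK)
  also have "A \<union> - K = UNIV" using assms by auto
  finally show ?thesis using assms by (intro test_funI[OF _ assms(3,4)]) auto
qed

lemma test_fun_continuous: "test_fun N \<phi> \<Longrightarrow> continuous_on S \<phi>"
  by (meson test_fun_smooth smooth_on_continuous continuous_on_subset subset_UNIV)

lemma borel_measurable_continuous_UNIV: "continuous_on UNIV f \<Longrightarrow> f \<in> borel_measurable borel"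
  by (rule borel_measurable_continuous_onI)

lemma test_fun_measurable: "test_fun N \<phi> \<Longrightarrow> \<phi> \<in> borel_measurable borel"
  by (simp add: borel_measurable_continuous_UNIV test_fun_continuous)

lemma test_fun_bounded:
  assumes "test_fun N \<phi>" obtains B where "B > 0" "\<And>x. \<bar>\<phi> x\<bar> \<le> B"
proof -
  obtain K where K: "compact K" "K \<subseteq> N" "\<And>x. x \<notin> K \<Longrightarrow> \<phi> x = 0"
    using assms by (rule test_funE) blast
  have "bounded (\<phi> ` K)"
    by (intro compact_imp_bounded compact_continuous_image K test_fun_continuous[OF assms])
  then obtain B where B: "\<And>x. x \<in> K \<Longrightarrow> \<bar>\<phi> x\<bar> \<le> B" by (auto simp: bounded_iff)
  have "\<bar>\<phi> x\<bar> \<le> max B 1" for x using B[of x] K(3)[of x] by (cases "x \<in> K") auto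
  then show ?thesis by (intro that[of "max B 1"]) auto
qed

section \<open>Integrals of test functions\<close>

lemma integrable_bounded_compact:
  fixes f :: "'a::euclidean_space \<Rightarrow> real"
  assumes "f \<in> borel_measurable borel" "compact K" "\<And>x. \<bar>f x\<bar> \<le> B" "\<And>x. x \<notin> K \<Longrightarrow> f x = 0"
  shows "integrable lborel f"
proof (rule Bochner_Integration.integrable_bound)
  show "integrable lborel (\<lambda>x. indicator K x * B)"
    using assms(2) by (intro integrable_mult_left integrable_real_indicator)
      (use emeasure_compact_finite[of K] in \<open>auto simp: compact_imp_closed borel_closed top.not_eq_extremum\<close>)
  show "AE x in lborel. norm (f x) \<le> norm (indicator K x * B)"
    using assms(3,4) by (intro AE_I2) (auto simp: indicator_def intro: order_trans[OF _ abs_ge_self])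
qed (use assms(1) in simp)

lemma test_fun_integrable: "test_fun N \<phi> \<Longrightarrow> integrable lborel \<phi>"
  by (metis integrable_bounded_compact test_funE test_fun_bounded test_fun_measurable)

lemma lborel_integral_translate:
  fixes f :: "'a::euclidean_space \<Rightarrow> real"
  assumes [measurable]: "f \<in> borel_measurable borel"
  shows "(\<integral>x. f (t + x) \<partial>lborel) = (\<integral>x. f x \<partial>lborel)"
proof -
  have "(\<integral>x. f x \<partial>lborel) = (\<integral>x. f x \<partial>(distr lborel borel ((+) t)))"
    by (simp add: lborel_distr_plus)
  also have "\<dots> = (\<integral>x. f (t + x) \<partial>lborel)" by (rule integral_distr) auto
  finally show ?thesis by simp
qed

lemma mean_value_bound:
  fixes f :: "real^'n \<Rightarrow> real"
  assumes "convex S" "\<And>x. x \<in> S \<Longrightarrow> f differentiable (at x)" "\<And>x. x \<in> S \<Longrightarrow> norm (grad f x) \<le> B"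
    and "x \<in> S" "y \<in> S"
  shows "\<bar>f y - f x\<bar> \<le> B * norm (y - x)"
proof -
  have "norm (f y - f x) \<le> B * norm (y - x)"
  proof (rule differentiable_bound[OF assms(1)])
    show "(f has_derivative (\<lambda>h. h \<bullet> grad f z)) (at z within S)" if "z \<in> S" for z
      using has_derivative_grad[OF assms(2)[OF that]] by (rule has_derivative_at_withinI)
    show "onorm (\<lambda>h. h \<bullet> grad f z) \<le> B" if "z \<in> S" for z
    proof (rule onorm_le)
      fix h show "norm (h \<bullet> grad f z) \<le> B * norm h"
        using Cauchy_Schwarz_ineq2[of h "grad f z"] mult_right_mono[OF assms(3)[OF that], of "norm h"]
        by (simp add: mult.commute)
    qed
  qed (use assms in auto)
  then show ?thesis by simp
qed

lemma test_fun_grad_bounded: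
  assumes "test_fun N \<phi>" obtains B where "B > 0" "\<And>x. norm (grad \<phi> x) \<le> B"
proof -
  have "\<forall>i. \<exists>B. \<forall>x. \<bar>partial_deriv \<phi> i x\<bar> \<le> B"
    by (meson assms test_fun_bounded test_fun_partial_deriv)
  then obtain B where B: "\<And>i x. \<bar>partial_deriv \<phi> i x\<bar> \<le> B i" by metis
  have "norm (grad \<phi> x) \<le> max 1 (\<Sum>i\<in>UNIV. B i)" for x
    using norm_le_l1_cart[of "grad \<phi> x"] sum_mono[of UNIV "\<lambda>i. \<bar>partial_deriv \<phi> i x\<bar>" B] B
    by simp
  then show ?thesis by (intro that[of "max 1 (\<Sum>i\<in>UNIV. B i)"]) auto
qed

text \<open>Translation invariance makes the integral of every difference quotient zero. The
  quotients are bounded by the supremum of the gradient and live in one fixed ball, so dominated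
  convergence passes this to the derivative.\<close>

lemma integral_partial_deriv_zero:
  fixes \<phi> :: "real^'n \<Rightarrow> real"
  assumes "test_fun UNIV \<phi>"
  shows "(\<integral>x. partial_deriv \<phi> i x \<partial>lborel) = 0"
proof -
  obtain K where K: "compact K" "\<And>x. x \<notin> K \<Longrightarrow> \<phi> x = 0"
    using assms by (rule test_funE) blast
  obtain B where B: "\<And>x. norm (grad \<phi> x) \<le> B" "B > 0" using assms test_fun_grad_bounded by blast
  obtain R where R: "\<And>x. x \<in> K \<Longrightarrow> norm x \<le> R" 
    using compact_imp_bounded[OF K(1)] by (auto simp: bounded_iff)
  let ?e = "axis i 1 :: real^'n"
  define q where "q n x = (\<phi> (inverse (real (Suc n)) *\<^sub>R ?e + x) - \<phi> x) / inverse (real (Suc n))" for n x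
  have [measurable]: "\<phi> \<in> borel_measurable borel" using assms by (rule test_fun_measurable)
  have [measurable]: "partial_deriv \<phi> i \<in> borel_measurable borel"
    using assms test_fun_measurable test_fun_partial_deriv by blast
  have dif: "\<phi> differentiable (at x)" for x
    using test_fun_smooth[OF assms] smooth_on_differentiable by blast
  have "(\<lambda>n. \<integral>x. q n x \<partial>lborel) \<longlonglongrightarrow> (\<integral>x. partial_deriv \<phi> i x \<partial>lborel)"
  proof (rule integral_dominated_convergence)
    show "integrable lborel (\<lambda>x. indicator (cball 0 (R + 1)) x * B)"
      by (rule integrable_bounded_compact[of _ "cball 0 (R + 1)" B])
        (use B(2) in \<open>auto simp: indicator_def\<close>)
    show "AE x in lborel. (\<lambda>n. q n x) \<longlonglongrightarrow> partial_deriv \<phi> i x"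
    proof (rule AE_I2)
      fix x
      have c: "((\<lambda>t. t *\<^sub>R ?e + x) has_vector_derivative ?e) (at 0)"
        by (auto intro!: derivative_eq_intros)
      have g: "(\<phi> has_derivative (\<lambda>h. h \<bullet> grad \<phi> x)) (at ((\<lambda>t. t *\<^sub>R ?e + x) 0))"
        using has_derivative_grad[OF dif[of x]] by simp
      have "((\<lambda>t. \<phi> (t *\<^sub>R ?e + x)) has_real_derivative partial_deriv \<phi> i x) (at 0)"
        using diff_chain_at[OF c[unfolded has_vector_derivative_def] g]
        by (simp add: o_def has_field_derivative_def inner_axis' mult_commute_abs)
      then have "((\<lambda>t. (\<phi> (t *\<^sub>R ?e + x) - \<phi> x) / t) \<longlongrightarrow> partial_deriv \<phi> i x) (at 0)"
        by (simp add: has_field_derivative_iff)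
      moreover have "filterlim (\<lambda>n. inverse (real (Suc n))) (at 0) sequentially"
        unfolding filterlim_at using LIMSEQ_inverse_real_of_nat by auto
      ultimately show "(\<lambda>n. q n x) \<longlonglongrightarrow> partial_deriv \<phi> i x"
        unfolding q_def by (rule filterlim_compose)
    qed
    show "AE x in lborel. norm (q n x) \<le> indicator (cball 0 (R + 1)) x * B" for n
    proof (rule AE_I2)
      fix x
      let ?t = "inverse (real (Suc n))"
      \<comment> \<open>Shifts of length at most 1 keep the quotients supported in the ball of
        radius R + 1.\<close>
      have t: "0 < ?t" "?t \<le> 1" by (auto simp: inverse_le_1_iff)
      have "\<bar>\<phi> (?t *\<^sub>R ?e + x) - \<phi> x\<bar> \<le> B * norm (?t *\<^sub>R ?e + x - x)"
        by (rule mean_value_bound[of UNIV]) (auto simp: dif B)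
      also have "\<dots> = B * ?t" using t by simp
      finally have 1: "norm (q n x) \<le> B" using t by (simp add: q_def abs_mult divide_simps mult.commute)
      show "norm (q n x) \<le> indicator (cball 0 (R + 1)) x * B"
      proof (cases "x \<in> cball 0 (R + 1)")
        case False
        then have "norm x > R + 1" by simp
        moreover have "norm x \<le> norm (?t *\<^sub>R ?e + x) + norm (?t *\<^sub>R ?e)"
          by (metis add_diff_cancel_left' norm_triangle_ineq4)
        moreover have "norm (?t *\<^sub>R ?e) \<le> 1" using t by simp
        ultimately have "norm (?t *\<^sub>R ?e + x) > R" "norm x > R" by linarith+
        then have "x \<notin> K" "?t *\<^sub>R ?e + x \<notin> K" using R leD by blast+
        then show ?thesis using K B(2) by (simp add: q_def less_imp_le)
      qed (use 1 in simp)
    qed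
  qed (auto simp: q_def)
  moreover have "(\<integral>x. q n x \<partial>lborel) = 0" for n
  proof -
    have i: "integrable lborel \<phi>" using assms test_fun_integrable by blast
    have "integrable lborel (\<lambda>x. \<phi> (t + x))" for t
    proof -
      have "integrable (distr lborel borel ((+) t)) \<phi>" using i by (simp add: lborel_distr_plus)
      then show ?thesis by (subst (asm) integrable_distr_eq) auto
    qed
    with i show ?thesis unfolding q_def
      by (simp add: lborel_integral_translate)
  qed
  ultimately show ?thesis by (simp add: LIMSEQ_const_iff)
qed

subsection \<open>Affine substitutions\<close>

lemma nn_integral_lborel_affine:
  fixes g :: "'a::euclidean_space \<Rightarrow> ennreal"
  assumes [measurable]: "g \<in> borel_measurable borel" and "c \<noteq> 0"
  shows "(\<integral>\<^sup>+x. g x \<partial>lborel) = ennreal (\<bar>c\<bar> ^ DIM('a)) * (\<integral>\<^sup>+x. g (t + c *\<^sub>R x) \<partial>lborel)"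
proof -
  have "(\<integral>\<^sup>+x. g x \<partial>lborel)
      = (\<integral>\<^sup>+x. g x \<partial>density (distr lborel borel (\<lambda>x. t + c *\<^sub>R x)) (\<lambda>_. ennreal (\<bar>c\<bar> ^ DIM('a))))"
    using lborel_affine[OF assms(2), of t] by simp
  also have "\<dots> = (\<integral>\<^sup>+x. ennreal (\<bar>c\<bar> ^ DIM('a)) * g (t + c *\<^sub>R x) \<partial>lborel)"
    by (simp add: nn_integral_density nn_integral_distr)
  also have "\<dots> = ennreal (\<bar>c\<bar> ^ DIM('a)) * (\<integral>\<^sup>+x. g (t + c *\<^sub>R x) \<partial>lborel)"
    by (rule nn_integral_cmult) simp
  finally show ?thesis .
qed

lemma lborel_integral_affine:
  fixes g :: "'a::euclidean_space \<Rightarrow> real"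
  assumes [measurable]: "g \<in> borel_measurable borel" and "c \<noteq> 0"
  shows "(\<integral>x. g x \<partial>lborel) = \<bar>c\<bar> ^ DIM('a) * (\<integral>x. g (t + c *\<^sub>R x) \<partial>lborel)"
proof -
  have "(\<integral>x. g x \<partial>lborel)
      = (\<integral>x. g x \<partial>density (distr lborel borel (\<lambda>x. t + c *\<^sub>R x)) (\<lambda>_. ennreal (\<bar>c\<bar> ^ DIM('a))))"
    using lborel_affine[OF assms(2), of t] by simp
  also have "\<dots> = (\<integral>x. \<bar>c\<bar> ^ DIM('a) * g (t + c *\<^sub>R x) \<partial>lborel)"
    by (simp add: integral_density integral_distr)
  finally show ?thesis by simp
qed

subsection \<open>Mean square convergence\<close>

text \<open>The nonnegative integral allows mean square distances to be stated and estimated without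
  integrability side conditions; measurability is built in because every estimate uses it.\<close>

definition L2lim :: "'a::euclidean_space set \<Rightarrow> (nat \<Rightarrow> 'a \<Rightarrow> real) \<Rightarrow> ('a \<Rightarrow> real) \<Rightarrow> bool" where
  "L2lim S fs f \<longleftrightarrow> (\<forall>k. fs k \<in> borel_measurable borel) \<and> f \<in> borel_measurable borel \<and>
     (\<lambda>k. \<integral>\<^sup>+x. ennreal ((fs k x - f x)\<^sup>2) * indicator S x \<partial>lborel) \<longlonglongrightarrow> 0"

lemma L2lim_squeeze:
  assumes "(\<lambda>k. h k) \<longlonglongrightarrow> (0::ennreal)"
    and "\<And>k. (\<integral>\<^sup>+x. ennreal ((fs k x - f x)\<^sup>2) * indicator S x \<partial>lborel) \<le> h k"
    and "\<And>k. fs k \<in> borel_measurable borel" "f \<in> borel_measurable borel"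
  shows "L2lim S fs f"
  unfolding L2lim_def using assms by (auto intro: tendsto_sandwich[OF _ _ tendsto_const assms(1)])

lemma power2_add_le: "(a + b)\<^sup>2 \<le> 2 * a\<^sup>2 + 2 * (b::real)\<^sup>2"
  using sum_squares_bound[of a b] by (simp add: power2_sum)

lemma ennreal_tendsto_0_cmult:
  "h \<longlonglongrightarrow> (0::ennreal) \<Longrightarrow> c \<noteq> top \<Longrightarrow> (\<lambda>k. c * h k) \<longlonglongrightarrow> 0"
  using ennreal_tendsto_cmult[of c h 0 sequentially] by (simp add: top.not_eq_extremum)

lemma L2lim_add:
  assumes [measurable]: "S \<in> sets borel" and f: "L2lim S fs f" and g: "L2lim S gs g"
  shows "L2lim S (\<lambda>k x. fs k x + gs k x) (\<lambda>x. f x + g x)"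
proof -
  have [measurable]: "\<And>k. fs k \<in> borel_measurable borel" "f \<in> borel_measurable borel"
     "\<And>k. gs k \<in> borel_measurable borel" "g \<in> borel_measurable borel"
    using f g by (auto simp: L2lim_def)
  let ?I = "\<lambda>fs f k. \<integral>\<^sup>+x. ennreal ((fs k x - f x)\<^sup>2) * indicator S x \<partial>lborel"
  have "(\<lambda>k. 2 * ?I fs f k + 2 * ?I gs g k) \<longlonglongrightarrow> 2 * 0 + 2 * 0"
    using f g by (intro tendsto_add ennreal_tendsto_cmult) (auto simp: L2lim_def)
  then have lim: "(\<lambda>k. 2 * ?I fs f k + 2 * ?I gs g k) \<longlonglongrightarrow> 0" by simp
  show ?thesis
  proof (rule L2lim_squeeze[OF lim])
    fix k
    have "(\<integral>\<^sup>+x. ennreal ((fs k x + gs k x - (f x + g x))\<^sup>2) * indicator S x \<partial>lborel)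
      \<le> (\<integral>\<^sup>+x. 2 * (ennreal ((fs k x - f x)\<^sup>2) * indicator S x)
           + 2 * (ennreal ((gs k x - g x)\<^sup>2) * indicator S x) \<partial>lborel)"
    proof (rule nn_integral_mono)
      fix x
      have "ennreal ((fs k x + gs k x - (f x + g x))\<^sup>2)
          \<le> ennreal (2 * (fs k x - f x)\<^sup>2 + 2 * (gs k x - g x)\<^sup>2)"
        using power2_add_le[of "fs k x - f x" "gs k x - g x"]
        by (intro ennreal_leI) (simp add: algebra_simps)
      also have "\<dots> = 2 * ennreal ((fs k x - f x)\<^sup>2) + 2 * ennreal ((gs k x - g x)\<^sup>2)"
        by (simp add: ennreal_mult')
      finally show "ennreal ((fs k x + gs k x - (f x + g x))\<^sup>2) * indicator S x
        \<le> 2 * (ennreal ((fs k x - f x)\<^sup>2) * indicator S x)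
           + 2 * (ennreal ((gs k x - g x)\<^sup>2) * indicator S x)"
        by (auto simp: indicator_def)
    qed
    also have "\<dots> = 2 * ?I fs f k + 2 * ?I gs g k"
      by (subst nn_integral_add) (auto simp: nn_integral_cmult)
    finally show "(\<integral>\<^sup>+x. ennreal ((fs k x + gs k x - (f x + g x))\<^sup>2) * indicator S x \<partial>lborel)
      \<le> 2 * ?I fs f k + 2 * ?I gs g k" .
  qed auto
qed

lemma L2lim_mult:
  assumes [measurable]: "S \<in> sets borel" "h \<in> borel_measurable borel" and f: "L2lim S fs f"
    and B: "\<And>x. x \<in> S \<Longrightarrow> \<bar>h x\<bar> \<le> B"
  shows "L2lim S (\<lambda>k x. h x * fs k x) (\<lambda>x. h x * f x)"
proof -
  have [measurable]: "\<And>k. fs k \<in> borel_measurable borel" "f \<in> borel_measurable borel"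
    using f by (auto simp: L2lim_def)
  let ?I = "\<lambda>k. \<integral>\<^sup>+x. ennreal ((fs k x - f x)\<^sup>2) * indicator S x \<partial>lborel"
  have lim: "(\<lambda>k. ennreal (B\<^sup>2) * ?I k) \<longlonglongrightarrow> 0"
    using f by (intro ennreal_tendsto_0_cmult) (auto simp: L2lim_def)
  show ?thesis
  proof (rule L2lim_squeeze[OF lim])
    fix k
    have "(\<integral>\<^sup>+x. ennreal ((h x * fs k x - h x * f x)\<^sup>2) * indicator S x \<partial>lborel)
      \<le> (\<integral>\<^sup>+x. ennreal (B\<^sup>2) * (ennreal ((fs k x - f x)\<^sup>2) * indicator S x) \<partial>lborel)"
    proof (rule nn_integral_mono)
      fix x
      have "(h x * fs k x - h x * f x)\<^sup>2 \<le> B\<^sup>2 * (fs k x - f x)\<^sup>2" if "x \<in> S"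
        using B[OF that] by (auto simp: right_diff_distrib[symmetric] power_mult_distrib
            intro!: mult_right_mono abs_le_square_iff[THEN iffD1])
      then show "ennreal ((h x * fs k x - h x * f x)\<^sup>2) * indicator S x
        \<le> ennreal (B\<^sup>2) * (ennreal ((fs k x - f x)\<^sup>2) * indicator S x)"
        by (auto simp: indicator_def ennreal_mult'[symmetric] intro: ennreal_leI)
    qed
    also have "\<dots> = ennreal (B\<^sup>2) * ?I k" by (rule nn_integral_cmult) auto
    finally show "(\<integral>\<^sup>+x. ennreal ((h x * fs k x - h x * f x)\<^sup>2) * indicator S x \<partial>lborel)
      \<le> ennreal (B\<^sup>2) * ?I k" .
  qed auto
qed

lemma L2lim_const: "f \<in> borel_measurable borel \<Longrightarrow> L2lim S (\<lambda>k. f) f"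
  by (simp add: L2lim_def)

lemma L2lim_subset:
  assumes "L2lim S fs f" "T \<subseteq> S" shows "L2lim T fs f"
proof -
  have "(\<lambda>k. \<integral>\<^sup>+x. ennreal ((fs k x - f x)\<^sup>2) * indicator S x \<partial>lborel) \<longlonglongrightarrow> 0"
    using assms by (simp add: L2lim_def)
  then show ?thesis
    by (rule L2lim_squeeze)
       (use assms in \<open>auto simp: L2lim_def indicator_def intro!: nn_integral_mono\<close>)
qed

lemma L2lim_cong:
  assumes "L2lim S fs f" "\<And>k. gs k \<in> borel_measurable borel" "g \<in> borel_measurable borel"
    and "\<And>k x. x \<in> S \<Longrightarrow> gs k x = fs k x" "AE x in lborel. x \<in> S \<longrightarrow> g x = f x"
  shows "L2lim S gs g"
proof -
  have "(\<integral>\<^sup>+x. ennreal ((gs k x - g x)\<^sup>2) * indicator S x \<partial>lborel)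
     = (\<integral>\<^sup>+x. ennreal ((fs k x - f x)\<^sup>2) * indicator S x \<partial>lborel)" for k
    by (rule nn_integral_cong_AE) (use assms(5,4) in \<open>auto simp: indicator_def\<close>)
  with assms(1-3) show ?thesis by (simp add: L2lim_def)
qed

lemma L2lim_cmult:
  assumes "S \<in> sets borel" "L2lim S fs f"
  shows "L2lim S (\<lambda>k x. c * fs k x) (\<lambda>x. c * f x)"
  using L2lim_mult[OF assms(1) _ assms(2), of "\<lambda>_. c" "\<bar>c\<bar>"] by simp

lemma L2lim_diff:
  assumes "S \<in> sets borel" "L2lim S fs f" "L2lim S gs g"
  shows "L2lim S (\<lambda>k x. fs k x - gs k x) (\<lambda>x. f x - g x)"
  using L2lim_add[OF assms(1,2) L2lim_cmult[OF assms(1,3), of "-1"]] by simp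

lemma L2lim_sum:
  assumes "S \<in> sets borel" "\<And>i. i \<in> I \<Longrightarrow> L2lim S (fs i) (f i)"
  shows "L2lim S (\<lambda>k x. \<Sum>i\<in>I. fs i k x) (\<lambda>x. \<Sum>i\<in>I. f i x)"
  using assms(2)
  by (induction I rule: infinite_finite_induct) (auto intro: L2lim_const L2lim_add[OF assms(1)])

section \<open>Square integrable Borel functions on the whole space\<close>

text \<open>Borel functions on the whole space fit Fubini and the substitution rules directly;
  \<open>L2_on_representative\<close> below passes from \<open>L2_on\<close> to this form.\<close>

definition sqint :: "('a::euclidean_space \<Rightarrow> real) \<Rightarrow> bool" where
  "sqint f \<longleftrightarrow> f \<in> borel_measurable borel \<and> integrable lborel (\<lambda>x. (f x)\<^sup>2)"

lemma sqint_measurable [measurable_dest]: "sqint f \<Longrightarrow> f \<in> borel_measurable borel"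
  by (simp add: sqint_def)

lemma sqint_iff:
  assumes [measurable]: "f \<in> borel_measurable borel"
  shows "sqint f \<longleftrightarrow> (\<integral>\<^sup>+x. ennreal ((f x)\<^sup>2) \<partial>lborel) < \<infinity>"
  by (auto simp: sqint_def integrable_iff_bounded)

lemma sqint_bound:
  assumes "sqint f" "g \<in> borel_measurable borel" "AE x in lborel. \<bar>g x\<bar> \<le> C * \<bar>f x\<bar>"
  shows "sqint g"
  unfolding sqint_def
proof
  show "integrable lborel (\<lambda>x. (g x)\<^sup>2)"
  proof (rule Bochner_Integration.integrable_bound)
    show "integrable lborel (\<lambda>x. C\<^sup>2 * (f x)\<^sup>2)" using assms(1) by (simp add: sqint_def)
    show "AE x in lborel. norm ((g x)\<^sup>2) \<le> norm (C\<^sup>2 * (f x)\<^sup>2)"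
      using assms(3)
    proof eventually_elim
      case (elim x)
      have "\<bar>g x\<bar>\<^sup>2 \<le> (C * \<bar>f x\<bar>)\<^sup>2" using elim by (intro power_mono) auto
      then show ?case by (simp add: power_mult_distrib)
    qed
  qed (use assms(2) in measurable)
qed (use assms in simp)

lemma sqint_mult_integrable:
  assumes "sqint f" "sqint g" shows "integrable lborel (\<lambda>x. f x * g x)"
proof (rule Bochner_Integration.integrable_bound)
  show "integrable lborel (\<lambda>x. (f x)\<^sup>2 + (g x)\<^sup>2)" using assms by (simp add: sqint_def)
  show "AE x in lborel. norm (f x * g x) \<le> norm ((f x)\<^sup>2 + (g x)\<^sup>2)"
  proof (rule AE_I2)
    fix x
    have "2 * (\<bar>f x\<bar> * \<bar>g x\<bar>) \<le> (f x)\<^sup>2 + (g x)\<^sup>2"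
      using sum_squares_bound[of "\<bar>f x\<bar>" "\<bar>g x\<bar>"] by (simp add: mult.assoc)
    moreover have "0 \<le> \<bar>f x\<bar> * \<bar>g x\<bar>" by simp
    ultimately have "\<bar>f x\<bar> * \<bar>g x\<bar> \<le> (f x)\<^sup>2 + (g x)\<^sup>2" by linarith
    then show "norm (f x * g x) \<le> norm ((f x)\<^sup>2 + (g x)\<^sup>2)" by (simp add: abs_mult)
  qed
  have [measurable]: "f \<in> borel_measurable borel" "g \<in> borel_measurable borel"
    using assms by (auto simp: sqint_def)
  show "(\<lambda>x. f x * g x) \<in> borel_measurable lborel" by measurable
qed

lemma sqint_bounded_compact:
  fixes f :: "'a::euclidean_space \<Rightarrow> real"
  assumes "f \<in> borel_measurable borel" "compact K" "\<And>x. \<bar>f x\<bar> \<le> B" "\<And>x. x \<notin> K \<Longrightarrow> f x = 0"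
  shows "sqint f"
  unfolding sqint_def
proof
  have "\<bar>(f x)\<^sup>2\<bar> \<le> B\<^sup>2" for x
    using power_mono[OF assms(3), of x 2] by simp
  then show "integrable lborel (\<lambda>x. (f x)\<^sup>2)"
    using assms by (intro integrable_bounded_compact[OF _ assms(2)]) auto
qed (use assms in simp)

lemma test_fun_sqint: "test_fun N \<phi> \<Longrightarrow> sqint \<phi>"
  by (metis sqint_bounded_compact test_funE test_fun_bounded test_fun_measurable)

lemma sqint_add: 
  assumes "sqint f" "sqint g" shows "sqint (\<lambda>x. f x + g x)"
proof -
  have [measurable]: "f \<in> borel_measurable borel" "g \<in> borel_measurable borel"
    using assms by (auto simp: sqint_def)
  show ?thesis unfolding sqint_def
    using assms sqint_mult_integrable[OF assms] by (auto simp: power2_sum sqint_def mult.assoc)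
qed

lemma sqint_cmult: "sqint f \<Longrightarrow> sqint (\<lambda>x. c * f x)"
  by (auto simp: sqint_def power_mult_distrib)

lemma sqint_diff: "sqint f \<Longrightarrow> sqint g \<Longrightarrow> sqint (\<lambda>x. f x - g x)"
  using sqint_add[OF _ sqint_cmult[of g "-1"], of f] by simp

lemma sqint_integrable_bounded:
  assumes "sqint f" "S \<in> sets borel" "bounded S" shows "integrable lborel (\<lambda>x. indicator S x * f x)"
proof -
  obtain R where "\<And>x. x \<in> S \<Longrightarrow> norm x \<le> R" using assms(3) by (meson bounded_iff)
  then have "S \<subseteq> cball 0 R" by auto
  then have "sqint (indicator S :: 'a \<Rightarrow> real)"
    using assms(2) by (intro sqint_bounded_compact[of _ "cball 0 R" 1]) (auto simp: indicator_def)
  then show ?thesis using sqint_mult_integrable assms(1) by blast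
qed

text \<open>Cauchy-Schwarz: the squared difference of the two pairings is at most the squared norm
  of \<psi> times the squared L2 distance on \<open>S\<close>, outside of which \<psi>
  vanishes.\<close>

lemma L2lim_integral:
  assumes S[measurable]: "S \<in> sets borel" and lim: "L2lim S fs f" and \<psi>: "sqint \<psi>"
    and z: "\<And>x. x \<notin> S \<Longrightarrow> \<psi> x = 0"
    and i: "\<And>k. integrable lborel (\<lambda>x. fs k x * \<psi> x)" "integrable lborel (\<lambda>x. f x * \<psi> x)"
  shows "(\<lambda>k. \<integral>x. fs k x * \<psi> x \<partial>lborel) \<longlonglongrightarrow> (\<integral>x. f x * \<psi> x \<partial>lborel)"
proof -
  have [measurable]: "\<And>k. fs k \<in> borel_measurable borel" "f \<in> borel_measurable borel"
    "\<psi> \<in> borel_measurable borel"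
    using lim \<psi> by (auto simp: L2lim_def sqint_def)
  let ?I = "\<lambda>k. \<integral>\<^sup>+x. ennreal ((fs k x - f x)\<^sup>2) * indicator S x \<partial>lborel"
  let ?C = "\<integral>\<^sup>+x. ennreal ((\<psi> x)\<^sup>2) \<partial>lborel"
  have C: "?C \<noteq> top" using \<psi> sqint_iff[of \<psi>] by (auto simp: less_top)
  let ?d = "\<lambda>k. \<integral>x. fs k x * \<psi> x \<partial>lborel - \<integral>x. f x * \<psi> x \<partial>lborel"
  have b: "ennreal ((?d k)\<^sup>2) \<le> ?C * ?I k" for k
  proof -
    let ?h = "\<lambda>x. fs k x * \<psi> x - f x * \<psi> x"
    have "ennreal \<bar>?d k\<bar> = ennreal (norm (\<integral>x. ?h x \<partial>lborel))"
      using i by simp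
    also have "\<dots> \<le> (\<integral>\<^sup>+x. ennreal (norm (?h x)) \<partial>lborel)"
      using i by (intro integral_norm_bound_ennreal) auto
    also have "\<dots> = (\<integral>\<^sup>+x. (ennreal \<bar>fs k x - f x\<bar> * indicator S x) * ennreal \<bar>\<psi> x\<bar> \<partial>lborel)"
      using z by (intro nn_integral_cong)
        (auto simp: indicator_def left_diff_distrib[symmetric] abs_mult ennreal_mult)
    finally have "(ennreal \<bar>?d k\<bar>)\<^sup>2 \<le> (\<integral>\<^sup>+x. (ennreal \<bar>fs k x - f x\<bar> * indicator S x) * ennreal \<bar>\<psi> x\<bar> \<partial>lborel)\<^sup>2"
      by (rule power_mono) simp
    also have "\<dots> \<le> (\<integral>\<^sup>+x. (ennreal \<bar>fs k x - f x\<bar> * indicator S x)\<^sup>2 \<partial>lborel) * (\<integral>\<^sup>+x. (ennreal \<bar>\<psi> x\<bar>)\<^sup>2 \<partial>lborel)"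
      by (rule Cauchy_Schwarz_nn_integral) auto
    also have "(\<integral>\<^sup>+x. (ennreal \<bar>fs k x - f x\<bar> * indicator S x)\<^sup>2 \<partial>lborel) = ?I k"
      by (intro nn_integral_cong) (auto simp: indicator_def ennreal_power)
    also have "(\<integral>\<^sup>+x. (ennreal \<bar>\<psi> x\<bar>)\<^sup>2 \<partial>lborel) = ?C"
      by (intro nn_integral_cong) (auto simp: ennreal_power)
    finally show ?thesis by (simp add: ennreal_power mult.commute)
  qed
  have "(\<lambda>k. ?C * ?I k) \<longlonglongrightarrow> ennreal 0"
    using lim C unfolding ennreal_0 by (intro ennreal_tendsto_0_cmult) (auto simp: L2lim_def)
  from tendsto_sandwich[OF _ _ tendsto_const this, of "\<lambda>k. ennreal ((?d k)\<^sup>2)"] b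
  have "(\<lambda>k. ennreal ((?d k)\<^sup>2)) \<longlonglongrightarrow> ennreal 0" by auto
  then have "(\<lambda>k. (?d k)\<^sup>2) \<longlonglongrightarrow> 0"
    by (subst (asm) tendsto_ennreal_iff) auto
  from tendsto_real_sqrt[OF this] have "?d \<longlonglongrightarrow> 0"
    by (intro tendsto_rabs_zero_cancel[of ?d]) simp
  then show ?thesis by (simp add: LIM_zero_iff)
qed

subsection \<open>Density of continuous functions\<close>

lemma sets_borel_ball [measurable, simp]: "ball c r \<in> sets borel" "cball c r \<in> sets borel"
  by (auto intro: borel_open borel_closed)

text \<open>A Lebesgue measurable function is almost everywhere a pointwise limit of continuous
  functions. Clipping these gives a common bound and a common compact support, and dominated
  convergence turns pointwise into mean square convergence.\<close>

lemma L2_continuous_dense_bounded: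
  fixes f :: "'a::euclidean_space \<Rightarrow> real"
  assumes f[measurable]: "f \<in> borel_measurable borel" and B: "\<And>x. \<bar>f x\<bar> \<le> B"
    and R: "\<And>x. norm x > R \<Longrightarrow> f x = 0"
  shows "\<exists>gs. (\<forall>n. continuous_on UNIV (gs n)) \<and> (\<forall>n x. \<bar>gs n x\<bar> \<le> B) \<and>
     (\<forall>n x. norm x > R + 1 \<longrightarrow> gs n x = 0) \<and> L2lim UNIV gs f"
proof -
  have "f measurable_on UNIV"
    by (rule lebesgue_measurable_imp_measurable_on)
      (use f in \<open>auto intro: measurable_completion\<close>)
  then obtain N g where N: "negligible N" and g: "\<And>n. continuous_on UNIV (g n)"
    and lim: "\<And>x. x \<notin> N \<Longrightarrow> (\<lambda>n. g n x) \<longlonglongrightarrow> f x"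
    by (auto simp: measurable_on_def)
  \<comment> \<open>The values are clipped to the range from -B to B and multiplied by a continuous
    factor that is 1 for norm at most R and 0 from R + 1 on.\<close>
  define h where "h n x = max (- B) (min B (g n x)) * max 0 (min 1 (R + 1 - norm x))" for n x
  have B0: "0 \<le> B" using B[of undefined] by simp
  have ch: "continuous_on UNIV (h n)" for n
    unfolding h_def by (intro continuous_intros g)
  have [measurable]: "h n \<in> borel_measurable borel" for n
    using ch borel_measurable_continuous_onI by blast
  have hB: "\<bar>h n x\<bar> \<le> B" for n x
  proof -
    have "\<bar>h n x\<bar> \<le> B * 1" unfolding h_def abs_mult by (intro mult_mono) (use B0 in auto)
    then show ?thesis by simp
  qed
  have h0: "h n x = 0" if "norm x > R + 1" for n x using that by (simp add: h_def)
  have "AE x in lborel. x \<notin> N"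
  proof -
    have "N \<in> null_sets lebesgue" using N by (simp add: negligible_iff_null_sets)
    then have "AE x in lebesgue. x \<notin> N" by (rule AE_not_in)
    then show ?thesis by (simp add: AE_completion_iff)
  qed
  then have pw: "AE x in lborel. (\<lambda>n. h n x) \<longlonglongrightarrow> f x"
  proof eventually_elim
    case (elim x)
    have "(\<lambda>n. h n x) \<longlonglongrightarrow> max (- B) (min B (f x)) * max 0 (min 1 (R + 1 - norm x))"
      unfolding h_def by (intro tendsto_intros lim elim)
    also have "max (- B) (min B (f x)) * max 0 (min 1 (R + 1 - norm x)) = f x"
      using B[of x] R[of x] by (cases "norm x > R") (auto simp: max_def min_def)
    finally show ?case .
  qed
  have "(\<lambda>n. \<integral>\<^sup>+x. ennreal ((h n x - f x)\<^sup>2) \<partial>lborel) \<longlonglongrightarrow> (\<integral>\<^sup>+x. 0 \<partial>(lborel :: 'a measure))"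
  proof (rule nn_integral_dominated_convergence)
    show "AE x in lborel. ennreal ((h n x - f x)\<^sup>2) \<le> ennreal ((2 * B)\<^sup>2) * indicator (cball 0 (R + 1)) x" for n
    proof (rule AE_I2)
      fix x
      have "\<bar>h n x - f x\<bar> \<le> \<bar>2 * B\<bar>" using hB[of n x] B[of x] by linarith
      then have "(h n x - f x)\<^sup>2 \<le> (2 * B)\<^sup>2" by (simp only: abs_le_square_iff)
      moreover have "(h n x - f x)\<^sup>2 = 0" if "x \<notin> cball 0 (R + 1)"
        using that h0[of x n] R[of x] by simp
      ultimately show "ennreal ((h n x - f x)\<^sup>2) \<le> ennreal ((2 * B)\<^sup>2) * indicator (cball 0 (R + 1)) x"
        by (auto simp: indicator_def intro: ennreal_leI)
    qed
    show "(\<integral>\<^sup>+x. ennreal ((2 * B)\<^sup>2) * indicator (cball 0 (R + 1)) x \<partial>(lborel :: 'a measure)) < \<infinity>"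
      using emeasure_compact_finite[of "cball (0::'a) (R + 1)"]
      by (simp add: nn_integral_cmult_indicator ennreal_mult_less_top)
    show "AE x in lborel. (\<lambda>n. ennreal ((h n x - f x)\<^sup>2)) \<longlonglongrightarrow> 0"
      using pw
    proof eventually_elim
      case (elim x)
      have "(\<lambda>n. ennreal ((h n x - f x)\<^sup>2)) \<longlonglongrightarrow> ennreal ((f x - f x)\<^sup>2)"
        by (intro tendsto_intros elim)
      then show ?case by simp
    qed
  qed auto
  then have "L2lim UNIV h f" by (simp add: L2lim_def)
  with ch hB h0 show ?thesis by blast
qed

lemma L2_truncation:
  fixes f :: "'a::euclidean_space \<Rightarrow> real"
  assumes f: "sqint f"
  shows "L2lim UNIV (\<lambda>n x. max (- real n) (min (real n) (f x)) * indicator (cball 0 (real n)) x) f"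
proof -
  have [measurable]: "f \<in> borel_measurable borel" using f by (simp add: sqint_def)
  let ?t = "\<lambda>n x. max (- real n) (min (real n) (f x)) * indicator (cball 0 (real n)) x"
  have [measurable]: "?t n \<in> borel_measurable borel" for n
    by (intro borel_measurable_times borel_measurable_max borel_measurable_min
          borel_measurable_const borel_measurable_indicator) auto
  have "(\<lambda>n. \<integral>\<^sup>+x. ennreal ((?t n x - f x)\<^sup>2) \<partial>lborel) \<longlonglongrightarrow> (\<integral>\<^sup>+x. 0 \<partial>(lborel :: 'a measure))"
  proof (rule nn_integral_dominated_convergence)
    show "AE x in lborel. ennreal ((?t n x - f x)\<^sup>2) \<le> ennreal ((f x)\<^sup>2)" for n
    proof (rule AE_I2)
      fix x
      have "\<bar>?t n x - f x\<bar> \<le> \<bar>f x\<bar>" by (auto simp: indicator_def max_def min_def abs_if)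
      then show "ennreal ((?t n x - f x)\<^sup>2) \<le> ennreal ((f x)\<^sup>2)"
        by (intro ennreal_leI) (simp only: abs_le_square_iff)
    qed
    show "(\<integral>\<^sup>+x. ennreal ((f x)\<^sup>2) \<partial>lborel) < \<infinity>" using f by (simp add: sqint_iff)
    show "AE x in lborel. (\<lambda>n. ennreal ((?t n x - f x)\<^sup>2)) \<longlonglongrightarrow> 0"
    proof (rule AE_I2)
      fix x
      obtain m where m: "norm x \<le> real m" "\<bar>f x\<bar> \<le> real m"
        by (meson order_trans max.bounded_iff real_arch_simple)
      have "eventually (\<lambda>n. ennreal ((?t n x - f x)\<^sup>2) = 0) sequentially"
        using eventually_ge_at_top[of m]
      proof eventually_elim
        case (elim n)
        then have "norm x \<le> real n" "\<bar>f x\<bar> \<le> real n" using m by linarith+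
        then show ?case by (auto simp: indicator_def max_def min_def abs_if split: if_splits)
      qed
      then show "(\<lambda>n. ennreal ((?t n x - f x)\<^sup>2)) \<longlonglongrightarrow> 0" by (rule tendsto_eventually)
    qed
  qed auto
  then show ?thesis by (simp add: L2lim_def)
qed

lemma L2_continuous_dense:
  fixes f :: "'a::euclidean_space \<Rightarrow> real"
  assumes f: "sqint f" and e: "e > 0"
  obtains g R B where "continuous_on UNIV g" "\<And>x. norm x > R \<Longrightarrow> g x = 0" "\<And>x. \<bar>g x\<bar> \<le> B"
    "(\<integral>\<^sup>+x. ennreal ((f x - g x)\<^sup>2) \<partial>lborel) < ennreal e"
proof -
  have [measurable]: "f \<in> borel_measurable borel" using f by (simp add: sqint_def)
  let ?t = "\<lambda>n x. max (- real n) (min (real n) (f x)) * indicator (cball 0 (real n)) x"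
  have [measurable]: "?t n \<in> borel_measurable borel" for n
    using L2_truncation[OF f] by (simp add: L2lim_def)
  have "(\<lambda>n. \<integral>\<^sup>+x. ennreal ((?t n x - f x)\<^sup>2) \<partial>lborel) \<longlonglongrightarrow> 0"
    using L2_truncation[OF f] by (simp add: L2lim_def)
  \<comment> \<open>Truncation and continuous approximation each get e/4, since
    \<open>power2_add_le\<close> doubles both squared errors.\<close>
  then have "eventually (\<lambda>n. (\<integral>\<^sup>+x. ennreal ((?t n x - f x)\<^sup>2) \<partial>lborel) < ennreal (e/4)) sequentially"
    using e by (intro order_tendstoD) auto
  then obtain n where n: "(\<integral>\<^sup>+x. ennreal ((?t n x - f x)\<^sup>2) \<partial>lborel) < ennreal (e/4)"
    by (auto dest: eventually_happens)
  obtain gs where gs: "\<And>m. continuous_on UNIV (gs m)" "\<And>m x. \<bar>gs m x\<bar> \<le> real n"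
     "\<And>m x. norm x > real n + 1 \<Longrightarrow> gs m x = 0" "L2lim UNIV gs (?t n)"
  proof -
    have "?t n \<in> borel_measurable borel" using L2_truncation[OF f] by (simp add: L2lim_def)
    moreover have "\<bar>?t n x\<bar> \<le> real n" for x by (auto simp: indicator_def max_def min_def abs_if)
    moreover have "?t n x = 0" if "norm x > real n" for x using that by simp
    ultimately show ?thesis using L2_continuous_dense_bounded[of "?t n" "real n" "real n"] that by blast
  qed
  have "(\<lambda>m. \<integral>\<^sup>+x. ennreal ((gs m x - ?t n x)\<^sup>2) \<partial>lborel) \<longlonglongrightarrow> 0"
    using gs(4) by (simp add: L2lim_def)
  then have "eventually (\<lambda>m. (\<integral>\<^sup>+x. ennreal ((gs m x - ?t n x)\<^sup>2) \<partial>lborel) < ennreal (e/4)) sequentially"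
    using e by (intro order_tendstoD) auto
  then obtain m where m: "(\<integral>\<^sup>+x. ennreal ((gs m x - ?t n x)\<^sup>2) \<partial>lborel) < ennreal (e/4)"
    by (auto dest: eventually_happens)
  have [measurable]: "gs m \<in> borel_measurable borel"
    using gs(1) borel_measurable_continuous_onI by blast
  have "(\<integral>\<^sup>+x. ennreal ((f x - gs m x)\<^sup>2) \<partial>lborel)
      \<le> (\<integral>\<^sup>+x. 2 * ennreal ((?t n x - f x)\<^sup>2) + 2 * ennreal ((gs m x - ?t n x)\<^sup>2) \<partial>lborel)"
  proof (rule nn_integral_mono)
    fix x
    have "(f x - gs m x)\<^sup>2 \<le> 2 * (?t n x - f x)\<^sup>2 + 2 * (gs m x - ?t n x)\<^sup>2"
      using power2_add_le[of "?t n x - f x" "gs m x - ?t n x"] by (simp add: power2_commute)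
    then have "ennreal ((f x - gs m x)\<^sup>2) \<le> ennreal (2 * (?t n x - f x)\<^sup>2 + 2 * (gs m x - ?t n x)\<^sup>2)"
      by (rule ennreal_leI)
    then show "ennreal ((f x - gs m x)\<^sup>2) \<le> 2 * ennreal ((?t n x - f x)\<^sup>2) + 2 * ennreal ((gs m x - ?t n x)\<^sup>2)"
      by (simp add: ennreal_mult')
  qed
  also have "\<dots> = 2 * (\<integral>\<^sup>+x. ennreal ((?t n x - f x)\<^sup>2) \<partial>lborel) + 2 * (\<integral>\<^sup>+x. ennreal ((gs m x - ?t n x)\<^sup>2) \<partial>lborel)"
    by (simp add: nn_integral_add nn_integral_cmult)
  also have "\<dots> < 2 * ennreal (e/4) + 2 * ennreal (e/4)"
    using n m by (intro add_strict_mono ennreal_mult_strict_left_mono) auto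
  also have "2 * ennreal (e/4) + 2 * ennreal (e/4) = ennreal (2 * (e/4) + 2 * (e/4))"
    using e by (simp only: ennreal_mult' ennreal_plus ennreal_numeral)
  also have "2 * (e/4) + 2 * (e/4) = e" by simp
  finally show ?thesis using that gs(1-3) by blast
qed

subsection \<open>Mollification\<close>

text \<open>The profile is \<open>flat 1\<close> rather than \<open>flat 0\<close> so that w times
  the mollifier is a multiple of the gradient of \<open>beta\<close>, the bump built from
  \<open>flat 0\<close>; Weyl's lemma rests on this relation.\<close>

definition eta_raw :: "real^'n \<Rightarrow> real" where
  "eta_raw x = flat 1 (1 - x \<bullet> x)"

definition eta :: "real^'n \<Rightarrow> real" where
  "eta x = eta_raw x / (\<integral>x. eta_raw x \<partial>(lborel :: (real^'n) measure))"

lemma flat_1_nonneg: "0 \<le> flat 1 t"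
  by (simp only: flat_1) auto

lemma eta_raw_nonneg: "0 \<le> eta_raw x"
  using flat_1_nonneg by (simp add: eta_raw_def)

lemma eta_raw_eq_0: "1 \<le> norm x \<Longrightarrow> eta_raw x = 0"
  unfolding eta_raw_def flat_def using power_mono[of 1 "norm x" 2]
  by (simp add: power2_norm_eq_inner)

lemma eta_raw_pos: "norm x < 1 \<Longrightarrow> 0 < eta_raw x"
  unfolding eta_raw_def flat_1[simplified] using power_strict_mono[of "norm x" 1 2]
  by (simp add: flat_1[simplified] power2_norm_eq_inner)

lemma smooth_on_eta_raw: "smooth_on UNIV (eta_raw :: real^'n \<Rightarrow> real)"
  unfolding eta_raw_def[abs_def]
  by (intro smooth_on_flat smooth_on_diff smooth_on_inner_self smooth_on_const) auto

lemma test_fun_eta_raw: "test_fun UNIV (eta_raw :: real^'n \<Rightarrow> real)"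
  by (rule test_funI[OF smooth_on_eta_raw, of "cball 0 1"]) (auto intro: eta_raw_eq_0)

lemma integral_eta_raw_pos: "0 < (\<integral>x. eta_raw x \<partial>(lborel :: (real^'n) measure))"
proof -
  have i: "integrable lborel (eta_raw :: real^'n \<Rightarrow> real)" using test_fun_eta_raw test_fun_integrable by blast
  have "(\<integral>x. eta_raw x \<partial>(lborel :: (real^'n) measure)) \<noteq> 0"
  proof
    assume "(\<integral>x. eta_raw x \<partial>(lborel :: (real^'n) measure)) = 0"
    then have "AE x in (lborel :: (real^'n) measure). eta_raw x = 0"
      using integral_nonneg_eq_0_iff_AE[OF i] eta_raw_nonneg by auto
    then have "AE x in (lborel :: (real^'n) measure). x \<notin> ball 0 1"
      by eventually_elim (use eta_raw_pos in \<open>force simp: less_le\<close>)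
    then have "ball (0::real^'n) 1 \<in> null_sets lborel" by (subst (asm) AE_iff_null_sets[symmetric]) auto
    then have "negligible (ball (0::real^'n) 1)"
      by (simp add: negligible_iff_null_sets null_sets_completionI)
    then show False using open_not_negligible[of "ball (0::real^'n) 1"] by simp
  qed
  moreover have "0 \<le> (\<integral>x. eta_raw x \<partial>(lborel :: (real^'n) measure))"
    by (simp add: eta_raw_nonneg)
  ultimately show ?thesis by linarith
qed

lemma eta_nonneg: "0 \<le> eta x"
  using integral_eta_raw_pos by (simp add: eta_def eta_raw_nonneg less_imp_le)

lemma eta_eq_0: "1 \<le> norm x \<Longrightarrow> eta x = 0"
  by (simp add: eta_def eta_raw_eq_0)

lemma smooth_on_eta: "smooth_on UNIV (eta :: real^'n \<Rightarrow> real)"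
  using smooth_on_cmult[OF open_UNIV smooth_on_eta_raw[where 'n='n],
      of "inverse (\<integral>x. eta_raw x \<partial>(lborel :: (real^'n) measure))"]
  by (simp add: eta_def[abs_def] divide_inverse mult.commute)

lemma test_fun_eta: "test_fun UNIV (eta :: real^'n \<Rightarrow> real)"
  by (rule test_funI[OF smooth_on_eta, of "cball 0 1"]) (auto intro: eta_eq_0)

lemma eta_measurable [measurable]: "eta \<in> borel_measurable borel"
  using test_fun_eta test_fun_measurable by blast

lemma eta_integrable: "integrable lborel (eta :: real^'n \<Rightarrow> real)"
  using test_fun_eta test_fun_integrable by blast

lemma integral_eta: "(\<integral>x. eta x \<partial>(lborel :: (real^'n) measure)) = 1"
  unfolding eta_def[abs_def] using integral_eta_raw_pos[where 'n='n] by simp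

lemma nn_integral_eta: "(\<integral>\<^sup>+x. ennreal (eta x) \<partial>(lborel :: (real^'n) measure)) = 1"
  using nn_integral_eq_integral[OF eta_integrable[where 'n='n]] by (simp add: integral_eta eta_nonneg)

text \<open>Mollification at scale \<open>e\<close> combined with the dilation x to c x. With c < 1
  the evaluation points are drawn into the ball, so that a mollification is defined and regular up
  to the boundary although weak derivatives are known only inside.\<close>

definition moll :: "real \<Rightarrow> real \<Rightarrow> (real^'n \<Rightarrow> real) \<Rightarrow> real^'n \<Rightarrow> real" where
  "moll c e f x = (\<integral>z. eta z * f (c *\<^sub>R x - e *\<^sub>R z) \<partial>lborel)"

lemma moll_measurable [measurable]:
  assumes [measurable]: "f \<in> borel_measurable borel"
  shows "moll c e f \<in> borel_measurable borel"
proof -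
  have "(\<lambda>x. \<integral>z. eta z * f (c *\<^sub>R x - e *\<^sub>R z) \<partial>lborel) \<in> borel_measurable lborel"
    by (rule lborel.borel_measurable_lebesgue_integral) measurable
  then show ?thesis by (simp add: moll_def[abs_def])
qed

text \<open>Jensen's inequality for the probability density \<open>eta\<close>, obtained from
  Cauchy-Schwarz.\<close>

lemma moll_power2_le:
  fixes f :: "real^'n \<Rightarrow> real"
  assumes [measurable]: "f \<in> borel_measurable borel"
  shows "ennreal ((moll c e f x)\<^sup>2) \<le> (\<integral>\<^sup>+z. ennreal (eta z) * ennreal ((f (c *\<^sub>R x - e *\<^sub>R z))\<^sup>2) \<partial>lborel)"
proof -
  let ?f = "\<lambda>z. f (c *\<^sub>R x - e *\<^sub>R z)"
  have "ennreal \<bar>moll c e f x\<bar> \<le> (\<integral>\<^sup>+z. ennreal \<bar>eta z * ?f z\<bar> \<partial>lborel)"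
  proof (cases "integrable lborel (\<lambda>z. eta z * ?f z)")
    case True
    then show ?thesis unfolding moll_def using integral_norm_bound_ennreal[OF True] by simp
  qed (simp add: moll_def not_integrable_integral_eq)
  \<comment> \<open>One square root of the weight goes to each factor; the first factor then has
    squared norm 1.\<close>
  also have "\<dots> = (\<integral>\<^sup>+z. ennreal (sqrt (eta z)) * ennreal (sqrt (eta z) * \<bar>?f z\<bar>) \<partial>lborel)"
    by (intro nn_integral_cong) (simp add: abs_mult eta_nonneg ennreal_mult'[symmetric] mult.assoc[symmetric])
  finally have "(ennreal \<bar>moll c e f x\<bar>)\<^sup>2 \<le> \<dots>\<^sup>2" by (rule power_mono) simp
  also have "\<dots> \<le> (\<integral>\<^sup>+z. (ennreal (sqrt (eta z)))\<^sup>2 \<partial>(lborel :: (real^'n) measure)) * (\<integral>\<^sup>+z. (ennreal (sqrt (eta z) * \<bar>?f z\<bar>))\<^sup>2 \<partial>lborel)"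
    by (rule Cauchy_Schwarz_nn_integral) auto
  also have "(\<integral>\<^sup>+z. (ennreal (sqrt (eta z)))\<^sup>2 \<partial>(lborel :: (real^'n) measure)) = 1"
    by (simp add: ennreal_power eta_nonneg nn_integral_eta)
  also have "(\<integral>\<^sup>+z. (ennreal (sqrt (eta z) * \<bar>?f z\<bar>))\<^sup>2 \<partial>lborel)
     = (\<integral>\<^sup>+z. ennreal (eta z) * ennreal ((?f z)\<^sup>2) \<partial>lborel)"
    by (intro nn_integral_cong) (simp add: ennreal_power eta_nonneg power_mult_distrib ennreal_mult'[symmetric])
  finally show ?thesis by (simp add: ennreal_power)
qed

text \<open>Integrate the pointwise bound, exchange the integrals and substitute affinely; the
  dilation contributes the factor |c|^(-n).\<close>

lemma nn_integral_moll_le: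
  fixes f :: "real^'n \<Rightarrow> real"
  assumes [measurable]: "f \<in> borel_measurable borel" and c: "c \<noteq> 0"
  shows "(\<integral>\<^sup>+x. ennreal ((moll c e f x)\<^sup>2) \<partial>lborel)
     \<le> ennreal (inverse (\<bar>c\<bar> ^ CARD('n))) * (\<integral>\<^sup>+x. ennreal ((f x)\<^sup>2) \<partial>lborel)"
proof -
  let ?I = "\<integral>\<^sup>+x. ennreal ((f x)\<^sup>2) \<partial>lborel"
  let ?k = "ennreal (inverse (\<bar>c\<bar> ^ CARD('n)))"
  have aff: "(\<integral>\<^sup>+x. ennreal ((f (c *\<^sub>R x - e *\<^sub>R z))\<^sup>2) \<partial>lborel) = ?k * ?I" for z
  proof -
    have "?I = ennreal (\<bar>c\<bar> ^ CARD('n)) * (\<integral>\<^sup>+x. ennreal ((f (- e *\<^sub>R z + c *\<^sub>R x))\<^sup>2) \<partial>lborel)"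
      using nn_integral_lborel_affine[OF _ c, of "\<lambda>x. ennreal ((f x)\<^sup>2)" "- e *\<^sub>R z"] by simp
    then have "?k * ?I = ?k * ennreal (\<bar>c\<bar> ^ CARD('n)) * (\<integral>\<^sup>+x. ennreal ((f (c *\<^sub>R x - e *\<^sub>R z))\<^sup>2) \<partial>lborel)"
      by (simp add: mult.assoc)
    also have "?k * ennreal (\<bar>c\<bar> ^ CARD('n)) = 1"
      using c by (simp add: ennreal_mult'[symmetric])
    finally show ?thesis by simp
  qed
  have "(\<integral>\<^sup>+x. ennreal ((moll c e f x)\<^sup>2) \<partial>lborel)
     \<le> (\<integral>\<^sup>+x. \<integral>\<^sup>+z. ennreal (eta z) * ennreal ((f (c *\<^sub>R x - e *\<^sub>R z))\<^sup>2) \<partial>lborel \<partial>lborel)"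
    by (intro nn_integral_mono moll_power2_le) simp
  also have "\<dots> = (\<integral>\<^sup>+z. \<integral>\<^sup>+x. ennreal (eta z) * ennreal ((f (c *\<^sub>R x - e *\<^sub>R z))\<^sup>2) \<partial>lborel \<partial>lborel)"
    by (rule lborel_pair.Fubini'[symmetric]) measurable
  also have "\<dots> = (\<integral>\<^sup>+z. ennreal (eta z) * (?k * ?I) \<partial>(lborel :: (real^'n) measure))"
    by (intro nn_integral_cong) (simp add: nn_integral_cmult aff)
  also have "\<dots> = ?k * ?I"
    by (simp add: nn_integral_multc nn_integral_eta)
  finally show ?thesis .
qed

lemma moll_integrand_integrable:
  assumes f: "sqint f" and c: "e \<noteq> 0"
  shows "integrable lborel (\<lambda>z. eta z * f (c *\<^sub>R x - e *\<^sub>R z))"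
proof -
  have [measurable]: "f \<in> borel_measurable borel" using f by (simp add: sqint_def)
  have "(\<integral>\<^sup>+y. ennreal ((f y)\<^sup>2) \<partial>lborel) < \<infinity>" using f by (simp add: sqint_iff)
  then have "(\<integral>\<^sup>+z. ennreal ((f (c *\<^sub>R x + (-e) *\<^sub>R z))\<^sup>2) \<partial>lborel) < \<infinity>"
    using c by (subst (asm) nn_integral_lborel_affine[of _ "-e" "c *\<^sub>R x"]) (auto simp: ennreal_mult_less_top)
  then have "sqint (\<lambda>z. f (c *\<^sub>R x - e *\<^sub>R z))" by (subst sqint_iff) auto
  then show ?thesis using sqint_mult_integrable test_fun_sqint[OF test_fun_eta] by blast
qed

lemma moll_diff:
  assumes "sqint f" "sqint g" "e \<noteq> 0"
  shows "moll c e (\<lambda>x. f x - g x) x = moll c e f x - moll c e g x"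
  unfolding moll_def using moll_integrand_integrable[OF assms(1,3)] moll_integrand_integrable[OF assms(2,3)]
  by (simp add: right_diff_distrib)

text \<open>Convergence is pointwise by continuity of \<open>g\<close>, and the mollifications share
  the bound \<open>B\<close> and a compact support, so they are dominated.\<close>

lemma moll_continuous_L2lim:
  fixes g :: "real^'n \<Rightarrow> real"
  assumes g: "continuous_on UNIV g" and R: "\<And>x. norm x > R \<Longrightarrow> g x = 0" and B: "\<And>x. \<bar>g x\<bar> \<le> B"
    and cs: "cs \<longlonglongrightarrow> 1" "\<And>k. 1/2 \<le> cs k" and es: "es \<longlonglongrightarrow> 0" "\<And>k. \<bar>es k\<bar> \<le> 1"
  shows "L2lim UNIV (\<lambda>k. moll (cs k) (es k) g) g"
proof -
  have [measurable]: "g \<in> borel_measurable borel" using g borel_measurable_continuous_onI by blast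
  have B0: "0 \<le> B" using B[of undefined] by linarith
  have pw: "(\<lambda>k. moll (cs k) (es k) g x) \<longlonglongrightarrow> g x" for x
  proof -
    have "(\<lambda>k. \<integral>z. eta z * g (cs k *\<^sub>R x - es k *\<^sub>R z) \<partial>lborel) \<longlonglongrightarrow> (\<integral>z. eta z * g x \<partial>(lborel :: (real^'n) measure))"
    proof (rule integral_dominated_convergence)
      show "integrable lborel (\<lambda>z :: real^'n. eta z * B)" by (simp add: eta_integrable)
      show "AE z in lborel. (\<lambda>k. eta z * g (cs k *\<^sub>R x - es k *\<^sub>R z)) \<longlonglongrightarrow> eta z * g x"
      proof (rule AE_I2)
        fix z
        have "(\<lambda>k. cs k *\<^sub>R x - es k *\<^sub>R z) \<longlonglongrightarrow> 1 *\<^sub>R x - 0 *\<^sub>R z"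
          by (intro tendsto_intros cs es)
        then have "(\<lambda>k. cs k *\<^sub>R x - es k *\<^sub>R z) \<longlonglongrightarrow> x" by simp
        then have "(\<lambda>k. g (cs k *\<^sub>R x - es k *\<^sub>R z)) \<longlonglongrightarrow> g x"
          using g continuous_on_tendsto_compose[of UNIV g] by auto
        then show "(\<lambda>k. eta z * g (cs k *\<^sub>R x - es k *\<^sub>R z)) \<longlonglongrightarrow> eta z * g x"
          by (intro tendsto_intros)
      qed
      show "AE z in lborel. norm (eta z * g (cs k *\<^sub>R x - es k *\<^sub>R z)) \<le> eta z * B" for k
        by (intro AE_I2) (auto simp: abs_mult eta_nonneg intro!: mult_left_mono B)
    qed auto
    then show ?thesis by (simp add: moll_def integral_eta)
  qed
  have bd: "\<bar>moll c e g x\<bar> \<le> B" for c e x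
  proof -
    have "\<bar>moll c e g x\<bar> \<le> (\<integral>z. eta z * B \<partial>(lborel :: (real^'n) measure))"
      unfolding moll_def
      by (rule integral_abs_bound[THEN order_trans], rule integral_mono_AE')
         (use B0 in \<open>auto simp: eta_integrable abs_mult eta_nonneg intro!: mult_left_mono B\<close>)
    then show ?thesis by (simp add: integral_eta)
  qed
  \<comment> \<open>The dilation is at least 1/2 and the shift at most 1, so for norm x beyond 2(|R|
    + 1) every evaluation point lies outside the ball of radius R.\<close>
  have z: "moll (cs k) (es k) g x = 0" if x: "norm x > 2 * (\<bar>R\<bar> + 1)" for k x
  proof -
    have "eta z * g (cs k *\<^sub>R x - es k *\<^sub>R z) = 0" for z
    proof (cases "norm z < 1")
      case True
      have "norm (es k *\<^sub>R z) \<le> 1 * 1" unfolding norm_scaleR using es(2) True by (intro mult_mono) auto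
      moreover have "\<bar>R\<bar> + 1 < cs k * norm x"
      proof -
        have "\<bar>R\<bar> + 1 < 1/2 * norm x" using x by simp
        also have "\<dots> \<le> cs k * norm x" by (rule mult_right_mono[OF cs(2)]) simp
        finally show ?thesis .
      qed
      moreover have "norm (cs k *\<^sub>R x) = cs k * norm x" using cs(2)[of k] by simp
      ultimately have "norm (cs k *\<^sub>R x - es k *\<^sub>R z) > R"
        using norm_triangle_ineq2[of "cs k *\<^sub>R x" "es k *\<^sub>R z"] by linarith
      then show ?thesis using R by simp
    qed (simp add: eta_eq_0)
    then show ?thesis by (simp only: moll_def Bochner_Integration.integral_zero)
  qed
  have "(\<lambda>k. \<integral>\<^sup>+x. ennreal ((moll (cs k) (es k) g x - g x)\<^sup>2) \<partial>lborel) \<longlonglongrightarrow> (\<integral>\<^sup>+x. 0 \<partial>(lborel :: (real^'n) measure))"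
  proof (rule nn_integral_dominated_convergence)
    show "AE x in lborel. ennreal ((moll (cs k) (es k) g x - g x)\<^sup>2)
       \<le> ennreal ((2 * B)\<^sup>2) * indicator (cball 0 (2 * (\<bar>R\<bar> + 1))) x" for k
    proof (rule AE_I2)
      fix x
      have "\<bar>moll (cs k) (es k) g x - g x\<bar> \<le> \<bar>2 * B\<bar>" using bd[of "cs k" "es k" x] B[of x] by linarith
      then have "(moll (cs k) (es k) g x - g x)\<^sup>2 \<le> (2 * B)\<^sup>2" by (simp only: abs_le_square_iff)
      moreover have "(moll (cs k) (es k) g x - g x)\<^sup>2 = 0" if "x \<notin> cball 0 (2 * (\<bar>R\<bar> + 1))"
        using that z[of x k] R[of x] by simp
      ultimately show "ennreal ((moll (cs k) (es k) g x - g x)\<^sup>2)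
       \<le> ennreal ((2 * B)\<^sup>2) * indicator (cball 0 (2 * (\<bar>R\<bar> + 1))) x"
        by (auto simp: indicator_def intro: ennreal_leI)
    qed
    show "(\<integral>\<^sup>+x. ennreal ((2 * B)\<^sup>2) * indicator (cball 0 (2 * (\<bar>R\<bar> + 1))) x \<partial>(lborel :: (real^'n) measure)) < \<infinity>"
      using emeasure_compact_finite[of "cball (0::real^'n) (2 * (\<bar>R\<bar> + 1))"]
      by (simp add: nn_integral_cmult_indicator ennreal_mult_less_top)
    show "AE x in lborel. (\<lambda>k. ennreal ((moll (cs k) (es k) g x - g x)\<^sup>2)) \<longlonglongrightarrow> 0"
    proof (rule AE_I2)
      fix x
      have "(\<lambda>n. ennreal ((moll (cs n) (es n) g x - g x)\<^sup>2)) \<longlonglongrightarrow> ennreal ((g x - g x)\<^sup>2)"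
        by (intro tendsto_intros pw)
      then show "(\<lambda>n. ennreal ((moll (cs n) (es n) g x - g x)\<^sup>2)) \<longlonglongrightarrow> 0" by simp
    qed
  qed auto
  then show ?thesis by (simp add: L2lim_def)
qed

text \<open>Approximate \<open>f\<close> by a continuous compactly supported \<open>g\<close>:
  mollification converges for \<open>g\<close>, and the uniform L2 bound
  \<open>nn_integral_moll_le\<close> controls what it does to f - g.\<close>

lemma moll_L2lim:
  fixes f :: "real^'n \<Rightarrow> real"
  assumes f: "sqint f" 
    and cs: "cs \<longlonglongrightarrow> 1" "\<And>k. 1/2 \<le> cs k" and es: "es \<longlonglongrightarrow> 0" "\<And>k. 0 < es k" "\<And>k. es k \<le> 1"
  shows "L2lim UNIV (\<lambda>k. moll (cs k) (es k) f) f"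
proof -
  have [measurable]: "f \<in> borel_measurable borel" using f by (simp add: sqint_def)
  let ?I = "\<lambda>h :: real^'n \<Rightarrow> real. \<integral>\<^sup>+x. ennreal ((h x)\<^sup>2) \<partial>lborel"
  have "(\<lambda>k. ?I (\<lambda>x. moll (cs k) (es k) f x - f x)) \<longlonglongrightarrow> 0"
  proof (rule order_tendstoI)
    fix a :: ennreal assume "0 < a"
    then obtain b' where b': "0 < b'" "b' < a" using dense by blast
    then have "b' < top" by (metis less_le_trans top_greatest)
    then obtain b where "0 \<le> b" "b' = ennreal b" by (cases b') auto
    with b' have b: "0 < b" "ennreal b < a" by (auto simp: less_le)
    \<comment> \<open>The three-term splitting below has coefficients 4, 4 and 2, and 2^n bounds the
      dilation factor for c at least 1/2. Thus C collects all terms in f - g, which contribute b/2,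
      and the term in \<open>g\<close> contributes the other b/2.\<close>
    define C where "C = (4::real) * 2 ^ CARD('n) + 2"
    have C: "C > 0" by (simp add: C_def add_pos_pos)
    obtain g R B where g: "continuous_on UNIV g" "\<And>x. norm x > R \<Longrightarrow> g x = 0" "\<And>x. \<bar>g x\<bar> \<le> B"
      and fg: "?I (\<lambda>x. f x - g x) < ennreal (b / (2 * C))"
      using L2_continuous_dense[OF f, of "b / (2 * C)"] b C by auto
    have [measurable]: "g \<in> borel_measurable borel" using g(1) borel_measurable_continuous_onI by blast
    have sg: "sqint g" by (rule sqint_bounded_compact[of _ "cball 0 R" B]) (use g in auto)
    have "(\<lambda>k. ?I (\<lambda>x. moll (cs k) (es k) g x - g x)) \<longlonglongrightarrow> 0"
      using moll_continuous_L2lim[OF g cs es(1)] es by (simp add: L2lim_def abs_of_pos)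
    then have "eventually (\<lambda>k. ?I (\<lambda>x. moll (cs k) (es k) g x - g x) < ennreal (b / 8)) sequentially"
      using b by (intro order_tendstoD) auto
    then show "eventually (\<lambda>k. ?I (\<lambda>x. moll (cs k) (es k) f x - f x) < a) sequentially"
    proof eventually_elim
      case (elim k)
      let ?M = "moll (cs k) (es k)"
      let ?P = "?I (?M (\<lambda>x. f x - g x))" and ?Q = "?I (\<lambda>x. ?M g x - g x)" and ?R = "?I (\<lambda>x. f x - g x)"
      have k: "cs k > 0" "es k \<noteq> 0" using cs(2)[of k] es(2)[of k] by auto
      have "?I (\<lambda>x. ?M f x - f x) \<le> (\<integral>\<^sup>+x. 4 * ennreal ((?M (\<lambda>x. f x - g x) x)\<^sup>2)
          + 4 * ennreal ((?M g x - g x)\<^sup>2) + 2 * ennreal ((f x - g x)\<^sup>2) \<partial>lborel)"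
      proof (rule nn_integral_mono)
        fix x
        have "?M f x - f x = ((?M (\<lambda>x. f x - g x) x) + (?M g x - g x)) + (-1) * (f x - g x)"
          using moll_diff[OF f sg k(2)] by simp
        then have "(?M f x - f x)\<^sup>2 \<le> 2 * ((?M (\<lambda>x. f x - g x) x) + (?M g x - g x))\<^sup>2 + 2 * (f x - g x)\<^sup>2"
          using power2_add_le[of "(?M (\<lambda>x. f x - g x) x) + (?M g x - g x)" "(-1) * (f x - g x)"]
          by (simp only: power_mult_distrib) simp
        also have "\<dots> \<le> 4 * (?M (\<lambda>x. f x - g x) x)\<^sup>2 + 4 * (?M g x - g x)\<^sup>2 + 2 * (f x - g x)\<^sup>2"
          using power2_add_le[of "?M (\<lambda>x. f x - g x) x" "?M g x - g x"] by linarith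
        finally have "ennreal ((?M f x - f x)\<^sup>2) \<le> ennreal (4 * (?M (\<lambda>x. f x - g x) x)\<^sup>2 + 4 * (?M g x - g x)\<^sup>2 + 2 * (f x - g x)\<^sup>2)"
          by (rule ennreal_leI)
        then show "ennreal ((?M f x - f x)\<^sup>2) \<le> 4 * ennreal ((?M (\<lambda>x. f x - g x) x)\<^sup>2)
          + 4 * ennreal ((?M g x - g x)\<^sup>2) + 2 * ennreal ((f x - g x)\<^sup>2)"
          by (simp add: ennreal_mult')
      qed
      also have "\<dots> = 4 * ?P + 4 * ?Q + 2 * ?R"
        by (simp add: nn_integral_add nn_integral_cmult)
      also have "4 * ?P + 4 * ?Q + 2 * ?R \<le> 4 * (ennreal (2 ^ CARD('n)) * ?R) + 4 * ?Q + 2 * ?R"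
      proof (intro add_right_mono mult_left_mono zero_le)
        have "(1/2) ^ CARD('n) \<le> \<bar>cs k\<bar> ^ CARD('n)" using cs(2)[of k] by (intro power_mono) auto
        then have "inverse (\<bar>cs k\<bar> ^ CARD('n)) \<le> inverse ((1/2) ^ CARD('n))"
          by (intro le_imp_inverse_le) auto
        then have "ennreal (inverse (\<bar>cs k\<bar> ^ CARD('n))) \<le> ennreal (2 ^ CARD('n))"
          by (intro ennreal_leI) (simp add: power_divide)
        then show "?P \<le> ennreal (2 ^ CARD('n)) * ?R"
          by (intro order_trans[OF nn_integral_moll_le mult_right_mono]) (use k in auto)
      qed
      also have "4 * (ennreal (2 ^ CARD('n)) * ?R) + 4 * ?Q + 2 * ?R = ennreal C * ?R + 4 * ?Q"
        unfolding C_def by (simp add: ennreal_mult' distrib_right algebra_simps)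
      also have "\<dots> < ennreal C * ennreal (b / (2 * C)) + 4 * ennreal (b / 8)"
        using elim fg C by (intro add_strict_mono ennreal_mult_strict_left_mono) auto
      also have "\<dots> = ennreal (C * (b / (2 * C)) + 4 * (b / 8))"
      proof -
        have 1: "4 * ennreal (b / 8) = ennreal (4 * (b / 8))" by (subst ennreal_mult') auto
        have 2: "ennreal C * ennreal (b / (2 * C)) = ennreal (C * (b / (2 * C)))"
          using C by (subst ennreal_mult') auto
        have "0 \<le> C * (b / (2 * C))" "0 \<le> 4 * (b / 8)" using b C by auto
        then show ?thesis unfolding 1 2 by (rule ennreal_plus[symmetric])
      qed
      also have "C * (b / (2 * C)) + 4 * (b / 8) = b" using C by (simp add: field_simps)
      also have "ennreal b < a" by (rule b)
      finally show ?case .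
    qed
  qed auto
  then show ?thesis by (simp add: L2lim_def)
qed

subsection \<open>Differentiation under the integral sign\<close>

lemma integrable_mult_bounded:
  fixes f g :: "'a::euclidean_space \<Rightarrow> real"
  assumes "integrable lborel f" "g \<in> borel_measurable borel" "\<And>x. \<bar>g x\<bar> \<le> B"
  shows "integrable lborel (\<lambda>x. g x * f x)"
proof (rule Bochner_Integration.integrable_bound)
  show "integrable lborel (\<lambda>x. B * f x)" using assms by simp
  show "(\<lambda>x. g x * f x) \<in> borel_measurable lborel" using assms by auto
  have "\<bar>g x\<bar> \<le> \<bar>B\<bar>" for x using assms(3)[of x] by linarith
  then show "AE x in lborel. norm (g x * f x) \<le> norm (B * f x)"
    by (intro AE_I2) (simp add: abs_mult mult_right_mono)
qed

text \<open>The uniform bound on the parameter derivative and the mean value inequality bound the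
  first order remainder by 2 B |t - t0|. Divided by |t - t0| and multiplied by \<open>f\<close> it
  is dominated by 2 B |f| and tends to 0 pointwise.\<close>

lemma has_derivative_param_integral:
  fixes k :: "'a::euclidean_space \<Rightarrow> 'b::euclidean_space \<Rightarrow> real" and f :: "'b \<Rightarrow> real"
  assumes f: "integrable lborel f" and r: "r > 0"
    and d: "\<And>t y. t \<in> ball t0 r \<Longrightarrow> ((\<lambda>t. k t y) has_derivative (\<lambda>h. h \<bullet> k' t y)) (at t)"
    and b: "\<And>t y. t \<in> ball t0 r \<Longrightarrow> norm (k' t y) \<le> B"
    and m[measurable]: "\<And>t. (\<lambda>y. k t y) \<in> borel_measurable borel"
    and m'[measurable]: "(\<lambda>y. k' t0 y) \<in> borel_measurable borel"
    and i: "\<And>t. t \<in> ball t0 r \<Longrightarrow> integrable lborel (\<lambda>y. k t y * f y)"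
  shows "((\<lambda>t. \<integral>y. k t y * f y \<partial>lborel) has_derivative (\<lambda>h. h \<bullet> (\<integral>y. f y *\<^sub>R k' t0 y \<partial>lborel))) (at t0)"
    and "integrable lborel (\<lambda>y. f y *\<^sub>R k' t0 y)"
proof -
  have t0: "t0 \<in> ball t0 r" using r by simp
  have [measurable]: "f \<in> borel_measurable borel" using f by auto
  have B0: "0 \<le> B" using b[OF t0] norm_ge_zero order_trans by blast
  show i': "integrable lborel (\<lambda>y. f y *\<^sub>R k' t0 y)"
  proof (rule Bochner_Integration.integrable_bound)
    show "integrable lborel (\<lambda>y. B * f y)" using f by simp
    show "AE y in lborel. norm (f y *\<^sub>R k' t0 y) \<le> norm (B * f y)"
    proof (rule AE_I2)
      fix y show "norm (f y *\<^sub>R k' t0 y) \<le> norm (B * f y)"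
        using mult_left_mono[OF b[OF t0, of y], of "\<bar>f y\<bar>"] B0 by (simp add: abs_mult mult.commute)
    qed
  qed measurable
  let ?F = "\<lambda>t. \<integral>y. k t y * f y \<partial>lborel"
  let ?D = "\<integral>y. f y *\<^sub>R k' t0 y \<partial>lborel"
  let ?e = "\<lambda>t y. k t y - k t0 y - (t - t0) \<bullet> k' t0 y"
  have eb: "\<bar>?e t y\<bar> \<le> 2 * B * norm (t - t0)" if "t \<in> ball t0 r" for t y
  proof -
    have "norm (k t y - k t0 y) \<le> B * norm (t - t0)"
    proof (rule differentiable_bound[OF convex_ball[of t0 r]])
      show "((\<lambda>t. k t y) has_derivative (\<lambda>h. h \<bullet> k' s y)) (at s within ball t0 r)" if "s \<in> ball t0 r" for s
        using d[OF that] by (rule has_derivative_at_withinI)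
      show "onorm (\<lambda>h. h \<bullet> k' s y) \<le> B" if "s \<in> ball t0 r" for s
      proof (rule onorm_le)
        fix h show "norm (h \<bullet> k' s y) \<le> B * norm h"
          using Cauchy_Schwarz_ineq2[of h "k' s y"] mult_right_mono[OF b[OF that, of y], of "norm h"]
          by (simp add: mult.commute)
      qed
    qed (use that t0 in auto)
    moreover have "\<bar>(t - t0) \<bullet> k' t0 y\<bar> \<le> B * norm (t - t0)"
      using Cauchy_Schwarz_ineq2[of "t - t0" "k' t0 y"] mult_right_mono[OF b[OF t0, of y], of "norm (t - t0)"]
      by (simp add: mult.commute)
    ultimately show ?thesis by simp
  qed
  have key: "?F t - ?F t0 - (t - t0) \<bullet> ?D = (\<integral>y. ?e t y * f y \<partial>lborel)"
    and ie: "integrable lborel (\<lambda>y. ?e t y * f y)" if "t \<in> ball t0 r" for t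
  proof -
    have i2: "integrable lborel (\<lambda>y. (t - t0) \<bullet> (f y *\<^sub>R k' t0 y))"
      using i' by (rule integrable_inner_right)
    have e: "?e t y * f y = k t y * f y - k t0 y * f y - (t - t0) \<bullet> (f y *\<^sub>R k' t0 y)" for y
      by (simp add: algebra_simps)
    show "integrable lborel (\<lambda>y. ?e t y * f y)"
      unfolding e using i[OF that] i[OF t0] i2 by (intro Bochner_Integration.integrable_diff)
    have "(t - t0) \<bullet> ?D = (\<integral>y. (t - t0) \<bullet> (f y *\<^sub>R k' t0 y) \<partial>lborel)"
      using i' by (subst integral_inner_right) auto
    then show "?F t - ?F t0 - (t - t0) \<bullet> ?D = (\<integral>y. ?e t y * f y \<partial>lborel)"
      unfolding e using i[OF that] i[OF t0] i2 by simp
  qed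
  have "((\<lambda>t. norm (?F t - ?F t0 - (t - t0) \<bullet> ?D) / norm (t - t0)) \<longlongrightarrow> 0) (at t0)"
    unfolding tendsto_at_iff_sequentially
  proof (intro allI impI)
    fix X :: "nat \<Rightarrow> 'a" assume X: "\<forall>i. X i \<in> UNIV - {t0}" "X \<longlonglongrightarrow> t0"
    then obtain M where M: "\<And>n. n \<ge> M \<Longrightarrow> X n \<in> ball t0 r"
      using r unfolding lim_sequentially by (metis dist_commute mem_ball)
    \<comment> \<open>Dropping the first M terms puts the whole sequence in the ball where the
      estimates hold; \<open>LIMSEQ_offset\<close> restores them at the end.\<close>
    define Y where "Y n = X (n + M)" for n
    have Y: "Y n \<in> ball t0 r" "Y n \<noteq> t0" for n using M[of "n + M"] X(1) by (auto simp: Y_def)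
    have Yl: "Y \<longlonglongrightarrow> t0" unfolding Y_def using X(2) by (rule LIMSEQ_ignore_initial_segment)
    have Yat: "filterlim Y (at t0) sequentially" using Yl Y(2) by (simp add: filterlim_at)
    have "(\<lambda>n. \<integral>y. ?e (Y n) y / norm (Y n - t0) * f y \<partial>lborel) \<longlonglongrightarrow> (\<integral>y. 0 \<partial>(lborel :: 'b measure))"
    proof (rule integral_dominated_convergence)
      show "integrable lborel (\<lambda>y. 2 * B * \<bar>f y\<bar>)" using f by simp
      show "AE y in lborel. (\<lambda>n. ?e (Y n) y / norm (Y n - t0) * f y) \<longlonglongrightarrow> 0"
      proof (rule AE_I2)
        fix y
        have "((\<lambda>t. ?e t y /\<^sub>R norm (t - t0)) \<longlongrightarrow> 0) (at t0)"
          using d[OF t0, of y] by (simp add: has_derivative_at_within divide_inverse)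
        then have "(\<lambda>n. ?e (Y n) y / norm (Y n - t0)) \<longlonglongrightarrow> 0"
          using filterlim_compose[OF _ Yat] by (simp add: divide_inverse mult.commute)
        then show "(\<lambda>n. ?e (Y n) y / norm (Y n - t0) * f y) \<longlonglongrightarrow> 0"
          by (rule tendsto_mult_left_zero)
      qed
      show "AE y in lborel. norm (?e (Y n) y / norm (Y n - t0) * f y) \<le> 2 * B * \<bar>f y\<bar>" for n
      proof (rule AE_I2)
        fix y
        have "\<bar>?e (Y n) y\<bar> / norm (Y n - t0) \<le> 2 * B"
          using eb[OF Y(1), of n y] Y(2)[of n] by (simp add: divide_simps)
        then have "\<bar>?e (Y n) y\<bar> / norm (Y n - t0) * \<bar>f y\<bar> \<le> 2 * B * \<bar>f y\<bar>"
          by (rule mult_right_mono) simp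
        then show "norm (?e (Y n) y / norm (Y n - t0) * f y) \<le> 2 * B * \<bar>f y\<bar>"
          by (simp add: abs_mult)
      qed
    qed measurable
    then have "(\<lambda>n. (?F (Y n) - ?F t0 - (Y n - t0) \<bullet> ?D) / norm (Y n - t0)) \<longlonglongrightarrow> 0"
      using key[OF Y(1)] by (simp add: field_simps)
    then have "(\<lambda>n. norm (?F (Y n) - ?F t0 - (Y n - t0) \<bullet> ?D) / norm (Y n - t0)) \<longlonglongrightarrow> 0"
      using tendsto_norm_zero by fastforce
    then have "(\<lambda>n. (\<lambda>n. norm (?F (X n) - ?F t0 - (X n - t0) \<bullet> ?D) / norm (X n - t0)) (n + M)) \<longlonglongrightarrow> 0"
      by (simp add: Y_def)
    then show "((\<lambda>t. norm (?F t - ?F t0 - (t - t0) \<bullet> ?D) / norm (t - t0)) \<circ> X) \<longlonglongrightarrow> 0"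
      unfolding o_def by (rule LIMSEQ_offset)
  qed
  then show "(?F has_derivative (\<lambda>h. h \<bullet> ?D)) (at t0)"
    by (simp add: has_derivative_iff_norm bounded_linear_inner_left)
qed

lemma partial_deriv_affine:
  fixes f :: "real^'n \<Rightarrow> real"
  assumes "f differentiable (at (s *\<^sub>R y + v))"
  shows "partial_deriv (\<lambda>y. f (s *\<^sub>R y + v)) i y = s * partial_deriv f i (s *\<^sub>R y + v)"
    and "((\<lambda>y. f (s *\<^sub>R y + v)) has_derivative (\<lambda>h. h \<bullet> (s *\<^sub>R grad f (s *\<^sub>R y + v)))) (at y)"
proof -
  have "((\<lambda>y. s *\<^sub>R y + v) has_derivative (\<lambda>h. s *\<^sub>R h)) (at y)"
    by (auto intro!: derivative_eq_intros)
  from has_derivative_compose[OF this has_derivative_grad[OF assms]]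
  show d: "((\<lambda>y. f (s *\<^sub>R y + v)) has_derivative (\<lambda>h. h \<bullet> (s *\<^sub>R grad f (s *\<^sub>R y + v)))) (at y)"
    by simp
  show "partial_deriv (\<lambda>y. f (s *\<^sub>R y + v)) i y = s * partial_deriv f i (s *\<^sub>R y + v)"
    using partial_deriv_eq[OF d, of i] by (simp add: inner_axis')
qed

lemma smooth_on_affine:
  fixes f :: "real^'n \<Rightarrow> real"
  assumes "smooth_on UNIV f" shows "smooth_on UNIV (\<lambda>y. f (s *\<^sub>R y + v))"
  by (rule smooth_on_compose[OF open_UNIV subset_UNIV _ assms])
     (auto intro!: smooth_on_add smooth_on_mult)

lemma conv_has_derivative:
  fixes K f :: "real^'n \<Rightarrow> real"
  assumes K: "test_fun UNIV K" and f: "integrable lborel f"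
  shows "((\<lambda>x. \<integral>y. K (c *\<^sub>R x - y) * f y \<partial>lborel) has_derivative
     (\<lambda>h. h \<bullet> (\<integral>y. f y *\<^sub>R (c *\<^sub>R grad K (c *\<^sub>R x - y)) \<partial>lborel))) (at x)"
    and "partial_deriv (\<lambda>x. \<integral>y. K (c *\<^sub>R x - y) * f y \<partial>lborel) i x
       = c * (\<integral>y. partial_deriv K i (c *\<^sub>R x - y) * f y \<partial>lborel)"
proof -
  have [measurable]: "K \<in> borel_measurable borel" using K by (rule test_fun_measurable)
  have [measurable]: "partial_deriv K i \<in> borel_measurable borel" for i
    using K test_fun_measurable test_fun_partial_deriv by blast
  have [measurable]: "grad K \<in> borel_measurable borel"
    by (rule borel_measurable_euclidean_space[THEN iffD2]) (auto simp: Basis_vec_def inner_axis)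
  obtain B where B: "B > 0" "\<And>x. norm (grad K x) \<le> B" using test_fun_grad_bounded[OF K] by blast
  obtain B' where B': "\<And>x. \<bar>K x\<bar> \<le> B'" using test_fun_bounded[OF K] by blast
  have dif: "K differentiable (at z)" for z
    using test_fun_smooth[OF K] smooth_on_differentiable by blast
  have 1: "((\<lambda>t. K (c *\<^sub>R t - y)) has_derivative (\<lambda>h. h \<bullet> (c *\<^sub>R grad K (c *\<^sub>R t - y)))) (at t)" for t y
    using partial_deriv_affine(2)[of K c t "- y"] dif by simp
  have 2: "norm (c *\<^sub>R grad K (c *\<^sub>R t - y)) \<le> \<bar>c\<bar> * B" for t y
    using B(2) by (simp add: mult_left_mono)
  have 3: "integrable lborel (\<lambda>y. K (c *\<^sub>R t - y) * f y)" for t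
    by (rule integrable_mult_bounded[OF f _ B']) measurable
  note der = has_derivative_param_integral[OF f zero_less_one 1 2 _ _ 3, of x]
  show d: "((\<lambda>x. \<integral>y. K (c *\<^sub>R x - y) * f y \<partial>lborel) has_derivative
     (\<lambda>h. h \<bullet> (\<integral>y. f y *\<^sub>R (c *\<^sub>R grad K (c *\<^sub>R x - y)) \<partial>lborel))) (at x)"
    by (rule der(1)) auto
  have i: "integrable lborel (\<lambda>y. f y *\<^sub>R (c *\<^sub>R grad K (c *\<^sub>R x - y)))"
    by (rule der(2)) auto
  have "axis i 1 \<bullet> (\<integral>y. f y *\<^sub>R (c *\<^sub>R grad K (c *\<^sub>R x - y)) \<partial>lborel)
     = (\<integral>y. axis i 1 \<bullet> (f y *\<^sub>R (c *\<^sub>R grad K (c *\<^sub>R x - y))) \<partial>lborel)"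
    using i by (subst integral_inner_right) auto
  also have "\<dots> = (\<integral>y. c * (partial_deriv K i (c *\<^sub>R x - y) * f y) \<partial>lborel)"
    by (intro Bochner_Integration.integral_cong) (auto simp: inner_axis')
  finally show "partial_deriv (\<lambda>x. \<integral>y. K (c *\<^sub>R x - y) * f y \<partial>lborel) i x
       = c * (\<integral>y. partial_deriv K i (c *\<^sub>R x - y) * f y \<partial>lborel)"
    unfolding partial_deriv_eq[OF d] by simp
qed

lemma smooth_on_conv:
  fixes K f :: "real^'n \<Rightarrow> real"
  assumes K: "test_fun UNIV K" and f: "integrable lborel f"
  shows "smooth_on UNIV (\<lambda>x. \<integral>y. K (c *\<^sub>R x - y) * f y \<partial>lborel)"
proof -
  have "Ck_on k UNIV (\<lambda>x. \<integral>y. K (c *\<^sub>R x - y) * f y \<partial>lborel)" for k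
    using K
  proof (induction k arbitrary: K)
    case 0
    have "continuous_on UNIV (\<lambda>x. \<integral>y. K (c *\<^sub>R x - y) * f y \<partial>lborel)"
      by (rule has_derivative_continuous_on[OF has_derivative_at_withinI[OF conv_has_derivative(1)[OF 0 f]]])
    then show ?case by simp
  next
    case (Suc k)
    have "Ck_on k UNIV (\<lambda>x. c * (\<integral>y. partial_deriv K i (c *\<^sub>R x - y) * f y \<partial>lborel))" for i
      by (intro Ck_on_mult Suc.IH test_fun_partial_deriv Suc.prems) auto
    moreover have "partial_deriv (\<lambda>x. \<integral>y. K (c *\<^sub>R x - y) * f y \<partial>lborel) i
       = (\<lambda>x. c * (\<integral>y. partial_deriv K i (c *\<^sub>R x - y) * f y \<partial>lborel))" for i
      using conv_has_derivative(2)[OF Suc.prems f] by blast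
    moreover have "continuous_on UNIV (\<lambda>x. \<integral>y. K (c *\<^sub>R x - y) * f y \<partial>lborel)"
      by (rule has_derivative_continuous_on[OF has_derivative_at_withinI[OF conv_has_derivative(1)[OF Suc.prems f]]])
    moreover have "(\<lambda>x. \<integral>y. K (c *\<^sub>R x - y) * f y \<partial>lborel) differentiable (at x)" for x
      using conv_has_derivative(1)[OF Suc.prems f] unfolding differentiable_def by blast
    ultimately show ?case by simp
  qed
  then show ?thesis by (simp add: smooth_on_def)
qed

definition keta :: "real \<Rightarrow> real^'n \<Rightarrow> real" where
  "keta e w = inverse (e ^ CARD('n)) * eta (w /\<^sub>R e)"

lemma test_fun_keta:
  assumes "0 < e" shows "test_fun UNIV (keta e :: real^'n \<Rightarrow> real)"
proof (rule test_funI[of _ "cball 0 e"])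
  show "smooth_on UNIV (keta e :: real^'n \<Rightarrow> real)"
    unfolding keta_def[abs_def] using smooth_on_affine[OF smooth_on_eta, of "inverse e" 0]
    by (intro smooth_on_cmult) auto
  show "keta e x = 0" if "x \<notin> cball 0 e" for x :: "real^'n"
    using that assms unfolding keta_def by (subst eta_eq_0) (auto simp: field_simps)
qed auto

text \<open>The substitution y = c x - e z moves the dependence on x from \<open>f\<close>, which
  need not be regular, to the smooth kernel, where it can be differentiated.\<close>

lemma moll_eq_conv:
  fixes f :: "real^'n \<Rightarrow> real"
  assumes [measurable]: "f \<in> borel_measurable borel" and e: "0 < e"
  shows "moll c e f x = (\<integral>y. keta e (c *\<^sub>R x - y) * f y \<partial>lborel)"
proof -
  have [measurable]: "(keta e :: real^'n \<Rightarrow> real) \<in> borel_measurable borel"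
    using test_fun_keta[OF e] test_fun_measurable by blast
  have "(\<integral>y. keta e (c *\<^sub>R x - y) * f y \<partial>lborel)
      = \<bar>- e\<bar> ^ DIM(real^'n) * (\<integral>z. keta e (c *\<^sub>R x - (c *\<^sub>R x + (- e) *\<^sub>R z)) * f (c *\<^sub>R x + (- e) *\<^sub>R z) \<partial>lborel)"
    using e by (intro lborel_integral_affine) auto
  also have "\<dots> = e ^ CARD('n) * (\<integral>z. inverse (e ^ CARD('n)) * (eta z * f (c *\<^sub>R x - e *\<^sub>R z)) \<partial>lborel)"
    using e by (simp add: keta_def mult.assoc)
  also have "\<dots> = moll c e f x" using e by (simp add: moll_def)
  finally show ?thesis by simp
qed

lemma smooth_on_moll:
  fixes f :: "real^'n \<Rightarrow> real"
  assumes "integrable lborel f" "0 < e" shows "smooth_on UNIV (moll c e f)"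
proof -
  have "moll c e f = (\<lambda>x. \<integral>y. keta e (c *\<^sub>R x - y) * f y \<partial>lborel)"
    using assms by (intro ext moll_eq_conv) auto
  then show ?thesis using smooth_on_conv[OF test_fun_keta[OF assms(2)] assms(1)] by simp
qed

text \<open>Lets a rescaled kernel centred at x, read as a function of the integration variable,
  serve as test function in weak identities.\<close>

lemma test_fun_reflect:
  assumes K: "smooth_on UNIV K" "\<And>w. norm w > 1 \<Longrightarrow> K w = 0" and e: "0 < e" "cball x e \<subseteq> N"
  shows "test_fun N (\<lambda>y. K ((x - y) /\<^sub>R e))"
proof (rule test_funI[OF _ compact_cball e(2)])
  show "smooth_on UNIV (\<lambda>y. K ((x - y) /\<^sub>R e))"
    using smooth_on_affine[OF K(1), of "- inverse e" "inverse e *\<^sub>R x"]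
    by (simp add: scaleR_diff_right)
  show "K ((x - y) /\<^sub>R e) = 0" if "y \<notin> cball x e" for y
  proof (rule K(2))
    have "norm ((x - y) /\<^sub>R e) = norm (x - y) / e" using e(1) by (simp add: divide_inverse_commute)
    then show "1 < norm ((x - y) /\<^sub>R e)" using that e(1) by (simp add: dist_norm)
  qed
qed

lemma partial_deriv_reflect:
  assumes "smooth_on UNIV K"
  shows "partial_deriv (\<lambda>y. K ((x - y) /\<^sub>R e)) i y = - inverse e * partial_deriv K i ((x - y) /\<^sub>R e)"
proof -
  have "K differentiable (at z)" for z using assms smooth_on_differentiable by blast
  from partial_deriv_affine(1)[OF this, of "- inverse e" "inverse e *\<^sub>R x" i y]
  show ?thesis by (simp add: scaleR_diff_right)
qed

subsection \<open>Weak gradients\<close>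

text \<open>The working form of \<open>is_weak_grad\<close>: Borel functions with integrals over the
  whole space. These agree with integrals over \<open>N\<close> because test functions vanish
  outside, so values of \<open>u\<close> and \<open>G\<close> off \<open>N\<close> are left
  free.\<close>

definition weak_pair :: "(real^'n) set \<Rightarrow> (real^'n \<Rightarrow> real) \<Rightarrow> (real^'n \<Rightarrow> real^'n) \<Rightarrow> bool" where
  "weak_pair N u G \<longleftrightarrow> sqint u \<and> (\<forall>i. sqint (\<lambda>x. G x $ i)) \<and>
     (\<forall>\<phi> i. test_fun N \<phi> \<longrightarrow> (\<integral>x. u x * partial_deriv \<phi> i x \<partial>lborel) = - (\<integral>x. G x $ i * \<phi> x \<partial>lborel))"

lemma weak_pairD:
  assumes "weak_pair N u G"
  shows "sqint u" "sqint (\<lambda>x. G x $ i)" "test_fun N \<phi> \<Longrightarrow>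
    (\<integral>x. u x * partial_deriv \<phi> i x \<partial>lborel) = - (\<integral>x. G x $ i * \<phi> x \<partial>lborel)"
  using assms by (auto simp: weak_pair_def)

text \<open>The derivative falls on the kernel. As a function of y the kernel is a test function on
  \<open>N\<close>, since its support is the ball of radius e about c x, so the weak gradient takes
  the derivative over; the factor c is the chain rule.\<close>

lemma partial_deriv_moll:
  fixes u :: "real^'n \<Rightarrow> real"
  assumes wp: "weak_pair N u G" and u: "integrable lborel u" and e: "0 < e" "cball (c *\<^sub>R x) e \<subseteq> N"
  shows "partial_deriv (moll c e u) i x = c * moll c e (\<lambda>y. G y $ i) x"
proof -
  have um: "u \<in> borel_measurable borel" "(\<lambda>y. G y $ i) \<in> borel_measurable borel"
    using weak_pairD(1,2)[OF wp] by (auto simp: sqint_def)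
  define \<phi> where "\<phi> y = keta e (c *\<^sub>R x - y)" for y
  let ?K = "\<lambda>w. inverse (e ^ CARD('n)) * eta w"
  have sK: "smooth_on UNIV ?K" by (intro smooth_on_cmult smooth_on_eta) auto
  have \<phi>: "test_fun N \<phi>"
    using test_fun_reflect[OF sK _ e] unfolding \<phi>_def keta_def by (simp add: eta_eq_0)
  have sk: "(keta e :: real^'n \<Rightarrow> real) differentiable (at z)" for z
    using smooth_on_differentiable test_fun_smooth[OF test_fun_keta[OF e(1)]] by blast
  have d\<phi>: "partial_deriv \<phi> i y = - partial_deriv (keta e) i (c *\<^sub>R x - y)" for y
    using partial_deriv_affine(1)[of "keta e" "-1" y "c *\<^sub>R x" i, OF sk] unfolding \<phi>_def by simp
  have "partial_deriv (moll c e u) i x = c * (\<integral>y. partial_deriv (keta e) i (c *\<^sub>R x - y) * u y \<partial>lborel)"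
  proof -
    have "moll c e u = (\<lambda>x. \<integral>y. keta e (c *\<^sub>R x - y) * u y \<partial>lborel)"
      by (intro ext moll_eq_conv um e)
    then show ?thesis using conv_has_derivative(2)[OF test_fun_keta[OF e(1)] u, of c i x] by simp
  qed
  also have "(\<integral>y. partial_deriv (keta e) i (c *\<^sub>R x - y) * u y \<partial>lborel) = - (\<integral>y. u y * partial_deriv \<phi> i y \<partial>lborel)"
    by (simp add: d\<phi> mult.commute)
  also have "\<dots> = (\<integral>y. G y $ i * \<phi> y \<partial>lborel)" using weak_pairD(3)[OF wp \<phi>] by simp
  also have "\<dots> = moll c e (\<lambda>y. G y $ i) x"
    unfolding moll_eq_conv[OF um(2) e(1)] \<phi>_def by (simp add: mult.commute)
  finally show ?thesis .
qed

text \<open>a_k f_k - b f is a_k (f_k - f) plus (a_k - b) f: boundedness of the a_k settles the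
  first term, the finite norm of \<open>f\<close> the second.\<close>

lemma L2lim_scale:
  assumes [measurable]: "S \<in> sets borel" and lim: "L2lim S fs f" and f: "sqint f" and a: "a \<longlonglongrightarrow> (b::real)"
  shows "L2lim S (\<lambda>k x. a k * fs k x) (\<lambda>x. b * f x)"
proof -
  have [measurable]: "f \<in> borel_measurable borel" "\<And>k. fs k \<in> borel_measurable borel"
    using lim by (auto simp: L2lim_def)
  obtain A where A: "\<And>k. \<bar>a k\<bar> \<le> A"
    using convergent_imp_Bseq[of a] a by (auto simp: convergent_def Bseq_def)
  have "L2lim S (\<lambda>k x. a k * (fs k x - f x)) (\<lambda>x. 0)"
  proof (rule L2lim_squeeze)
    show "(\<lambda>k. ennreal (A\<^sup>2) * (\<integral>\<^sup>+x. ennreal ((fs k x - f x)\<^sup>2) * indicator S x \<partial>lborel)) \<longlonglongrightarrow> 0"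
      using lim by (intro ennreal_tendsto_0_cmult) (auto simp: L2lim_def)
    fix k
    have "(\<integral>\<^sup>+x. ennreal ((a k * (fs k x - f x) - 0)\<^sup>2) * indicator S x \<partial>lborel)
      \<le> (\<integral>\<^sup>+x. ennreal (A\<^sup>2) * (ennreal ((fs k x - f x)\<^sup>2) * indicator S x) \<partial>lborel)"
    proof (rule nn_integral_mono)
      fix x
      have "(a k * (fs k x - f x) - 0)\<^sup>2 \<le> A\<^sup>2 * (fs k x - f x)\<^sup>2"
        using power_mono[OF A[of k], of 2] by (simp add: power_mult_distrib mult_right_mono)
      then show "ennreal ((a k * (fs k x - f x) - 0)\<^sup>2) * indicator S x
          \<le> ennreal (A\<^sup>2) * (ennreal ((fs k x - f x)\<^sup>2) * indicator S x)"
        by (auto simp: indicator_def ennreal_mult'[symmetric] intro: ennreal_leI)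
    qed
    then show "(\<integral>\<^sup>+x. ennreal ((a k * (fs k x - f x) - 0)\<^sup>2) * indicator S x \<partial>lborel)
      \<le> ennreal (A\<^sup>2) * (\<integral>\<^sup>+x. ennreal ((fs k x - f x)\<^sup>2) * indicator S x \<partial>lborel)"
      by (subst (asm) nn_integral_cmult) auto
  qed auto
  moreover have "L2lim S (\<lambda>k x. a k * f x) (\<lambda>x. b * f x)"
  proof (rule L2lim_squeeze)
    let ?F = "\<integral>\<^sup>+x. ennreal ((f x)\<^sup>2) \<partial>lborel"
    have F: "?F \<noteq> top" using f by (simp add: sqint_iff less_top)
    have "(\<lambda>k. ennreal ((a k - b)\<^sup>2)) \<longlonglongrightarrow> ennreal ((b - b)\<^sup>2)" by (intro tendsto_intros a)
    then show "(\<lambda>k. ?F * ennreal ((a k - b)\<^sup>2)) \<longlonglongrightarrow> 0" by (intro ennreal_tendsto_0_cmult F) simp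
    fix k
    have "(\<integral>\<^sup>+x. ennreal ((a k * f x - b * f x)\<^sup>2) * indicator S x \<partial>lborel)
       \<le> (\<integral>\<^sup>+x. ennreal ((f x)\<^sup>2) * ennreal ((a k - b)\<^sup>2) \<partial>lborel)"
      by (intro nn_integral_mono)
         (auto simp: indicator_def left_diff_distrib[symmetric] power_mult_distrib ennreal_mult'[symmetric] mult.commute)
    then show "(\<integral>\<^sup>+x. ennreal ((a k * f x - b * f x)\<^sup>2) * indicator S x \<partial>lborel) \<le> ?F * ennreal ((a k - b)\<^sup>2)"
      by (subst (asm) nn_integral_multc) auto
  qed auto
  ultimately have "L2lim S (\<lambda>k x. a k * (fs k x - f x) + a k * f x) (\<lambda>x. 0 + b * f x)"
    by (rule L2lim_add[rotated]) simp
  then show ?thesis by (simp add: right_diff_distrib)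
qed

text \<open>The ball is star-shaped: mollifying u((1 - e) x) at scale e uses only values within e of
  (1 - e) x, and 2 (1 - e) + e < 2. Hence gradients converge on the entire ball, up to the
  boundary.\<close>

theorem weak_pair_density:
  fixes u :: "real^'n \<Rightarrow> real"
  assumes wp: "weak_pair (ball 0 2) u G" and u: "integrable lborel u"
  obtains us where "\<And>k. smooth_on UNIV (us k)" "L2lim UNIV us u"
     "\<And>i. L2lim (ball 0 2) (\<lambda>k. partial_deriv (us k) i) (\<lambda>x. G x $ i)"
proof -
  \<comment> \<open>Starting at 1/2 keeps the dilation 1 - e at least 1/2, as
    \<open>moll_L2lim\<close> requires.\<close>
  define e where "e k = inverse (real (Suc (Suc k)))" for k
  define us where "us k = moll (1 - e k) (e k) u" for k
  have e0: "0 < e k" "e k \<le> 1/2" for k by (auto simp: e_def divide_simps)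
  have el: "e \<longlonglongrightarrow> 0" unfolding e_def by (rule LIMSEQ_Suc[OF LIMSEQ_inverse_real_of_nat])
  have cl: "(\<lambda>k. 1 - e k) \<longlonglongrightarrow> 1" using tendsto_diff[OF tendsto_const el, of 1] by simp
  have s: "smooth_on UNIV (us k)" for k unfolding us_def by (rule smooth_on_moll[OF u e0(1)])
  have c12: "1/2 \<le> 1 - e k" "e k \<le> 1" for k using e0(2)[of k] by auto
  have 1: "L2lim UNIV us u"
    unfolding us_def[abs_def] by (rule moll_L2lim[OF weak_pairD(1)[OF wp] cl _ el]) (use e0(1) c12 in auto)
  have 2: "L2lim (ball 0 2) (\<lambda>k. partial_deriv (us k) i) (\<lambda>x. G x $ i)" for i
  proof -
    have "L2lim UNIV (\<lambda>k. moll (1 - e k) (e k) (\<lambda>x. G x $ i)) (\<lambda>x. G x $ i)"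
      by (rule moll_L2lim[OF weak_pairD(2)[OF wp] cl _ el]) (use e0(1) c12 in auto)
    then have "L2lim UNIV (\<lambda>k x. (1 - e k) * moll (1 - e k) (e k) (\<lambda>x. G x $ i) x) (\<lambda>x. 1 * G x $ i)"
      by (intro L2lim_scale cl weak_pairD(2)[OF wp]) auto
    then have lim: "L2lim (ball 0 2) (\<lambda>k x. (1 - e k) * moll (1 - e k) (e k) (\<lambda>x. G x $ i) x) (\<lambda>x. G x $ i)"
      using L2lim_subset[OF _ subset_UNIV] by fastforce
    have m: "partial_deriv (us k) i \<in> borel_measurable borel" for k
      by (rule borel_measurable_continuous_UNIV[OF smooth_on_continuous[OF smooth_on_partial_deriv[OF s]]])
    have m': "(\<lambda>x. G x $ i) \<in> borel_measurable borel" using weak_pairD(2)[OF wp] by (simp add: sqint_def)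
    have eq: "partial_deriv (us k) i x = (1 - e k) * moll (1 - e k) (e k) (\<lambda>x. G x $ i) x"
      if x: "x \<in> ball 0 2" for k and x :: "real^'n"
    proof -
    have "norm (z :: real^'n) < 2" if "z \<in> cball ((1 - e k) *\<^sub>R x) (e k)" for z
    proof -
      have "norm z \<le> norm ((1 - e k) *\<^sub>R x) + dist ((1 - e k) *\<^sub>R x) z"
        by (metis norm_triangle_sub add.commute dist_norm norm_minus_commute)
      also have "\<dots> \<le> (1 - e k) * 2 + e k"
      proof (rule add_mono)
        have "(1 - e k) * norm x \<le> (1 - e k) * 2" using x e0[of k] by (intro mult_left_mono) auto
        then show "norm ((1 - e k) *\<^sub>R x) \<le> (1 - e k) * 2" using e0[of k] by simp
      qed (use that in simp)
      also have "\<dots> < 2" using e0(1)[of k] by simp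
      finally show ?thesis .
    qed
    then show "partial_deriv (us k) i x = (1 - e k) * moll (1 - e k) (e k) (\<lambda>x. G x $ i) x"
      unfolding us_def by (intro partial_deriv_moll[OF wp u e0(1)]) auto
    qed
    show ?thesis by (rule L2lim_cong[OF lim m m' eq]) auto
  qed
  show ?thesis by (rule that[of us]) (fact s 1 2)+
qed

text \<open>At each point of \<open>N\<close> the mollifications of \<open>h\<close> are eventually
  pairings with test functions on \<open>N\<close>, hence zero, while they converge to
  \<open>h\<close> in mean square. Fatou's lemma then makes the integral of h^2 over
  \<open>N\<close> vanish.\<close>

lemma AE_zero_of_test_fun:
  fixes h :: "real^'n \<Rightarrow> real"
  assumes N: "open N" and h: "sqint h" and z: "\<And>\<phi>. test_fun N \<phi> \<Longrightarrow> (\<integral>x. h x * \<phi> x \<partial>lborel) = 0"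
  shows "AE x in lborel. x \<in> N \<longrightarrow> h x = 0"
proof -
  have [measurable]: "N \<in> sets borel" using N by simp
  have [measurable]: "h \<in> borel_measurable borel" using h by (simp add: sqint_def)
  define e where "e k = inverse (real (Suc k))" for k
  have e0: "0 < e k" "e k \<le> 1" for k by (auto simp: e_def divide_simps)
  have el: "e \<longlonglongrightarrow> 0" unfolding e_def by (rule LIMSEQ_inverse_real_of_nat)
  let ?M = "\<lambda>k. moll 1 (e k) h"
  have "L2lim UNIV ?M h"
    by (rule moll_L2lim[OF h tendsto_const _ el]) (use e0 in auto)
  then have "L2lim N ?M h" by (rule L2lim_subset) simp
  then have lim: "(\<lambda>k. \<integral>\<^sup>+x. ennreal ((?M k x - h x)\<^sup>2) * indicator N x \<partial>lborel) \<longlonglongrightarrow> 0"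
    by (simp add: L2lim_def)
  have ev: "eventually (\<lambda>k. ?M k x = 0) sequentially" if x: "x \<in> N" for x
  proof -
    obtain r where r: "r > 0" "cball x r \<subseteq> N" using N x open_contains_cball by blast
    have "eventually (\<lambda>k. e k < r) sequentially" using el r by (intro order_tendstoD) auto
    then show ?thesis
    proof eventually_elim
      case (elim k)
      have "test_fun N (\<lambda>y. inverse (e k ^ CARD('n)) * eta ((x - y) /\<^sub>R e k))"
        using elim r by (intro test_fun_reflect smooth_on_cmult smooth_on_eta e0) (auto simp: eta_eq_0)
      from z[OF this] show ?case
        using moll_eq_conv[of h "e k" 1 x] e0(1) by (simp add: keta_def mult.commute)
    qed
  qed
  have "(\<integral>\<^sup>+x. ennreal ((h x)\<^sup>2) * indicator N x \<partial>lborel)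
      \<le> (\<integral>\<^sup>+x. liminf (\<lambda>k. ennreal ((?M k x - h x)\<^sup>2) * indicator N x) \<partial>lborel)"
  proof (rule nn_integral_mono)
    fix x
    show "ennreal ((h x)\<^sup>2) * indicator N x \<le> liminf (\<lambda>k. ennreal ((?M k x - h x)\<^sup>2) * indicator N x)"
    proof (cases "x \<in> N")
      case True
      have "eventually (\<lambda>k. ennreal ((h x)\<^sup>2) * indicator N x \<le> ennreal ((?M k x - h x)\<^sup>2) * indicator N x) sequentially"
        using ev[OF True] by eventually_elim simp
      then show ?thesis by (rule Liminf_bounded)
    qed simp
  qed
  also have "\<dots> \<le> liminf (\<lambda>k. \<integral>\<^sup>+x. ennreal ((?M k x - h x)\<^sup>2) * indicator N x \<partial>lborel)"
    by (rule nn_integral_liminf) measurable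
  also have "\<dots> = 0" using lim by (intro lim_imp_Liminf) auto
  finally have "(\<integral>\<^sup>+x. ennreal ((h x)\<^sup>2) * indicator N x \<partial>lborel) = 0" by simp
  then have "AE x in lborel. ennreal ((h x)\<^sup>2) * indicator N x = 0"
    by (subst (asm) nn_integral_0_iff_AE) auto
  then show ?thesis by eventually_elim (auto simp: indicator_def split: if_splits)
qed

text \<open>\<open>u\<close> and \<open>v\<close> agree almost everywhere on \<open>N\<close>, so
  both gradients have the same pairing with every test function there;
  \<open>AE_zero_of_test_fun\<close> applies to each component of the difference.\<close>

lemma weak_pair_unique:
  assumes N: "open N" and 1: "weak_pair N u G" and 2: "weak_pair N v H"
    and uv: "AE x in lborel. x \<in> N \<longrightarrow> u x = v x"
  shows "AE x in lborel. x \<in> N \<longrightarrow> G x = H x"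
proof -
  have "AE x in lborel. x \<in> N \<longrightarrow> G x $ i - H x $ i = 0" for i
  proof (rule AE_zero_of_test_fun[OF N])
    show "sqint (\<lambda>x. G x $ i - H x $ i)" using 1 2 by (intro sqint_diff weak_pairD(2))
    fix \<phi> assume \<phi>: "test_fun N \<phi>"
    have [measurable]: "u \<in> borel_measurable borel" "v \<in> borel_measurable borel"
       "partial_deriv \<phi> i \<in> borel_measurable borel"
      using weak_pairD(1)[OF 1] weak_pairD(1)[OF 2] test_fun_measurable[OF test_fun_partial_deriv[OF \<phi>]]
      by (auto simp: sqint_def)
    obtain K where K: "K \<subseteq> N" "\<And>x. x \<notin> K \<Longrightarrow> partial_deriv \<phi> i x = 0"
      using test_fun_partial_deriv[OF \<phi>, of i] by (rule test_funE) blast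
    have "(\<integral>x. u x * partial_deriv \<phi> i x \<partial>lborel) = (\<integral>x. v x * partial_deriv \<phi> i x \<partial>lborel)"
    proof (rule integral_cong_AE)
      show "AE x in lborel. u x * partial_deriv \<phi> i x = v x * partial_deriv \<phi> i x"
        using uv by eventually_elim (use K in auto)
    qed measurable
    then have "(\<integral>x. G x $ i * \<phi> x \<partial>lborel) = (\<integral>x. H x $ i * \<phi> x \<partial>lborel)"
      using weak_pairD(3)[OF 1 \<phi>, of i] weak_pairD(3)[OF 2 \<phi>, of i] by simp
    then show "(\<integral>x. (G x $ i - H x $ i) * \<phi> x \<partial>lborel) = 0"
      using 1 2 sqint_mult_integrable[OF weak_pairD(2) test_fun_sqint[OF \<phi>]]
      by (simp add: left_diff_distrib)
  qed
  then have "AE x in lborel. \<forall>i\<in>UNIV. x \<in> N \<longrightarrow> G x $ i - H x $ i = 0"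
    by (intro AE_finite_allI) auto
  then show ?thesis by eventually_elim (simp add: vec_eq_iff)
qed

subsection \<open>Weyl's lemma\<close>

lemma partial_deriv_cmult:
  "f differentiable (at x) \<Longrightarrow> partial_deriv (\<lambda>x. c * f x) i x = c * partial_deriv f i x"
  using partial_deriv_eq[OF has_derivative_mult_right[OF has_derivative_grad, of f x c], of i]
  by (simp add: inner_axis')

lemma partial_deriv_add:
  "f differentiable (at x) \<Longrightarrow> g differentiable (at x) \<Longrightarrow>
    partial_deriv (\<lambda>x. f x + g x) i x = partial_deriv f i x + partial_deriv g i x"
  using partial_deriv_eq[OF has_derivative_add[OF has_derivative_grad has_derivative_grad], of f x g i]
  by (simp add: inner_axis')

lemma partial_deriv_diff:
  "f differentiable (at x) \<Longrightarrow> g differentiable (at x) \<Longrightarrow>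
    partial_deriv (\<lambda>x. f x - g x) i x = partial_deriv f i x - partial_deriv g i x"
  using partial_deriv_eq[OF has_derivative_diff[OF has_derivative_grad has_derivative_grad], of f x g i]
  by (simp add: inner_axis')

lemma partial_deriv_mult:
  "f differentiable (at x) \<Longrightarrow> g differentiable (at x) \<Longrightarrow>
    partial_deriv (\<lambda>x. f x * g x) i x = f x * partial_deriv g i x + partial_deriv f i x * g x"
  using partial_deriv_eq[OF has_derivative_mult[OF has_derivative_grad has_derivative_grad], of f x g i]
  by (simp add: inner_axis')

lemma partial_deriv_component: "partial_deriv (\<lambda>x. x $ j) i x = (if i = j then 1 else 0)"
  by (subst partial_deriv_eq[OF bounded_linear.has_derivative[OF bounded_linear_vec_nth has_derivative_ident]])
     (simp add: axis_def)

lemma component_differentiable: "(\<lambda>x :: real^'n. x $ j) differentiable (at x)"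
  unfolding differentiable_def
  using bounded_linear.has_derivative[OF bounded_linear_vec_nth has_derivative_ident] by blast

text \<open>\<open>dil\<close> is the divergence of \<open>eta w *\<^sub>R w\<close>, so \<open>- dil\<close> is the derivative of \<open>t\<^sup>-\<^sup>n eta (w / t)\<close>
  in \<open>t\<close> at \<open>t = 1\<close>.\<close>
definition dil :: "real^'n \<Rightarrow> real" where
  "dil w = real CARD('n) * eta w + w \<bullet> grad eta w"

definition beta :: "real^'n \<Rightarrow> real" where
  "beta w = flat 0 (1 - w \<bullet> w)"

lemma smooth_on_beta: "smooth_on UNIV (beta :: real^'n \<Rightarrow> real)"
  unfolding beta_def[abs_def]
  by (intro smooth_on_flat smooth_on_diff smooth_on_inner_self smooth_on_const) auto

lemma beta_eq_0: "1 \<le> norm w \<Longrightarrow> beta w = 0"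
  unfolding beta_def flat_def using power_mono[of 1 "norm w" 2] by (simp add: power2_norm_eq_inner)

lemma partial_deriv_beta:
  fixes w :: "real^'n"
  shows "partial_deriv beta i w = - 2 * (\<integral>x. eta_raw x \<partial>(lborel :: (real^'n) measure)) * (w $ i * eta w)"
proof -
  have q: "((\<lambda>w :: real^'n. 1 - w \<bullet> w) has_derivative (\<lambda>h. - (2 * (w \<bullet> h)))) (at w)"
    by (auto intro!: derivative_eq_intros simp: inner_commute)
  have "(beta has_derivative (\<lambda>h. - (2 * (w \<bullet> h)) * flat (Suc 0) (1 - w \<bullet> w))) (at w)"
    unfolding beta_def[abs_def] using DERIV_compose_FDERIV[OF flat_has_derivative q] by simp
  from partial_deriv_eq[OF this, of i] show ?thesis
    using integral_eta_raw_pos[where 'n='n] by (simp add: eta_def eta_raw_def inner_axis)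
qed

text \<open>The gradient of \<open>beta\<close> is a constant times w eta(w), and \<open>dil\<close>
  is the divergence of that field.\<close>

lemma laplacian_beta:
  fixes w :: "real^'n"
  shows "(\<Sum>i\<in>UNIV. partial_deriv (partial_deriv beta i) i w)
     = - 2 * (\<integral>x. eta_raw x \<partial>(lborel :: (real^'n) measure)) * dil w"
proof -
  let ?c = "- 2 * (\<integral>x. eta_raw x \<partial>(lborel :: (real^'n) measure))"
  have de: "(eta :: real^'n \<Rightarrow> real) differentiable (at w)"
    using smooth_on_eta smooth_on_differentiable by blast
  have "partial_deriv (partial_deriv beta i) i w = ?c * (w $ i * partial_deriv eta i w + eta w)" for i
  proof -
    have "partial_deriv (partial_deriv beta i) i w = partial_deriv (\<lambda>w. ?c * (w $ i * eta w)) i w"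
      using partial_deriv_beta by (metis (no_types, lifting) ext)
    also have "\<dots> = ?c * partial_deriv (\<lambda>w. w $ i * eta w) i w"
      by (intro partial_deriv_cmult differentiable_mult component_differentiable de)
    also have "partial_deriv (\<lambda>w. w $ i * eta w) i w = w $ i * partial_deriv eta i w + eta w"
      by (simp add: partial_deriv_mult[OF component_differentiable de] partial_deriv_component)
    finally show ?thesis .
  qed
  then have "(\<Sum>i\<in>UNIV. partial_deriv (partial_deriv beta i) i w)
     = ?c * (\<Sum>i\<in>UNIV. w $ i * partial_deriv eta i w + eta w)"
    by (simp only: sum_distrib_left)
  also have "(\<Sum>i\<in>UNIV. w $ i * partial_deriv eta i w + eta w) = dil w"
    by (simp add: dil_def sum.distrib inner_vec_def)
  finally show ?thesis .
qed

lemma dil_bounded: obtains B where "B > 0" "\<And>w :: real^'n. \<bar>dil w\<bar> \<le> B"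
proof -
  obtain B0 where B0: "B0 > 0" "\<And>w :: real^'n. \<bar>eta w\<bar> \<le> B0" using test_fun_bounded[OF test_fun_eta] by blast
  obtain B1 where B1: "B1 > 0" "\<And>w :: real^'n. norm (grad eta w) \<le> B1"
    using test_fun_grad_bounded[OF test_fun_eta] by blast
  have "\<bar>dil w\<bar> \<le> real CARD('n) * B0 + B1" for w :: "real^'n"
  proof -
    have "\<bar>w \<bullet> grad eta w\<bar> \<le> B1"
    proof (cases "norm w \<le> 1")
      case True
      have "\<bar>w \<bullet> grad eta w\<bar> \<le> norm w * norm (grad eta w)" by (rule Cauchy_Schwarz_ineq2)
      also have "\<dots> \<le> 1 * B1" using True B1 by (intro mult_mono) auto
      finally show ?thesis by simp
    next
      case False
      have "partial_deriv eta i w = 0" for i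
        by (rule partial_deriv_zero_open[of "- cball 0 1"]) (use False in \<open>auto intro: eta_eq_0\<close>)
      then have "grad eta w = 0" by (simp add: vec_eq_iff)
      then show ?thesis using B1 by simp
    qed
    moreover have "\<bar>real CARD('n) * eta w\<bar> \<le> real CARD('n) * B0"
      by (simp add: abs_mult mult_left_mono B0)
    ultimately show ?thesis unfolding dil_def by linarith
  qed
  moreover have "0 < real CARD('n) * B0 + B1" using B0(1) B1(1) by (intro add_nonneg_pos) auto
  ultimately show ?thesis using that by blast
qed

lemma dil_measurable [measurable]: "dil \<in> borel_measurable (borel :: (real^'n) measure)"
proof -
  have "continuous_on UNIV (\<lambda>w :: real^'n. \<Sum>i\<in>UNIV. w $ i * partial_deriv eta i w)"
    by (intro continuous_intros smooth_on_continuous smooth_on_partial_deriv smooth_on_eta)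
  then have [measurable]: "(\<lambda>w :: real^'n. w \<bullet> grad eta w) \<in> borel_measurable borel"
    by (intro borel_measurable_continuous_UNIV) (simp add: inner_vec_def)
  show ?thesis unfolding dil_def[abs_def] by measurable
qed

text \<open>Differentiating t^(-n) gives the term with CARD('n), differentiating w / t gives the
  radial derivative; together they form \<open>dil\<close>.\<close>

lemma keta_has_derivative:
  fixes w :: "real^'n"
  assumes t: "0 < t"
  shows "((\<lambda>t. keta t w) has_derivative (\<lambda>h. h * (- (inverse t ^ Suc CARD('n)) * dil (w /\<^sub>R t)))) (at t)"
proof -
  have i: "((\<lambda>t. inverse t *\<^sub>R w) has_derivative (\<lambda>h. (- (inverse t * h * inverse t)) *\<^sub>R w)) (at t)"
    using t by (auto intro!: derivative_eq_intros)
  have e: "((\<lambda>t. eta (inverse t *\<^sub>R w)) has_derivative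
      (\<lambda>h. ((- (inverse t * h * inverse t)) *\<^sub>R w) \<bullet> grad eta (inverse t *\<^sub>R w))) (at t)"
    by (rule has_derivative_compose[OF i smooth_on_has_derivative[OF smooth_on_eta UNIV_I]])
  have p: "((\<lambda>t. inverse t ^ CARD('n)) has_derivative
      (\<lambda>h. real CARD('n) * (- (inverse t * h * inverse t)) * inverse t ^ (CARD('n) - 1))) (at t)"
    using t by (auto intro!: derivative_eq_intros)
  obtain m where m: "CARD('n) = Suc m" using not0_implies_Suc[of "CARD('n)"] by auto
  have "((\<lambda>t. inverse t ^ CARD('n) * eta (inverse t *\<^sub>R w)) has_derivative
      (\<lambda>h. h * (- (inverse t ^ Suc CARD('n)) * dil (w /\<^sub>R t)))) (at t)"
    by (rule has_derivative_eq_rhs[OF has_derivative_mult[OF p e]])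
       (auto simp: dil_def m algebra_simps fun_eq_iff)
  then show ?thesis by (simp add: keta_def[abs_def] power_inverse)
qed

text \<open>Mollifications at different scales of a harmonic function agree, because the derivative of the
  mollifier with respect to its scale is a Laplacian.\<close>
lemma moll_harmonic_const:
  fixes u :: "real^'n \<Rightarrow> real"
  assumes wp: "weak_pair N u G" and u: "integrable lborel u"
    and harm: "\<And>\<phi>. test_fun N \<phi> \<Longrightarrow> (\<integral>x. G x \<bullet> grad \<phi> x \<partial>lborel) = 0"
    and x: "cball x r \<subseteq> N" and s: "0 < s" "s < r" and t: "0 < t" "t < r"
  shows "moll 1 s u x = moll 1 t u x"
proof -
  have [measurable]: "u \<in> borel_measurable borel" using u by auto
  let ?Z = "\<integral>x. eta_raw x \<partial>(lborel :: (real^'n) measure)"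
  let ?k' = "\<lambda>t y. - (inverse t ^ Suc CARD('n)) * dil ((x - y) /\<^sub>R t)"
  \<comment> \<open>Testing with \<open>beta\<close> rescaled about x and integrating by parts once
    more makes \<open>u\<close> orthogonal to the Laplacian of that bump, a nonzero multiple of the
    \<open>dil\<close> kernel.\<close>
  have int0: "(\<integral>y. u y * dil ((x - y) /\<^sub>R e) \<partial>lborel) = 0" if e: "0 < e" "e < r" for e
  proof -
    have sub: "cball x e \<subseteq> N" using x e by auto
    define \<phi> where "\<phi> y = beta ((x - y) /\<^sub>R e)" for y
    have \<phi>: "test_fun N \<phi>" unfolding \<phi>_def
      by (rule test_fun_reflect[OF smooth_on_beta _ e(1) sub]) (simp add: beta_eq_0)
    have d1: "partial_deriv \<phi> i = (\<lambda>y. - inverse e * partial_deriv beta i ((x - y) /\<^sub>R e))" for i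
      unfolding \<phi>_def by (rule ext) (rule partial_deriv_reflect[OF smooth_on_beta])
    have d2: "partial_deriv (partial_deriv \<phi> i) i y
        = (inverse e)\<^sup>2 * partial_deriv (partial_deriv beta i) i ((x - y) /\<^sub>R e)" for i y
    proof -
      have sb: "smooth_on UNIV (partial_deriv beta i :: real^'n \<Rightarrow> real)" 
        by (intro smooth_on_partial_deriv smooth_on_beta)
      have "(\<lambda>y. partial_deriv beta i ((x - y) /\<^sub>R e)) differentiable (at y)"
        using smooth_on_differentiable[OF smooth_on_affine[OF sb, of "- inverse e" "inverse e *\<^sub>R x"], of y]
        by (simp add: scaleR_diff_right)
      then show ?thesis unfolding d1
        by (simp add: partial_deriv_cmult[of _ _ "- inverse e", simplified] partial_deriv_reflect[OF sb] power2_eq_square)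
    qed
    have "(\<Sum>i\<in>UNIV. \<integral>y. u y * partial_deriv (partial_deriv \<phi> i) i y \<partial>lborel)
       = (\<Sum>i\<in>UNIV. - (\<integral>y. G y $ i * partial_deriv \<phi> i y \<partial>lborel))"
      by (intro sum.cong refl weak_pairD(3)[OF wp] test_fun_partial_deriv \<phi>)
    also have "\<dots> = - (\<integral>y. (\<Sum>i\<in>UNIV. G y $ i * partial_deriv \<phi> i y) \<partial>lborel)"
      unfolding sum_negf
      by (subst Bochner_Integration.integral_sum)
         (auto intro!: sqint_mult_integrable weak_pairD(2)[OF wp] test_fun_sqint test_fun_partial_deriv \<phi>)
    also have "\<dots> = 0" using harm[OF \<phi>] by (simp add: inner_vec_def)
    also have "(\<Sum>i\<in>UNIV. \<integral>y. u y * partial_deriv (partial_deriv \<phi> i) i y \<partial>lborel)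
       = (\<integral>y. (\<Sum>i\<in>UNIV. u y * partial_deriv (partial_deriv \<phi> i) i y) \<partial>lborel)"
      by (subst Bochner_Integration.integral_sum)
         (auto intro!: sqint_mult_integrable weak_pairD(1)[OF wp] test_fun_sqint test_fun_partial_deriv \<phi>)
    also have "\<dots> = (\<integral>y. (inverse e)\<^sup>2 * (- 2 * ?Z) * (u y * dil ((x - y) /\<^sub>R e)) \<partial>lborel)"
      by (simp only: d2 sum_distrib_left[symmetric] laplacian_beta) (simp add: algebra_simps)
    also have "\<dots> = (inverse e)\<^sup>2 * (- 2 * ?Z) * (\<integral>y. u y * dil ((x - y) /\<^sub>R e) \<partial>lborel)"
      by (rule integral_mult_right_zero)
    finally show ?thesis using e integral_eta_raw_pos[where 'n='n] by simp
  qed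
  obtain B where B: "B > 0" "\<And>w :: real^'n. \<bar>dil w\<bar> \<le> B" using dil_bounded by blast
  have der: "((\<lambda>t. moll 1 t u x) has_real_derivative 0) (at e)" if e: "0 < e" "e < r" for e
  proof -
    \<comment> \<open>On the ball of radius e/2 about e the scale stays above e/2, which bounds the
      negative powers of t uniformly.\<close>
    have pos: "e / 2 < t" if "t \<in> ball e (e / 2)" for t using that by (auto simp: dist_real_def abs_if split: if_splits)
    have 1: "((\<lambda>t. keta t (x - y)) has_derivative (\<lambda>h. h \<bullet> ?k' t y)) (at t)" if "t \<in> ball e (e / 2)" for t y
      using keta_has_derivative[of t "x - y"] pos[OF that] e by simp
    have 2: "norm (?k' t y) \<le> inverse (e / 2) ^ Suc CARD('n) * B" if "t \<in> ball e (e / 2)" for t y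
    proof -
      have "0 < t" using pos[OF that] e by simp
      then have "inverse t ^ Suc CARD('n) \<le> inverse (e / 2) ^ Suc CARD('n)"
        using pos[OF that] e by (intro power_mono le_imp_inverse_le) auto
      then have "inverse t ^ Suc CARD('n) * \<bar>dil ((x - y) /\<^sub>R t)\<bar> \<le> inverse (e / 2) ^ Suc CARD('n) * B"
        using B e by (intro mult_mono) auto
      then show ?thesis using \<open>0 < t\<close> by (simp add: abs_mult power_abs)
    qed
    have 3: "integrable lborel (\<lambda>y. keta t (x - y) * u y)" if "t \<in> ball e (e / 2)" for t
    proof -
      have t: "0 < t" using pos[OF that] e by simp
      obtain C where C: "\<And>w :: real^'n. \<bar>keta t w\<bar> \<le> C" using test_fun_bounded[OF test_fun_keta[OF t]] by blast
      have [measurable]: "(keta t :: real^'n \<Rightarrow> real) \<in> borel_measurable borel"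
        using test_fun_keta[OF t] test_fun_measurable by blast
      show ?thesis by (rule integrable_mult_bounded[OF u _ C]) measurable
    qed
    have m: "(\<lambda>y. keta t (x - y)) \<in> borel_measurable borel" for t
      unfolding keta_def by measurable
    have m': "(\<lambda>y. ?k' e y) \<in> borel_measurable borel" by measurable
    have e2: "0 < e / 2" using e by simp
    have z: "(\<integral>y. u y *\<^sub>R ?k' e y \<partial>lborel) = 0"
    proof -
      have "(\<integral>y. u y *\<^sub>R ?k' e y \<partial>lborel) = (\<integral>y. - (inverse e ^ Suc CARD('n)) * (u y * dil ((x - y) /\<^sub>R e)) \<partial>lborel)"
        by (intro Bochner_Integration.integral_cong) (auto simp: algebra_simps)
      also have "\<dots> = - (inverse e ^ Suc CARD('n)) * (\<integral>y. u y * dil ((x - y) /\<^sub>R e) \<partial>lborel)"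
        by (rule integral_mult_right_zero)
      finally show ?thesis using int0[OF e] by simp
    qed
    have "((\<lambda>t. \<integral>y. keta t (x - y) * u y \<partial>lborel) has_derivative (\<lambda>h. h \<bullet> (\<integral>y. u y *\<^sub>R ?k' e y \<partial>lborel))) (at e)"
      by (rule has_derivative_param_integral(1)[OF u e2 1 2 m m' 3])
    then have "((\<lambda>t. \<integral>y. keta t (x - y) * u y \<partial>lborel) has_real_derivative 0) (at e)"
      unfolding z by (simp add: has_field_derivative_def lambda_zero)
    then show ?thesis
      by (rule has_field_derivative_transform_within_open[of _ _ _ "{0<..}"])
         (use e in \<open>auto simp: moll_eq_conv\<close>)
  qed
  have "\<exists>c. \<forall>e\<in>{0<..<r}. moll 1 e u x = c"
    by (rule has_field_derivative_zero_constant) (use der in \<open>auto intro: has_field_derivative_at_within\<close>)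
  then show ?thesis using s t by auto
qed

text \<open>A point of the unit ball has distance more than 1 from the sphere of radius 2, so all
  scales below 1 are admissible there and give the value of the smooth mollification at scale 1/2.
  Letting the scale tend to 0 recovers \<open>u\<close>.\<close>

theorem weyl:
  fixes u :: "real^'n \<Rightarrow> real"
  assumes wp: "weak_pair (ball 0 2) u G" and u: "integrable lborel u"
    and harm: "\<And>\<phi>. test_fun (ball 0 2) \<phi> \<Longrightarrow> (\<integral>x. G x \<bullet> grad \<phi> x \<partial>lborel) = 0"
  obtains h where "smooth_on UNIV h" "AE x in lborel. x \<in> ball 0 1 \<longrightarrow> u x = h x"
proof -
  define h where "h = moll 1 (1/2) u"
  have sh: "smooth_on UNIV h" unfolding h_def by (rule smooth_on_moll[OF u]) simp
  have [measurable]: "u \<in> borel_measurable borel" "h \<in> borel_measurable borel"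
    using u sh by (auto intro: borel_measurable_continuous_UNIV smooth_on_continuous)
  define e where "e k = inverse (real (Suc (Suc k)))" for k
  have e0: "0 < e k" "e k < 1" for k by (auto simp: e_def divide_simps)
  have el: "e \<longlonglongrightarrow> 0" unfolding e_def by (rule LIMSEQ_Suc[OF LIMSEQ_inverse_real_of_nat])
  have sub: "L2lim UNIV (\<lambda>k. moll 1 (e k) u) u"
    by (rule moll_L2lim[OF weak_pairD(1)[OF wp] tendsto_const _ el]) (use e0 in \<open>auto intro: less_imp_le\<close>)
  have eq: "moll 1 (e k) u x = h x" if x: "x \<in> ball 0 1" for k x
  proof -
    \<comment> \<open>For norm x below 1 this is above 1, while norm x + r = (3 + norm x)/2 stays
      below 2.\<close>
    define r where "r = (2 - norm x + 1) / 2"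
    have r: "1 < r" "norm x + r < 2" using x by (auto simp: r_def field_simps)
    have "cball x r \<subseteq> ball 0 2"
    proof
      fix z assume "z \<in> cball x r"
      then show "z \<in> ball 0 2"
        using r norm_triangle_sub[of z x] by (auto simp: dist_norm norm_minus_commute)
    qed
    then show ?thesis unfolding h_def
      using e0[of k] r by (intro moll_harmonic_const[OF wp u harm]) auto
  qed
  have "L2lim (ball 0 1) (\<lambda>k. h) u"
    by (rule L2lim_cong[OF L2lim_subset[OF sub subset_UNIV]]) (use eq in auto)
  then have "(\<integral>\<^sup>+x. ennreal ((h x - u x)\<^sup>2) * indicator (ball 0 1) x \<partial>lborel) = 0"
    by (simp add: L2lim_def LIMSEQ_const_iff)
  then have "AE x in lborel. ennreal ((h x - u x)\<^sup>2) * indicator (ball 0 1) x = 0"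
    by (subst (asm) nn_integral_0_iff_AE) auto
  then have "AE x in lborel. x \<in> ball 0 1 \<longrightarrow> u x = h x"
    by eventually_elim (auto simp: indicator_def split: if_splits)
  with sh show ?thesis by (rule that)
qed

subsection \<open>Transfer between Lebesgue and Borel measurable representatives\<close>

lemma AE_lebesgue_iff: "(AE x in lebesgue. P x) \<longleftrightarrow> (AE x in lborel. P x)"
  by (rule AE_completion_iff)

text \<open>The bridge between the integrals of the definitions, over Lebesgue measurable functions
  known up to null sets, and Borel integrals over \<open>lborel\<close>.\<close>

lemma set_lebesgue_transfer:
  fixes f g :: "'a::euclidean_space \<Rightarrow> real"
  assumes N[measurable]: "N \<in> sets borel" and g[measurable]: "g \<in> borel_measurable borel"
    and eq: "AE x in lborel. x \<in> N \<longrightarrow> f x = g x"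
  shows "set_borel_measurable lebesgue N f"
    and "set_integrable lebesgue N f \<longleftrightarrow> integrable lborel (\<lambda>x. indicator N x * g x)"
    and "(LINT x:N|lebesgue. f x) = (\<integral>x. indicator N x * g x \<partial>lborel)"
proof -
  have ae: "AE x in lebesgue. indicator N x * g x = indicator N x *\<^sub>R f x"
    using eq unfolding AE_lebesgue_iff by eventually_elim (auto simp: indicator_def)
  have m[measurable]: "(\<lambda>x. indicator N x * g x) \<in> borel_measurable lborel" by measurable
  have ml: "(\<lambda>x. indicator N x * g x) \<in> borel_measurable lebesgue" using m by (rule measurable_completion)
  show mf: "set_borel_measurable lebesgue N f"
    unfolding set_borel_measurable_def using borel_measurable_AE[OF ml ae] .
  then have mf': "(\<lambda>x. indicator N x *\<^sub>R f x) \<in> borel_measurable lebesgue" by (simp add: set_borel_measurable_def)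
  show "set_integrable lebesgue N f \<longleftrightarrow> integrable lborel (\<lambda>x. indicator N x * g x)"
    unfolding set_integrable_def using integrable_cong_AE[OF ml mf' ae] integrable_completion[OF m] by simp
  show "(LINT x:N|lebesgue. f x) = (\<integral>x. indicator N x * g x \<partial>lborel)"
    unfolding set_lebesgue_integral_def using integral_cong_AE[OF ml mf' ae] integral_completion[OF m] by simp
qed

text \<open>A function measurable for the completed measure agrees almost everywhere with a Borel
  function; multiplying by the indicator of \<open>N\<close> makes it vanish outside.\<close>

lemma L2_on_representative:
  fixes f :: "real^'n \<Rightarrow> real"
  assumes N[measurable]: "N \<in> sets borel" and f: "L2_on N f"
  obtains g where "sqint g" "\<And>x. x \<notin> N \<Longrightarrow> g x = 0" "AE x in lborel. x \<in> N \<longrightarrow> f x = g x"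
proof -
  have "(\<lambda>x. indicator N x *\<^sub>R f x) \<in> borel_measurable lebesgue"
    using f by (simp add: L2_on_def set_borel_measurable_def)
  then obtain g' where g'[measurable]: "g' \<in> borel_measurable lborel" "AE x in lborel. indicator N x *\<^sub>R f x = g' x"
    using completion_ex_borel_measurable_real by blast
  define g where "g x = indicator N x * g' x" for x
  have [measurable]: "g \<in> borel_measurable borel" using g'(1) unfolding g_def[abs_def] by simp
  have eq: "AE x in lborel. x \<in> N \<longrightarrow> f x = g x"
    using g'(2) by eventually_elim (auto simp: g_def indicator_def)
  then have eq2: "AE x in lborel. x \<in> N \<longrightarrow> (f x)\<^sup>2 = (g x)\<^sup>2" by eventually_elim auto
  have "integrable lborel (\<lambda>x. indicator N x * (g x)\<^sup>2)"
    using f set_lebesgue_transfer(2)[OF N _ eq2] by (auto simp: L2_on_def)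
  moreover have "(\<lambda>x. indicator N x * (g x)\<^sup>2) = (\<lambda>x. (g x)\<^sup>2)" by (auto simp: g_def indicator_def)
  ultimately have "sqint g" by (simp add: sqint_def)
  then show ?thesis using that[of g] eq by (simp add: g_def)
qed

lemma L2_on_sqint:
  fixes f :: "real^'n \<Rightarrow> real"
  assumes N[measurable]: "N \<in> sets borel" and g: "sqint g" and eq: "AE x in lborel. x \<in> N \<longrightarrow> f x = g x"
  shows "L2_on N f"
proof -
  have [measurable]: "g \<in> borel_measurable borel" using g by (simp add: sqint_def)
  have eq2: "AE x in lborel. x \<in> N \<longrightarrow> (f x)\<^sup>2 = (g x)\<^sup>2" using eq by eventually_elim auto
  have "integrable lborel (\<lambda>x. indicator N x * (g x)\<^sup>2)"
    using g integrable_real_mult_indicator[of N lborel "\<lambda>x. (g x)\<^sup>2"] by (simp add: sqint_def mult.commute)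
  then show ?thesis unfolding L2_on_def
    using set_lebesgue_transfer(1)[OF N _ eq] set_lebesgue_transfer(2)[OF N _ eq2] by auto
qed

lemma set_lebesgue_integral_test_fun:
  fixes f :: "real^'n \<Rightarrow> real"
  assumes N: "N \<in> sets borel" and g: "sqint g" and eq: "AE x in lborel. x \<in> N \<longrightarrow> f x = g x" and p: "test_fun N p"
  shows "(LINT x:N|lebesgue. f x * p x) = (\<integral>x. g x * p x \<partial>lborel)"
proof -
  have [measurable]: "g \<in> borel_measurable borel" "p \<in> borel_measurable borel"
    using g p by (auto simp: sqint_def test_fun_measurable)
  obtain K where K: "K \<subseteq> N" "\<And>x. x \<notin> K \<Longrightarrow> p x = 0" using p by (rule test_funE) blast
  have eq2: "AE x in lborel. x \<in> N \<longrightarrow> f x * p x = g x * p x" using eq by eventually_elim auto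
  have "(LINT x:N|lebesgue. f x * p x) = (\<integral>x. indicator N x * (g x * p x) \<partial>lborel)"
    by (rule set_lebesgue_transfer(3)[OF N _ eq2]) measurable
  also have "\<dots> = (\<integral>x. g x * p x \<partial>lborel)"
    using K by (intro Bochner_Integration.integral_cong) (auto simp: indicator_def)
  finally show ?thesis .
qed

lemma weak_pair_representative:
  assumes N: "N \<in> sets borel" and u: "L2_on N u" and G: "is_weak_grad N u G"
  obtains u0 G0 where "weak_pair N u0 G0" "\<And>x. x \<notin> N \<Longrightarrow> u0 x = 0" "\<And>x. x \<notin> N \<Longrightarrow> G0 x = 0"
    "AE x in lborel. x \<in> N \<longrightarrow> u x = u0 x" "AE x in lborel. x \<in> N \<longrightarrow> G x = G0 x"
proof -
  obtain u0 where u0: "sqint u0" "\<And>x. x \<notin> N \<Longrightarrow> u0 x = 0" "AE x in lborel. x \<in> N \<longrightarrow> u x = u0 x"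
    using L2_on_representative[OF N u] by blast
  have "\<forall>i. \<exists>g. sqint g \<and> (\<forall>x. x \<notin> N \<longrightarrow> g x = 0) \<and> (AE x in lborel. x \<in> N \<longrightarrow> G x $ i = g x)"
  proof
    fix i
    have "L2_on N (\<lambda>x. G x $ i)" using G by (simp add: is_weak_grad_def)
    from L2_on_representative[OF N this]
    show "\<exists>g. sqint g \<and> (\<forall>x. x \<notin> N \<longrightarrow> g x = 0) \<and> (AE x in lborel. x \<in> N \<longrightarrow> G x $ i = g x)"
      by blast
  qed
  then obtain g where g: "\<And>i. sqint (g i)" "\<And>i x. x \<notin> N \<Longrightarrow> g i x = 0"
     "\<And>i. AE x in lborel. x \<in> N \<longrightarrow> G x $ i = g i x"
    by (subst (asm) choice_iff) blast
  define G0 where "G0 x = (\<chi> i. g i x)" for x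
  have "weak_pair N u0 G0"
    unfolding weak_pair_def
  proof (intro conjI allI impI)
    show "sqint u0" by (rule u0)
    show "sqint (\<lambda>x. G0 x $ i)" for i using g(1) by (simp add: G0_def)
    fix \<phi> i assume \<phi>: "test_fun N \<phi>"
    have "(LINT x:N|lebesgue. u x * partial_deriv \<phi> i x) = - (LINT x:N|lebesgue. G x $ i * \<phi> x)"
      using G \<phi> by (simp add: is_weak_grad_def)
    then show "(\<integral>x. u0 x * partial_deriv \<phi> i x \<partial>lborel) = - (\<integral>x. G0 x $ i * \<phi> x \<partial>lborel)"
      using set_lebesgue_integral_test_fun[OF N u0(1,3) test_fun_partial_deriv[OF \<phi>]]
        set_lebesgue_integral_test_fun[OF N g(1,3) \<phi>] by (simp add: G0_def)
  qed
  moreover have "AE x in lborel. \<forall>i\<in>UNIV. x \<in> N \<longrightarrow> G x $ i = g i x"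
    using g(3) by (intro AE_finite_allI) auto
  then have "AE x in lborel. x \<in> N \<longrightarrow> G x = G0 x" by eventually_elim (simp add: G0_def vec_eq_iff)
  ultimately show ?thesis using that[of u0 G0] u0 g(2) by (simp add: G0_def vec_eq_iff)
qed

lemma weak_pair_imp_H1:
  assumes N: "N \<in> sets borel" and wp: "weak_pair N u0 G0"
    and u: "AE x in lborel. x \<in> N \<longrightarrow> u x = u0 x"
  shows "H1 N u" "is_weak_grad N u G0"
proof -
  have "AE x in lborel. x \<in> N \<longrightarrow> G0 x $ i = G0 x $ i" for i by simp
  note G = weak_pairD(2)[OF wp] this
  show "is_weak_grad N u G0" unfolding is_weak_grad_def
  proof (intro conjI allI impI)
    show "L2_on N (\<lambda>x. G0 x $ i)" for i by (rule L2_on_sqint[OF N G])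
    fix \<phi> i assume \<phi>: "test_fun N \<phi>"
    show "(LINT x:N|lebesgue. u x * partial_deriv \<phi> i x) = - (LINT x:N|lebesgue. G0 x $ i * \<phi> x)"
      using set_lebesgue_integral_test_fun[OF N weak_pairD(1)[OF wp] u test_fun_partial_deriv[OF \<phi>]]
        set_lebesgue_integral_test_fun[OF N G \<phi>] weak_pairD(3)[OF wp \<phi>] by simp
  qed
  then show "H1 N u" unfolding H1_def using L2_on_sqint[OF N weak_pairD(1)[OF wp] u] by blast
qed

lemma H1_representative:
  assumes N: "N \<in> sets borel" and u: "H1 N u"
  obtains u0 G0 where "weak_pair N u0 G0" "\<And>x. x \<notin> N \<Longrightarrow> u0 x = 0" "\<And>x. x \<notin> N \<Longrightarrow> G0 x = 0"
    "AE x in lborel. x \<in> N \<longrightarrow> u x = u0 x" "AE x in lborel. x \<in> N \<longrightarrow> wgrad N u x = G0 x"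
proof -
  have ex: "\<exists>G. is_weak_grad N u G" and L: "L2_on N u" using u by (simp_all add: H1_def)
  have "is_weak_grad N u (wgrad N u)" unfolding wgrad_def using ex by (rule someI_ex)
  from weak_pair_representative[OF N L this] show ?thesis using that by blast
qed

text \<open>\<open>wgrad\<close> is a choice among weak gradients, so only its almost everywhere
  class is determined; this identifies that class with any explicit weak gradient.\<close>

lemma wgrad_eq_AE:
  assumes N: "open N" and wp: "weak_pair N u0 G0" and u: "AE x in lborel. x \<in> N \<longrightarrow> u x = u0 x"
  shows "AE x in lborel. x \<in> N \<longrightarrow> wgrad N u x = G0 x"
proof -
  have Nb: "N \<in> sets borel" using N by simp
  obtain u1 G1 where 1: "weak_pair N u1 G1" "AE x in lborel. x \<in> N \<longrightarrow> u x = u1 x"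
     "AE x in lborel. x \<in> N \<longrightarrow> wgrad N u x = G1 x"
    by (rule H1_representative[OF Nb weak_pair_imp_H1(1)[OF Nb wp u]])
  have "AE x in lborel. x \<in> N \<longrightarrow> u1 x = u0 x" using 1(2) u by eventually_elim auto
  from weak_pair_unique[OF N 1(1) wp this] 1(3) show ?thesis by eventually_elim auto
qed

subsection \<open>Rank one perturbations of a multiple of the identity\<close>

text \<open>The symmetric map a I - c x x^T. The derivative of a radial map x to f(|x|) x has this
  form: it acts as a orthogonally to x and as a - c |x|^2 along x.\<close>

definition lin :: "real \<Rightarrow> real \<Rightarrow> real^'n \<Rightarrow> real^'n \<Rightarrow> real^'n" where
  "lin a c x h = a *\<^sub>R h - (c * (x \<bullet> h)) *\<^sub>R x"

lemma linear_lin: "linear (lin a c x)"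
  by (rule linearI) (simp_all add: lin_def algebra_simps inner_right_distrib)

lemma inner_lin: "lin a c x v \<bullet> w = v \<bullet> lin a c x w"
  by (simp add: lin_def inner_diff_left inner_diff_right inner_commute)

lemma norm_lin_le: "norm (lin a c x h) \<le> (\<bar>a\<bar> + \<bar>c\<bar> * (norm x)\<^sup>2) * norm h"
proof -
  have "norm (lin a c x h) \<le> norm (a *\<^sub>R h) + norm ((c * (x \<bullet> h)) *\<^sub>R x)"
    unfolding lin_def by (rule norm_triangle_ineq4)
  also have "norm ((c * (x \<bullet> h)) *\<^sub>R x) \<le> \<bar>c\<bar> * (norm x * norm h) * norm x"
    by (simp add: abs_mult mult_left_mono mult_right_mono Cauchy_Schwarz_ineq2)
  finally show ?thesis by (simp add: algebra_simps power2_eq_square)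
qed

text \<open>An orthogonal map carries a coordinate axis to the direction of x and conjugates the map
  to a diagonal one.\<close>

lemma det_lin:
  fixes x :: "real^'n"
  assumes x: "x \<noteq> 0"
  shows "det (matrix (lin a c x)) = a ^ (CARD('n) - 1) * (a - c * (norm x)\<^sup>2)"
proof -
  obtain k :: 'n where True by simp
  let ?e = "axis k (1::real)"
  have "norm (norm x *\<^sub>R ?e) = norm x" by simp
  then obtain f where f: "orthogonal_transformation f" "f (norm x *\<^sub>R ?e) = x"
    using orthogonal_transformation_exists[of "norm x *\<^sub>R ?e" x] by blast
  have lf: "linear f" using f(1) by (rule orthogonal_transformation_linear)
  have fe: "x = norm x *\<^sub>R f ?e" using f(2) linear_scale[OF lf] by simp
  let ?D = "lin a (c * (norm x)\<^sup>2) ?e"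
  have ax: "axis i (1::real) $ j = (if i = j then 1 else 0)" for i j :: 'n by (simp add: axis_def)
  have comm: "lin a c x (f h) = f (?D h)" for h
  proof -
    have "x \<bullet> f h = norm x * (?e \<bullet> h)"
      using f(1) by (subst fe) (simp add: orthogonal_transformation_def)
    then have "lin a c x (f h) = a *\<^sub>R f h - (c * (norm x * (?e \<bullet> h))) *\<^sub>R (norm x *\<^sub>R f ?e)"
      unfolding lin_def using fe by simp
    also have "\<dots> = f (?D h)"
      by (simp add: lin_def linear_diff[OF lf] linear_scale[OF lf] power2_eq_square algebra_simps)
    finally show ?thesis .
  qed
  have "matrix (lin a c x \<circ> f) = matrix (f \<circ> ?D)" using comm by (auto simp: o_def)
  then have "matrix (lin a c x) ** matrix f = matrix f ** matrix ?D"
    by (simp add: matrix_compose[OF lf linear_lin] matrix_compose[OF linear_lin lf])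
  then have "det (matrix (lin a c x)) * det (matrix f) = det (matrix f) * det (matrix ?D)"
    by (metis det_mul)
  moreover have "det (matrix f) \<noteq> 0"
    using f(1) det_orthogonal_matrix[of "matrix f"] orthogonal_transformation_matrix[of f] by fastforce
  ultimately have "det (matrix (lin a c x)) = det (matrix ?D)" by simp
  also have "\<dots> = (\<Prod>i\<in>UNIV. matrix ?D $ i $ i)"
    by (rule det_diagonal) (auto simp: matrix_def lin_def inner_axis_axis ax)
  also have "\<dots> = (matrix ?D $ k $ k) * (\<Prod>i\<in>UNIV - {k}. matrix ?D $ i $ i)"
    by (rule prod.remove) auto
  also have "(\<Prod>i\<in>UNIV - {k}. matrix ?D $ i $ i) = (\<Prod>i\<in>UNIV - {k}. a)"
    by (rule prod.cong) (auto simp: matrix_def lin_def inner_axis_axis ax)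
  also have "matrix ?D $ k $ k = a - c * (norm x)\<^sup>2"
    by (simp add: matrix_def lin_def inner_axis_axis ax)
  finally show ?thesis by (simp add: card_Diff_subset)
qed

subsection \<open>The blow-up map and its inverse\<close>

definition N0 :: "(real^'n) set" where "N0 = ball 0 2 - {0}"

definition Fi :: "real^'n \<Rightarrow> real^'n" where
  "Fi y = (2 - 2 / norm y) *\<^sub>R y"

text \<open>Derivative of \<open>F1\<close> at x: eigenvalue 1/2 radially and 1/2 + 1/|x|
  tangentially. For its inverse \<open>DFi\<close> at y these are 2 and 2 - 2/|y|.\<close>

definition DF :: "real^'n \<Rightarrow> real^'n \<Rightarrow> real^'n" where
  "DF x = lin (1/2 + 1 / norm x) (1 / norm x ^ 3) x"

definition DFi :: "real^'n \<Rightarrow> real^'n \<Rightarrow> real^'n" where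
  "DFi y = lin (2 - 2 / norm y) (- 2 / norm y ^ 3) y"

text \<open>Jacobian determinant of \<open>F1\<close>: CARD('n) - 1 tangential eigenvalues times the
  radial eigenvalue 1/2.\<close>

definition JF :: "real^'n \<Rightarrow> real" where
  "JF x = (1/2 + 1 / norm x) ^ (CARD('n) - 1) / 2"

definition JFi :: "real^'n \<Rightarrow> real" where
  "JFi y = 2 * (2 - 2 / norm y) ^ (CARD('n) - 1)"

lemma N0_iff: "x \<in> N0 \<longleftrightarrow> x \<noteq> 0 \<and> norm x < 2" by (auto simp: N0_def)

lemma N1_iff: "y \<in> N1 \<longleftrightarrow> 1 < norm y \<and> norm y < 2" by (auto simp: N1_def)

lemma open_N0: "open N0" unfolding N0_def by (simp add: open_Diff)

lemma open_N1: "open N1" unfolding N1_def by (simp add: open_Diff)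

lemma sets_N0_N1 [measurable, simp]: "N0 \<in> sets borel" "N1 \<in> sets borel"
  by (simp_all add: open_N0 open_N1 borel_open)

lemma F1_eq: "x \<noteq> 0 \<Longrightarrow> F1 x = (1/2 + 1 / norm x) *\<^sub>R x"
  by (simp add: F1_def field_simps)

lemma F1_zero [simp]: "F1 0 = 0" by (simp add: F1_def)

lemma norm_F1: "x \<noteq> 0 \<Longrightarrow> norm (F1 x) = norm x / 2 + 1"
  by (simp add: F1_def)

lemma norm_Fi: "1 \<le> norm y \<Longrightarrow> norm (Fi y) = 2 * (norm y - 1)"
  by (cases "y = 0") (auto simp: Fi_def field_simps abs_if)

lemma Fi_F1: "x \<noteq> 0 \<Longrightarrow> Fi (F1 x) = x"
proof -
  assume x: "x \<noteq> 0"
  have s: "norm x > 0" using x by simp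
  have "Fi (F1 x) = ((2 - 2 / (norm x / 2 + 1)) * (1/2 + 1 / norm x)) *\<^sub>R x"
    by (simp only: Fi_def norm_F1[OF x]) (simp only: F1_eq[OF x] scaleR_scaleR)
  also have "(2 - 2 / (norm x / 2 + 1)) * (1/2 + 1 / norm x) = 1"
  proof -
    have "norm x / 2 + 1 \<noteq> 0" "norm x \<noteq> 0" "norm x + 2 \<noteq> 0" using s by linarith+
    then show ?thesis by (simp add: divide_simps)
  qed
  finally show ?thesis by simp
qed

lemma F1_Fi: "1 < norm y \<Longrightarrow> F1 (Fi y) = y"
proof -
  assume y: "1 < norm y"
  have n: "norm (Fi y) = 2 * (norm y - 1)" using y by (simp add: norm_Fi)
  then have z: "Fi y \<noteq> 0" using y by auto
  have "F1 (Fi y) = ((1/2 + 1 / (2 * (norm y - 1))) * (2 - 2 / norm y)) *\<^sub>R y"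
    unfolding F1_eq[OF z] n by (simp add: Fi_def)
  also have "(1/2 + 1 / (2 * (norm y - 1))) * (2 - 2 / norm y) = 1"
  proof -
    have "norm y \<noteq> 0" "norm y - 1 \<noteq> 0" using y by linarith+
    then show ?thesis by (simp add: divide_simps)
  qed
  finally show ?thesis by simp
qed

lemma F1_in_N1: "x \<in> N0 \<Longrightarrow> F1 x \<in> N1" by (auto simp: N0_iff N1_iff norm_F1)

lemma Fi_in_N0: "y \<in> N1 \<Longrightarrow> Fi y \<in> N0"
  using norm_Fi[of y] by (auto simp: N0_iff N1_iff)

lemma F1_image: "F1 ` N0 = N1"
  using F1_in_N1 Fi_in_N0 F1_Fi by (force simp: N1_iff image_iff)

lemma inj_on_F1: "inj_on F1 N0"
  by (rule inj_on_inverseI[of _ Fi]) (simp add: Fi_F1 N0_iff)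

lemma F1_has_derivative: "x \<noteq> 0 \<Longrightarrow> (F1 has_derivative DF x) (at x)"
proof -
  assume x: "x \<noteq> 0"
  have n: "norm x \<noteq> 0" using x by simp
  note has_derivative_scaleR[OF has_derivative_add[OF has_derivative_const[of "1/2"]
      Deriv.has_derivative_inverse[OF n has_derivative_norm[OF x]]] has_derivative_ident]
  then have "((\<lambda>x. (1/2 + 1 / norm x) *\<^sub>R x) has_derivative DF x) (at x)"
    by (simp add: DF_def lin_def[abs_def] sgn_div_norm power3_eq_cube inner_commute inverse_eq_divide)
  then show ?thesis
    by (rule has_derivative_transform_within_open[of _ _ _ _ "- {0}"]) (use x in \<open>auto simp: F1_eq\<close>)
qed

lemma Fi_has_derivative: "y \<noteq> 0 \<Longrightarrow> (Fi has_derivative DFi y) (at y)"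
proof -
  assume y: "y \<noteq> 0"
  have n: "norm y \<noteq> 0" using y by simp
  note has_derivative_scaleR[OF has_derivative_diff[OF has_derivative_const[of 2]
      has_derivative_mult_right[OF Deriv.has_derivative_inverse[OF n has_derivative_norm[OF y]], of 2]] has_derivative_ident]
  then show ?thesis unfolding Fi_def[abs_def]
    by (simp add: DFi_def lin_def[abs_def] sgn_div_norm power3_eq_cube inner_commute inverse_eq_divide)
qed

text \<open>Obtained by differentiating Fi(F1 x) = x and using uniqueness of derivatives, without
  computing with the matrices.\<close>

lemma DFi_DF: "x \<noteq> 0 \<Longrightarrow> DFi (F1 x) (DF x h) = h"
proof -
  assume x: "x \<noteq> 0"
  then have "norm (F1 x) > 0" by (simp add: norm_F1 add_nonneg_pos)
  then have "F1 x \<noteq> 0" by auto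
  then have d: "((\<lambda>x. Fi (F1 x)) has_derivative (\<lambda>h. DFi (F1 x) (DF x h))) (at x)"
    by (rule has_derivative_compose[OF F1_has_derivative[OF x] Fi_has_derivative])
  have "((\<lambda>x. x) has_derivative (\<lambda>h. DFi (F1 x) (DF x h))) (at x)"
    by (rule has_derivative_transform_within_open[OF d, of "- {0}"]) (use x Fi_F1 in auto)
  from has_derivative_unique[OF this has_derivative_ident] show ?thesis by (simp add: fun_eq_iff)
qed

lemma DF_DFi: "1 < norm y \<Longrightarrow> DF (Fi y) (DFi y h) = h"
proof -
  assume y: "1 < norm y"
  then have "norm (Fi y) \<noteq> 0" "y \<noteq> 0" by (auto simp: norm_Fi)
  then have z: "Fi y \<noteq> 0" "y \<noteq> 0" by auto
  have d: "((\<lambda>y. F1 (Fi y)) has_derivative (\<lambda>h. DF (Fi y) (DFi y h))) (at y)"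
    by (rule has_derivative_compose[OF Fi_has_derivative[OF z(2)] F1_has_derivative[OF z(1)]])
  have "open (- cball (0::real^'a) 1)" by auto
  then have "((\<lambda>x. x) has_derivative (\<lambda>h. DF (Fi y) (DFi y h))) (at y)"
    by (rule has_derivative_transform_within_open[OF d]) (use y in \<open>auto simp: F1_Fi\<close>)
  from has_derivative_unique[OF this has_derivative_ident] show ?thesis by (simp add: fun_eq_iff)
qed

lemma DFi_DF_Fi: "1 < norm y \<Longrightarrow> DFi y (DF (Fi y) h) = h"
  using DFi_DF[of "Fi y" h] F1_Fi[of y] norm_Fi[of y] by fastforce

lemma det_DF: 
  fixes x :: "real^'n" assumes "x \<noteq> 0" shows "det (matrix (DF x)) = JF x"
proof -
  have "1 / 2 + 1 / norm x - 1 / norm x ^ 3 * (norm x)\<^sup>2 = 1 / 2"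
    using assms by (simp add: power2_eq_square power3_eq_cube)
  then show ?thesis unfolding DF_def JF_def by (simp add: det_lin[OF assms])
qed

lemma det_DFi: 
  fixes y :: "real^'n" assumes "y \<noteq> 0" shows "det (matrix (DFi y)) = JFi y"
proof -
  have "2 - 2 / norm y - (- 2 / norm y ^ 3) * (norm y)\<^sup>2 = 2"
    using assms by (simp add: power2_eq_square power3_eq_cube)
  then show ?thesis unfolding DFi_def JFi_def by (simp add: det_lin[OF assms])
qed

lemma JF_pos: "x \<noteq> 0 \<Longrightarrow> 0 < JF x"
  by (simp add: JF_def add_pos_pos)

lemma JF_ge: "x \<noteq> 0 \<Longrightarrow> (1/2) ^ (CARD('n) - 1) / 2 \<le> JF (x :: real^'n)"
  unfolding JF_def by (intro divide_right_mono power_mono) auto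

lemma JFi_pos: "1 < norm y \<Longrightarrow> 0 < JFi y"
proof -
  assume "1 < norm y"
  then have "0 < 2 - 2 / norm y" by (simp add: divide_simps)
  then show ?thesis unfolding JFi_def by (intro mult_pos_pos zero_less_power) auto
qed

lemma JFi_F1:
  fixes x :: "real^'n" assumes "x \<noteq> 0" shows "JFi (F1 x) * JF x = 1"
proof -
  have "norm x > 0" using assms by simp
  then have "norm x / 2 + 1 \<noteq> 0" "norm x \<noteq> 0" "norm x + 2 \<noteq> 0" by linarith+
  then have "(2 - 2 / (norm x / 2 + 1)) * (1/2 + 1 / norm x) = 1" by (simp add: divide_simps)
  then have "((2 - 2 / (norm x / 2 + 1)) * (1/2 + 1 / norm x)) ^ (CARD('n) - 1) = 1" by simp
  then show ?thesis by (simp add: JFi_def JF_def norm_F1[OF assms] power_mult_distrib)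
qed

lemma F1_measurable [measurable]: "F1 \<in> borel_measurable borel"
  unfolding F1_def[abs_def] by measurable

lemma Fi_measurable [measurable]: "Fi \<in> borel_measurable borel"
  unfolding Fi_def[abs_def] by measurable

lemma JF_measurable [measurable]: "JF \<in> borel_measurable borel"
  unfolding JF_def[abs_def] by measurable

lemma JFi_measurable [measurable]: "JFi \<in> borel_measurable borel"
  unfolding JFi_def[abs_def] by measurable

lemma DF_apply_measurable [measurable]:
  assumes [measurable]: "v \<in> borel_measurable borel" "P \<in> borel_measurable borel"
  shows "(\<lambda>x. DF (P x) (v x)) \<in> borel_measurable borel"
  unfolding DF_def lin_def by measurable

lemma DFi_apply_measurable [measurable]:
  assumes [measurable]: "v \<in> borel_measurable borel" "P \<in> borel_measurable borel"
  shows "(\<lambda>x. DFi (P x) (v x)) \<in> borel_measurable borel"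
  unfolding DFi_def lin_def by measurable

subsection \<open>Change of variables\<close>

text \<open>The library's change of variables theorem needs a well-ordered index type; a copy of the index
  type carries an arbitrary such order.\<close>
typedef ('a::finite) ix = "UNIV :: 'a set" ..

lemma bij_Rep_ix: "bij (Rep_ix :: 'a::finite ix \<Rightarrow> 'a)"
proof (rule bijI)
  show "inj (Rep_ix :: 'a ix \<Rightarrow> 'a)" by (rule injI) (simp only: Rep_ix_inject)
  show "surj (Rep_ix :: 'a ix \<Rightarrow> 'a)" by (rule surjI[of _ Abs_ix]) (simp add: Abs_ix_inverse)
qed

instance ix :: (finite) finite
proof
  show "finite (UNIV :: 'a ix set)"
    by (rule bij_betw_finite[OF bij_Rep_ix, THEN iffD2]) simp
qed

instantiation ix :: (finite) wellorder
begin

definition ix_rank :: "'a ix \<Rightarrow> nat" where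
  "ix_rank i = (SOME f :: 'a \<Rightarrow> nat. inj f) (Rep_ix i)"

definition less_eq_ix :: "'a ix \<Rightarrow> 'a ix \<Rightarrow> bool" where
  "less_eq_ix i j \<longleftrightarrow> ix_rank i \<le> ix_rank j"

definition less_ix :: "'a ix \<Rightarrow> 'a ix \<Rightarrow> bool" where
  "less_ix i j \<longleftrightarrow> ix_rank i < ix_rank j"

lemma ix_rank_inj: "ix_rank (i :: 'a ix) = ix_rank j \<Longrightarrow> i = j"
proof -
  have "\<exists>f :: 'a \<Rightarrow> nat. inj f" using finite_imp_inj_to_nat_seg[OF finite[of "UNIV :: 'a set"]] by blast
  then have "inj (SOME f :: 'a \<Rightarrow> nat. inj f)" by (rule someI_ex)
  moreover assume "ix_rank i = ix_rank j"
  ultimately have "Rep_ix i = Rep_ix j" unfolding ix_rank_def by (rule injD)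
  then show "i = j" by (simp add: Rep_ix_inject)
qed

instance
proof
  fix P :: "'a ix \<Rightarrow> bool" and a :: "'a ix"
  assume step: "\<And>x. (\<And>y. y < x \<Longrightarrow> P y) \<Longrightarrow> P x"
  show "P a"
  proof (rule measure_induct_rule[of ix_rank P a])
    fix x assume IH: "\<And>y. ix_rank y < ix_rank x \<Longrightarrow> P y"
    show "P x" by (rule step) (simp only: less_ix_def IH)
  qed
qed (auto simp: less_eq_ix_def less_ix_def ix_rank_inj)

end

text \<open>Integrability and value are kept in one equivalence, the form of
  \<open>has_absolute_integral_change_of_variables\<close>.\<close>

lemma change_of_variables_F1_wellorder:
  fixes f :: "real^'m::{finite,wellorder} \<Rightarrow> real"
  shows "set_integrable lebesgue N0 (\<lambda>x. JF x * f (F1 x)) \<and> (LINT x:N0|lebesgue. JF x * f (F1 x)) = b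
    \<longleftrightarrow> set_integrable lebesgue N1 f \<and> (LINT x:N1|lebesgue. f x) = b"
proof -
  \<comment> \<open>The general substitution theorem is applied to integrands with values in real^1;
    \<open>vec\<close> carries \<open>f\<close> there and component 1 carries the result
    back.\<close>
  have vecm: "set_integrable lebesgue S (\<lambda>x. vec (h x) :: real^1) \<longleftrightarrow> set_integrable lebesgue S h"
    for S and h :: "(real, 'm) vec \<Rightarrow> real"
  proof
    assume "set_integrable lebesgue S (\<lambda>x. vec (h x) :: real^1)"
    then have "integrable lebesgue (\<lambda>x. (indicator S x *\<^sub>R (vec (h x) :: real^1)) $ 1)"
      unfolding set_integrable_def by (rule integrable_bounded_linear[OF bounded_linear_vec_nth])
    then show "set_integrable lebesgue S h" by (simp add: set_integrable_def)
  next
    assume "set_integrable lebesgue S h"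
    then have "integrable lebesgue (\<lambda>x. (indicator S x *\<^sub>R h x) *\<^sub>R (vec 1 :: real^1))"
      unfolding set_integrable_def by (intro integrable_scaleR_left)
    moreover have "(indicator S x *\<^sub>R h x) *\<^sub>R (vec 1 :: real^1) = indicator S x *\<^sub>R vec (h x)" for x
      by (simp add: vec_eq_iff)
    ultimately show "set_integrable lebesgue S (\<lambda>x. vec (h x) :: real^1)" by (simp add: set_integrable_def)
  qed
  have veci: "integral S (\<lambda>x. vec (h x) :: real^1) = vec (LINT x:S|lebesgue. h x)"
    if "set_integrable lebesgue S h" for S and h :: "(real, 'm) vec \<Rightarrow> real"
  proof -
    have i: "set_integrable lebesgue S (\<lambda>x. vec (h x) :: real^1)" using that vecm by blast
    have "integral S (\<lambda>x. vec (h x) :: real^1) = (LINT x:S|lebesgue. (vec (h x) :: real^1))"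
      using set_lebesgue_integral_eq_integral(2)[OF i] by simp
    also have "\<dots> $ 1 = (\<integral>x. (indicator S x *\<^sub>R (vec (h x) :: real^1)) $ 1 \<partial>lebesgue)"
      using i unfolding set_lebesgue_integral_def set_integrable_def
      by (rule integral_bounded_linear[OF bounded_linear_vec_nth, symmetric])
    also have "\<dots> = (LINT x:S|lebesgue. h x)" by (simp add: set_lebesgue_integral_def)
    finally show ?thesis by (simp add: vec_eq_iff forall_1)
  qed
  let ?f = "\<lambda>x. vec (f x) :: real^1"
  have S: "(N0 :: ((real, 'm) vec) set) \<in> sets lebesgue" using open_N0 by auto
  have d: "(F1 has_derivative DF x) (at x within N0)" if "x \<in> N0" for x :: "(real, 'm) vec"
    using that F1_has_derivative by (auto simp: N0_iff intro: has_derivative_at_withinI)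
  have eq: "indicator N0 x *\<^sub>R (\<bar>det (matrix (DF x))\<bar> *\<^sub>R ?f (F1 x)) = indicator N0 x *\<^sub>R (vec (JF x * f (F1 x)) :: real^1)" for x
    using JF_pos[of x] det_DF[of x] by (cases "x \<in> N0") (simp_all add: N0_iff vec_eq_iff)
  have i1: "(\<lambda>x. \<bar>det (matrix (DF x))\<bar> *\<^sub>R ?f (F1 x)) absolutely_integrable_on N0
     \<longleftrightarrow> set_integrable lebesgue N0 (\<lambda>x. JF x * f (F1 x))"
    unfolding vecm[of N0 "\<lambda>x. JF x * f (F1 x)", symmetric] unfolding set_integrable_def eq ..
  have i2: "integral N0 (\<lambda>x. \<bar>det (matrix (DF x))\<bar> *\<^sub>R ?f (F1 x)) = integral N0 (\<lambda>x. vec (JF x * f (F1 x)) :: real^1)"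
  proof (rule integral_cong)
    fix x :: "(real, 'm) vec" assume "x \<in> N0"
    then have "x \<noteq> 0" by (simp add: N0_iff)
    then show "\<bar>det (matrix (DF x))\<bar> *\<^sub>R ?f (F1 x) = vec (JF x * f (F1 x))"
      using JF_pos[of x] det_DF[of x] by (simp add: vec_eq_iff)
  qed
  have cv: "(\<lambda>x. \<bar>det (matrix (DF x))\<bar> *\<^sub>R ?f (F1 x)) absolutely_integrable_on N0 \<and>
        integral N0 (\<lambda>x. \<bar>det (matrix (DF x))\<bar> *\<^sub>R ?f (F1 x)) = vec b
     \<longleftrightarrow> ?f absolutely_integrable_on N1 \<and> integral N1 ?f = vec b"
    using has_absolute_integral_change_of_variables[OF S d inj_on_F1, of ?f "vec b"] by (simp add: F1_image)
  have vb: "(vec p :: real^1) = vec q \<longleftrightarrow> p = q" for p q :: real by (simp add: vec_eq_iff)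
  show ?thesis
  proof
    assume L: "set_integrable lebesgue N0 (\<lambda>x. JF x * f (F1 x)) \<and> (LINT x:N0|lebesgue. JF x * f (F1 x)) = b"
    then have "set_integrable lebesgue N1 f \<and> integral N1 ?f = vec b"
      using cv unfolding i1 i2 vecm by (simp add: veci)
    then show "set_integrable lebesgue N1 f \<and> (LINT x:N1|lebesgue. f x) = b"
      using veci[of N1 f] by (simp add: vb)
  next
    assume L: "set_integrable lebesgue N1 f \<and> (LINT x:N1|lebesgue. f x) = b"
    then have "set_integrable lebesgue N0 (\<lambda>x. JF x * f (F1 x)) \<and> integral N0 (\<lambda>x. vec (JF x * f (F1 x)) :: real^1) = vec b"
      using cv unfolding i1 i2 vecm by (simp add: veci)
    then show "set_integrable lebesgue N0 (\<lambda>x. JF x * f (F1 x)) \<and> (LINT x:N0|lebesgue. JF x * f (F1 x)) = b"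
      using veci[of N0 "\<lambda>x. JF x * f (F1 x)"] by (simp add: vb)
  qed
qed

definition to_ix :: "real^'n \<Rightarrow> real^('n ix)" where
  "to_ix x = (\<chi> i. x $ Rep_ix i)"

definition of_ix :: "real^('n ix) \<Rightarrow> real^'n" where
  "of_ix y = (\<chi> i. y $ Abs_ix i)"

lemma of_ix_to_ix [simp]: "of_ix (to_ix x) = x"
  by (simp add: of_ix_def to_ix_def Abs_ix_inverse vec_eq_iff)

lemma sum_ix: "(\<Sum>i\<in>(UNIV :: ('n::finite) ix set). f (Rep_ix i)) = (\<Sum>i\<in>UNIV. f i)"
  by (rule sum.reindex_bij_betw) (rule bij_Rep_ix)

lemma prod_ix: "(\<Prod>i\<in>(UNIV :: ('n::finite) ix set). f (Rep_ix i)) = (\<Prod>i\<in>UNIV. f i)"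
  by (rule prod.reindex_bij_betw) (rule bij_Rep_ix)

lemma card_ix: "CARD(('n::finite) ix) = CARD('n)"
  using bij_Rep_ix[where 'a='n] bij_betw_same_card by blast

lemma norm_to_ix [simp]: "norm (to_ix x) = norm x"
  by (simp add: norm_eq_sqrt_inner inner_vec_def to_ix_def sum_ix[of "\<lambda>i. x $ i * x $ i"])

lemma to_ix_scaleR: "to_ix (c *\<^sub>R x) = c *\<^sub>R to_ix x"
  by (simp add: to_ix_def vec_eq_iff)

lemma to_ix_measurable [measurable]: "to_ix \<in> borel_measurable borel"
  unfolding to_ix_def[abs_def]
  by (intro borel_measurable_continuous_onI continuous_on_vec_lambda continuous_intros)

lemma of_ix_measurable [measurable]: "of_ix \<in> borel_measurable borel"
  unfolding of_ix_def[abs_def]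
  by (intro borel_measurable_continuous_onI continuous_on_vec_lambda continuous_intros)

lemma prod_Basis_vec: 
  fixes f :: "real^'n \<Rightarrow> real"
  shows "(\<Prod>b\<in>Basis. f b) = (\<Prod>i\<in>UNIV. f (axis i 1))"
proof -
  have "(Basis :: (real^'n) set) = range (\<lambda>i. axis i 1)" by (auto simp: Basis_vec_def)
  note B = this
  show ?thesis unfolding B by (subst prod.reindex) (auto simp: inj_def axis_eq_axis)
qed

text \<open>Relabelling coordinates maps boxes to boxes with the same side lengths, and boxes
  determine Lebesgue measure.\<close>

lemma distr_to_ix: "distr lborel borel (to_ix :: real^'n \<Rightarrow> _) = lborel"
proof (rule lborel_eqI[symmetric])
  fix l u :: "real^('n ix)"
  assume le: "\<And>b. b \<in> Basis \<Longrightarrow> l \<bullet> b \<le> u \<bullet> b"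
  then have le': "l $ i \<le> u $ i" for i using le[of "axis i 1"] by (auto simp: Basis_vec_def inner_axis)
  have v: "to_ix -` box l u = (box (of_ix l) (of_ix u) :: (real^'n) set)"
  proof (intro set_eqI)
    fix x :: "real^'n"
    have "(\<forall>i. l $ i < x $ Rep_ix i \<and> x $ Rep_ix i < u $ i) \<longleftrightarrow>
       (\<forall>i. l $ Abs_ix i < x $ i \<and> x $ i < u $ Abs_ix i)"
      by (metis Abs_ix_inverse Rep_ix_inverse UNIV_I)
    then show "x \<in> to_ix -` box l u \<longleftrightarrow> x \<in> box (of_ix l) (of_ix u)"
      by (simp add: mem_box_cart to_ix_def of_ix_def)
  qed
  have "emeasure (distr lborel borel (to_ix :: real^'n \<Rightarrow> _)) (box l u)
      = emeasure lborel (box (of_ix l) (of_ix u) :: (real^'n) set)"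
    by (simp add: emeasure_distr v)
  also have "\<dots> = (\<Prod>b\<in>Basis. (of_ix u - of_ix l :: real^'n) \<bullet> b)"
    by (rule emeasure_lborel_box) (auto simp: Basis_vec_def inner_axis of_ix_def le')
  also have "(\<Prod>b\<in>Basis. (of_ix u - of_ix l :: real^'n) \<bullet> b) = (\<Prod>b\<in>Basis. (u - l) \<bullet> b)"
    unfolding prod_Basis_vec prod_ix[of "\<lambda>i. (of_ix u - of_ix l) \<bullet> axis i 1", symmetric]
    by (simp add: inner_axis of_ix_def Rep_ix_inverse)
  finally show "emeasure (distr lborel borel (to_ix :: real^'n \<Rightarrow> _)) (box l u) = (\<Prod>b\<in>Basis. (u - l) \<bullet> b)" .
qed simp

lemma integral_to_ix:
  fixes g :: "real^(('n::finite) ix) \<Rightarrow> real"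
  assumes [measurable]: "g \<in> borel_measurable borel"
  shows "integrable lborel (\<lambda>x :: real^'n. g (to_ix x)) \<longleftrightarrow> integrable lborel g"
    and "(\<integral>x. g (to_ix (x :: real^'n)) \<partial>lborel) = (\<integral>y. g y \<partial>lborel)"
proof -
  have "integrable (distr lborel borel (to_ix :: real^'n \<Rightarrow> _)) g \<longleftrightarrow> integrable lborel (\<lambda>x :: real^'n. g (to_ix x))"
    by (rule integrable_distr_eq) measurable
  then show "integrable lborel (\<lambda>x :: real^'n. g (to_ix x)) \<longleftrightarrow> integrable lborel g" by (simp add: distr_to_ix)
  have "integral\<^sup>L (distr lborel borel (to_ix :: real^'n \<Rightarrow> _)) g = (\<integral>x. g (to_ix (x :: real^'n)) \<partial>lborel)"
    by (rule integral_distr) measurable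
  then show "(\<integral>x. g (to_ix (x :: real^'n)) \<partial>lborel) = (\<integral>y. g y \<partial>lborel)" by (simp add: distr_to_ix)
qed

theorem change_of_variables_F1:
  fixes f :: "real^'n \<Rightarrow> real"
  assumes [measurable]: "f \<in> borel_measurable borel"
  shows "integrable lborel (\<lambda>x. indicator N0 x * (JF x * f (F1 x))) \<longleftrightarrow> integrable lborel (\<lambda>y. indicator N1 y * f y)"
    and "(\<integral>x. indicator N0 x * (JF x * f (F1 x)) \<partial>lborel) = (\<integral>y. indicator N1 y * f y \<partial>lborel)"
proof -
  define g where "g y = f (of_ix y)" for y
  have [measurable]: "g \<in> borel_measurable borel" unfolding g_def by measurable
  have F: "of_ix (F1 (to_ix x)) = F1 x" for x :: "real^'n"
    by (metis (no_types, lifting) F1_def norm_to_ix of_ix_to_ix to_ix_scaleR)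
  have N: "to_ix x \<in> N0 \<longleftrightarrow> x \<in> N0" "to_ix x \<in> N1 \<longleftrightarrow> x \<in> N1" for x :: "real^'n"
  proof -
    have "to_ix x = 0 \<longleftrightarrow> x = 0" using norm_eq_zero[of "to_ix x"] norm_eq_zero[of x] by (simp only: norm_to_ix)
    then show "to_ix x \<in> N0 \<longleftrightarrow> x \<in> N0" "to_ix x \<in> N1 \<longleftrightarrow> x \<in> N1" by (simp_all add: N0_iff N1_iff)
  qed
  have l: "indicator N0 x * (JF x * f (F1 x)) = (indicator N0 (to_ix x) * (JF (to_ix x) * g (F1 (to_ix x))) :: real)" for x :: "real^'n"
    by (simp add: g_def F N indicator_def JF_def card_ix)
  have r: "indicator N1 x * f x = (indicator N1 (to_ix x) * g (to_ix x) :: real)" for x :: "real^'n"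
    by (simp add: g_def N indicator_def)
  have t: "set_integrable lebesgue N0 (\<lambda>x. JF x * g (F1 x)) \<longleftrightarrow> integrable lborel (\<lambda>x. indicator N0 x * (JF x * g (F1 x)))"
     "(LINT x:N0|lebesgue. JF x * g (F1 x)) = (\<integral>x. indicator N0 x * (JF x * g (F1 x)) \<partial>lborel)"
     "set_integrable lebesgue N1 g \<longleftrightarrow> integrable lborel (\<lambda>x. indicator N1 x * g x)"
     "(LINT x:N1|lebesgue. g x) = (\<integral>x. indicator N1 x * g x \<partial>lborel)"
    by (rule set_lebesgue_transfer; measurable; simp)+
  note cv = change_of_variables_F1_wellorder[of g, unfolded t]
  show 1: "integrable lborel (\<lambda>x. indicator N0 x * (JF x * f (F1 x))) \<longleftrightarrow> integrable lborel (\<lambda>y. indicator N1 y * f y)"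
    unfolding l r using cv by (subst integral_to_ix(1), measurable)+ blast
  have 2: "(\<integral>x. indicator N0 x * (JF x * f (F1 x)) \<partial>lborel) = (\<integral>x. indicator N0 x * (JF x * g (F1 x)) \<partial>lborel)"
    unfolding l by (rule integral_to_ix(2)) measurable
  have 3: "(\<integral>y. indicator N1 y * f y \<partial>lborel) = (\<integral>x. indicator N1 x * g x \<partial>lborel)"
    unfolding r by (rule integral_to_ix(2)) measurable
  show "(\<integral>x. indicator N0 x * (JF x * f (F1 x)) \<partial>lborel) = (\<integral>y. indicator N1 y * f y \<partial>lborel)"
  proof (cases "integrable lborel (\<lambda>x. indicator N1 x * g x)")
    case True
    then show ?thesis unfolding 2 3 using cv by blast
  next
    \<comment> \<open>Neither integrand is integrable, and both Bochner integrals take the default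
      value 0.\<close>
    case False
    then have "\<not> integrable lborel (\<lambda>x. indicator N0 x * (JF x * g (F1 x)))" using cv by blast
    with False show ?thesis unfolding 2 3 by (simp add: not_integrable_integral_eq)
  qed
qed

text \<open>The real-valued substitution rule for indicators of Borel sets, integrable because
  \<open>N1\<close> is bounded, identifies two measures; nonnegative functions then follow without
  integrability conditions.\<close>

theorem nn_change_of_variables_F1:
  fixes w :: "real^'n \<Rightarrow> ennreal"
  assumes [measurable]: "w \<in> borel_measurable borel"
  shows "(\<integral>\<^sup>+x. indicator N0 x * (ennreal (JF x) * w (F1 x)) \<partial>lborel) = (\<integral>\<^sup>+y. indicator N1 y * w y \<partial>lborel)"
proof -
  let ?M = "distr (density lborel (\<lambda>x :: real^'n. indicator N0 x * ennreal (JF x))) borel F1"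
  let ?M' = "density lborel (indicator (N1 :: (real^'n) set) :: _ \<Rightarrow> ennreal)"
  have "?M = ?M'"
  proof (rule measure_eqI)
    fix B assume "B \<in> sets ?M"
    then have [measurable]: "B \<in> sets borel" by simp
    have i1: "integrable lborel (\<lambda>y :: real^'n. indicator N1 y * indicator B y :: real)"
      by (rule integrable_bounded_compact[of _ "cball 0 2" 1]) (auto simp: indicator_def N1_iff)
    have i0: "integrable lborel (\<lambda>x :: real^'n. indicator N0 x * (JF x * indicator B (F1 x)) :: real)"
      using i1 change_of_variables_F1(1)[of "indicator B"] by simp
    have "emeasure ?M B = (\<integral>\<^sup>+x. indicator N0 x * ennreal (JF x) * indicator B (F1 x) \<partial>lborel)"
      by (subst emeasure_distr, measurable, subst emeasure_density, measurable)
         (auto intro!: nn_integral_cong simp: indicator_def)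
    also have "\<dots> = (\<integral>\<^sup>+x. ennreal (indicator N0 x * (JF x * indicator B (F1 x))) \<partial>lborel)"
      by (intro nn_integral_cong) (auto simp: indicator_def)
    also have "\<dots> = ennreal (\<integral>x. indicator N0 x * (JF x * indicator B (F1 x)) \<partial>lborel)"
      using i0 JF_pos by (intro nn_integral_eq_integral) (auto simp: indicator_def N0_iff intro!: AE_I2 less_imp_le)
    also have "\<dots> = ennreal (\<integral>y. indicator N1 y * indicator B y \<partial>(lborel :: (real^'n) measure))"
      using change_of_variables_F1(2)[of "indicator B :: real^'n \<Rightarrow> real"] by simp
    also have "\<dots> = (\<integral>\<^sup>+y. ennreal (indicator N1 y * indicator B y) \<partial>(lborel :: (real^'n) measure))"
      using i1 by (intro nn_integral_eq_integral[symmetric]) auto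
    also have "\<dots> = emeasure ?M' B"
      by (subst emeasure_density, measurable) (auto intro!: nn_integral_cong simp: indicator_def)
    finally show "emeasure ?M B = emeasure ?M' B" .
  qed simp
  then have "(\<integral>\<^sup>+y. w y \<partial>?M) = (\<integral>\<^sup>+y. w y \<partial>?M')" by simp
  then show ?thesis by (simp add: nn_integral_distr nn_integral_density mult.assoc)
qed

subsection \<open>The transformed conductivity\<close>

text \<open>The action of \<open>sigma_tilde\<close> on \<open>N1\<close> written through the
  derivative of \<open>F1\<close>: the metric is the square of \<open>DFi y\<close>, so its inverse
  is the square of \<open>DF (Fi y)\<close> and the root of its determinant is
  \<open>JFi y\<close>.\<close>

definition Sv :: "real^'n \<Rightarrow> real^'n \<Rightarrow> real^'n" where
  "Sv y v = JFi y *\<^sub>R DF (Fi y) (DF (Fi y) v)"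

lemma Sv_measurable [measurable]:
  assumes [measurable]: "v \<in> borel_measurable borel"
  shows "(\<lambda>y. Sv y (v y)) \<in> borel_measurable borel"
  unfolding Sv_def by measurable

lemma linear_DF: "linear (DF x)" and linear_DFi: "linear (DFi x)"
  by (simp_all add: DF_def DFi_def linear_lin)

lemma inner_DF: "DF x v \<bullet> w = v \<bullet> DF x w" and inner_DFi: "DFi x v \<bullet> w = v \<bullet> DFi x w"
  by (simp_all add: DF_def DFi_def inner_lin)

lemma transpose_matrix_self_adjoint:
  fixes f :: "real^'n \<Rightarrow> real^'n"
  assumes "\<And>v w. f v \<bullet> w = v \<bullet> f w"
  shows "transpose (matrix f) = matrix f"
proof -
  have "f (axis i 1) $ j = f (axis j 1) $ i" for i j
  proof -
    have "f (axis i 1) $ j = f (axis i 1) \<bullet> axis j 1" by (simp add: inner_axis)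
    also have "\<dots> = f (axis j 1) \<bullet> axis i 1" by (subst assms) (rule inner_commute)
    finally show ?thesis by (simp add: inner_axis)
  qed
  then show ?thesis by (simp add: transpose_def matrix_def vec_eq_iff)
qed

text \<open>The Jacobian matrix of the inverse map is symmetric, so the pushed-forward Euclidean
  metric is its square, and determinant and inverse can be read off.\<close>

lemma sigma_tilde_N1:
  fixes y :: "real^'n"
  assumes y: "y \<in> N1"
  shows "sigma_tilde a y *v v = Sv y v"
proof -
  have n: "1 < norm y" "y \<noteq> 0" using y by (auto simp: N1_iff)
  \<comment> \<open>This inverse agrees with \<open>Fi\<close> on the open set \<open>N1\<close>,
    hence has the same derivative there.\<close>
  let ?inv = "the_inv_into (ball 0 2 - {0}) F1 :: real^'n \<Rightarrow> real^'n"
  have inv: "?inv z = Fi z" if "z \<in> N1" for z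
    using that Fi_in_N0[OF that] F1_Fi[of z]
    by (intro the_inv_into_f_eq[OF inj_on_F1[unfolded N0_def]]) (auto simp: N1_iff N0_def)
  have "(?inv has_derivative DFi y) (at y)"
    by (rule has_derivative_transform_within_open[OF Fi_has_derivative[OF n(2)] open_N1 y]) (simp add: inv)
  then have "frechet_derivative ?inv (at y) = DFi y" by (rule frechet_derivative_at[symmetric])
  then have jac: "jacobian ?inv (at y) = matrix (DFi y)" by (simp add: jacobian_def)
  let ?M = "matrix (DFi y)" and ?W = "matrix (DF (Fi y))"
  have g: "gtilde y = ?M ** ?M"
    by (simp add: gtilde_def push_forward_def jac g0_def transpose_matrix_self_adjoint inner_DFi)
  have "det (gtilde y) = (JFi y)\<^sup>2"
    by (simp add: g det_mul det_DFi[OF n(2)] power2_eq_square)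
  then have sq: "sqrt (det (gtilde y)) = JFi y" using JFi_pos[OF n(1)] by simp
  have "DFi y \<circ> DF (Fi y) = id" using DFi_DF_Fi[OF n(1)] by (auto simp: fun_eq_iff)
  then have MW: "?M ** ?W = mat 1"
    by (metis matrix_compose[OF linear_DF linear_DFi] matrix_id_mat_1)
  have G: "gtilde y ** (?W ** ?W) = mat 1"
    by (simp add: g matrix_mul_assoc[symmetric]) (simp add: matrix_mul_assoc MW)
  then have inv_g: "invertible (gtilde y)"
    by (meson invertible_right_inverse)
  have "matrix_inv (gtilde y) = matrix_inv (gtilde y) ** (gtilde y ** (?W ** ?W))" by (simp add: G)
  also have "\<dots> = ?W ** ?W"
  proof -
    have "matrix_inv (gtilde y) ** gtilde y = mat 1"
      using someI_ex[OF inv_g[unfolded invertible_def]] by (simp add: matrix_inv_def)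
    then show ?thesis by (simp add: matrix_mul_assoc)
  qed
  finally have "sigma_tilde a y = JFi y *\<^sub>R (?W ** ?W)"
    using y by (simp add: sigma_tilde_def sq)
  moreover have "?W *v w = DF (Fi y) w" for w
    by (rule fun_cong[OF matrix_vector_mul(2)[OF linear_DF]])
  ultimately show ?thesis
    by (simp add: Sv_def scaleR_matrix_vector_assoc[symmetric] matrix_vector_mul_assoc[symmetric])
qed

lemma norm_DF_le:
  assumes "x \<noteq> 0" "norm x < 2" shows "norm (DF x h) \<le> 3 / norm x * norm h"
proof -
  have "norm (DF x h) \<le> (\<bar>1/2 + 1 / norm x\<bar> + \<bar>1 / norm x ^ 3\<bar> * (norm x)\<^sup>2) * norm h"
    unfolding DF_def by (rule norm_lin_le)
  also have "\<dots> \<le> 3 / norm x * norm h"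
    using assms by (intro mult_right_mono) (simp_all add: abs_of_nonneg power2_eq_square power3_eq_cube divide_simps)
  finally show ?thesis .
qed

lemma norm_DFi_le:
  assumes "1 < norm y" shows "norm (DFi y h) \<le> 4 * norm h"
proof -
  have "norm (DFi y h) \<le> (\<bar>2 - 2 / norm y\<bar> + \<bar>- 2 / norm y ^ 3\<bar> * (norm y)\<^sup>2) * norm h"
    unfolding DFi_def by (rule norm_lin_le)
  also have "\<dots> \<le> 4 * norm h"
  proof (rule mult_right_mono)
    have "\<bar>- 2 / norm y ^ 3\<bar> * (norm y)\<^sup>2 = 2 / norm y"
      using assms by (simp add: power2_eq_square power3_eq_cube divide_simps abs_mult)
    moreover have "0 < 2 / norm y" "2 / norm y \<le> 2" using assms by (auto simp: divide_simps)
    ultimately show "\<bar>2 - 2 / norm y\<bar> + \<bar>- 2 / norm y ^ 3\<bar> * (norm y)\<^sup>2 \<le> 4" by linarith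
  qed simp
  finally show ?thesis .
qed

text \<open>With s = norm (Fi y), two applications of \<open>DF\<close> cost at most 9/s^2, while
  \<open>JFi y\<close> is 2 (s/|y|)^(n-1), at most 2 s^2 because n - 1 >= 2 and s <= |y|. The
  product of the constants is 18.\<close>

lemma norm_Sv_le:
  fixes y :: "real^'n"
  assumes dim: "CARD('n) \<ge> 3" and y: "y \<in> N1"
  shows "norm (Sv y v) \<le> 18 * norm v"
proof -
  define s where "s = norm (Fi y)"
  have n: "1 < norm y" "norm y < 2" using y by (auto simp: N1_iff)
  have s: "s = 2 * (norm y - 1)" "0 < s" "s < 2" using n by (auto simp: s_def norm_Fi)
  then have Fi0: "Fi y \<noteq> 0" by (auto simp: s_def)
  have D: "norm (DF (Fi y) h) \<le> 3 / s * norm h" for h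
    using norm_DF_le[OF Fi0, of h] s by (simp add: s_def)
  have "0 < norm y" using n by linarith
  then have e: "2 - 2 / norm y = s / norm y" by (simp add: s divide_simps)
  have "(s / norm y) ^ (CARD('n) - 1) \<le> (s / norm y)\<^sup>2"
    using s n dim by (intro power_decreasing) (auto simp: divide_simps)
  also have "\<dots> \<le> s\<^sup>2"
    using s n by (intro power_mono) (auto simp: divide_simps)
  finally have J: "JFi y \<le> 2 * s\<^sup>2" by (simp add: JFi_def e)
  have "norm (Sv y v) = JFi y * norm (DF (Fi y) (DF (Fi y) v))"
    using JFi_pos[OF n(1)] by (simp add: Sv_def)
  also have "\<dots> \<le> (2 * s\<^sup>2) * (3 / s * (3 / s * norm v))"
    using s by (intro mult_mono J order_trans[OF D] mult_left_mono D) auto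
  also have "\<dots> = 18 * norm v" using s by (simp add: power2_eq_square)
  finally show ?thesis .
qed

text \<open>Substituting y = F1 x cancels the two Jacobians, and self-adjointness of
  \<open>DF\<close> moves one of its two copies to the other argument.\<close>

lemma energy_identity:
  fixes U V :: "real^'n \<Rightarrow> real^'n"
  assumes [measurable]: "U \<in> borel_measurable borel" "V \<in> borel_measurable borel"
  shows "integrable lborel (\<lambda>x. indicator N0 x * (DF x (U (F1 x)) \<bullet> DF x (V (F1 x))))
      \<longleftrightarrow> integrable lborel (\<lambda>y. indicator N1 y * (Sv y (U y) \<bullet> V y))"
    and "(\<integral>x. indicator N0 x * (DF x (U (F1 x)) \<bullet> DF x (V (F1 x))) \<partial>lborel)
      = (\<integral>y. indicator N1 y * (Sv y (U y) \<bullet> V y) \<partial>lborel)"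
proof -
  have [measurable]: "(\<lambda>y. Sv y (U y) \<bullet> V y) \<in> borel_measurable borel" by measurable
  have eq: "indicator N0 x * (JF x * (Sv (F1 x) (U (F1 x)) \<bullet> V (F1 x)))
     = indicator N0 x * (DF x (U (F1 x)) \<bullet> DF x (V (F1 x)))" for x :: "real^'n"
  proof (cases "x \<in> N0")
    case True
    then have x: "x \<noteq> 0" by (simp add: N0_iff)
    have "JF x * (Sv (F1 x) (U (F1 x)) \<bullet> V (F1 x))
        = (JFi (F1 x) * JF x) * (DF x (DF x (U (F1 x))) \<bullet> V (F1 x))"
      by (simp add: Sv_def Fi_F1[OF x])
    also have "\<dots> = DF x (U (F1 x)) \<bullet> DF x (V (F1 x))" by (simp add: JFi_F1[OF x] inner_DF)
    finally show ?thesis by simp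
  qed simp
  show "integrable lborel (\<lambda>x. indicator N0 x * (DF x (U (F1 x)) \<bullet> DF x (V (F1 x))))
      \<longleftrightarrow> integrable lborel (\<lambda>y. indicator N1 y * (Sv y (U y) \<bullet> V y))"
    using change_of_variables_F1(1)[of "\<lambda>y. Sv y (U y) \<bullet> V y"] by (simp only: eq) simp
  show "(\<integral>x. indicator N0 x * (DF x (U (F1 x)) \<bullet> DF x (V (F1 x))) \<partial>lborel)
      = (\<integral>y. indicator N1 y * (Sv y (U y) \<bullet> V y) \<partial>lborel)"
    using change_of_variables_F1(2)[of "\<lambda>y. Sv y (U y) \<bullet> V y"] by (simp only: eq) simp
qed

subsection \<open>Composition with a diffeomorphism\<close>

text \<open>Boundedness of composition with \<open>P\<close>, stated for all nonnegative Borel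
  weights so that square integrability and L2 limits transfer alike. The set \<open>K\<close> allows
  maps whose bound degenerates elsewhere.\<close>

definition comp_bound :: "(real^'n) set \<Rightarrow> (real^'n \<Rightarrow> real^'n) \<Rightarrow> real \<Rightarrow> bool" where
  "comp_bound K P C \<longleftrightarrow> K \<in> sets borel \<and> P \<in> borel_measurable borel \<and> (\<forall>w\<in>borel_measurable borel.
     (\<integral>\<^sup>+x. indicator K x * w (P x) \<partial>lborel) \<le> ennreal C * (\<integral>\<^sup>+y. indicator (ball 0 2) y * w y \<partial>lborel))"

lemma comp_boundD:
  "comp_bound K P C \<Longrightarrow> w \<in> borel_measurable borel \<Longrightarrow>
     (\<integral>\<^sup>+x. indicator K x * w (P x) \<partial>lborel) \<le> ennreal C * (\<integral>\<^sup>+y. indicator (ball 0 2) y * w y \<partial>lborel)"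
  by (simp only: comp_bound_def)

text \<open>The Jacobian of \<open>F1\<close> is bounded below on the whole punctured ball, so
  \<open>K\<close> may reach the origin.\<close>

lemma comp_bound_F1:
  fixes K :: "(real^'n) set"
  assumes [measurable]: "K \<in> sets borel" and K: "K \<subseteq> N0"
  shows "comp_bound K F1 (2 * 2 ^ (CARD('n) - 1))"
  unfolding comp_bound_def
proof (intro conjI ballI)
  fix w :: "real^'n \<Rightarrow> ennreal" assume [measurable]: "w \<in> borel_measurable borel"
  let ?C = "2 * 2 ^ (CARD('n) - 1) :: real"
  have C: "1 \<le> ?C * JF x" if "x \<noteq> 0" for x :: "real^'n"
  proof -
    have "?C * ((1/2) ^ (CARD('n) - 1) / 2) \<le> ?C * JF x" using JF_ge[OF that] by (intro mult_left_mono) auto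
    then show ?thesis by (simp add: power_divide)
  qed
  have "(\<integral>\<^sup>+x. indicator K x * w (F1 x) \<partial>lborel)
      \<le> (\<integral>\<^sup>+x. ennreal ?C * (indicator N0 x * (ennreal (JF x) * w (F1 x))) \<partial>lborel)"
  proof (rule nn_integral_mono)
    fix x :: "real^'n"
    show "indicator K x * w (F1 x) \<le> ennreal ?C * (indicator N0 x * (ennreal (JF x) * w (F1 x)))"
    proof (cases "x \<in> K")
      case True
      then have x: "x \<in> N0" "x \<noteq> 0" using K by (auto simp: N0_iff)
      have "1 * w (F1 x) \<le> ennreal (?C * JF x) * w (F1 x)"
        using C[OF x(2)] ennreal_leI[of 1] by (intro mult_right_mono) auto
      also have "ennreal (?C * JF x) = ennreal ?C * ennreal (JF x)" by (rule ennreal_mult') simp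
      finally show ?thesis using True x by (simp add: mult.assoc)
    qed simp
  qed
  also have "\<dots> = ennreal ?C * (\<integral>\<^sup>+y. indicator N1 y * w y \<partial>lborel)"
    by (simp add: nn_integral_cmult nn_change_of_variables_F1)
  also have "\<dots> \<le> ennreal ?C * (\<integral>\<^sup>+y. indicator (ball 0 2) y * w y \<partial>lborel)"
    by (intro mult_left_mono nn_integral_mono) (auto simp: indicator_def N1_iff)
  finally show "(\<integral>\<^sup>+x. indicator K x * w (F1 x) \<partial>lborel)
    \<le> ennreal ?C * (\<integral>\<^sup>+y. indicator (ball 0 2) y * w y \<partial>lborel)" .
qed measurable

text \<open>The Jacobian of \<open>F1\<close> is unbounded at the origin, so \<open>K\<close> must
  keep distance d from the unit sphere; its preimage then stays outside radius 2 d.\<close>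

lemma comp_bound_Fi:
  fixes K :: "(real^'n) set"
  assumes [measurable]: "K \<in> sets borel" and K: "K \<subseteq> N1" and d: "0 < d" "\<And>y. y \<in> K \<Longrightarrow> 1 + d \<le> norm y"
  shows "comp_bound K Fi ((1/2 + 1 / (2 * d)) ^ (CARD('n) - 1) / 2)"
  unfolding comp_bound_def
proof (intro conjI ballI)
  fix w :: "real^'n \<Rightarrow> ennreal" assume [measurable]: "w \<in> borel_measurable borel"
  let ?C = "(1/2 + 1 / (2 * d)) ^ (CARD('n) - 1) / 2"
  have "(\<integral>\<^sup>+y. indicator K y * w (Fi y) \<partial>lborel) = (\<integral>\<^sup>+y. indicator N1 y * (indicator K y * w (Fi y)) \<partial>lborel)"
    using K by (intro nn_integral_cong) (auto simp: indicator_def)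
  also have "\<dots> = (\<integral>\<^sup>+x. indicator N0 x * (ennreal (JF x) * (indicator K (F1 x) * w (Fi (F1 x)))) \<partial>lborel)"
    by (rule nn_change_of_variables_F1[symmetric]) measurable
  also have "\<dots> \<le> (\<integral>\<^sup>+x. ennreal ?C * (indicator (ball 0 2) x * w x) \<partial>lborel)"
  proof (rule nn_integral_mono)
    fix x :: "real^'n"
    show "indicator N0 x * (ennreal (JF x) * (indicator K (F1 x) * w (Fi (F1 x)))) \<le> ennreal ?C * (indicator (ball 0 2) x * w x)"
    proof (cases "x \<in> N0 \<and> F1 x \<in> K")
      case True
      then have x: "x \<noteq> 0" "norm x < 2" by (auto simp: N0_iff)
      have "1 + d \<le> norm x / 2 + 1" using True d(2)[of "F1 x"] norm_F1[OF x(1)] by simp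
      then have "1 / norm x \<le> 1 / (2 * d)" using d(1) x by (intro divide_left_mono) auto
      then have "JF x \<le> ?C" unfolding JF_def by (intro divide_right_mono power_mono) auto
      then have "ennreal (JF x) * w x \<le> ennreal ?C * w x" by (intro mult_right_mono ennreal_leI) auto
      then show ?thesis using True x by (simp add: Fi_F1)
    qed (auto simp: indicator_def)
  qed
  also have "\<dots> = ennreal ?C * (\<integral>\<^sup>+x. indicator (ball 0 2) x * w x \<partial>lborel)"
    by (rule nn_integral_cmult) measurable
  finally show "(\<integral>\<^sup>+y. indicator K y * w (Fi y) \<partial>lborel) \<le> ennreal ?C * (\<integral>\<^sup>+y. indicator (ball 0 2) y * w y \<partial>lborel)" .
qed measurable

lemma comp_bound_sqint:
  fixes f :: "real^'n \<Rightarrow> real"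
  assumes cb: "comp_bound K P C" and f: "sqint f"
  shows "sqint (\<lambda>x. indicator K x * f (P x))"
proof -
  have [measurable]: "K \<in> sets borel" "P \<in> borel_measurable borel" "f \<in> borel_measurable borel"
    using cb f by (auto simp: comp_bound_def sqint_def)
  have "(\<integral>\<^sup>+x. ennreal ((indicator K x * f (P x))\<^sup>2) \<partial>lborel) = (\<integral>\<^sup>+x. indicator K x * ennreal ((f (P x))\<^sup>2) \<partial>lborel)"
    by (intro nn_integral_cong) (auto simp: indicator_def)
  also have "\<dots> \<le> ennreal C * (\<integral>\<^sup>+y. indicator (ball 0 2) y * ennreal ((f y)\<^sup>2) \<partial>lborel)"
    by (rule comp_boundD[OF cb, of "\<lambda>y. ennreal ((f y)\<^sup>2)"]) measurable
  also have "\<dots> \<le> ennreal C * (\<integral>\<^sup>+y. ennreal ((f y)\<^sup>2) \<partial>lborel)"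
    by (intro mult_left_mono nn_integral_mono) (auto simp: indicator_def)
  also have "\<dots> < \<infinity>" using f by (simp add: sqint_iff ennreal_mult_less_top)
  finally show ?thesis by (subst sqint_iff) auto
qed

lemma comp_bound_L2lim:
  fixes f :: "real^'n \<Rightarrow> real"
  assumes cb: "comp_bound K P C" and lim: "L2lim (ball 0 2) fs f"
  shows "L2lim K (\<lambda>k x. fs k (P x)) (\<lambda>x. f (P x))"
proof (rule L2lim_squeeze)
  have [measurable]: "K \<in> sets borel" "P \<in> borel_measurable borel" "f \<in> borel_measurable borel"
     "\<And>k. fs k \<in> borel_measurable borel"
    using cb lim by (auto simp: comp_bound_def L2lim_def)
  show "(\<lambda>x. fs k (P x)) \<in> borel_measurable borel" "(\<lambda>x. f (P x)) \<in> borel_measurable borel" for k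
    by measurable
  show "(\<lambda>k. ennreal C * (\<integral>\<^sup>+y. ennreal ((fs k y - f y)\<^sup>2) * indicator (ball 0 2) y \<partial>lborel)) \<longlonglongrightarrow> 0"
    using lim by (intro ennreal_tendsto_0_cmult) (auto simp: L2lim_def)
  show "(\<integral>\<^sup>+x. ennreal ((fs k (P x) - f (P x))\<^sup>2) * indicator K x \<partial>lborel)
     \<le> ennreal C * (\<integral>\<^sup>+y. ennreal ((fs k y - f y)\<^sup>2) * indicator (ball 0 2) y \<partial>lborel)" for k
  proof -
    have "(\<lambda>y. ennreal ((fs k y - f y)\<^sup>2)) \<in> borel_measurable borel" by measurable
    from comp_boundD[OF cb this] show ?thesis by (simp only: mult.commute)
  qed
qed

text \<open>True for smooth functions by the classical chain rule and integration by parts.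
  Approximating \<open>u\<close> together with its gradient, the pairings on both sides converge
  because \<open>comp_bound\<close> carries L2 limits through \<open>P\<close>.\<close>

lemma weak_chain_rule:
  fixes u :: "real^'n \<Rightarrow> real" and P :: "real^'n \<Rightarrow> real^'n"
  assumes wp: "weak_pair (ball 0 2) u G" and u: "integrable lborel u"
    and A: "open A" and PA: "P ` A \<subseteq> ball 0 2"
    and P: "\<And>x. x \<in> A \<Longrightarrow> (P has_derivative P' x) (at x)" and sP: "\<And>j. smooth_on A (\<lambda>x. P x $ j)"
    and K: "compact K" "K \<subseteq> A" and cb: "comp_bound K P C"
    and \<phi>: "smooth_on UNIV \<phi>" "\<And>x. x \<notin> K \<Longrightarrow> \<phi> x = 0"
  shows "(\<integral>x. u (P x) * partial_deriv \<phi> i x \<partial>lborel)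
     = - (\<integral>x. indicator K x * ((G (P x) \<bullet> P' x (axis i 1)) * \<phi> x) \<partial>lborel)"
proof -
  have t\<phi>: "test_fun A \<phi>" by (rule test_funI[OF \<phi>(1) K \<phi>(2)])
  have [measurable]: "K \<in> sets borel" "P \<in> borel_measurable borel"
    using cb by (auto simp: comp_bound_def)
  have d\<phi>0: "partial_deriv \<phi> i x = 0" if "x \<notin> K" for x
    by (rule partial_deriv_zero_open[of "- K"]) (use K that \<phi> compact_imp_closed in auto)
  \<comment> \<open>The derivative of \<open>P\<close> is absorbed into the test function, so that
    only derivatives of the approximants, composed with \<open>P\<close>, have to converge.\<close>
  define q where "q j x = (if x \<in> A then partial_deriv (\<lambda>x. P x $ j) i x * \<phi> x else 0)" for j x
  have tq: "test_fun A (q j)" for j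
    unfolding q_def
    by (rule test_fun_extend[OF A _ K])
       (use \<phi> A in \<open>auto intro!: smooth_on_mult smooth_on_partial_deriv sP intro: smooth_on_subset\<close>)
  have q0: "q j x = 0" if "x \<notin> K" for j x using that \<phi>(2) by (simp add: q_def)
  have pd: "partial_deriv (\<lambda>x. P x $ j) i x = P' x (axis i 1) $ j" if "x \<in> A" for x j
    by (rule partial_deriv_eq) (rule bounded_linear.has_derivative[OF bounded_linear_vec_nth P[OF that]])
  have eqG: "(\<Sum>j\<in>UNIV. g $ j * q j x) = indicator K x * ((g \<bullet> P' x (axis i 1)) * \<phi> x)" for g x
    using K(2) q0 by (auto simp: indicator_def q_def pd inner_vec_def sum_distrib_right mult.assoc subset_iff)
  obtain us where us: "\<And>k. smooth_on UNIV (us k)" "L2lim UNIV us u"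
     "\<And>j. L2lim (ball 0 2) (\<lambda>k. partial_deriv (us k) j) (\<lambda>x. G x $ j)"
    using weak_pair_density[OF wp u] by blast
  have Kb: "P ` K \<subseteq> ball 0 2" using PA K by auto
  have int_c: "integrable lborel (\<lambda>x. c (P x) * p x)"
    if cc: "continuous_on UNIV c" and pp: "test_fun A p" and pz: "\<And>x. x \<notin> K \<Longrightarrow> p x = 0"
    for c p :: "real^'n \<Rightarrow> real"
  proof -
    have [measurable]: "c \<in> borel_measurable borel" "p \<in> borel_measurable borel"
      using cc pp by (auto intro: borel_measurable_continuous_UNIV test_fun_measurable)
    have "bounded (c ` cball 0 2)"
      by (intro compact_imp_bounded compact_continuous_image continuous_on_subset[OF cc]) auto
    then obtain Bc where Bc: "\<And>y. y \<in> cball 0 2 \<Longrightarrow> \<bar>c y\<bar> \<le> Bc"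
      by (metis bounded_iff imageI real_norm_def)
    obtain Bp where Bp: "\<And>x. \<bar>p x\<bar> \<le> Bp" using test_fun_bounded[OF pp] by blast
    show ?thesis
    proof (rule integrable_bounded_compact[OF _ K(1)])
      show "\<bar>c (P x) * p x\<bar> \<le> \<bar>Bc\<bar> * \<bar>Bp\<bar>" for x
      proof (cases "x \<in> K")
        case True
        then have "P x \<in> cball 0 2" using Kb by auto
        then have "\<bar>c (P x)\<bar> \<le> \<bar>Bc\<bar>" using Bc by fastforce
        moreover have "\<bar>p x\<bar> \<le> \<bar>Bp\<bar>" using Bp[of x] by linarith
        ultimately show ?thesis unfolding abs_mult by (intro mult_mono) auto
      qed (simp add: pz)
    qed (use pz in \<open>measurable, auto\<close>)
  qed
  have smooth_case: "(\<integral>x. us k (P x) * partial_deriv \<phi> i x \<partial>lborel)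
     = - (\<Sum>j\<in>UNIV. \<integral>x. partial_deriv (us k) j (P x) * q j x \<partial>lborel)" for k
  proof -
    let ?\<psi> = "\<lambda>x. if x \<in> A then us k (P x) * \<phi> x else 0"
    have suP: "smooth_on A (\<lambda>x. us k (P x))"
      by (rule smooth_on_compose[OF A subset_UNIV sP us(1)])
    have t: "test_fun A ?\<psi>"
      by (rule test_fun_extend[OF A _ K])
         (use \<phi> A suP in \<open>auto intro!: smooth_on_mult intro: smooth_on_subset\<close>)
    have "(\<integral>x. partial_deriv ?\<psi> i x \<partial>lborel) = 0"
      using integral_partial_deriv_zero[OF test_fun_mono[OF t subset_UNIV]] .
    moreover have "partial_deriv ?\<psi> i x
       = us k (P x) * partial_deriv \<phi> i x + (\<Sum>j\<in>UNIV. partial_deriv (us k) j (P x) * q j x)" for x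
    proof (cases "x \<in> A")
      case True
      have dif: "(\<lambda>x. us k (P x)) differentiable (at x)" "\<phi> differentiable (at x)"
        using suP \<phi>(1) True smooth_on_differentiable by blast+
      have "partial_deriv ?\<psi> i x = partial_deriv (\<lambda>x. us k (P x) * \<phi> x) i x"
        by (rule partial_deriv_cong_open[OF A True]) (use dif in auto)
      also have "\<dots> = us k (P x) * partial_deriv \<phi> i x + partial_deriv (\<lambda>x. us k (P x)) i x * \<phi> x"
        by (rule partial_deriv_mult[OF dif])
      also have "partial_deriv (\<lambda>x. us k (P x)) i x
          = (\<Sum>j\<in>UNIV. partial_deriv (us k) j (P x) * partial_deriv (\<lambda>x. P x $ j) i x)"
        by (rule partial_deriv_compose) (use sP us(1) True smooth_on_differentiable in blast)+
      finally show ?thesis using True by (simp add: q_def sum_distrib_right mult.assoc)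
    next
      case False
      then have "x \<in> - K" using K by auto
      then have "partial_deriv ?\<psi> i x = 0"
        by (rule partial_deriv_zero_open[rotated]) (use K \<phi> compact_imp_closed in auto)
      then show ?thesis using False \<open>x \<in> - K\<close> d\<phi>0[of x] q0[of x] by simp
    qed
    moreover have "integrable lborel (\<lambda>x. us k (P x) * partial_deriv \<phi> i x)"
      by (rule int_c[OF smooth_on_continuous[OF us(1)] test_fun_partial_deriv[OF t\<phi>] d\<phi>0])
    moreover have "integrable lborel (\<lambda>x. partial_deriv (us k) j (P x) * q j x)" for j
      by (rule int_c[OF smooth_on_continuous[OF smooth_on_partial_deriv[OF us(1)]] tq q0])
    ultimately show ?thesis by (simp add: Bochner_Integration.integral_sum add_eq_0_iff2)
  qed
  have loc: "integrable lborel (\<lambda>x. f (P x) * p x)"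
    if "sqint f" "test_fun A p" "\<And>x. x \<notin> K \<Longrightarrow> p x = 0" for f p :: "real^'n \<Rightarrow> real"
  proof -
    have "integrable lborel (\<lambda>x. (indicator K x * f (P x)) * p x)"
      by (rule sqint_mult_integrable[OF comp_bound_sqint[OF cb that(1)] test_fun_sqint[OF that(2)]])
    moreover have "(indicator K x * f (P x)) * p x = f (P x) * p x" for x
      using that(3) by (cases "x \<in> K") auto
    ultimately show ?thesis by simp
  qed
  have lim1: "(\<lambda>k. \<integral>x. us k (P x) * partial_deriv \<phi> i x \<partial>lborel) \<longlonglongrightarrow> (\<integral>x. u (P x) * partial_deriv \<phi> i x \<partial>lborel)"
  proof (rule L2lim_integral[of K "\<lambda>k x. us k (P x)" "\<lambda>x. u (P x)" "partial_deriv \<phi> i"])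
    show "L2lim K (\<lambda>k x. us k (P x)) (\<lambda>x. u (P x))"
      by (rule comp_bound_L2lim[OF cb L2lim_subset[OF us(2) subset_UNIV]])
    show "sqint (partial_deriv \<phi> i)" by (rule test_fun_sqint[OF test_fun_partial_deriv[OF t\<phi>]])
    show "integrable lborel (\<lambda>x. us k (P x) * partial_deriv \<phi> i x)" for k
      by (rule int_c[OF smooth_on_continuous[OF us(1)] test_fun_partial_deriv[OF t\<phi>] d\<phi>0])
    show "integrable lborel (\<lambda>x. u (P x) * partial_deriv \<phi> i x)"
      by (rule loc[OF weak_pairD(1)[OF wp] test_fun_partial_deriv[OF t\<phi>] d\<phi>0])
  qed (simp_all add: d\<phi>0)
  have lim2: "(\<lambda>k. \<integral>x. partial_deriv (us k) j (P x) * q j x \<partial>lborel) \<longlonglongrightarrow> (\<integral>x. G (P x) $ j * q j x \<partial>lborel)" for j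
  proof (rule L2lim_integral[of K "\<lambda>k x. partial_deriv (us k) j (P x)" "\<lambda>x. G (P x) $ j" "q j"])
    show "L2lim K (\<lambda>k x. partial_deriv (us k) j (P x)) (\<lambda>x. G (P x) $ j)"
      by (rule comp_bound_L2lim[OF cb us(3)])
    show "sqint (q j)" by (rule test_fun_sqint[OF tq])
    show "integrable lborel (\<lambda>x. partial_deriv (us k) j (P x) * q j x)" for k
      by (rule int_c[OF smooth_on_continuous[OF smooth_on_partial_deriv[OF us(1)]] tq q0])
    show "integrable lborel (\<lambda>x. G (P x) $ j * q j x)"
      by (rule loc[OF weak_pairD(2)[OF wp] tq q0])
  qed (simp_all add: q0)
  have "(\<lambda>k. - (\<Sum>j\<in>UNIV. \<integral>x. partial_deriv (us k) j (P x) * q j x \<partial>lborel))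
     \<longlonglongrightarrow> - (\<Sum>j\<in>UNIV. \<integral>x. G (P x) $ j * q j x \<partial>lborel)"
    by (intro tendsto_intros lim2)
  from LIMSEQ_unique[OF lim1[unfolded smooth_case] this]
  have "(\<integral>x. u (P x) * partial_deriv \<phi> i x \<partial>lborel) = - (\<Sum>j\<in>UNIV. \<integral>x. G (P x) $ j * q j x \<partial>lborel)" .
  also have "(\<Sum>j\<in>UNIV. \<integral>x. G (P x) $ j * q j x \<partial>lborel) = (\<integral>x. (\<Sum>j\<in>UNIV. G (P x) $ j * q j x) \<partial>lborel)"
    using loc[OF weak_pairD(2)[OF wp] tq q0] by (subst Bochner_Integration.integral_sum) auto
  finally show ?thesis by (simp only: eqG)
qed

subsection \<open>Cutoff functions at the origin\<close>

text \<open>Radial cutoff, zero up to radius 1/(k+1) and one from 2/(k+1) on; using x \<bullet> x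
  keeps it smooth at the origin.\<close>

definition cut :: "nat \<Rightarrow> real^'n \<Rightarrow> real" where
  "cut k x = 1 - step (2 - (real (Suc k))\<^sup>2 * (x \<bullet> x))"

lemma smooth_on_cut: "smooth_on UNIV (cut k)"
  unfolding cut_def[abs_def]
  by (intro smooth_on_diff smooth_on_const smooth_on_step smooth_on_cmult smooth_on_inner_self) auto

lemma cut_bounds: "0 \<le> cut k x" "cut k x \<le> 1"
  by (simp_all add: cut_def step_nonneg step_le_1)

lemma abs_cut_le: "\<bar>cut k x\<bar> \<le> 1"
  using cut_bounds[of k x] by simp

lemma cut_eq_0: "norm x \<le> 1 / real (Suc k) \<Longrightarrow> cut k x = 0"
proof -
  assume "norm x \<le> 1 / real (Suc k)"
  then have "real (Suc k) * norm x \<le> 1" by (simp add: field_simps)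
  then have "(real (Suc k) * norm x)\<^sup>2 \<le> 1" by (simp add: power_le_one)
  then show ?thesis unfolding cut_def
    by (subst step_eq_1) (simp_all add: power_mult_distrib power2_norm_eq_inner)
qed

lemma cut_eq_1: "2 / real (Suc k) \<le> norm x \<Longrightarrow> cut k x = 1"
proof -
  assume "2 / real (Suc k) \<le> norm x"
  then have "2 \<le> real (Suc k) * norm x" by (simp add: field_simps)
  then have "2\<^sup>2 \<le> (real (Suc k) * norm x)\<^sup>2" by (intro power_mono) auto
  then show ?thesis unfolding cut_def
    by (subst step_eq_0) (simp_all add: power_mult_distrib power2_norm_eq_inner)
qed

lemma cut_tendsto: "x \<noteq> 0 \<Longrightarrow> (\<lambda>k. cut k x) \<longlonglongrightarrow> 1"
proof -
  assume x: "x \<noteq> 0"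
  have "(\<lambda>k. 2 * inverse (real (Suc k))) \<longlonglongrightarrow> 2 * 0"
    by (intro tendsto_intros LIMSEQ_inverse_real_of_nat)
  from order_tendstoD(2)[OF this, of "norm x"] x
  have "eventually (\<lambda>k. 2 * inverse (real (Suc k)) < norm x) sequentially" by simp
  then have "eventually (\<lambda>k. cut k x = 1) sequentially"
    by eventually_elim (rule cut_eq_1, simp add: divide_inverse)
  then show ?thesis by (rule tendsto_eventually)
qed

lemma grad_cut_bound:
  obtains C where "C > 0" "\<And>k (x :: real^'n). norm (grad (cut k) x) \<le> C * real (Suc k)"
    "\<And>k (x :: real^'n). 2 / real (Suc k) < norm x \<Longrightarrow> grad (cut k) x = 0"
proof -
  obtain s' C where s': "\<And>t. (step has_real_derivative s' t) (at t)" "\<And>t. \<bar>s' t\<bar> \<le> C"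
    "\<And>t. t \<le> 0 \<or> 1 \<le> t \<Longrightarrow> s' t = 0" using step_has_derivative_bounded by blast
  have C0: "0 \<le> C" using s'(2)[of 0] by linarith
  have g: "grad (cut k) x = (2 * (real (Suc k))\<^sup>2 * s' (2 - (real (Suc k))\<^sup>2 * (x \<bullet> x))) *\<^sub>R x" for k and x :: "real^'n"
  proof (rule grad_eqI)
    let ?m = "(real (Suc k))\<^sup>2"
    have q: "((\<lambda>x :: real^'n. 2 - ?m * (x \<bullet> x)) has_derivative (\<lambda>h. - (?m * (2 * (x \<bullet> h))))) (at x)"
      by (auto intro!: derivative_eq_intros simp: inner_commute)
    have "(cut k has_derivative (\<lambda>h. 0 - (- (?m * (2 * (x \<bullet> h)))) * s' (2 - ?m * (x \<bullet> x)))) (at x)"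
      unfolding cut_def[abs_def]
      by (intro has_derivative_diff has_derivative_const DERIV_compose_FDERIV[OF s'(1) q])
    then show "(cut k has_derivative (\<lambda>h. h \<bullet> (2 * ?m * s' (2 - ?m * (x \<bullet> x))) *\<^sub>R x)) (at x)"
      by (simp add: inner_commute mult.assoc mult.commute mult.left_commute)
  qed
  have z: "grad (cut k) x = 0" if "2 / real (Suc k) < norm x" for k and x :: "real^'n"
  proof -
    have "2 \<le> real (Suc k) * norm x" using that by (simp add: field_simps)
    then have "2\<^sup>2 \<le> (real (Suc k) * norm x)\<^sup>2" by (intro power_mono) auto
    then show ?thesis unfolding g
      by (subst s'(3)) (simp_all add: power_mult_distrib power2_norm_eq_inner)
  qed
  \<comment> \<open>Where the gradient does not vanish, m |x| <= 2 with m = k + 1, so 2 m (m |x|)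
    times the bound on the derivative of \<open>step\<close> is at most 4 C m. The added 1 makes the
    constant positive.\<close>
  have b: "norm (grad (cut k) x) \<le> (4 * C + 1) * real (Suc k)" for k and x :: "real^'n"
  proof (cases "2 / real (Suc k) < norm x")
    case False
    then have n: "real (Suc k) * norm x \<le> 2" by (simp add: field_simps)
    have "norm (grad (cut k) x) = 2 * real (Suc k) * (real (Suc k) * norm x) * \<bar>s' (2 - (real (Suc k))\<^sup>2 * (x \<bullet> x))\<bar>"
      unfolding g by (simp add: abs_mult power2_eq_square)
    also have "\<dots> \<le> 2 * real (Suc k) * 2 * C"
      using n C0 by (intro mult_mono s'(2)) auto
    also have "\<dots> \<le> (4 * C + 1) * real (Suc k)" by (simp add: algebra_simps)
    finally show ?thesis .
  qed (use z C0 in simp)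
  show ?thesis using that[of "4 * C + 1"] b z C0 by simp
qed

lemma partial_deriv_cut_measurable [measurable]: "partial_deriv (cut k) i \<in> borel_measurable borel"
  by (rule borel_measurable_continuous_UNIV[OF smooth_on_continuous[OF smooth_on_partial_deriv[OF smooth_on_cut]]])

lemma cut_measurable [measurable]: "cut k \<in> borel_measurable borel"
  by (rule borel_measurable_continuous_UNIV[OF smooth_on_continuous[OF smooth_on_cut]])

lemma test_fun_cut:
  assumes "test_fun N \<phi>" shows "test_fun (N - {0}) (\<lambda>x. cut k x * \<phi> x)"
proof -
  obtain K where K: "compact K" "K \<subseteq> N" "\<And>x. x \<notin> K \<Longrightarrow> \<phi> x = 0"
    using assms by (rule test_funE) blast
  show ?thesis
  proof (rule test_funI[of _ "K - ball 0 (1 / real (Suc k))"])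
    show "smooth_on UNIV (\<lambda>x. cut k x * \<phi> x)"
      by (intro smooth_on_mult smooth_on_cut test_fun_smooth[OF assms]) simp
    show "compact (K - ball 0 (1 / real (Suc k)))" using K(1) by (intro compact_diff) auto
    show "K - ball 0 (1 / real (Suc k)) \<subseteq> N - {0}" using K(2) by auto
    show "cut k x * \<phi> x = 0" if "x \<notin> K - ball 0 (1 / real (Suc k))" for x
      using that K(3)[of x] cut_eq_0[of x k] by (auto simp: less_imp_le)
  qed
qed

text \<open>A point has zero capacity in dimension at least three.\<close>
lemma integral_grad_cut_tendsto_0:
  fixes f g :: "real^'n \<Rightarrow> real"
  assumes dim: "CARD('n) \<ge> 3" and f: "sqint f" and g[measurable]: "g \<in> borel_measurable borel" and B: "\<And>x. \<bar>g x\<bar> \<le> B"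
  shows "(\<lambda>k. \<integral>x. f x * (g x * partial_deriv (cut k) i x) \<partial>lborel) \<longlonglongrightarrow> 0"
    and "integrable lborel (\<lambda>x. f x * (g x * partial_deriv (cut k) i x))"
proof -
  have [measurable]: "f \<in> borel_measurable borel" using f by (simp add: sqint_def)
  obtain C where C: "C > 0" "\<And>k (x :: real^'n). norm (grad (cut k) x) \<le> C * real (Suc k)"
    "\<And>k (x :: real^'n). 2 / real (Suc k) < norm x \<Longrightarrow> grad (cut k) x = 0" using grad_cut_bound by blast
  have B0: "0 \<le> B" using B[of 0] by linarith
  have pb: "\<bar>g x * partial_deriv (cut k) i x\<bar> \<le> B * C * real (Suc k) * indicator (cball 0 (2 / real (Suc k))) x" for k x
  proof (cases "x \<in> cball 0 (2 / real (Suc k))")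
    case True
    have "\<bar>partial_deriv (cut k) i x\<bar> \<le> norm (grad (cut k) x)" by (metis component_le_norm_cart grad_component)
    then have "\<bar>partial_deriv (cut k) i x\<bar> \<le> C * real (Suc k)" using C(2) order_trans by blast
    then have "\<bar>g x\<bar> * \<bar>partial_deriv (cut k) i x\<bar> \<le> B * (C * real (Suc k))"
      using B B0 by (intro mult_mono) auto
    then show ?thesis using True by (simp add: abs_mult mult.assoc)
  next
    case False
    then have "grad (cut k) x = 0" by (intro C(3)) auto
    then have "partial_deriv (cut k) i x = 0" by (metis grad_component zero_index)
    then show ?thesis using False by simp
  qed
  have sq: "sqint (\<lambda>x. g x * partial_deriv (cut k) i x)" for k
  proof (rule sqint_bounded_compact[of _ "cball 0 (2 / real (Suc k))" "B * C * real (Suc k)"])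
    show "\<bar>g x * partial_deriv (cut k) i x\<bar> \<le> B * C * real (Suc k)" for x
    proof -
      have "0 \<le> B * C * real (Suc k)" using B0 C(1) by simp
      then have "B * C * real (Suc k) * indicator (cball 0 (2 / real (Suc k))) x \<le> B * C * real (Suc k)"
        by (simp add: indicator_def del: of_nat_Suc)
      with pb[of x k] show ?thesis by linarith
    qed
    show "g x * partial_deriv (cut k) i x = 0" if "x \<notin> cball 0 (2 / real (Suc k))" for x
      using pb[of x k] that by simp
  qed auto
  show int: "integrable lborel (\<lambda>x. f x * (g x * partial_deriv (cut k) i x))" for k
    by (rule sqint_mult_integrable[OF f sq])
  let ?F = "\<integral>\<^sup>+x. ennreal ((f x)\<^sup>2) \<partial>lborel"
  have F: "?F \<noteq> top" using f by (simp add: sqint_iff less_top)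
  define v where "v = unit_ball_vol (real CARD('n))"
  \<comment> \<open>The squared norm of the second factor is at most (B C m)^2 times the volume of a
    ball of radius 2/m, that is c m^(2-n), which is at most c/m for n >= 3.\<close>
  define c where "c = (B * C)\<^sup>2 * v * 2 ^ CARD('n)"
  have v0: "0 \<le> v" by (simp add: v_def)
  let ?d = "\<lambda>k. \<integral>x. f x * (g x * partial_deriv (cut k) i x) \<partial>lborel"
  have bd: "ennreal ((?d k)\<^sup>2) \<le> ?F * ennreal (c * inverse (real (Suc k)))" for k
  proof -
    let ?p = "\<lambda>x. g x * partial_deriv (cut k) i x"
    have "ennreal \<bar>?d k\<bar> \<le> (\<integral>\<^sup>+x. ennreal (norm (f x * ?p x)) \<partial>lborel)"
      using integral_norm_bound_ennreal[OF int] by simp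
    also have "\<dots> = (\<integral>\<^sup>+x. ennreal \<bar>f x\<bar> * ennreal \<bar>?p x\<bar> \<partial>lborel)"
      by (intro nn_integral_cong) (simp only: real_norm_def abs_mult[of "f _"] ennreal_mult abs_ge_zero)
    finally have "(ennreal \<bar>?d k\<bar>)\<^sup>2 \<le> \<dots>\<^sup>2" by (rule power_mono) simp
    also have "\<dots> \<le> (\<integral>\<^sup>+x. (ennreal \<bar>f x\<bar>)\<^sup>2 \<partial>lborel) * (\<integral>\<^sup>+x. (ennreal \<bar>?p x\<bar>)\<^sup>2 \<partial>lborel)"
      by (rule Cauchy_Schwarz_nn_integral) auto
    also have "(\<integral>\<^sup>+x. (ennreal \<bar>f x\<bar>)\<^sup>2 \<partial>lborel) = ?F" by (simp add: ennreal_power)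
    also have "(\<integral>\<^sup>+x. (ennreal \<bar>?p x\<bar>)\<^sup>2 \<partial>lborel) \<le> ennreal (c * inverse (real (Suc k)))"
    proof -
      let ?m = "real (Suc k)"
      have "(\<integral>\<^sup>+x. (ennreal \<bar>?p x\<bar>)\<^sup>2 \<partial>lborel)
         \<le> (\<integral>\<^sup>+x. ennreal ((B * C * ?m)\<^sup>2) * indicator (cball 0 (2 / ?m)) x \<partial>(lborel :: (real^'n) measure))"
      proof (rule nn_integral_mono)
        fix x :: "real^'n"
        have "\<bar>?p x\<bar>\<^sup>2 \<le> (B * C * ?m * indicator (cball 0 (2 / ?m)) x)\<^sup>2"
          by (rule power_mono[OF pb]) simp
        then have "ennreal (\<bar>?p x\<bar>\<^sup>2) \<le> ennreal ((B * C * ?m * indicator (cball 0 (2 / ?m)) x)\<^sup>2)"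
          by (rule ennreal_leI)
        then show "(ennreal \<bar>?p x\<bar>)\<^sup>2 \<le> ennreal ((B * C * ?m)\<^sup>2) * indicator (cball 0 (2 / ?m)) x"
          by (auto simp: ennreal_power indicator_def split: if_splits)
      qed
      also have "\<dots> = ennreal ((B * C * ?m)\<^sup>2) * emeasure lborel (cball (0::real^'n) (2 / ?m))"
        by (rule nn_integral_cmult_indicator) simp
      also have "\<dots> = ennreal ((B * C * ?m)\<^sup>2) * ennreal (v * (2 / ?m) ^ CARD('n))"
        by (simp add: emeasure_cball v_def)
      also have "\<dots> = ennreal ((B * C * ?m)\<^sup>2 * (v * (2 / ?m) ^ CARD('n)))"
        using v0 by (intro ennreal_mult[symmetric]) auto
      also have "(B * C * ?m)\<^sup>2 * (v * (2 / ?m) ^ CARD('n)) = c * (?m\<^sup>2 * inverse ?m ^ CARD('n))"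
        by (simp only: c_def power_mult_distrib divide_inverse mult_ac)
      also have "ennreal (c * (?m\<^sup>2 * inverse ?m ^ CARD('n))) \<le> ennreal (c * inverse ?m)"
      proof (rule ennreal_leI, rule mult_left_mono)
        show "0 \<le> c" using v0 by (simp add: c_def)
        have "inverse ?m ^ CARD('n) \<le> inverse ?m ^ 3"
          using dim by (intro power_decreasing) (auto simp: inverse_le_1_iff)
        then have "?m\<^sup>2 * inverse ?m ^ CARD('n) \<le> ?m\<^sup>2 * inverse ?m ^ 3" by (intro mult_left_mono) auto
        also have "\<dots> = inverse ?m" by (simp add: power2_eq_square power3_eq_cube divide_simps)
        finally show "?m\<^sup>2 * inverse ?m ^ CARD('n) \<le> inverse ?m" .
      qed
      finally show ?thesis .
    qed
    finally show ?thesis by (simp add: ennreal_power mult_left_mono del: of_nat_Suc)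
  qed
  have "(\<lambda>k. ennreal (c * inverse (real (Suc k)))) \<longlonglongrightarrow> ennreal (c * 0)"
    by (intro tendsto_intros LIMSEQ_inverse_real_of_nat)
  then have "(\<lambda>k. ?F * ennreal (c * inverse (real (Suc k)))) \<longlonglongrightarrow> ennreal 0"
    unfolding ennreal_0 by (intro ennreal_tendsto_0_cmult F) simp
  from tendsto_sandwich[OF _ _ tendsto_const this, of "\<lambda>k. ennreal ((?d k)\<^sup>2)"] bd
  have "(\<lambda>k. ennreal ((?d k)\<^sup>2)) \<longlonglongrightarrow> ennreal 0" by auto
  then have "(\<lambda>k. (?d k)\<^sup>2) \<longlonglongrightarrow> 0"
    by (subst (asm) tendsto_ennreal_iff) auto
  from tendsto_real_sqrt[OF this] show "?d \<longlonglongrightarrow> 0"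
    by (intro tendsto_rabs_zero_cancel[of ?d]) simp
qed

lemma integral_cut_tendsto:
  fixes f :: "real^'n \<Rightarrow> real"
  assumes f: "integrable lborel f"
  shows "(\<lambda>k. \<integral>x. cut k x * f x \<partial>lborel) \<longlonglongrightarrow> (\<integral>x. f x \<partial>lborel)"
proof (rule integral_dominated_convergence)
  have [measurable]: "f \<in> borel_measurable borel" using f by auto
  show "f \<in> borel_measurable lborel" "(\<lambda>x. cut k x * f x) \<in> borel_measurable lborel" for k by measurable
  show "integrable lborel (\<lambda>x. \<bar>f x\<bar>)" using f by simp
  have "AE x in (lborel :: (real^'n) measure). x \<noteq> 0" using AE_lborel_singleton[of 0] .
  then show "AE x in lborel. (\<lambda>k. cut k x * f x) \<longlonglongrightarrow> f x"
  proof eventually_elim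
    case (elim x)
    have "(\<lambda>k. cut k x * f x) \<longlonglongrightarrow> 1 * f x" by (intro tendsto_intros cut_tendsto elim)
    then show ?case by simp
  qed
  show "AE x in lborel. norm (cut k x * f x) \<le> \<bar>f x\<bar>" for k
  proof (rule AE_I2)
    fix x :: "real^'n"
    have "\<bar>cut k x\<bar> \<le> 1" by (rule abs_cut_le)
    from mult_right_mono[OF this, of "\<bar>f x\<bar>"] show "norm (cut k x * f x) \<le> \<bar>f x\<bar>" by (simp add: abs_mult)
  qed
qed

text \<open>In the second limit the product rule produces an extra term with the gradient of
  \<open>cut\<close>, which tends to 0 by the capacity estimate; the rest is dominated
  convergence.\<close>

lemma cut_limits:
  fixes f :: "real^'n \<Rightarrow> real"
  assumes dim: "CARD('n) \<ge> 3" and f: "sqint f" and \<phi>: "test_fun N \<phi>"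
  shows "(\<lambda>k. \<integral>x. f x * (cut k x * \<phi> x) \<partial>lborel) \<longlonglongrightarrow> (\<integral>x. f x * \<phi> x \<partial>lborel)"
    and "(\<lambda>k. \<integral>x. f x * partial_deriv (\<lambda>x. cut k x * \<phi> x) i x \<partial>lborel) \<longlonglongrightarrow> (\<integral>x. f x * partial_deriv \<phi> i x \<partial>lborel)"
proof -
  have i1: "integrable lborel (\<lambda>x. f x * \<phi> x)" by (rule sqint_mult_integrable[OF f test_fun_sqint[OF \<phi>]])
  have i2: "integrable lborel (\<lambda>x. f x * partial_deriv \<phi> i x)"
    by (rule sqint_mult_integrable[OF f test_fun_sqint[OF test_fun_partial_deriv[OF \<phi>]]])
  show "(\<lambda>k. \<integral>x. f x * (cut k x * \<phi> x) \<partial>lborel) \<longlonglongrightarrow> (\<integral>x. f x * \<phi> x \<partial>lborel)"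
    using integral_cut_tendsto[OF i1] by (simp add: mult.left_commute)
  have [measurable]: "f \<in> borel_measurable borel" "\<phi> \<in> borel_measurable borel" "partial_deriv \<phi> i \<in> borel_measurable borel"
    using f \<phi> test_fun_measurable[OF test_fun_partial_deriv[OF \<phi>]] by (auto simp: sqint_def test_fun_measurable)
  obtain B where B: "\<And>x. \<bar>\<phi> x\<bar> \<le> B" using test_fun_bounded[OF \<phi>] by blast
  have d: "partial_deriv (\<lambda>x. cut k x * \<phi> x) i x = cut k x * partial_deriv \<phi> i x + \<phi> x * partial_deriv (cut k) i x" for k x
    using partial_deriv_mult[OF smooth_on_differentiable[OF smooth_on_cut UNIV_I]
        smooth_on_differentiable[OF test_fun_smooth[OF \<phi>] UNIV_I], of k i x]
    by (simp only: mult.commute[of "\<phi> x"])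
  have i3: "integrable lborel (\<lambda>x. cut k x * (f x * partial_deriv \<phi> i x))" for k
    by (rule integrable_mult_bounded[OF i2 _ abs_cut_le]) measurable
  have i4: "integrable lborel (\<lambda>x. f x * (\<phi> x * partial_deriv (cut k) i x))" for k
    by (rule integral_grad_cut_tendsto_0(2)[OF dim f _ B]) measurable
  have eq: "f x * partial_deriv (\<lambda>x. cut k x * \<phi> x) i x
     = cut k x * (f x * partial_deriv \<phi> i x) + f x * (\<phi> x * partial_deriv (cut k) i x)" for k x
    unfolding d by (simp add: algebra_simps)
  have "(\<integral>x. f x * partial_deriv (\<lambda>x. cut k x * \<phi> x) i x \<partial>lborel)
     = (\<integral>x. cut k x * (f x * partial_deriv \<phi> i x) \<partial>lborel) + (\<integral>x. f x * (\<phi> x * partial_deriv (cut k) i x) \<partial>lborel)" for k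
    unfolding eq by (rule Bochner_Integration.integral_add[OF i3 i4])
  moreover have "(\<lambda>k. (\<integral>x. cut k x * (f x * partial_deriv \<phi> i x) \<partial>lborel) + (\<integral>x. f x * (\<phi> x * partial_deriv (cut k) i x) \<partial>lborel))
     \<longlonglongrightarrow> (\<integral>x. f x * partial_deriv \<phi> i x \<partial>lborel) + 0"
    by (intro tendsto_add integral_cut_tendsto i2 integral_grad_cut_tendsto_0(1)[OF dim f _ B]) measurable
  ultimately show "(\<lambda>k. \<integral>x. f x * partial_deriv (\<lambda>x. cut k x * \<phi> x) i x \<partial>lborel) \<longlonglongrightarrow> (\<integral>x. f x * partial_deriv \<phi> i x \<partial>lborel)"
    by simp
qed

text \<open>\<open>cut k * \<phi>\<close> is a test function on the punctured set; both sides of the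
  weak identity converge as k grows.\<close>

lemma weak_pair_removable:
  fixes v :: "real^'n \<Rightarrow> real"
  assumes dim: "CARD('n) \<ge> 3" and wp: "weak_pair (N - {0}) v H"
  shows "weak_pair N v H"
  unfolding weak_pair_def
proof (intro conjI allI impI)
  show v: "sqint v" and H: "sqint (\<lambda>x. H x $ i)" for i using weak_pairD[OF wp] by auto
  fix \<phi> i assume \<phi>: "test_fun N \<phi>"
  have "(\<lambda>k. - (\<integral>x. H x $ i * (cut k x * \<phi> x) \<partial>lborel)) \<longlonglongrightarrow> - (\<integral>x. H x $ i * \<phi> x \<partial>lborel)"
    by (intro tendsto_minus cut_limits(1)[OF dim H \<phi>])
  then have "(\<lambda>k. \<integral>x. v x * partial_deriv (\<lambda>x. cut k x * \<phi> x) i x \<partial>lborel) \<longlonglongrightarrow> - (\<integral>x. H x $ i * \<phi> x \<partial>lborel)"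
    using weak_pairD(3)[OF wp test_fun_cut[OF \<phi>]] by simp
  from LIMSEQ_unique[OF cut_limits(2)[OF dim v \<phi>] this]
  show "(\<integral>x. v x * partial_deriv \<phi> i x \<partial>lborel) = - (\<integral>x. H x $ i * \<phi> x \<partial>lborel)" .
qed

lemma integral_inner_grad:
  assumes H: "\<And>i. sqint (\<lambda>x. H x $ i)" and \<phi>: "test_fun N \<phi>"
  shows "(\<integral>x. H x \<bullet> grad \<phi> x \<partial>lborel) = (\<Sum>i\<in>UNIV. \<integral>x. H x $ i * partial_deriv \<phi> i x \<partial>lborel)"
    and "integrable lborel (\<lambda>x. H x \<bullet> grad \<phi> x)"
proof -
  have i: "integrable lborel (\<lambda>x. H x $ i * partial_deriv \<phi> i x)" for i
    by (rule sqint_mult_integrable[OF H test_fun_sqint[OF test_fun_partial_deriv[OF \<phi>]]])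
  show "(\<integral>x. H x \<bullet> grad \<phi> x \<partial>lborel) = (\<Sum>i\<in>UNIV. \<integral>x. H x $ i * partial_deriv \<phi> i x \<partial>lborel)"
    unfolding inner_vec_def using i by (subst Bochner_Integration.integral_sum[symmetric]) auto
  show "integrable lborel (\<lambda>x. H x \<bullet> grad \<phi> x)"
    unfolding inner_vec_def using i by simp
qed

text \<open>The same cutoffs, now in the equation: testing involves only the square integrable field
  \<open>H\<close>, so the gradient of the cutoff disappears in the limit.\<close>

lemma harmonic_removable:
  fixes H :: "real^'n \<Rightarrow> real^'n"
  assumes dim: "CARD('n) \<ge> 3" and H: "\<And>i. sqint (\<lambda>x. H x $ i)"
    and harm: "\<And>\<phi>. test_fun (N - {0}) \<phi> \<Longrightarrow> (\<integral>x. H x \<bullet> grad \<phi> x \<partial>lborel) = 0"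
    and \<phi>: "test_fun N \<phi>"
  shows "(\<integral>x. H x \<bullet> grad \<phi> x \<partial>lborel) = 0"
proof -
  have "(\<lambda>k. \<Sum>i\<in>UNIV. \<integral>x. H x $ i * partial_deriv (\<lambda>x. cut k x * \<phi> x) i x \<partial>lborel)
     \<longlonglongrightarrow> (\<Sum>i\<in>UNIV. \<integral>x. H x $ i * partial_deriv \<phi> i x \<partial>lborel)"
    by (intro tendsto_sum cut_limits(2)[OF dim H \<phi>])
  then have "(\<lambda>k. 0) \<longlonglongrightarrow> (\<integral>x. H x \<bullet> grad \<phi> x \<partial>lborel)"
    using integral_inner_grad(1)[OF H test_fun_cut[OF \<phi>]] harm[OF test_fun_cut[OF \<phi>]] integral_inner_grad(1)[OF H \<phi>]
    by simp
  then show ?thesis by (simp add: LIMSEQ_const_iff)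
qed

subsection \<open>From the cloaked ball to the homogeneous ball\<close>

lemma smooth_on_norm_scale:
  "smooth_on (- {0}) (\<lambda>x :: real^'n. ((a + b * inverse (norm x)) *\<^sub>R x) $ j)"
proof -
  have o: "open (- {0 :: real^'n})" by auto
  have "smooth_on (- {0 :: real^'n}) (\<lambda>x. (a + b * inverse (norm x)) * x $ j)"
    by (intro smooth_on_mult smooth_on_add smooth_on_const smooth_on_inverse smooth_on_norm smooth_on_component o) auto
  then show ?thesis by simp
qed

lemma smooth_on_F1: "smooth_on (- {0}) (\<lambda>x :: real^'n. F1 x $ j)"
  by (rule smooth_on_cong_open[OF _ smooth_on_norm_scale[of "1/2" 1]]) (auto simp: F1_eq inverse_eq_divide)

lemma smooth_on_Fi: "smooth_on (- {0}) (\<lambda>y :: real^'n. Fi y $ j)"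
  by (rule smooth_on_cong_open[OF _ smooth_on_norm_scale[of 2 "-2"]]) (auto simp: Fi_def inverse_eq_divide)

lemma smooth_on_compose_F1:
  assumes "open S" "0 \<notin> S" "smooth_on UNIV f" shows "smooth_on S (\<lambda>x. f (F1 x))"
  by (rule smooth_on_compose[OF assms(1) subset_UNIV smooth_on_subset[OF smooth_on_F1] assms(3)]) (use assms in auto)

lemma smooth_on_compose_Fi:
  assumes "open S" "0 \<notin> S" "smooth_on UNIV f" shows "smooth_on S (\<lambda>x. f (Fi x))"
  by (rule smooth_on_compose[OF assms(1) subset_UNIV smooth_on_subset[OF smooth_on_Fi] assms(3)]) (use assms in auto)

lemma grad_compose:
  fixes P :: "real^'n \<Rightarrow> real^'n"
  assumes P: "(P has_derivative P') (at x)" and sa: "\<And>v w. P' v \<bullet> w = v \<bullet> P' w" and f: "f differentiable (at (P x))"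
  shows "grad (\<lambda>x. f (P x)) x = P' (grad f (P x))"
proof (rule grad_eqI)
  show "((\<lambda>x. f (P x)) has_derivative (\<lambda>h. h \<bullet> P' (grad f (P x)))) (at x)"
    using has_derivative_compose[OF P has_derivative_grad[OF f]] by (simp add: sa)
qed

lemma grad_compose_F1: "x \<noteq> 0 \<Longrightarrow> f differentiable (at (F1 x)) \<Longrightarrow> grad (\<lambda>x. f (F1 x)) x = DF x (grad f (F1 x))"
  by (rule grad_compose[OF F1_has_derivative]) (auto simp: inner_DF)

lemma grad_compose_Fi: "y \<noteq> 0 \<Longrightarrow> f differentiable (at (Fi y)) \<Longrightarrow> grad (\<lambda>y. f (Fi y)) y = DFi y (grad f (Fi y))"
  by (rule grad_compose[OF Fi_has_derivative]) (auto simp: inner_DFi)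

lemma sqint_norm:
  fixes G :: "real^'n \<Rightarrow> real^'n"
  assumes "\<And>i. sqint (\<lambda>x. G x $ i)"
  shows "sqint (\<lambda>x. norm (G x))" "G \<in> borel_measurable borel"
proof -
  show m[measurable]: "G \<in> borel_measurable borel"
    by (rule borel_measurable_euclidean_space[THEN iffD2])
       (use assms in \<open>auto simp: Basis_vec_def inner_axis sqint_def\<close>)
  have "(norm (G x))\<^sup>2 = (\<Sum>i\<in>UNIV. (G x $ i)\<^sup>2)" for x
    by (simp only: power2_norm_eq_inner inner_vec_def) (simp add: power2_eq_square)
  then show "sqint (\<lambda>x. norm (G x))" using assms by (simp add: sqint_def)
qed

lemma sqint_components:
  fixes G :: "real^'n \<Rightarrow> real^'n"
  assumes "sqint (\<lambda>x. norm (G x))" "G \<in> borel_measurable borel"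
  shows "sqint (\<lambda>x. G x $ i)"
proof (rule sqint_bound[OF assms(1), of _ 1])
  have [measurable]: "G \<in> borel_measurable borel" by (rule assms)
  have "(\<lambda>x. G x \<bullet> axis i 1) \<in> borel_measurable borel" by measurable
  then show "(\<lambda>x. G x $ i) \<in> borel_measurable borel" by (simp add: inner_axis)
  show "AE x in lborel. \<bar>G x $ i\<bar> \<le> 1 * \<bar>norm (G x)\<bar>"
    using component_le_norm_cart by (intro AE_I2) auto
qed

lemma test_fun_N0_compose_Fi:
  fixes \<psi> :: "real^'n \<Rightarrow> real"
  assumes "test_fun N0 \<psi>" shows "test_fun N1 (\<lambda>y. if y \<in> N1 then \<psi> (Fi y) else 0)"
proof -
  obtain K where K: "compact K" "K \<subseteq> N0" "\<And>x. x \<notin> K \<Longrightarrow> \<psi> x = 0"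
    using assms by (rule test_funE) blast
  show ?thesis
  proof (rule test_fun_extend[OF open_N1, where K = "F1 ` K" and f = "\<lambda>y. \<psi> (Fi y)"])
    show "smooth_on N1 (\<lambda>y. \<psi> (Fi y))"
      by (rule smooth_on_compose_Fi[OF open_N1 _ test_fun_smooth[OF assms]]) (simp add: N1_iff)
    have "continuous_on K F1"
    proof (rule has_derivative_continuous_on)
      fix x assume "x \<in> K"
      then have "x \<noteq> 0" using K(2) by (auto simp: N0_iff)
      then show "(F1 has_derivative DF x) (at x within K)"
        by (rule has_derivative_at_withinI[OF F1_has_derivative])
    qed
    then show "compact (F1 ` K)" using K(1) by (rule compact_continuous_image)
    show "F1 ` K \<subseteq> N1" using K(2) F1_in_N1 by auto
    show "\<psi> (Fi y) = 0" if y: "y \<in> N1 - F1 ` K" for y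
    proof (rule K(3))
      show "Fi y \<notin> K" using y F1_Fi[of y] by (force simp: N1_iff image_iff)
    qed
  qed
qed

lemma integrable_Sv:
  fixes G V :: "real^'n \<Rightarrow> real^'n"
  assumes dim: "CARD('n) \<ge> 3" and G: "\<And>i. sqint (\<lambda>x. G x $ i)" and V: "\<And>i. sqint (\<lambda>x. V x $ i)"
  shows "integrable lborel (\<lambda>y. indicator N1 y * (Sv y (G y) \<bullet> V y))"
proof (rule Bochner_Integration.integrable_bound)
  have [measurable]: "G \<in> borel_measurable borel" "V \<in> borel_measurable borel"
    using sqint_norm[OF G] sqint_norm[OF V] by auto
  show "(\<lambda>y. indicator N1 y * (Sv y (G y) \<bullet> V y)) \<in> borel_measurable lborel" by measurable
  show "integrable lborel (\<lambda>y. 18 * (norm (G y) * norm (V y)))"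
    using sqint_mult_integrable[OF sqint_norm(1)[OF G] sqint_norm(1)[OF V]] by simp
  show "AE y in lborel. norm (indicator N1 y * (Sv y (G y) \<bullet> V y)) \<le> norm (18 * (norm (G y) * norm (V y)))"
  proof (rule AE_I2)
    fix y
    have "\<bar>Sv y (G y) \<bullet> V y\<bar> \<le> 18 * (norm (G y) * norm (V y))" if "y \<in> N1"
    proof -
      have "\<bar>Sv y (G y) \<bullet> V y\<bar> \<le> norm (Sv y (G y)) * norm (V y)" by (rule Cauchy_Schwarz_ineq2)
      also have "\<dots> \<le> 18 * norm (G y) * norm (V y)" by (intro mult_right_mono norm_Sv_le[OF dim that]) simp
      finally show ?thesis by (simp add: mult.assoc)
    qed
    then show "norm (indicator N1 y * (Sv y (G y) \<bullet> V y)) \<le> norm (18 * (norm (G y) * norm (V y)))"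
      by (auto simp: indicator_def)
  qed
qed

text \<open>\<open>DF\<close> blows up at the origin, so square integrability of the new gradient is
  read off from the energy identity with both fields equal to \<open>G\<close>, the conductivity
  being bounded. The chain rule holds off the origin, and the origin is removable.\<close>

lemma weak_pair_pull_back:
  fixes u :: "real^'n \<Rightarrow> real"
  assumes dim: "CARD('n) \<ge> 3" and wp: "weak_pair (ball 0 2) u G" and u: "integrable lborel u"
  shows "weak_pair (ball 0 2) (\<lambda>x. indicator N0 x * u (F1 x)) (\<lambda>x. indicator N0 x *\<^sub>R DF x (G (F1 x)))"
proof -
  let ?v = "\<lambda>x. indicator N0 x * u (F1 x)" and ?H = "\<lambda>x. indicator N0 x *\<^sub>R DF x (G (F1 x))"
  have [measurable]: "G \<in> borel_measurable borel"
    using sqint_norm[OF weak_pairD(2)[OF wp]] by auto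
  have sv: "sqint ?v"
    by (rule comp_bound_sqint[OF comp_bound_F1 weak_pairD(1)[OF wp]]) auto
  have "integrable lborel (\<lambda>y. indicator N1 y * (Sv y (G y) \<bullet> G y))"
    by (rule integrable_Sv[OF dim weak_pairD(2)[OF wp] weak_pairD(2)[OF wp]])
  then have "integrable lborel (\<lambda>x. indicator N0 x * (DF x (G (F1 x)) \<bullet> DF x (G (F1 x))))"
    by (subst energy_identity(1)) measurable
  moreover have "indicator N0 x * (DF x (G (F1 x)) \<bullet> DF x (G (F1 x))) = (norm (?H x))\<^sup>2" for x
    by (auto simp: indicator_def power2_norm_eq_inner)
  ultimately have "sqint (\<lambda>x. norm (?H x))" by (simp add: sqint_def)
  then have sH: "sqint (\<lambda>x. ?H x $ i)" for i by (rule sqint_components) measurable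
  have "weak_pair (ball 0 2 - {0}) ?v ?H"
    unfolding weak_pair_def
  proof (intro conjI allI impI)
    show "sqint ?v" by (rule sv)
    show "sqint (\<lambda>x. ?H x $ i)" for i by (rule sH)
    fix \<phi> :: "real^'n \<Rightarrow> real" and i assume \<phi>: "test_fun (ball 0 2 - {0}) \<phi>"
    then obtain K where K: "compact K" "K \<subseteq> ball 0 2 - {0}" "\<And>x. x \<notin> K \<Longrightarrow> \<phi> x = 0"
      by (rule test_funE) blast
    have KN0: "K \<subseteq> N0" using K(2) by (simp add: N0_def)
    have d0: "partial_deriv \<phi> i x = 0" if "x \<notin> K" for x
      by (rule partial_deriv_zero_open[of "- K"]) (use K that compact_imp_closed in auto)
    have "(\<integral>x. ?v x * partial_deriv \<phi> i x \<partial>lborel) = (\<integral>x. u (F1 x) * partial_deriv \<phi> i x \<partial>lborel)"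
      using d0 KN0 by (intro Bochner_Integration.integral_cong) (auto simp: indicator_def)
    also have "\<dots> = - (\<integral>x. indicator K x * ((G (F1 x) \<bullet> DF x (axis i 1)) * \<phi> x) \<partial>lborel)"
    proof (rule weak_chain_rule[OF wp u open_N0 _ _ _ K(1) KN0 comp_bound_F1[OF _ KN0] test_fun_smooth[OF \<phi>] K(3)])
      show "F1 ` N0 \<subseteq> ball 0 2" unfolding F1_image by (auto simp: N1_def)
      show "(F1 has_derivative DF x) (at x)" if "x \<in> N0" for x using that by (simp add: F1_has_derivative N0_iff)
      show "smooth_on N0 (\<lambda>x. F1 x $ j)" for j by (rule smooth_on_subset[OF smooth_on_F1]) (auto simp: N0_iff)
      show "K \<in> sets borel" using K(1) by (simp add: borel_compact)
    qed
    also have "(\<integral>x. indicator K x * ((G (F1 x) \<bullet> DF x (axis i 1)) * \<phi> x) \<partial>lborel) = (\<integral>x. ?H x $ i * \<phi> x \<partial>lborel)"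
    proof (rule Bochner_Integration.integral_cong[OF refl])
      fix x
      have "G (F1 x) \<bullet> DF x (axis i 1) = DF x (G (F1 x)) $ i" by (simp add: inner_DF[symmetric] inner_axis)
      then show "indicator K x * ((G (F1 x) \<bullet> DF x (axis i 1)) * \<phi> x) = ?H x $ i * \<phi> x"
        using K(3)[of x] KN0 by (auto simp: indicator_def)
    qed
    finally show "(\<integral>x. ?v x * partial_deriv \<phi> i x \<partial>lborel) = - (\<integral>x. ?H x $ i * \<phi> x \<partial>lborel)" .
  qed
  then show ?thesis by (rule weak_pair_removable[OF dim])
qed

text \<open>By the energy identity, testing the pull-back on the punctured ball amounts to testing
  the original equation with the transplanted function; removability then admits tests at the
  origin.\<close>

lemma harmonic_pull_back:
  fixes u :: "real^'n \<Rightarrow> real"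
  assumes dim: "CARD('n) \<ge> 3" and wp: "weak_pair (ball 0 2) u G" and u: "integrable lborel u"
    and sol: "\<And>\<phi>. test_fun N1 \<phi> \<Longrightarrow> (\<integral>y. indicator N1 y * (Sv y (G y) \<bullet> grad \<phi> y) \<partial>lborel) = 0"
    and \<phi>: "test_fun (ball 0 2) \<phi>"
  shows "(\<integral>x. (indicator N0 x *\<^sub>R DF x (G (F1 x))) \<bullet> grad \<phi> x \<partial>lborel) = 0"
proof (rule harmonic_removable[OF dim weak_pairD(2)[OF weak_pair_pull_back[OF dim wp u]] _ \<phi>])
  fix \<psi> assume \<psi>: "test_fun (ball 0 2 - {0}) (\<psi> :: real^'n \<Rightarrow> real)"
  have [measurable]: "G \<in> borel_measurable borel"
    using sqint_norm[OF weak_pairD(2)[OF wp]] by auto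
  \<comment> \<open>The support of \<psi> is compact in the punctured ball, so its image under
    \<open>F1\<close> is compact in \<open>N1\<close> and extension by zero is smooth.\<close>
  let ?\<psi> = "\<lambda>y. if y \<in> N1 then \<psi> (Fi y) else 0"
  have t: "test_fun N1 ?\<psi>" by (rule test_fun_N0_compose_Fi) (use \<psi> in \<open>simp add: N0_def\<close>)
  have [measurable]: "grad ?\<psi> \<in> borel_measurable borel"
    by (rule sqint_norm(2)) (simp add: test_fun_sqint[OF test_fun_partial_deriv[OF t]])
  have "(indicator N0 x *\<^sub>R DF x (G (F1 x))) \<bullet> grad \<psi> x = indicator N0 x * (DF x (G (F1 x)) \<bullet> DF x (grad ?\<psi> (F1 x)))" for x
  proof (cases "x \<in> N0")
    case True
    then have x: "x \<noteq> 0" by (simp add: N0_iff)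
    have d: "?\<psi> differentiable (at (F1 x))" "\<psi> differentiable (at x)"
      using smooth_on_differentiable[OF test_fun_smooth[OF t]] smooth_on_differentiable[OF test_fun_smooth[OF \<psi>]] by auto
    have "grad \<psi> x = grad (\<lambda>x. ?\<psi> (F1 x)) x"
    proof -
      have "partial_deriv (\<lambda>x. ?\<psi> (F1 x)) i x = partial_deriv \<psi> i x" for i
        by (rule partial_deriv_cong_open[OF open_N0 True _ d(2)]) (simp add: F1_in_N1 Fi_F1 N0_iff)
      then show ?thesis by (simp add: vec_eq_iff)
    qed
    also have "\<dots> = DF x (grad ?\<psi> (F1 x))" by (rule grad_compose_F1[OF x d(1)])
    finally show ?thesis by simp
  qed simp
  then have "(\<integral>x. (indicator N0 x *\<^sub>R DF x (G (F1 x))) \<bullet> grad \<psi> x \<partial>lborel)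
     = (\<integral>x. indicator N0 x * (DF x (G (F1 x)) \<bullet> DF x (grad ?\<psi> (F1 x))) \<partial>lborel)"
    by (intro Bochner_Integration.integral_cong refl)
  also have "\<dots> = (\<integral>y. indicator N1 y * (Sv y (G y) \<bullet> grad ?\<psi> y) \<partial>lborel)"
    by (rule energy_identity(2)) measurable
  also have "\<dots> = 0" by (rule sol[OF t])
  finally show "(\<integral>x. (indicator N0 x *\<^sub>R DF x (G (F1 x))) \<bullet> grad \<psi> x \<partial>lborel) = 0" .
qed

subsection \<open>From the homogeneous ball to the cloaked ball\<close>

lemma integral_by_parts:
  fixes h :: "real^'n \<Rightarrow> real"
  assumes h: "smooth_on UNIV h" and \<phi>: "test_fun UNIV \<phi>"
  shows "(\<integral>x. h x * partial_deriv \<phi> i x \<partial>lborel) = - (\<integral>x. partial_deriv h i x * \<phi> x \<partial>lborel)"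
proof -
  have t: "test_fun UNIV (\<lambda>x. h x * \<phi> x)" by (rule test_fun_mult[OF \<phi> h])
  have "partial_deriv (\<lambda>x. h x * \<phi> x) i x = h x * partial_deriv \<phi> i x + partial_deriv h i x * \<phi> x" for x
    using smooth_on_differentiable[OF h] smooth_on_differentiable[OF test_fun_smooth[OF \<phi>]]
    by (intro partial_deriv_mult) auto
  then have "(\<integral>x. h x * partial_deriv \<phi> i x + partial_deriv h i x * \<phi> x \<partial>lborel) = 0"
    using integral_partial_deriv_zero[OF t, of i] by simp
  moreover have "integrable lborel (\<lambda>x. h x * partial_deriv \<phi> i x)"
    by (rule test_fun_integrable[OF test_fun_mult[OF test_fun_partial_deriv[OF \<phi>] h]])
  moreover have "integrable lborel (\<lambda>x. partial_deriv h i x * \<phi> x)"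
    by (rule test_fun_integrable[OF test_fun_mult[OF \<phi> smooth_on_partial_deriv[OF h]]])
  ultimately show ?thesis by simp
qed

lemma sqint_bounded_indicator:
  fixes f :: "real^'n \<Rightarrow> real"
  assumes "f \<in> borel_measurable borel" "\<And>x. norm x \<le> r \<Longrightarrow> \<bar>f x\<bar> \<le> B"
  shows "sqint (\<lambda>x. indicator (ball 0 r) x * f x)"
proof (rule sqint_bounded_compact[of _ "cball 0 r" "\<bar>B\<bar>"])
  have [measurable]: "f \<in> borel_measurable borel" by (rule assms)
  show "(\<lambda>x. indicator (ball 0 r) x * f x) \<in> borel_measurable borel" by measurable
  show "\<bar>indicator (ball 0 r) x * f x\<bar> \<le> \<bar>B\<bar>" for x
    using assms(2)[of x] by (auto simp: indicator_def intro: order_trans[OF _ abs_ge_self])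
qed auto

lemma smooth_on_bounded_cball:
  fixes h :: "real^'n \<Rightarrow> real"
  assumes "smooth_on UNIV h" obtains B where "B > 0" "\<And>x. norm x \<le> r \<Longrightarrow> \<bar>h x\<bar> \<le> B"
proof -
  have "bounded (h ` cball 0 r)"
    by (intro compact_imp_bounded compact_continuous_image continuous_on_subset[OF smooth_on_continuous[OF assms]]) auto
  then obtain B where B: "\<And>x. x \<in> cball 0 r \<Longrightarrow> \<bar>h x\<bar> \<le> B" by (metis bounded_iff imageI real_norm_def)
  have "\<bar>h x\<bar> \<le> max B 1" if "norm x \<le> r" for x using B[of x] that by simp
  then show ?thesis by (intro that[of "max B 1"]) auto
qed

lemma smooth_on_grad_bounded_cball:
  fixes h :: "real^'n \<Rightarrow> real"
  assumes "smooth_on UNIV h" obtains B where "B > 0" "\<And>x. norm x \<le> r \<Longrightarrow> norm (grad h x) \<le> B"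
proof -
  have "\<forall>i. \<exists>B. \<forall>x. norm x \<le> r \<longrightarrow> \<bar>partial_deriv h i x\<bar> \<le> B"
  proof
    fix i show "\<exists>B. \<forall>x. norm x \<le> r \<longrightarrow> \<bar>partial_deriv h i x\<bar> \<le> B"
      using smooth_on_bounded_cball[OF smooth_on_partial_deriv[OF assms], of r i] by blast
  qed
  then obtain B where B: "\<And>i x. norm x \<le> r \<Longrightarrow> \<bar>partial_deriv h i x\<bar> \<le> B i" by metis
  have "norm (grad h x) \<le> max 1 (\<Sum>i\<in>UNIV. B i)" if "norm x \<le> r" for x
  proof -
    have "norm (grad h x) \<le> (\<Sum>i\<in>UNIV. \<bar>grad h x $ i\<bar>)" by (rule norm_le_l1_cart)
    also have "\<dots> \<le> (\<Sum>i\<in>UNIV. B i)" using B[OF that] by (intro sum_mono) simp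
    finally show ?thesis by simp
  qed
  then show ?thesis by (intro that[of "max 1 (\<Sum>i\<in>UNIV. B i)"]) auto
qed

lemma compact_in_N1:
  fixes K :: "(real^'n) set"
  assumes "compact K" "K \<subseteq> N1"
  obtains d where "0 < d" "\<And>y. y \<in> K \<Longrightarrow> 1 + d \<le> norm y"
proof (cases "K = {}")
  case False
  obtain z where z: "z \<in> K" "\<And>y. y \<in> K \<Longrightarrow> norm z \<le> norm y"
    using continuous_attains_inf[OF assms(1) False, of norm] continuous_on_norm_id by blast
  then show ?thesis using that[of "norm z - 1"] assms(2) by (auto simp: N1_iff)
qed (use that[of 1] in simp)

definition push_fun :: "(real^'n \<Rightarrow> real) \<Rightarrow> real^'n \<Rightarrow> real" where
  "push_fun v y = (if norm y \<le> 1 then v 0 else if norm y < 2 then v (Fi y) else 0)"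

definition push_grad :: "(real^'n \<Rightarrow> real^'n) \<Rightarrow> real^'n \<Rightarrow> real^'n" where
  "push_grad H y = indicator N1 y *\<^sub>R DFi y (H (Fi y))"

lemma push_fun_measurable [measurable]:
  assumes [measurable]: "v \<in> borel_measurable borel"
  shows "push_fun v \<in> borel_measurable borel"
  unfolding push_fun_def[abs_def] by measurable

lemma push_grad_measurable [measurable]:
  assumes [measurable]: "H \<in> borel_measurable borel"
  shows "push_grad H \<in> borel_measurable borel"
  unfolding push_grad_def[abs_def] by measurable

lemma norm_Fi_lt: "1 < norm y \<Longrightarrow> norm y < 3/2 \<Longrightarrow> norm (Fi y) < 1"
  by (simp add: norm_Fi)

text \<open>The split is at radius 3/2, since \<open>Fi\<close> maps 1 < |y| < 3/2 into the unit
  ball, where \<open>v\<close> is the bounded smooth \<open>h\<close>. Beyond it composition with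
  \<open>Fi\<close> is bounded by \<open>comp_bound_Fi\<close> with d = 1/2.\<close>

lemma sqint_push_fun:
  fixes v h :: "real^'n \<Rightarrow> real"
  assumes v: "sqint v" and h: "smooth_on UNIV h" and vh: "\<And>x. norm x < 1 \<Longrightarrow> v x = h x"
  shows "sqint (push_fun v)"
proof -
  let ?K = "{y. 3/2 \<le> norm y \<and> norm y < 2} :: (real^'n) set"
  have [measurable]: "v \<in> borel_measurable borel" using v by (simp add: sqint_def)
  have K[measurable]: "?K \<in> sets borel" by measurable
  obtain B where B: "B > 0" "\<And>x. norm x \<le> 1 \<Longrightarrow> \<bar>h x\<bar> \<le> B" using smooth_on_bounded_cball[OF h] by blast
  have p: "\<bar>indicator (ball 0 (3/2)) y * push_fun v y\<bar> \<le> B" for y :: "real^'n"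
  proof (cases "norm y < 3/2")
    case True
    have "\<bar>push_fun v y\<bar> \<le> B"
    proof (cases "norm y \<le> 1")
      case False
      then have "norm (Fi y) < 1" using True by (intro norm_Fi_lt) auto
      then show ?thesis using B(2)[of "Fi y"] vh[of "Fi y"] True False by (simp add: push_fun_def)
    qed (use B(2)[of 0] vh[of 0] in \<open>simp add: push_fun_def\<close>)
    then show ?thesis using True by simp
  qed (use B(1) in simp)
  have 1: "sqint (\<lambda>y. indicator (ball 0 (3/2)) y * push_fun v y)"
    by (rule sqint_bounded_compact[of _ "cball 0 (3/2)" B]) (use p in \<open>auto simp: indicator_def\<close>)
  have 2: "sqint (\<lambda>y. indicator ?K y * v (Fi y))"
    by (rule comp_bound_sqint[OF comp_bound_Fi[of _ "1/2"] v]) (auto simp: N1_iff)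
  have "push_fun v y = indicator (ball 0 (3/2)) y * push_fun v y + indicator ?K y * v (Fi y)" for y
    by (auto simp: push_fun_def indicator_def)
  then show ?thesis using sqint_add[OF 1 2] by presburger
qed

text \<open>The degenerate energy gives no control of this gradient near the sphere. Boundedness of
  grad h near the origin does, with \<open>DFi\<close> at most 4; away from the sphere the argument
  is that of \<open>sqint_push_fun\<close>.\<close>

lemma sqint_push_grad:
  fixes H :: "real^'n \<Rightarrow> real^'n"
  assumes H: "\<And>i. sqint (\<lambda>x. H x $ i)" and h: "smooth_on UNIV h" and Hh: "\<And>x. norm x < 1 \<Longrightarrow> H x = grad h x"
  shows "sqint (\<lambda>y. push_grad H y $ i)"
proof (rule sqint_components)
  let ?K = "{y. 3/2 \<le> norm y \<and> norm y < 2} :: (real^'n) set"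
  have [measurable]: "H \<in> borel_measurable borel" using sqint_norm(2)[OF H] .
  show "push_grad H \<in> borel_measurable borel" by measurable
  have K[measurable]: "?K \<in> sets borel" by measurable
  obtain B where B: "B > 0" "\<And>x. norm x \<le> 1 \<Longrightarrow> norm (grad h x) \<le> B" using smooth_on_grad_bounded_cball[OF h] by blast
  have 1: "sqint (\<lambda>y :: real^'n. indicator (ball 0 (3/2)) y * B)"
    by (rule sqint_bounded_indicator) auto
  have 2: "sqint (\<lambda>y. indicator ?K y * norm (H (Fi y)))"
    by (rule comp_bound_sqint[OF comp_bound_Fi[of _ "1/2"] sqint_norm(1)[OF H]]) (auto simp: N1_iff)
  show "sqint (\<lambda>y. norm (push_grad H y))"
  proof (rule sqint_bound[OF sqint_add[OF 1 2], of _ 4])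
    show "AE y in lborel. \<bar>norm (push_grad H y)\<bar> \<le> 4 * \<bar>indicator (ball 0 (3/2)) y * B + indicator ?K y * norm (H (Fi y))\<bar>"
    proof (rule AE_I2)
      fix y :: "real^'n"
      show "\<bar>norm (push_grad H y)\<bar> \<le> 4 * \<bar>indicator (ball 0 (3/2)) y * B + indicator ?K y * norm (H (Fi y))\<bar>"
      proof (cases "y \<in> N1")
        case True
        then have y: "1 < norm y" "norm y < 2" by (auto simp: N1_iff)
        have "norm (H (Fi y)) \<le> \<bar>indicator (ball 0 (3/2)) y * B + indicator ?K y * norm (H (Fi y))\<bar>"
        proof (cases "norm y < 3/2")
          case True
          then have "norm (Fi y) < 1" using y by (intro norm_Fi_lt) auto
          then show ?thesis using B Hh[of "Fi y"] B(2)[of "Fi y"] True by simp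
        qed (use y in simp)
        then show ?thesis using norm_DFi_le[OF y(1), of "H (Fi y)"] True by (simp add: push_grad_def)
      qed (simp add: push_grad_def)
    qed
  qed measurable
qed

text \<open>A compact subset of \<open>N1\<close> keeps positive distance from the unit sphere, so
  \<open>comp_bound_Fi\<close> and the weak chain rule apply.\<close>

lemma weak_pair_push_N1:
  fixes v :: "real^'n \<Rightarrow> real"
  assumes wp: "weak_pair (ball 0 2) v H" and v: "integrable lborel v" and h: "smooth_on UNIV h"
    and vh: "\<And>x. norm x < 1 \<Longrightarrow> v x = h x" and Hh: "\<And>x. norm x < 1 \<Longrightarrow> H x = grad h x"
    and \<phi>: "test_fun N1 \<phi>"
  shows "(\<integral>y. push_fun v y * partial_deriv \<phi> i y \<partial>lborel) = - (\<integral>y. push_grad H y $ i * \<phi> y \<partial>lborel)"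
proof -
  obtain K where K: "compact K" "K \<subseteq> N1" "\<And>x. x \<notin> K \<Longrightarrow> \<phi> x = 0"
    using \<phi> by (rule test_funE) blast
  obtain d where d: "0 < d" "\<And>y. y \<in> K \<Longrightarrow> 1 + d \<le> norm y" using compact_in_N1[OF K(1,2)] by blast
  have Kb: "K \<in> sets borel" using K(1) by (simp add: borel_compact)
  have d0: "partial_deriv \<phi> i x = 0" if "x \<notin> K" for x
    by (rule partial_deriv_zero_open[of "- K"]) (use K that compact_imp_closed in auto)
  have "push_fun v y * partial_deriv \<phi> i y = v (Fi y) * partial_deriv \<phi> i y" for y
    using d0[of y] K(2) by (cases "y \<in> K") (auto simp: push_fun_def N1_iff)
  then have "(\<integral>y. push_fun v y * partial_deriv \<phi> i y \<partial>lborel) = (\<integral>y. v (Fi y) * partial_deriv \<phi> i y \<partial>lborel)"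
    by (intro Bochner_Integration.integral_cong refl)
  also have "\<dots> = - (\<integral>y. indicator K y * ((H (Fi y) \<bullet> DFi y (axis i 1)) * \<phi> y) \<partial>lborel)"
  proof (rule weak_chain_rule[OF wp v open_N1 _ _ _ K(1,2) comp_bound_Fi[OF Kb K(2) d] test_fun_smooth[OF \<phi>] K(3)])
    show "Fi ` N1 \<subseteq> ball 0 2" by (auto dest!: Fi_in_N0 simp: N0_iff)
    show "(Fi has_derivative DFi y) (at y)" if "y \<in> N1" for y
      using that by (intro Fi_has_derivative) (auto simp: N1_iff)
    show "smooth_on N1 (\<lambda>y. Fi y $ j)" for j by (rule smooth_on_subset[OF smooth_on_Fi]) (auto simp: N1_iff)
  qed
  also have "(\<integral>y. indicator K y * ((H (Fi y) \<bullet> DFi y (axis i 1)) * \<phi> y) \<partial>lborel) = (\<integral>y. push_grad H y $ i * \<phi> y \<partial>lborel)"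
  proof (rule Bochner_Integration.integral_cong[OF refl])
    fix y
    have "H (Fi y) \<bullet> DFi y (axis i 1) = DFi y (H (Fi y)) $ i" by (simp add: inner_DFi[symmetric] inner_axis)
    then show "indicator K y * ((H (Fi y) \<bullet> DFi y (axis i 1)) * \<phi> y) = push_grad H y $ i * \<phi> y"
      using K(3)[of y] K(2) by (auto simp: indicator_def push_grad_def)
  qed
  finally show ?thesis .
qed

text \<open>Across the sphere the transplanted function is Lipschitz, so the cutoffs transplanted from the
  origin cost nothing in the limit.\<close>
lemma weak_pair_push:
  fixes v :: "real^'n \<Rightarrow> real"
  assumes wp: "weak_pair (ball 0 2) v H" and v: "integrable lborel v" and h: "smooth_on UNIV h"
    and vh: "\<And>x. norm x < 1 \<Longrightarrow> v x = h x" and Hh: "\<And>x. norm x < 1 \<Longrightarrow> H x = grad h x"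
  shows "weak_pair (ball 0 2) (push_fun v) (push_grad H)"
  unfolding weak_pair_def
proof (intro conjI allI impI)
  let ?u = "push_fun v" and ?G = "push_grad H"
  show su: "sqint ?u" by (rule sqint_push_fun[OF weak_pairD(1)[OF wp] h vh])
  show sG: "sqint (\<lambda>y. ?G y $ i)" for i by (rule sqint_push_grad[OF weak_pairD(2)[OF wp] h Hh])
  fix \<phi> :: "real^'n \<Rightarrow> real" and i assume \<phi>: "test_fun (ball 0 2) \<phi>"
  have [measurable]: "?u \<in> borel_measurable borel" "(\<lambda>y. ?G y $ i) \<in> borel_measurable borel"
     "\<phi> \<in> borel_measurable borel" "partial_deriv \<phi> i \<in> borel_measurable borel"
    using su sG[of i] \<phi> test_fun_measurable[OF test_fun_partial_deriv[OF \<phi>]] by (auto simp: sqint_def test_fun_measurable)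
  obtain K where K: "compact K" "K \<subseteq> ball 0 2" "\<And>x. x \<notin> K \<Longrightarrow> \<phi> x = 0"
    using \<phi> by (rule test_funE) blast
  have d0: "partial_deriv \<phi> i x = 0" if "x \<notin> K" for x
    by (rule partial_deriv_zero_open[of "- K"]) (use K that compact_imp_closed in auto)
  obtain C where C: "C > 0" "\<And>k (x :: real^'n). norm (grad (cut k) x) \<le> C * real (Suc k)"
    "\<And>k (x :: real^'n). 2 / real (Suc k) < norm x \<Longrightarrow> grad (cut k) x = 0" using grad_cut_bound by blast
  obtain L where L: "L > 0" "\<And>x. norm x \<le> 1 \<Longrightarrow> norm (grad h x) \<le> L" using smooth_on_grad_bounded_cball[OF h] by blast
  have hL: "\<bar>h x - h 0\<bar> \<le> L * norm x" if "norm x \<le> 1" for x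
    using mean_value_bound[of "cball 0 1" h L 0 x] smooth_on_differentiable[OF h] L(2) that by auto
  \<comment> \<open>\<phi> cut off near the unit sphere by the transplanted cutoff; the cutoff
    vanishes for |y| up to 1 + 1/(2(k+1)).\<close>
  define \<psi> where "\<psi> k y = (if y \<in> N1 then cut k (Fi y) * \<phi> y else 0)" for k y
  have t\<psi>: "test_fun N1 (\<psi> k)" for k
    unfolding \<psi>_def
  proof (rule test_fun_extend[OF open_N1, where K = "K - ball 0 (1 + 1 / (2 * real (Suc k)))" and f = "\<lambda>y. cut k (Fi y) * \<phi> y"])
    show "smooth_on N1 (\<lambda>y. cut k (Fi y) * \<phi> y)"
      by (intro smooth_on_mult open_N1 smooth_on_compose_Fi smooth_on_cut smooth_on_subset[OF test_fun_smooth[OF \<phi>]])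
         (auto simp: N1_iff)
    show "compact (K - ball 0 (1 + 1 / (2 * real (Suc k))))" using K(1) by (intro compact_diff) auto
    show "K - ball 0 (1 + 1 / (2 * real (Suc k))) \<subseteq> N1"
    proof
      fix y assume y: "y \<in> K - ball 0 (1 + 1 / (2 * real (Suc k)))"
      have "0 < 1 / (2 * real (Suc k))" by simp
      moreover have "1 + 1 / (2 * real (Suc k)) \<le> norm y" "norm y < 2" using y K(2) by auto
      ultimately show "y \<in> N1" unfolding N1_iff by linarith
    qed
    show "cut k (Fi y) * \<phi> y = 0" if y: "y \<in> N1 - (K - ball 0 (1 + 1 / (2 * real (Suc k))))" for y
    proof (cases "y \<in> K")
      case True
      then have "norm y < 1 + 1 / (2 * real (Suc k))" "1 < norm y" using y by (auto simp: N1_iff)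
      then have "norm (Fi y) \<le> 1 / real (Suc k)" by (simp add: norm_Fi field_simps)
      then show ?thesis by (simp add: cut_eq_0)
    qed (simp add: K(3))
  qed
  define r where "r k y = (if y \<in> N1 then DFi y (grad (cut k) (Fi y)) $ i * \<phi> y else 0)" for k y
  have d\<psi>: "partial_deriv (\<psi> k) i y = (if y \<in> N1 then cut k (Fi y) * partial_deriv \<phi> i y else 0) + r k y" for k y
  proof (cases "y \<in> N1")
    case True
    then have y: "y \<noteq> 0" by (auto simp: N1_iff)
    have dc: "(\<lambda>y. cut k (Fi y)) differentiable (at y)"
      using smooth_on_differentiable[OF smooth_on_compose_Fi[OF open_N1 _ smooth_on_cut] True] by (simp add: N1_iff)
    have dp: "\<phi> differentiable (at y)" using smooth_on_differentiable[OF test_fun_smooth[OF \<phi>]] by simp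
    have "partial_deriv (\<psi> k) i y = partial_deriv (\<lambda>y. cut k (Fi y) * \<phi> y) i y"
      by (rule partial_deriv_cong_open[OF open_N1 True]) (use dc dp in \<open>auto simp: \<psi>_def\<close>)
    also have "\<dots> = cut k (Fi y) * partial_deriv \<phi> i y + partial_deriv (\<lambda>y. cut k (Fi y)) i y * \<phi> y"
      by (rule partial_deriv_mult[OF dc dp])
    also have "partial_deriv (\<lambda>y. cut k (Fi y)) i y = DFi y (grad (cut k) (Fi y)) $ i"
      using grad_compose_Fi[OF y smooth_on_differentiable[OF smooth_on_cut UNIV_I], of k] grad_component by metis
    finally show ?thesis using True by (simp add: r_def)
  next
    case False
    obtain K' where K': "compact K'" "K' \<subseteq> N1" "\<And>x. x \<notin> K' \<Longrightarrow> \<psi> k x = 0"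
      using t\<psi>[of k] by (rule test_funE) blast
    have "partial_deriv (\<psi> k) i y = 0"
      by (rule partial_deriv_zero_open[of "- K'"]) (use K' False compact_imp_closed in auto)
    then show ?thesis using False by (simp add: r_def)
  qed
  \<comment> \<open>Subtracting the value at the sphere changes no pairing, as derivatives of test
    functions integrate to zero, and makes the function vanish at the sphere, which offsets the
    growing gradient of the cutoff.\<close>
  let ?h0 = "h 0"
  have v0: "v 0 = ?h0" using vh[of 0] by simp
  \<comment> \<open>The shift by 2 gives 2/(k+3) < 1, so that \<open>Fi y\<close> lies where
    \<open>v\<close> is \<open>h\<close>. The function is at most 2 L/(k+3) and the cutoff gradient
    at most 4 C (k+3); the product is 8 C L.\<close>
  have rb: "\<bar>(?u y - ?h0) * r (k + 2) y\<bar> \<le> 8 * C * L * \<bar>\<phi> y\<bar>"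
    and rz: "2 / real (k + 3) < norm (Fi y) \<Longrightarrow> r (k + 2) y = 0" for k and y :: "real^'n"
  proof -
    show rz': "r (k + 2) y = 0" if "2 / real (k + 3) < norm (Fi y)"
      using C(3)[of "k + 2" "Fi y"] that linear_0[OF linear_DFi[of y]] by (simp add: r_def add.commute)
    show "\<bar>(?u y - ?h0) * r (k + 2) y\<bar> \<le> 8 * C * L * \<bar>\<phi> y\<bar>"
    proof (cases "y \<in> N1 \<and> norm (Fi y) \<le> 2 / real (k + 3)")
      case True
      then have y: "1 < norm y" "norm y < 2" by (auto simp: N1_iff)
      have "norm (Fi y) \<le> 2 / real (k + 3)" using True by simp
      also have "2 / real (k + 3) < 1" by simp
      finally have F1: "norm (Fi y) < 1" .
      have uh: "\<bar>?u y - ?h0\<bar> \<le> L * (2 / real (k + 3))"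
      proof -
        have "\<bar>h (Fi y) - h 0\<bar> \<le> L * norm (Fi y)" by (rule hL[OF less_imp_le[OF F1]])
        also have "\<dots> \<le> L * (2 / real (k + 3))" using True L(1) by (intro mult_left_mono) auto
        finally show ?thesis using y vh[OF F1] by (simp add: push_fun_def)
      qed
      have "\<bar>DFi y (grad (cut (k + 2)) (Fi y)) $ i\<bar> \<le> norm (DFi y (grad (cut (k + 2)) (Fi y)))"
        by (rule component_le_norm_cart)
      also have "\<dots> \<le> 4 * norm (grad (cut (k + 2)) (Fi y))" by (rule norm_DFi_le[OF y(1)])
      also have "\<dots> \<le> 4 * (C * real (k + 3))" using C(2)[of "k + 2" "Fi y"] by (simp add: add.commute)
      finally have "\<bar>?u y - ?h0\<bar> * \<bar>DFi y (grad (cut (k + 2)) (Fi y)) $ i\<bar> \<le> (L * (2 / real (k + 3))) * (4 * (C * real (k + 3)))"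
        using uh L(1) by (intro mult_mono) auto
      also have "\<dots> = 8 * C * L" by (simp add: field_simps)
      finally have "\<bar>?u y - ?h0\<bar> * \<bar>DFi y (grad (cut (k + 2)) (Fi y)) $ i\<bar> * \<bar>\<phi> y\<bar> \<le> 8 * C * L * \<bar>\<phi> y\<bar>"
        by (rule mult_right_mono) simp
      then show ?thesis using True by (simp add: r_def abs_mult mult.assoc)
    next
      case False
      then have "r (k + 2) y = 0" using rz' by (cases "y \<in> N1") (auto simp: r_def)
      then show ?thesis using C(1) L(1) by simp
    qed
  qed
  have i1: "integrable lborel (\<lambda>y. ?u y * partial_deriv \<phi> i y)"
    by (rule sqint_mult_integrable[OF su test_fun_sqint[OF test_fun_partial_deriv[OF \<phi>]]])
  have i2: "integrable lborel (\<lambda>y. (?u y - ?h0) * partial_deriv \<phi> i y)"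
    using i1 test_fun_integrable[OF test_fun_partial_deriv[OF \<phi>], of i] by (simp add: left_diff_distrib)
  have i3: "integrable lborel (\<lambda>y. ?G y $ i * \<phi> y)"
    by (rule sqint_mult_integrable[OF sG test_fun_sqint[OF \<phi>]])
  have [measurable]: "partial_deriv (\<psi> k) i \<in> borel_measurable borel" "\<psi> k \<in> borel_measurable borel" for k
    using test_fun_measurable[OF test_fun_partial_deriv[OF t\<psi>]] test_fun_measurable[OF t\<psi>] by auto
  have lim1: "(\<lambda>k. \<integral>y. (?u y - ?h0) * partial_deriv (\<psi> (k + 2)) i y \<partial>lborel) \<longlonglongrightarrow> (\<integral>y. (?u y - ?h0) * partial_deriv \<phi> i y \<partial>lborel)"
  proof (rule integral_dominated_convergence)
    show "integrable lborel (\<lambda>y. \<bar>(?u y - ?h0) * partial_deriv \<phi> i y\<bar> + 8 * C * L * \<bar>\<phi> y\<bar>)"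
      using i2 test_fun_integrable[OF \<phi>] by (intro Bochner_Integration.integrable_add integrable_abs integrable_mult_right) auto
    show "AE y in lborel. norm ((?u y - ?h0) * partial_deriv (\<psi> (k + 2)) i y) \<le> \<bar>(?u y - ?h0) * partial_deriv \<phi> i y\<bar> + 8 * C * L * \<bar>\<phi> y\<bar>" for k
    proof (rule AE_I2)
      fix y :: "real^'n"
      let ?c = "if y \<in> N1 then cut (k + 2) (Fi y) else 0"
      have "\<bar>?c\<bar> \<le> 1" using abs_cut_le by auto
      then have "\<bar>?c\<bar> * \<bar>(?u y - ?h0) * partial_deriv \<phi> i y\<bar> \<le> 1 * \<bar>(?u y - ?h0) * partial_deriv \<phi> i y\<bar>"
        by (rule mult_right_mono) simp
      moreover have "(?u y - ?h0) * partial_deriv (\<psi> (k + 2)) i y = ?c * ((?u y - ?h0) * partial_deriv \<phi> i y) + (?u y - ?h0) * r (k + 2) y"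
        unfolding d\<psi> by (simp add: algebra_simps)
      ultimately show "norm ((?u y - ?h0) * partial_deriv (\<psi> (k + 2)) i y) \<le> \<bar>(?u y - ?h0) * partial_deriv \<phi> i y\<bar> + 8 * C * L * \<bar>\<phi> y\<bar>"
        using rb[of y k] abs_triangle_ineq[of "?c * ((?u y - ?h0) * partial_deriv \<phi> i y)" "(?u y - ?h0) * r (k + 2) y"]
        by (simp only: real_norm_def abs_mult[of ?c])
    qed
    show "AE y in lborel. (\<lambda>k. (?u y - ?h0) * partial_deriv (\<psi> (k + 2)) i y) \<longlonglongrightarrow> (?u y - ?h0) * partial_deriv \<phi> i y"
    proof (rule AE_I2)
      fix y :: "real^'n"
      show "(\<lambda>k. (?u y - ?h0) * partial_deriv (\<psi> (k + 2)) i y) \<longlonglongrightarrow> (?u y - ?h0) * partial_deriv \<phi> i y"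
      proof (cases "y \<in> N1")
        case True
        then have y: "1 < norm y" by (simp add: N1_iff)
        then have F0: "0 < norm (Fi y)" "Fi y \<noteq> 0" using norm_Fi[of y] by auto
        have "(\<lambda>k. 2 * inverse (real (Suc (k + 2)))) \<longlonglongrightarrow> 2 * 0"
          by (intro tendsto_intros LIMSEQ_ignore_initial_segment[OF LIMSEQ_inverse_real_of_nat, of 2])
        from order_tendstoD(2)[OF this, of "norm (Fi y)"] F0
        have "eventually (\<lambda>k. 2 * inverse (real (Suc (k + 2))) < norm (Fi y)) sequentially" by simp
        then have "eventually (\<lambda>k. r (k + 2) y = 0) sequentially"
          by eventually_elim (rule rz, simp add: inverse_eq_divide add.commute)
        then have "(\<lambda>k. r (k + 2) y) \<longlonglongrightarrow> 0" by (rule tendsto_eventually)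
        moreover have "(\<lambda>k. cut (k + 2) (Fi y)) \<longlonglongrightarrow> 1"
          by (rule LIMSEQ_ignore_initial_segment[OF cut_tendsto[OF F0(2)]])
        ultimately have "(\<lambda>k. (?u y - ?h0) * (cut (k + 2) (Fi y) * partial_deriv \<phi> i y + r (k + 2) y)) \<longlonglongrightarrow> (?u y - ?h0) * (1 * partial_deriv \<phi> i y + 0)"
          by (intro tendsto_intros)
        then show ?thesis using True by (simp add: d\<psi>)
      next
        case False
        \<comment> \<open>In the closed unit ball the first factor vanishes by the choice of
          constant, outside the ball of radius 2 the second does.\<close>
        have "(?u y - ?h0) * partial_deriv \<phi> i y = 0"
        proof (cases "norm y \<le> 1")
          case False
          then have "y \<notin> K" using \<open>y \<notin> N1\<close> K(2) by (auto simp: N1_iff)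
          then show ?thesis using d0 by simp
        qed (simp add: push_fun_def v0)
        note e = this
        show ?thesis unfolding e using False by (simp add: d\<psi> r_def)
      qed
    qed
  qed measurable
  have lim2: "(\<lambda>k. \<integral>y. ?G y $ i * \<psi> (k + 2) y \<partial>lborel) \<longlonglongrightarrow> (\<integral>y. ?G y $ i * \<phi> y \<partial>lborel)"
  proof (rule integral_dominated_convergence)
    show "integrable lborel (\<lambda>y. \<bar>?G y $ i * \<phi> y\<bar>)" using i3 by simp
    show "AE y in lborel. norm (?G y $ i * \<psi> (k + 2) y) \<le> \<bar>?G y $ i * \<phi> y\<bar>" for k
    proof (rule AE_I2)
      fix y :: "real^'n"
      have "\<bar>\<psi> (k + 2) y\<bar> \<le> \<bar>\<phi> y\<bar>"
        using mult_right_mono[OF abs_cut_le[of "k + 2" "Fi y"], of "\<bar>\<phi> y\<bar>"] by (simp add: \<psi>_def abs_mult)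
      then show "norm (?G y $ i * \<psi> (k + 2) y) \<le> \<bar>?G y $ i * \<phi> y\<bar>" by (simp add: abs_mult mult_left_mono)
    qed
    show "AE y in lborel. (\<lambda>k. ?G y $ i * \<psi> (k + 2) y) \<longlonglongrightarrow> ?G y $ i * \<phi> y"
    proof (rule AE_I2)
      fix y :: "real^'n"
      show "(\<lambda>k. ?G y $ i * \<psi> (k + 2) y) \<longlonglongrightarrow> ?G y $ i * \<phi> y"
      proof (cases "y \<in> N1")
        case True
        then have "Fi y \<noteq> 0" using norm_Fi[of y] by (auto simp: N1_iff)
        then have "(\<lambda>k. cut (k + 2) (Fi y)) \<longlonglongrightarrow> 1"
          by (rule LIMSEQ_ignore_initial_segment[OF cut_tendsto])
        then have "(\<lambda>k. ?G y $ i * (cut (k + 2) (Fi y) * \<phi> y)) \<longlonglongrightarrow> ?G y $ i * (1 * \<phi> y)"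
          by (intro tendsto_intros)
        then show ?thesis using True by (simp add: \<psi>_def)
      qed (simp add: push_grad_def)
    qed
  qed measurable
  have eq: "(\<integral>y. (?u y - ?h0) * partial_deriv (\<psi> k) i y \<partial>lborel) = - (\<integral>y. ?G y $ i * \<psi> k y \<partial>lborel)" for k
  proof -
    have a: "integrable lborel (\<lambda>y. ?u y * partial_deriv (\<psi> k) i y)"
      by (rule sqint_mult_integrable[OF su test_fun_sqint[OF test_fun_partial_deriv[OF t\<psi>]]])
    have b: "integrable lborel (\<lambda>y. ?h0 * partial_deriv (\<psi> k) i y)"
      using test_fun_integrable[OF test_fun_partial_deriv[OF t\<psi>]] by simp
    have "(\<integral>y. (?u y - ?h0) * partial_deriv (\<psi> k) i y \<partial>lborel)
       = (\<integral>y. ?u y * partial_deriv (\<psi> k) i y \<partial>lborel) - ?h0 * (\<integral>y. partial_deriv (\<psi> k) i y \<partial>lborel)"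
      using a b by (simp add: left_diff_distrib)
    also have "(\<integral>y. partial_deriv (\<psi> k) i y \<partial>lborel) = 0"
      by (rule integral_partial_deriv_zero[OF test_fun_mono[OF t\<psi> subset_UNIV]])
    finally show ?thesis using weak_pair_push_N1[OF wp v h vh Hh t\<psi>] by simp
  qed
  have "(\<integral>y. (?u y - ?h0) * partial_deriv \<phi> i y \<partial>lborel) = - (\<integral>y. ?G y $ i * \<phi> y \<partial>lborel)"
    by (rule LIMSEQ_unique[OF lim1]) (simp only: eq tendsto_minus[OF lim2])
  moreover have "(\<integral>y. (?u y - ?h0) * partial_deriv \<phi> i y \<partial>lborel) = (\<integral>y. ?u y * partial_deriv \<phi> i y \<partial>lborel)"
  proof -
    have b: "integrable lborel (\<lambda>y. ?h0 * partial_deriv \<phi> i y)"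
      using test_fun_integrable[OF test_fun_partial_deriv[OF \<phi>]] by simp
    have "(\<integral>y. (?u y - ?h0) * partial_deriv \<phi> i y \<partial>lborel)
       = (\<integral>y. ?u y * partial_deriv \<phi> i y \<partial>lborel) - ?h0 * (\<integral>y. partial_deriv \<phi> i y \<partial>lborel)"
      using i1 b by (simp add: left_diff_distrib)
    also have "(\<integral>y. partial_deriv \<phi> i y \<partial>lborel) = 0"
      by (rule integral_partial_deriv_zero[OF test_fun_mono[OF \<phi> subset_UNIV]])
    finally show ?thesis by simp
  qed
  ultimately show "(\<integral>y. ?u y * partial_deriv \<phi> i y \<partial>lborel) = - (\<integral>y. ?G y $ i * \<phi> y \<partial>lborel)" by simp
qed

lemma DF_push_grad: "x \<in> N0 \<Longrightarrow> DF x (push_grad H (F1 x)) = H x"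
  using F1_in_N1[of x] DF_DFi[of "F1 x" "H x"] Fi_F1[of x]
  by (auto simp: push_grad_def N0_iff N1_iff)

text \<open>The energy identity turns the pairing into that of \<open>H\<close> with the gradient of
  \<phi> composed with \<open>F1\<close>. This composition is bounded but in general has no limit at
  the origin, so it is cut off there; the extra term has a bounded factor and vanishes by the
  capacity estimate.\<close>

lemma push_solution:
  fixes H :: "real^'n \<Rightarrow> real^'n"
  assumes dim: "CARD('n) \<ge> 3" and H: "\<And>i. sqint (\<lambda>x. H x $ i)" and G: "\<And>i. sqint (\<lambda>x. push_grad H x $ i)"
    and harm: "\<And>\<phi>. test_fun (ball 0 2) \<phi> \<Longrightarrow> (\<integral>x. H x \<bullet> grad \<phi> x \<partial>lborel) = 0"
    and \<phi>: "test_fun (ball 0 2) \<phi>"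
  shows "(\<integral>y. indicator N1 y * (Sv y (push_grad H y) \<bullet> grad \<phi> y) \<partial>lborel) = 0"
proof -
  have g\<phi>: "sqint (\<lambda>x. grad \<phi> x $ i)" for i using test_fun_sqint[OF test_fun_partial_deriv[OF \<phi>]] by simp
  have [measurable]: "H \<in> borel_measurable borel" "push_grad H \<in> borel_measurable borel" "grad \<phi> \<in> borel_measurable borel"
     "\<phi> \<in> borel_measurable borel"
    using sqint_norm(2)[OF H] sqint_norm(2)[OF G] sqint_norm(2)[OF g\<phi>] test_fun_measurable[OF \<phi>] by auto
  let ?q = "\<lambda>x. indicator N0 x * (H x \<bullet> DF x (grad \<phi> (F1 x)))"
  have eq: "indicator N0 x * (DF x (push_grad H (F1 x)) \<bullet> DF x (grad \<phi> (F1 x))) = ?q x" for x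
    by (cases "x \<in> N0") (auto simp: DF_push_grad)
  have iq: "integrable lborel ?q"
    using energy_identity(1)[of "push_grad H" "grad \<phi>"] integrable_Sv[OF dim G g\<phi>] by (simp add: eq)
  have q: "(\<integral>y. indicator N1 y * (Sv y (push_grad H y) \<bullet> grad \<phi> y) \<partial>lborel) = (\<integral>x. ?q x \<partial>lborel)"
    using energy_identity(2)[of "push_grad H" "grad \<phi>"] by (simp add: eq)
  obtain K where K: "compact K" "K \<subseteq> ball 0 2" "\<And>x. x \<notin> K \<Longrightarrow> \<phi> x = 0"
    using \<phi> by (rule test_funE) blast
  obtain B where B: "B > 0" "\<And>x. \<bar>\<phi> x\<bar> \<le> B" using test_fun_bounded[OF \<phi>] by blast
  let ?g = "\<lambda>x. indicator N0 x * \<phi> (F1 x)"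
  have gB: "\<bar>?g x\<bar> \<le> B" for x using B by (simp add: indicator_def)
  define \<psi> where "\<psi> k x = (if x \<in> N0 then cut k x * \<phi> (F1 x) else 0)" for k x
  have t\<psi>: "test_fun N0 (\<psi> k)" for k
    unfolding \<psi>_def
  proof (rule test_fun_extend[OF open_N0, where K = "Fi ` (K - ball 0 (1 + 1 / (2 * real (Suc k))))" and f = "\<lambda>x. cut k x * \<phi> (F1 x)"])
    let ?K = "K - ball 0 (1 + 1 / (2 * real (Suc k)))"
    have p: "0 < 1 / (2 * real (Suc k))" by simp
    have sub: "?K \<subseteq> N1"
    proof
      fix y assume y: "y \<in> ?K"
      have "1 + 1 / (2 * real (Suc k)) \<le> norm y" "norm y < 2" using y K(2) by auto
      with p show "y \<in> N1" unfolding N1_iff by linarith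
    qed
    show "smooth_on N0 (\<lambda>x. cut k x * \<phi> (F1 x))"
      by (intro smooth_on_mult open_N0 smooth_on_compose_F1 smooth_on_subset[OF smooth_on_cut] test_fun_smooth[OF \<phi>])
         (auto simp: N0_iff)
    have "continuous_on ?K Fi"
    proof (rule has_derivative_continuous_on)
      fix y assume "y \<in> ?K"
      then have "y \<noteq> 0" using sub by (auto simp: N1_iff)
      then show "(Fi has_derivative DFi y) (at y within ?K)"
        by (rule has_derivative_at_withinI[OF Fi_has_derivative])
    qed
    moreover have "compact ?K" using K(1) by (intro compact_diff) auto
    ultimately show "compact (Fi ` ?K)" by (rule compact_continuous_image)
    show "Fi ` ?K \<subseteq> N0" using sub Fi_in_N0 by auto
    show "cut k x * \<phi> (F1 x) = 0" if x: "x \<in> N0 - Fi ` ?K" for x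
    proof (cases "F1 x \<in> K")
      case True
      have x0: "x \<noteq> 0" using x by (simp add: N0_iff)
      have "F1 x \<notin> ?K" using x Fi_F1[OF x0] by (metis DiffD2 imageI)
      then have "norm x / 2 < 1 / (2 * real (Suc k))" using True norm_F1[OF x0] by simp
      then have "norm x \<le> 1 / real (Suc k)" by (simp add: field_simps)
      then show ?thesis by (simp add: cut_eq_0)
    qed (simp add: K(3))
  qed
  have d\<psi>: "H x \<bullet> grad (\<psi> k) x = cut k x * ?q x + (\<Sum>i\<in>UNIV. H x $ i * (?g x * partial_deriv (cut k) i x))" for k x
  proof (cases "x \<in> N0")
    case True
    then have x: "x \<noteq> 0" by (auto simp: N0_iff)
    have df: "\<phi> differentiable (at z)" for z using smooth_on_differentiable[OF test_fun_smooth[OF \<phi>]] by simp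
    have dp: "(\<lambda>x. \<phi> (F1 x)) differentiable (at x)"
      using smooth_on_differentiable[OF smooth_on_compose_F1[OF open_N0 _ test_fun_smooth[OF \<phi>]] True] by (simp add: N0_iff)
    have dc: "cut k differentiable (at x)" by (rule smooth_on_differentiable[OF smooth_on_cut UNIV_I])
    have "grad (\<psi> k) x $ i = cut k x * DF x (grad \<phi> (F1 x)) $ i + partial_deriv (cut k) i x * \<phi> (F1 x)" for i
    proof -
      have "partial_deriv (\<psi> k) i x = partial_deriv (\<lambda>x. cut k x * \<phi> (F1 x)) i x"
        by (rule partial_deriv_cong_open[OF open_N0 True]) (use dc dp in \<open>auto simp: \<psi>_def\<close>)
      also have "\<dots> = cut k x * partial_deriv (\<lambda>x. \<phi> (F1 x)) i x + partial_deriv (cut k) i x * \<phi> (F1 x)"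
        by (rule partial_deriv_mult[OF dc dp])
      also have "partial_deriv (\<lambda>x. \<phi> (F1 x)) i x = DF x (grad \<phi> (F1 x)) $ i"
        using grad_compose_F1[OF x df] grad_component by metis
      finally show ?thesis by simp
    qed
    then have "H x \<bullet> grad (\<psi> k) x = (\<Sum>i\<in>UNIV. H x $ i * (cut k x * DF x (grad \<phi> (F1 x)) $ i + partial_deriv (cut k) i x * \<phi> (F1 x)))"
      unfolding inner_vec_def by simp
    also have "\<dots> = cut k x * (H x \<bullet> DF x (grad \<phi> (F1 x))) + (\<Sum>i\<in>UNIV. H x $ i * (\<phi> (F1 x) * partial_deriv (cut k) i x))"
      unfolding inner_vec_def by (simp add: sum_distrib_left sum.distrib algebra_simps)
    finally show ?thesis using True by simp
  next
    case False
    obtain K' where K': "compact K'" "K' \<subseteq> N0" "\<And>x. x \<notin> K' \<Longrightarrow> \<psi> k x = 0"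
      using t\<psi>[of k] by (rule test_funE) blast
    have "partial_deriv (\<psi> k) i x = 0" for i
      by (rule partial_deriv_zero_open[of "- K'"]) (use K' False compact_imp_closed in auto)
    then have "grad (\<psi> k) x = 0" by (simp add: vec_eq_iff)
    then show ?thesis using False by simp
  qed
  have gm: "?g \<in> borel_measurable borel" by measurable
  have ic: "integrable lborel (\<lambda>x. cut k x * ?q x)" for k
    by (rule integrable_mult_bounded[OF iq _ abs_cut_le]) measurable
  note ir = integral_grad_cut_tendsto_0(2)[OF dim H gm gB]
  have "0 = (\<integral>x. cut k x * ?q x \<partial>lborel) + (\<Sum>i\<in>UNIV. \<integral>x. H x $ i * (?g x * partial_deriv (cut k) i x) \<partial>lborel)" for k
  proof -
    have "test_fun (ball 0 2) (\<psi> k)" by (rule test_fun_mono[OF t\<psi>]) (auto simp: N0_iff)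
    from harm[OF this] have "0 = (\<integral>x. cut k x * ?q x + (\<Sum>i\<in>UNIV. H x $ i * (?g x * partial_deriv (cut k) i x)) \<partial>lborel)"
      by (simp only: d\<psi>)
    also have "\<dots> = (\<integral>x. cut k x * ?q x \<partial>lborel) + (\<integral>x. (\<Sum>i\<in>UNIV. H x $ i * (?g x * partial_deriv (cut k) i x)) \<partial>lborel)"
      by (rule Bochner_Integration.integral_add[OF ic Bochner_Integration.integrable_sum[OF ir]])
    also have "(\<integral>x. (\<Sum>i\<in>UNIV. H x $ i * (?g x * partial_deriv (cut k) i x)) \<partial>lborel)
       = (\<Sum>i\<in>UNIV. \<integral>x. H x $ i * (?g x * partial_deriv (cut k) i x) \<partial>lborel)"
      by (rule Bochner_Integration.integral_sum[OF ir])
    finally show ?thesis .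
  qed
  moreover have "(\<lambda>k. (\<integral>x. cut k x * ?q x \<partial>lborel) + (\<Sum>i\<in>UNIV. \<integral>x. H x $ i * (?g x * partial_deriv (cut k) i x) \<partial>lborel))
    \<longlonglongrightarrow> (\<integral>x. ?q x \<partial>lborel) + (\<Sum>i\<in>(UNIV :: 'n set). 0)"
    by (intro tendsto_add integral_cut_tendsto iq tendsto_sum integral_grad_cut_tendsto_0(1)[OF dim H gm gB])
  ultimately have "(\<lambda>k::nat. 0) \<longlonglongrightarrow> (\<integral>x. ?q x \<partial>lborel)" by simp
  then show ?thesis unfolding q by (simp add: LIMSEQ_const_iff)
qed

subsection \<open>Approximation of functions vanishing on the boundary\<close>

text \<open>Cutoff at the outer sphere: zero where 4 - |x|^2 is at most 1/(j+1), one where it is at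
  least 2/(j+1).\<close>

definition rho :: "nat \<Rightarrow> real^'n \<Rightarrow> real" where
  "rho j x = step (real (Suc j) * (4 - x \<bullet> x) - 1)"

lemma smooth_on_rho: "smooth_on UNIV (rho j)"
  unfolding rho_def[abs_def]
  by (intro smooth_on_step smooth_on_diff smooth_on_cmult smooth_on_const smooth_on_inner_self) auto

lemma abs_rho_le: "\<bar>rho j x\<bar> \<le> 1"
  unfolding rho_def using step_nonneg step_le_1 by (simp add: abs_of_nonneg)

lemma rho_eventually_1:
  assumes "norm x < 2" shows "eventually (\<lambda>j. 2 < real (Suc j) * (4 - x \<bullet> x)) sequentially"
proof -
  have "(norm x)\<^sup>2 < 2\<^sup>2" using assms by (intro power_strict_mono) auto
  then have d: "0 < 4 - x \<bullet> x" by (simp add: power2_norm_eq_inner)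
  then obtain m where "2 < real m * (4 - x \<bullet> x)" using reals_Archimedean3 by blast
  then have "2 < real (Suc j) * (4 - x \<bullet> x)" if "j \<ge> m" for j
  proof -
    have "real m * (4 - x \<bullet> x) \<le> real (Suc j) * (4 - x \<bullet> x)" using that d by (intro mult_right_mono) auto
    with \<open>2 < real m * (4 - x \<bullet> x)\<close> show ?thesis by linarith
  qed
  then show ?thesis by (rule eventually_sequentiallyI)
qed

lemma grad_rho:
  obtains C where "0 \<le> C" "\<And>j (x :: real^'n). norm (grad (rho j) x) \<le> 2 * real (Suc j) * C * norm x"
    "\<And>j (x :: real^'n). 2 < real (Suc j) * (4 - x \<bullet> x) \<Longrightarrow> grad (rho j) x = 0"
proof -
  obtain s' C where s': "\<And>t. (step has_real_derivative s' t) (at t)" "\<And>t. \<bar>s' t\<bar> \<le> C"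
    "\<And>t. t \<le> 0 \<or> 1 \<le> t \<Longrightarrow> s' t = 0" using step_has_derivative_bounded by blast
  have C0: "0 \<le> C" using s'(2)[of 0] by linarith
  have g: "grad (rho j) x = (- (2 * real (Suc j)) * s' (real (Suc j) * (4 - x \<bullet> x) - 1)) *\<^sub>R x" for j and x :: "real^'n"
  proof (rule grad_eqI)
    let ?m = "real (Suc j)"
    have q: "((\<lambda>x :: real^'n. ?m * (4 - x \<bullet> x) - 1) has_derivative (\<lambda>h. - (?m * (2 * (x \<bullet> h))))) (at x)"
      by (auto intro!: derivative_eq_intros simp: inner_commute)
    have "(rho j has_derivative (\<lambda>h. (- (?m * (2 * (x \<bullet> h)))) * s' (?m * (4 - x \<bullet> x) - 1))) (at x)"
      unfolding rho_def[abs_def] by (rule DERIV_compose_FDERIV[OF s'(1) q])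
    then show "(rho j has_derivative (\<lambda>h. h \<bullet> (- (2 * ?m) * s' (?m * (4 - x \<bullet> x) - 1)) *\<^sub>R x)) (at x)"
      by (simp add: inner_commute mult.assoc mult.commute mult.left_commute del: of_nat_Suc)
  qed
  have "norm (grad (rho j) x) \<le> 2 * real (Suc j) * C * norm x" for j and x :: "real^'n"
    unfolding g norm_scaleR abs_mult using s'(2) by (intro mult_right_mono mult_mono) auto
  moreover have "grad (rho j) x = 0" if "2 < real (Suc j) * (4 - x \<bullet> x)" for j and x :: "real^'n"
    unfolding g using that by (subst s'(3)) auto
  ultimately show ?thesis using that C0 by blast
qed

lemma test_fun_rho:
  assumes "smooth_on UNIV \<zeta>" shows "test_fun (ball 0 2) (\<lambda>x. rho j x * \<zeta> x)"
proof (rule test_funI)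
  let ?K = "{x :: real^'a. x \<bullet> x \<le> 4 - 1 / real (Suc j)}"
  have sub: "norm x < 2" if "x \<in> ?K" for x
  proof -
    have "0 < 1 / real (Suc j)" by simp
    moreover have "x \<bullet> x \<le> 4 - 1 / real (Suc j)" using that by (simp only: mem_Collect_eq)
    ultimately have "x \<bullet> x < 4" by linarith
    then have "(norm x)\<^sup>2 < 2\<^sup>2" by (simp add: power2_norm_eq_inner)
    then show ?thesis by (rule power_less_imp_less_base) simp
  qed
  show "smooth_on UNIV (\<lambda>x. rho j x * \<zeta> x)" by (intro smooth_on_mult smooth_on_rho assms) simp
  have "closed ?K" by (intro closed_Collect_le continuous_intros)
  moreover have "bounded ?K" unfolding bounded_iff using sub by (intro exI[of _ 2]) (auto intro: less_imp_le)
  ultimately show "compact ?K" by (simp add: compact_eq_bounded_closed)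
  show "?K \<subseteq> ball 0 2" using sub by auto
  show "rho j x * \<zeta> x = 0" if "x \<notin> ?K" for x
  proof -
    have "real (Suc j) * (4 - x \<bullet> x) - 1 \<le> 0" using that by (simp add: field_simps)
    then show ?thesis by (simp add: rho_def step_eq_0 del: of_nat_Suc)
  qed
qed

text \<open>Compare x with its radial projection to the sphere, at distance 2 - |x|, and use 2 - |x|
  <= (2 - |x|)(2 + |x|). The point 0 is excluded because it has no projection.\<close>

lemma smooth_zero_boundary_bound:
  fixes \<zeta> :: "real^'n \<Rightarrow> real"
  assumes \<zeta>: "smooth_on UNIV \<zeta>" and z: "\<And>x. norm x = 2 \<Longrightarrow> \<zeta> x = 0" and L: "\<And>x. norm x \<le> 2 \<Longrightarrow> norm (grad \<zeta> x) \<le> L"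
    and x: "x \<noteq> 0" "norm x < 2"
  shows "\<bar>\<zeta> x\<bar> \<le> L * (4 - x \<bullet> x)"
proof -
  let ?y = "(2 / norm x) *\<^sub>R x"
  have y: "norm ?y = 2" using x by simp
  have L0: "0 \<le> L" by (rule order_trans[OF norm_ge_zero L[of 0]]) simp
  have "\<bar>\<zeta> x - \<zeta> ?y\<bar> \<le> L * norm (x - ?y)"
    by (rule mean_value_bound[of "cball 0 2"]) (use smooth_on_differentiable[OF \<zeta>] L x y in auto)
  also have "x - ?y = (1 - 2 / norm x) *\<^sub>R x" by (simp add: scaleR_diff_left)
  also have "norm \<dots> = 2 - norm x" using x by (simp add: abs_if field_simps)
  also have "2 - norm x \<le> 4 - x \<bullet> x"
  proof -
    have "(2 - norm x) * 1 \<le> (2 - norm x) * (2 + norm x)" using x by (intro mult_left_mono) auto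
    also have "\<dots> = 4 - x \<bullet> x" by (simp add: algebra_simps power2_norm_eq_inner[symmetric] power2_eq_square)
    finally show ?thesis by simp
  qed
  finally show ?thesis using z[OF y] L0 by (simp add: mult_left_mono)
qed

lemma L2lim_dominated:
  fixes f :: "real^'n \<Rightarrow> real"
  assumes [measurable]: "\<And>k. fs k \<in> borel_measurable borel" "f \<in> borel_measurable borel"
    and b: "\<And>k x. x \<in> ball 0 2 \<Longrightarrow> \<bar>fs k x - f x\<bar> \<le> B"
    and lim: "\<And>x. x \<in> ball 0 2 \<Longrightarrow> x \<noteq> 0 \<Longrightarrow> (\<lambda>k. fs k x) \<longlonglongrightarrow> f x"
  shows "L2lim (ball 0 2) fs f"
proof -
  have "(\<lambda>k. \<integral>\<^sup>+x. ennreal ((fs k x - f x)\<^sup>2) * indicator (ball 0 2) x \<partial>lborel) \<longlonglongrightarrow> (\<integral>\<^sup>+x. 0 \<partial>(lborel :: (real^'n) measure))"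
  proof (rule nn_integral_dominated_convergence)
    show "AE x in lborel. ennreal ((fs k x - f x)\<^sup>2) * indicator (ball 0 2) x \<le> ennreal (B\<^sup>2) * indicator (cball 0 2) x" for k
    proof (rule AE_I2)
      fix x :: "real^'n"
      have "(fs k x - f x)\<^sup>2 \<le> B\<^sup>2" if "x \<in> ball 0 2"
      proof -
        have "\<bar>fs k x - f x\<bar> \<le> \<bar>B\<bar>" using b[OF that, of k] by linarith
        then show ?thesis by (simp only: abs_le_square_iff)
      qed
      then show "ennreal ((fs k x - f x)\<^sup>2) * indicator (ball 0 2) x \<le> ennreal (B\<^sup>2) * indicator (cball 0 2) x"
        by (auto simp: indicator_def intro: ennreal_leI)
    qed
    show "(\<integral>\<^sup>+x. ennreal (B\<^sup>2) * indicator (cball 0 2) x \<partial>(lborel :: (real^'n) measure)) < \<infinity>"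
      using emeasure_compact_finite[of "cball (0::real^'n) 2"]
      by (simp add: nn_integral_cmult_indicator ennreal_mult_less_top)
    have "AE x in (lborel :: (real^'n) measure). x \<noteq> 0" by (rule AE_lborel_singleton)
    then show "AE x in lborel. (\<lambda>k. ennreal ((fs k x - f x)\<^sup>2) * indicator (ball 0 2) x) \<longlonglongrightarrow> 0"
    proof eventually_elim
      case (elim x)
      show ?case
      proof (cases "x \<in> ball 0 2")
        case True
        have "(\<lambda>k. ennreal ((fs k x - f x)\<^sup>2)) \<longlonglongrightarrow> ennreal ((f x - f x)\<^sup>2)"
          by (intro tendsto_intros lim[OF True elim])
        then show ?thesis using True by simp
      qed simp
    qed
  qed measurable
  then show ?thesis by (simp add: L2lim_def)
qed

lemma smooth_measurable: "smooth_on UNIV f \<Longrightarrow> f \<in> borel_measurable borel"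
  by (rule borel_measurable_continuous_UNIV[OF smooth_on_continuous])

text \<open>The gradient of \<open>rho\<close> is of order j but lives where the distance to the
  sphere is of order 1/j, and there \<zeta> is of order 1/j because it vanishes on the sphere. All
  terms are thus bounded and converge pointwise.\<close>

lemma rho_approx:
  fixes \<zeta> :: "real^'n \<Rightarrow> real"
  assumes \<zeta>: "smooth_on UNIV \<zeta>" and z: "\<And>x. norm x = 2 \<Longrightarrow> \<zeta> x = 0"
  shows "L2lim (ball 0 2) (\<lambda>j x. rho j x * \<zeta> x) \<zeta>"
    and "L2lim (ball 0 2) (\<lambda>j. partial_deriv (\<lambda>x. rho j x * \<zeta> x) i) (partial_deriv \<zeta> i)"
proof -
  obtain B where B: "B > 0" "\<And>x. norm x \<le> 2 \<Longrightarrow> \<bar>\<zeta> x\<bar> \<le> B" using smooth_on_bounded_cball[OF \<zeta>] by blast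
  obtain L where L: "L > 0" "\<And>x. norm x \<le> 2 \<Longrightarrow> norm (grad \<zeta> x) \<le> L" using smooth_on_grad_bounded_cball[OF \<zeta>] by blast
  obtain C where C: "0 \<le> C" "\<And>j (x :: real^'n). norm (grad (rho j) x) \<le> 2 * real (Suc j) * C * norm x"
    "\<And>j (x :: real^'n). 2 < real (Suc j) * (4 - x \<bullet> x) \<Longrightarrow> grad (rho j) x = 0" using grad_rho by blast
  note t = test_fun_rho[OF \<zeta>]
  have m: "(\<lambda>x. rho j x * \<zeta> x) \<in> borel_measurable borel" "partial_deriv (\<lambda>x. rho j x * \<zeta> x) i \<in> borel_measurable borel" for j
    using test_fun_measurable[OF t] test_fun_measurable[OF test_fun_partial_deriv[OF t]] by auto
  have m': "\<zeta> \<in> borel_measurable borel" "partial_deriv \<zeta> i \<in> borel_measurable borel"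
    using smooth_measurable[OF \<zeta>] smooth_measurable[OF smooth_on_partial_deriv[OF \<zeta>]] by auto
  have rho1: "eventually (\<lambda>j. rho j x = 1) sequentially" if "x \<in> ball 0 2" for x :: "real^'n"
    using rho_eventually_1[of x] that
    by (auto elim!: eventually_mono simp: rho_def step_eq_1 simp del: of_nat_Suc)
  have le1: "\<bar>rho j x * a - a\<bar> \<le> 2 * \<bar>a\<bar>" for j a and x :: "real^'n"
  proof -
    have "\<bar>rho j x * a\<bar> \<le> 1 * \<bar>a\<bar>" unfolding abs_mult by (rule mult_right_mono[OF abs_rho_le]) simp
    then show ?thesis by linarith
  qed
  show "L2lim (ball 0 2) (\<lambda>j x. rho j x * \<zeta> x) \<zeta>"
  proof (rule L2lim_dominated[OF m(1) m'(1)])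
    show "\<bar>rho k x * \<zeta> x - \<zeta> x\<bar> \<le> 2 * B" if "x \<in> ball 0 2" for k x
      using le1[of k x "\<zeta> x"] B(2)[of x] that by simp
    show "(\<lambda>k. rho k x * \<zeta> x) \<longlonglongrightarrow> \<zeta> x" if "x \<in> ball 0 2" for x
      by (rule tendsto_eventually) (use rho1[OF that] in \<open>auto elim!: eventually_mono\<close>)
  qed
  have d: "partial_deriv (\<lambda>x. rho j x * \<zeta> x) i x = rho j x * partial_deriv \<zeta> i x + partial_deriv (rho j) i x * \<zeta> x" for j x
    by (rule partial_deriv_mult[OF smooth_on_differentiable[OF smooth_on_rho UNIV_I] smooth_on_differentiable[OF \<zeta> UNIV_I]])
  have pz: "partial_deriv (rho j) i x = 0" if "2 < real (Suc j) * (4 - x \<bullet> x)" for j and x :: "real^'n"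
    using C(3)[OF that] by (metis grad_component zero_index)
  \<comment> \<open>Off the region where the gradient vanishes, 4 C (j+1) meets the bound L (4 -
    |x|^2), and (j+1)(4 - |x|^2) <= 2, which gives 8 C L.\<close>
  have pb: "\<bar>partial_deriv (rho j) i x * \<zeta> x\<bar> \<le> 8 * C * L" if x: "x \<in> ball 0 2" for j x
  proof (cases "x = 0 \<or> 2 < real (Suc j) * (4 - x \<bullet> x)")
    case True
    have "partial_deriv (rho j) i x = 0"
    proof (cases "x = 0")
      case True
      then have "norm (grad (rho j) x) \<le> 0" using C(2)[of j x] by simp
      then have "grad (rho j) x = 0" by simp
      then show ?thesis by (metis grad_component zero_index)
    qed (use True pz in blast)
    then show ?thesis using C(1) L(1) by simp
  next
    case False
    have "\<bar>partial_deriv (rho j) i x\<bar> \<le> norm (grad (rho j) x)" by (metis component_le_norm_cart grad_component)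
    also have "\<dots> \<le> 2 * real (Suc j) * C * norm x" by (rule C(2))
    also have "\<dots> \<le> 2 * real (Suc j) * C * 2" using x C(1) by (intro mult_left_mono) auto
    finally have a: "\<bar>partial_deriv (rho j) i x\<bar> \<le> 4 * C * real (Suc j)" by (simp add: algebra_simps)
    have "\<bar>\<zeta> x\<bar> \<le> L * (4 - x \<bullet> x)"
      by (rule smooth_zero_boundary_bound[OF \<zeta> z L(2)]) (use False x in auto)
    then have "\<bar>partial_deriv (rho j) i x\<bar> * \<bar>\<zeta> x\<bar> \<le> (4 * C * real (Suc j)) * (L * (4 - x \<bullet> x))"
      using a C(1) by (intro mult_mono) auto
    also have "\<dots> = 4 * C * L * (real (Suc j) * (4 - x \<bullet> x))" by (simp add: algebra_simps)
    also have "\<dots> \<le> 4 * C * L * 2" using False C(1) L(1) by (intro mult_left_mono) auto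
    finally show ?thesis by (simp add: abs_mult)
  qed
  show "L2lim (ball 0 2) (\<lambda>j. partial_deriv (\<lambda>x. rho j x * \<zeta> x) i) (partial_deriv \<zeta> i)"
  proof (rule L2lim_dominated[OF m(2) m'(2)])
    fix k and x :: "real^'n" assume x: "x \<in> ball 0 2"
    have "\<bar>partial_deriv \<zeta> i x\<bar> \<le> L"
      using L(2)[of x] x component_le_norm_cart[of "grad \<zeta> x" i] by simp
    then show "\<bar>partial_deriv (\<lambda>x. rho k x * \<zeta> x) i x - partial_deriv \<zeta> i x\<bar> \<le> 2 * L + 8 * C * L"
      using le1[of k x "partial_deriv \<zeta> i x"] pb[OF x, of k] unfolding d by linarith
  next
    fix x :: "real^'n" assume x: "x \<in> ball 0 2"
    have "eventually (\<lambda>j. 2 < real (Suc j) * (4 - x \<bullet> x)) sequentially" using x by (intro rho_eventually_1) simp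
    then have "eventually (\<lambda>j. partial_deriv (\<lambda>x. rho j x * \<zeta> x) i x = partial_deriv \<zeta> i x) sequentially"
      using rho1[OF x] by eventually_elim (simp add: d pz)
    then show "(\<lambda>k. partial_deriv (\<lambda>x. rho k x * \<zeta> x) i x) \<longlonglongrightarrow> partial_deriv \<zeta> i x"
      by (rule tendsto_eventually)
  qed
qed

text \<open>Extends the weak equation from compactly supported tests to smooth functions vanishing
  on the boundary, by passing to the limit in \<open>rho_approx\<close>.\<close>

lemma harmonic_zero_boundary:
  fixes H :: "real^'n \<Rightarrow> real^'n"
  assumes H: "\<And>i. sqint (\<lambda>x. H x $ i)" and H0: "\<And>x. x \<notin> ball 0 2 \<Longrightarrow> H x = 0"
    and harm: "\<And>\<phi>. test_fun (ball 0 2) \<phi> \<Longrightarrow> (\<integral>x. H x \<bullet> grad \<phi> x \<partial>lborel) = 0"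
    and \<zeta>: "smooth_on UNIV \<zeta>" and z: "\<And>x. norm x = 2 \<Longrightarrow> \<zeta> x = 0"
  shows "(\<integral>x. H x \<bullet> grad \<zeta> x \<partial>lborel) = 0"
proof -
  have i: "integrable lborel (\<lambda>x. partial_deriv f i x * H x $ i)" if f: "smooth_on UNIV f" for f i
  proof -
    obtain B where "\<And>x. norm x \<le> 2 \<Longrightarrow> \<bar>partial_deriv f i x\<bar> \<le> B" using smooth_on_bounded_cball[OF smooth_on_partial_deriv[OF f]] by blast
    then have "sqint (\<lambda>x. indicator (ball 0 2) x * partial_deriv f i x)"
      by (intro sqint_bounded_indicator smooth_measurable smooth_on_partial_deriv f) auto
    from sqint_mult_integrable[OF this H[of i]]
    show ?thesis by (rule Bochner_Integration.integrable_cong[THEN iffD1, rotated -1]) (use H0 in \<open>auto simp: indicator_def\<close>)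
  qed
  have sr: "smooth_on UNIV (\<lambda>x. rho j x * \<zeta> x)" for j by (intro smooth_on_mult smooth_on_rho \<zeta>) simp
  have "(\<lambda>j. \<integral>x. partial_deriv (\<lambda>x. rho j x * \<zeta> x) i x * H x $ i \<partial>lborel) \<longlonglongrightarrow> (\<integral>x. partial_deriv \<zeta> i x * H x $ i \<partial>lborel)" for i
  proof (rule L2lim_integral[of "ball 0 2" "\<lambda>j. partial_deriv (\<lambda>x. rho j x * \<zeta> x) i" "partial_deriv \<zeta> i" "\<lambda>x. H x $ i"])
    show "L2lim (ball 0 2) (\<lambda>j. partial_deriv (\<lambda>x. rho j x * \<zeta> x) i) (partial_deriv \<zeta> i)" by (rule rho_approx(2)[OF \<zeta> z])
    show "integrable lborel (\<lambda>x. partial_deriv (\<lambda>x. rho k x * \<zeta> x) i x * H x $ i)" for k by (rule i[OF sr])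
    show "integrable lborel (\<lambda>x. partial_deriv \<zeta> i x * H x $ i)" by (rule i[OF \<zeta>])
  qed (use H H0 in auto)
  then have "(\<lambda>j. \<Sum>i\<in>UNIV. \<integral>x. partial_deriv (\<lambda>x. rho j x * \<zeta> x) i x * H x $ i \<partial>lborel) \<longlonglongrightarrow> (\<Sum>i\<in>UNIV. \<integral>x. partial_deriv \<zeta> i x * H x $ i \<partial>lborel)"
    by (rule tendsto_sum)
  moreover have "(\<Sum>i\<in>UNIV. \<integral>x. partial_deriv f i x * H x $ i \<partial>lborel) = (\<integral>x. H x \<bullet> grad f x \<partial>lborel)" if f: "smooth_on UNIV f" for f
  proof -
    have "(\<Sum>i\<in>UNIV. \<integral>x. partial_deriv f i x * H x $ i \<partial>lborel) = (\<integral>x. (\<Sum>i\<in>UNIV. partial_deriv f i x * H x $ i) \<partial>lborel)"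
      by (rule Bochner_Integration.integral_sum[symmetric]) (rule i[OF f])
    then show ?thesis by (simp add: inner_vec_def mult.commute)
  qed
  ultimately have "(\<lambda>j::nat. 0) \<longlonglongrightarrow> (\<integral>x. H x \<bullet> grad \<zeta> x \<partial>lborel)"
    using harm[OF test_fun_rho[OF \<zeta>]] \<zeta> sr by simp
  then show ?thesis by (simp add: LIMSEQ_const_iff)
qed

subsection \<open>The space of functions with zero trace\<close>

lemma weak_pair_add_cmult:
  assumes 1: "weak_pair N u G" and 2: "weak_pair N v H"
  shows "weak_pair N (\<lambda>x. u x + c * v x) (\<lambda>x. G x + c *\<^sub>R H x)"
  unfolding weak_pair_def
proof (intro conjI allI impI)
  show "sqint (\<lambda>x. u x + c * v x)" by (intro sqint_add sqint_cmult weak_pairD(1)[OF 1] weak_pairD(1)[OF 2])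
  show "sqint (\<lambda>x. (G x + c *\<^sub>R H x) $ i)" for i
    using sqint_add[OF weak_pairD(2)[OF 1] sqint_cmult[OF weak_pairD(2)[OF 2]]] by simp
  fix \<phi> i assume \<phi>: "test_fun N \<phi>"
  note t = test_fun_sqint[OF \<phi>] and t' = test_fun_sqint[OF test_fun_partial_deriv[OF \<phi>, of i]]
  note i = sqint_mult_integrable[OF weak_pairD(1)[OF 1] t'] sqint_mult_integrable[OF weak_pairD(1)[OF 2] t']
     sqint_mult_integrable[OF weak_pairD(2)[OF 1] t] sqint_mult_integrable[OF weak_pairD(2)[OF 2] t]
  have "(\<integral>x. (u x + c * v x) * partial_deriv \<phi> i x \<partial>lborel)
     = (\<integral>x. u x * partial_deriv \<phi> i x \<partial>lborel) + c * (\<integral>x. v x * partial_deriv \<phi> i x \<partial>lborel)"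
    using i by (simp add: distrib_right mult.assoc)
  also have "\<dots> = - ((\<integral>x. G x $ i * \<phi> x \<partial>lborel) + c * (\<integral>x. H x $ i * \<phi> x \<partial>lborel))"
    using weak_pairD(3)[OF 1 \<phi>] weak_pairD(3)[OF 2 \<phi>] by simp
  also have "(\<integral>x. G x $ i * \<phi> x \<partial>lborel) + c * (\<integral>x. H x $ i * \<phi> x \<partial>lborel) = (\<integral>x. (G x + c *\<^sub>R H x) $ i * \<phi> x \<partial>lborel)"
    using i by (simp add: distrib_right mult.assoc)
  finally show "(\<integral>x. (u x + c * v x) * partial_deriv \<phi> i x \<partial>lborel) = - (\<integral>x. (G x + c *\<^sub>R H x) $ i * \<phi> x \<partial>lborel)" .
qed

text \<open>\<open>H1_0\<close> for Borel representatives, with an explicit gradient in place of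
  \<open>wgrad\<close> and the single norm split into L2 limits of the components.\<close>

definition zero_trace :: "(real^'n) set \<Rightarrow> (real^'n \<Rightarrow> real) \<Rightarrow> (real^'n \<Rightarrow> real^'n) \<Rightarrow> bool" where
  "zero_trace N w W \<longleftrightarrow> weak_pair N w W \<and> (\<exists>\<phi>s. (\<forall>k. test_fun N (\<phi>s k)) \<and> L2lim N \<phi>s w \<and>
     (\<forall>i. L2lim N (\<lambda>k. partial_deriv (\<phi>s k) i) (\<lambda>x. W x $ i)))"

text \<open>The integrand is integrable, so the real integral in \<open>H1_0\<close> equals the sum
  of the nonnegative integrals in the component limits; such a sum tends to 0 exactly when each
  summand does.\<close>

lemma L2lim_dist_integral:
  fixes w :: "real^'n \<Rightarrow> real"
  assumes N[measurable]: "N \<in> sets borel" and wp: "weak_pair N w W" and \<phi>: "\<And>k. test_fun N (\<phi>s k)"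
  shows "(\<lambda>k. \<integral>x. indicator N x * ((w x - \<phi>s k x)\<^sup>2 + (norm (W x - grad (\<phi>s k) x))\<^sup>2) \<partial>lborel) \<longlonglongrightarrow> 0
    \<longleftrightarrow> L2lim N \<phi>s w \<and> (\<forall>i. L2lim N (\<lambda>k. partial_deriv (\<phi>s k) i) (\<lambda>x. W x $ i))"
proof -
  have m[measurable]: "w \<in> borel_measurable borel" "(\<lambda>x. W x $ i) \<in> borel_measurable borel"
    "\<phi>s k \<in> borel_measurable borel" "partial_deriv (\<phi>s k) i \<in> borel_measurable borel" for i k
    using weak_pairD(1,2)[OF wp] test_fun_measurable[OF \<phi>] test_fun_measurable[OF test_fun_partial_deriv[OF \<phi>]]
    by (auto simp: sqint_def)
  let ?a = "\<lambda>k. \<integral>\<^sup>+x. ennreal ((\<phi>s k x - w x)\<^sup>2) * indicator N x \<partial>lborel"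
  let ?b = "\<lambda>i k. \<integral>\<^sup>+x. ennreal ((partial_deriv (\<phi>s k) i x - W x $ i)\<^sup>2) * indicator N x \<partial>lborel"
  let ?d = "\<lambda>k. \<integral>x. indicator N x * ((w x - \<phi>s k x)\<^sup>2 + (norm (W x - grad (\<phi>s k) x))\<^sup>2) \<partial>lborel"
  have nrm: "(norm (W x - grad (\<phi>s k) x))\<^sup>2 = (\<Sum>i\<in>UNIV. (partial_deriv (\<phi>s k) i x - W x $ i)\<^sup>2)" for x k
    by (simp only: power2_norm_eq_inner inner_vec_def) (simp add: power2_eq_square[symmetric] power2_commute)
  have int: "integrable lborel (\<lambda>x. indicator N x * ((w x - \<phi>s k x)\<^sup>2 + (norm (W x - grad (\<phi>s k) x))\<^sup>2))" for k
  proof -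
    have 1: "integrable lborel (\<lambda>x. (w x - \<phi>s k x)\<^sup>2)"
      using sqint_diff[OF weak_pairD(1)[OF wp] test_fun_sqint[OF \<phi>]] by (simp add: sqint_def)
    have 2: "integrable lborel (\<lambda>x. (partial_deriv (\<phi>s k) i x - W x $ i)\<^sup>2)" for i
      using sqint_diff[OF test_fun_sqint[OF test_fun_partial_deriv[OF \<phi>]] weak_pairD(2)[OF wp]] by (simp add: sqint_def)
    have "integrable lborel (\<lambda>x. (w x - \<phi>s k x)\<^sup>2 + (norm (W x - grad (\<phi>s k) x))\<^sup>2)"
      unfolding nrm by (intro Bochner_Integration.integrable_add 1 Bochner_Integration.integrable_sum 2)
    from integrable_real_mult_indicator[OF _ this, of N] show ?thesis by (simp add: mult.commute)
  qed
  have key: "ennreal (?d k) = ?a k + (\<Sum>i\<in>UNIV. ?b i k)" for k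
  proof -
    have "ennreal (?d k) = (\<integral>\<^sup>+x. ennreal (indicator N x * ((w x - \<phi>s k x)\<^sup>2 + (norm (W x - grad (\<phi>s k) x))\<^sup>2)) \<partial>lborel)"
      by (rule nn_integral_eq_integral[OF int, symmetric]) auto
    also have "\<dots> = (\<integral>\<^sup>+x. ennreal ((\<phi>s k x - w x)\<^sup>2) * indicator N x + (\<Sum>i\<in>UNIV. ennreal ((partial_deriv (\<phi>s k) i x - W x $ i)\<^sup>2) * indicator N x) \<partial>lborel)"
    proof (rule nn_integral_cong)
      fix x
      have "ennreal ((w x - \<phi>s k x)\<^sup>2 + (norm (W x - grad (\<phi>s k) x))\<^sup>2)
         = ennreal ((\<phi>s k x - w x)\<^sup>2) + (\<Sum>i\<in>UNIV. ennreal ((partial_deriv (\<phi>s k) i x - W x $ i)\<^sup>2))"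
        unfolding nrm by (subst ennreal_plus) (auto simp: sum_nonneg power2_commute sum_ennreal)
      then show "ennreal (indicator N x * ((w x - \<phi>s k x)\<^sup>2 + (norm (W x - grad (\<phi>s k) x))\<^sup>2))
         = ennreal ((\<phi>s k x - w x)\<^sup>2) * indicator N x + (\<Sum>i\<in>UNIV. ennreal ((partial_deriv (\<phi>s k) i x - W x $ i)\<^sup>2) * indicator N x)"
        by (cases "x \<in> N") simp_all
    qed
    also have "\<dots> = ?a k + (\<integral>\<^sup>+x. (\<Sum>i\<in>UNIV. ennreal ((partial_deriv (\<phi>s k) i x - W x $ i)\<^sup>2) * indicator N x) \<partial>lborel)"
      by (rule nn_integral_add) measurable
    also have "(\<integral>\<^sup>+x. (\<Sum>i\<in>UNIV. ennreal ((partial_deriv (\<phi>s k) i x - W x $ i)\<^sup>2) * indicator N x) \<partial>lborel) = (\<Sum>i\<in>UNIV. ?b i k)"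
      by (rule nn_integral_sum) measurable
    finally show ?thesis .
  qed
  have d0: "0 \<le> ?d k" for k by (intro Bochner_Integration.integral_nonneg) auto
  have "?d \<longlonglongrightarrow> 0 \<longleftrightarrow> (\<lambda>k. ennreal (?d k)) \<longlonglongrightarrow> ennreal 0"
    by (rule tendsto_ennreal_iff[symmetric]) (use d0 in auto)
  also have "\<dots> \<longleftrightarrow> ?a \<longlonglongrightarrow> 0 \<and> (\<forall>i. ?b i \<longlonglongrightarrow> 0)"
  proof
    assume "(\<lambda>k. ennreal (?d k)) \<longlonglongrightarrow> ennreal 0"
    then have l: "(\<lambda>k. ?a k + (\<Sum>i\<in>UNIV. ?b i k)) \<longlonglongrightarrow> 0" by (simp add: key)
    have "?a \<longlonglongrightarrow> 0" by (rule tendsto_sandwich[OF _ _ tendsto_const l]) auto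
    moreover have "?b i \<longlonglongrightarrow> 0" for i
    proof (rule tendsto_sandwich[OF _ _ tendsto_const l])
      have "?b i k \<le> ?a k + (\<Sum>i\<in>UNIV. ?b i k)" for k
        using member_le_sum[of i UNIV "\<lambda>i. ?b i k"] by (simp add: add_increasing)
      then show "eventually (\<lambda>k. ?b i k \<le> ?a k + (\<Sum>i\<in>UNIV. ?b i k)) sequentially" by simp
    qed auto
    ultimately show "?a \<longlonglongrightarrow> 0 \<and> (\<forall>i. ?b i \<longlonglongrightarrow> 0)" by blast
  next
    assume "?a \<longlonglongrightarrow> 0 \<and> (\<forall>i. ?b i \<longlonglongrightarrow> 0)"
    then have "(\<lambda>k. ?a k + (\<Sum>i\<in>UNIV. ?b i k)) \<longlonglongrightarrow> 0 + (\<Sum>i\<in>(UNIV :: 'n set). 0)" by (intro tendsto_add tendsto_sum) auto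
    then show "(\<lambda>k. ennreal (?d k)) \<longlonglongrightarrow> ennreal 0" by (simp add: key)
  qed
  also have "\<dots> \<longleftrightarrow> L2lim N \<phi>s w \<and> (\<forall>i. L2lim N (\<lambda>k. partial_deriv (\<phi>s k) i) (\<lambda>x. W x $ i))"
    using m by (simp add: L2lim_def)
  finally show ?thesis .
qed

lemma H1_0_iff_zero_trace:
  fixes w :: "real^'n \<Rightarrow> real"
  assumes N: "open N"
  shows "H1_0 N w \<longleftrightarrow> (\<exists>w0 W0. zero_trace N w0 W0 \<and> (AE x in lborel. x \<in> N \<longrightarrow> w x = w0 x))"
proof -
  have Nb[measurable]: "N \<in> sets borel" using N by simp
  have eq: "(LINT x:N|lebesgue. (w x - \<phi> x)\<^sup>2 + (norm (wgrad N w x - grad \<phi> x))\<^sup>2)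
      = (\<integral>x. indicator N x * ((w0 x - \<phi> x)\<^sup>2 + (norm (W0 x - grad \<phi> x))\<^sup>2) \<partial>lborel)"
    if wp: "weak_pair N w0 W0" and 1: "AE x in lborel. x \<in> N \<longrightarrow> w x = w0 x" and \<phi>: "test_fun N \<phi>" for w0 W0 \<phi>
  proof (rule set_lebesgue_transfer(3)[OF Nb])
    have [measurable]: "w0 \<in> borel_measurable borel" "\<phi> \<in> borel_measurable borel" "W0 \<in> borel_measurable borel" "grad \<phi> \<in> borel_measurable borel"
      using weak_pairD(1)[OF wp] test_fun_measurable[OF \<phi>] sqint_norm(2)[OF weak_pairD(2)[OF wp]]
        sqint_norm(2)[of "grad \<phi>"] test_fun_sqint[OF test_fun_partial_deriv[OF \<phi>]] by (auto simp: sqint_def)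
    show "(\<lambda>x. (w0 x - \<phi> x)\<^sup>2 + (norm (W0 x - grad \<phi> x))\<^sup>2) \<in> borel_measurable borel" by measurable
    show "AE x in lborel. x \<in> N \<longrightarrow> (w x - \<phi> x)\<^sup>2 + (norm (wgrad N w x - grad \<phi> x))\<^sup>2 = (w0 x - \<phi> x)\<^sup>2 + (norm (W0 x - grad \<phi> x))\<^sup>2"
      using 1 wgrad_eq_AE[OF N wp 1] by eventually_elim auto
  qed
  show ?thesis
  proof
    assume w: "H1_0 N w"
    then have h1: "H1 N w" by (simp add: H1_0_def)
    obtain w0 W0 where wp: "weak_pair N w0 W0" and 1: "AE x in lborel. x \<in> N \<longrightarrow> w x = w0 x"
      by (rule H1_representative[OF Nb h1])
    obtain \<phi>s where t: "\<And>k. test_fun N (\<phi>s k)" and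
      l: "(\<lambda>k. LINT x:N|lebesgue. (w x - \<phi>s k x)\<^sup>2 + (norm (wgrad N w x - grad (\<phi>s k) x))\<^sup>2) \<longlonglongrightarrow> 0"
      using w by (auto simp: H1_0_def)
    have "L2lim N \<phi>s w0 \<and> (\<forall>i. L2lim N (\<lambda>k. partial_deriv (\<phi>s k) i) (\<lambda>x. W0 x $ i))"
      using l unfolding eq[OF wp 1 t] by (rule L2lim_dist_integral[OF Nb wp t, THEN iffD1])
    then have "zero_trace N w0 W0" unfolding zero_trace_def using wp t by blast
    with 1 show "\<exists>w0 W0. zero_trace N w0 W0 \<and> (AE x in lborel. x \<in> N \<longrightarrow> w x = w0 x)" by blast
  next
    assume "\<exists>w0 W0. zero_trace N w0 W0 \<and> (AE x in lborel. x \<in> N \<longrightarrow> w x = w0 x)"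
    then obtain w0 W0 \<phi>s where wp: "weak_pair N w0 W0" and 1: "AE x in lborel. x \<in> N \<longrightarrow> w x = w0 x"
      and t: "\<And>k. test_fun N (\<phi>s k)" and l: "L2lim N \<phi>s w0 \<and> (\<forall>i. L2lim N (\<lambda>k. partial_deriv (\<phi>s k) i) (\<lambda>x. W0 x $ i))"
      unfolding zero_trace_def by blast
    have "(\<lambda>k. LINT x:N|lebesgue. (w x - \<phi>s k x)\<^sup>2 + (norm (wgrad N w x - grad (\<phi>s k) x))\<^sup>2) \<longlonglongrightarrow> 0"
      unfolding eq[OF wp 1 t] using l by (rule L2lim_dist_integral[OF Nb wp t, THEN iffD2])
    with weak_pair_imp_H1(1)[OF Nb wp 1] t show "H1_0 N w" unfolding H1_0_def by blast
  qed
qed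

lemma zero_trace_add_cmult:
  assumes N: "N \<in> sets borel" and 1: "zero_trace N u G" and 2: "zero_trace N v H"
  shows "zero_trace N (\<lambda>x. u x + c * v x) (\<lambda>x. G x + c *\<^sub>R H x)"
proof -
  obtain p where p: "\<And>k. test_fun N (p k)" "L2lim N p u" "\<And>i. L2lim N (\<lambda>k. partial_deriv (p k) i) (\<lambda>x. G x $ i)"
    and wp: "weak_pair N u G" using 1 unfolding zero_trace_def by blast
  obtain q where q: "\<And>k. test_fun N (q k)" "L2lim N q v" "\<And>i. L2lim N (\<lambda>k. partial_deriv (q k) i) (\<lambda>x. H x $ i)"
    and wq: "weak_pair N v H" using 2 unfolding zero_trace_def by blast
  let ?r = "\<lambda>k x. p k x + c * q k x"
  have dp: "p k differentiable (at x)" "q k differentiable (at x)" for k x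
    using smooth_on_differentiable[OF test_fun_smooth[OF p(1)]] smooth_on_differentiable[OF test_fun_smooth[OF q(1)]] by auto
  have t: "test_fun N (?r k)" for k
  proof -
    obtain K where K: "compact K" "K \<subseteq> N" "\<And>x. x \<notin> K \<Longrightarrow> p k x = 0" using p(1)[of k] by (rule test_funE) blast
    obtain L where L: "compact L" "L \<subseteq> N" "\<And>x. x \<notin> L \<Longrightarrow> q k x = 0" using q(1)[of k] by (rule test_funE) blast
    show ?thesis
      by (rule test_funI[of _ "K \<union> L"])
         (use K L in \<open>auto intro!: smooth_on_add smooth_on_cmult test_fun_smooth[OF p(1)] test_fun_smooth[OF q(1)]\<close>)
  qed
  have d: "partial_deriv (?r k) i = (\<lambda>x. partial_deriv (p k) i x + c * partial_deriv (q k) i x)" for k i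
    using dp by (intro ext) (simp add: partial_deriv_add partial_deriv_cmult differentiable_mult)
  show ?thesis unfolding zero_trace_def
  proof (intro conjI exI[of _ ?r] allI)
    show "weak_pair N (\<lambda>x. u x + c * v x) (\<lambda>x. G x + c *\<^sub>R H x)" by (rule weak_pair_add_cmult[OF wp wq])
    show "test_fun N (?r k)" for k by (rule t)
    show "L2lim N ?r (\<lambda>x. u x + c * v x)" by (intro L2lim_add L2lim_cmult N p q)
    show "L2lim N (\<lambda>k. partial_deriv (?r k) i) (\<lambda>x. (G x + c *\<^sub>R H x) $ i)" for i
      unfolding d using L2lim_add[OF N p(3) L2lim_cmult[OF N q(3)]] by simp
  qed
qed

text \<open>\<open>H1_0\<close> is closed under linear combinations, so two functions differing by a
  member of it determine the same coset.\<close>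

lemma dirichlet_datum_eqI:
  fixes u v :: "real^'n \<Rightarrow> real"
  assumes N: "open N" and uv: "H1_0 N (\<lambda>x. u x - v x)"
  shows "dirichlet_datum N u = dirichlet_datum N v"
proof -
  have Nb: "N \<in> sets borel" using N by simp
  obtain z Z where z: "zero_trace N z Z" "AE x in lborel. x \<in> N \<longrightarrow> u x - v x = z x"
    using uv unfolding H1_0_iff_zero_trace[OF N] by blast
  have shift: "H1_0 N (\<lambda>x. w x + c * (u x - v x))" if w: "H1_0 N w" for w c
  proof -
    obtain y Y where y: "zero_trace N y Y" "AE x in lborel. x \<in> N \<longrightarrow> w x = y x"
      using w unfolding H1_0_iff_zero_trace[OF N] by blast
    have "AE x in lborel. x \<in> N \<longrightarrow> w x + c * (u x - v x) = y x + c * z x"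
      using z(2) y(2) by eventually_elim auto
    with zero_trace_add_cmult[OF Nb y(1) z(1)] show ?thesis unfolding H1_0_iff_zero_trace[OF N] by blast
  qed
  have "H1_0 N (\<lambda>x. w x - u x) \<longleftrightarrow> H1_0 N (\<lambda>x. w x - v x)" for w
    using shift[of "\<lambda>x. w x - u x" 1] shift[of "\<lambda>x. w x - v x" "-1"] by auto
  then show ?thesis by (simp add: dirichlet_datum_def)
qed

text \<open>Each approximant vanishes only on the sphere. A diagonal choice multiplies the k-th by a
  \<open>rho j\<close> so close to one that function and gradient move by squared distance below
  1/(k+1), which yields test functions with the same limit.\<close>

lemma zero_trace_approx:
  fixes w :: "real^'n \<Rightarrow> real"
  assumes wp: "weak_pair (ball 0 2) w W" and \<psi>: "\<And>k. smooth_on UNIV (\<psi> k)" "\<And>k x. norm x = 2 \<Longrightarrow> \<psi> k x = 0"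
    and lim: "L2lim (ball 0 2) \<psi> w" "\<And>i. L2lim (ball 0 2) (\<lambda>k. partial_deriv (\<psi> k) i) (\<lambda>x. W x $ i)"
  shows "zero_trace (ball 0 2) w W"
proof -
  let ?N = "ball 0 2 :: (real^'n) set"
  let ?e = "\<lambda>k. ennreal (inverse (real (Suc k)))"
  let ?P = "\<lambda>k \<phi>. test_fun ?N \<phi> \<and> (\<integral>\<^sup>+x. ennreal ((\<phi> x - \<psi> k x)\<^sup>2) * indicator ?N x \<partial>lborel) < ?e k \<and>
     (\<forall>i\<in>UNIV. (\<integral>\<^sup>+x. ennreal ((partial_deriv \<phi> i x - partial_deriv (\<psi> k) i x)\<^sup>2) * indicator ?N x \<partial>lborel) < ?e k)"
  have ex: "\<exists>\<phi>. ?P k \<phi>" for k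
  proof -
    have "eventually (\<lambda>j. (\<integral>\<^sup>+x. ennreal ((rho j x * \<psi> k x - \<psi> k x)\<^sup>2) * indicator ?N x \<partial>lborel) < ?e k) sequentially"
      using rho_approx(1)[OF \<psi>(1) \<psi>(2)] unfolding L2lim_def by (intro order_tendstoD) auto
    moreover have "eventually (\<lambda>j. \<forall>i\<in>UNIV. (\<integral>\<^sup>+x. ennreal ((partial_deriv (\<lambda>x. rho j x * \<psi> k x) i x - partial_deriv (\<psi> k) i x)\<^sup>2) * indicator ?N x \<partial>lborel) < ?e k) sequentially"
    proof (rule eventually_ball_finite, simp, rule ballI)
      fix i
      show "eventually (\<lambda>j. (\<integral>\<^sup>+x. ennreal ((partial_deriv (\<lambda>x. rho j x * \<psi> k x) i x - partial_deriv (\<psi> k) i x)\<^sup>2) * indicator ?N x \<partial>lborel) < ?e k) sequentially"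
        using rho_approx(2)[OF \<psi>(1) \<psi>(2)] unfolding L2lim_def by (intro order_tendstoD) auto
    qed
    ultimately have "eventually (\<lambda>j. test_fun ?N (\<lambda>x. rho j x * \<psi> k x) \<and> (\<integral>\<^sup>+x. ennreal ((rho j x * \<psi> k x - \<psi> k x)\<^sup>2) * indicator ?N x \<partial>lborel) < ?e k \<and>
       (\<forall>i\<in>UNIV. (\<integral>\<^sup>+x. ennreal ((partial_deriv (\<lambda>x. rho j x * \<psi> k x) i x - partial_deriv (\<psi> k) i x)\<^sup>2) * indicator ?N x \<partial>lborel) < ?e k)) sequentially"
      by eventually_elim (simp add: test_fun_rho[OF \<psi>(1)])
    then obtain j where "test_fun ?N (\<lambda>x. rho j x * \<psi> k x) \<and> (\<integral>\<^sup>+x. ennreal ((rho j x * \<psi> k x - \<psi> k x)\<^sup>2) * indicator ?N x \<partial>lborel) < ?e k \<and>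
       (\<forall>i\<in>UNIV. (\<integral>\<^sup>+x. ennreal ((partial_deriv (\<lambda>x. rho j x * \<psi> k x) i x - partial_deriv (\<psi> k) i x)\<^sup>2) * indicator ?N x \<partial>lborel) < ?e k)"
      by (elim eventually_happens'[OF sequentially_bot, THEN exE]) (rule that)
    then show ?thesis by (rule exI[of "?P k"])
  qed
  have "\<forall>k. \<exists>\<phi>. ?P k \<phi>" by (rule allI) (rule ex)
  from choice[OF this] obtain \<phi>s where \<phi>s: "\<forall>k. ?P k (\<phi>s k)" by (elim exE) (rule that)
  have t: "test_fun ?N (\<phi>s k)" for k
    by (rule conjunct1[OF spec[OF \<phi>s]])
  have a: "(\<integral>\<^sup>+x. ennreal ((\<phi>s k x - \<psi> k x)\<^sup>2) * indicator ?N x \<partial>lborel) < ?e k" for k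
    by (rule conjunct1[OF conjunct2[OF spec[OF \<phi>s]]])
  have b: "(\<integral>\<^sup>+x. ennreal ((partial_deriv (\<phi>s k) i x - partial_deriv (\<psi> k) i x)\<^sup>2) * indicator ?N x \<partial>lborel) < ?e k" for k i
    by (rule bspec[OF conjunct2[OF conjunct2[OF spec[OF \<phi>s]]] UNIV_I])
  have e0: "?e \<longlonglongrightarrow> 0"
    using tendsto_ennrealI[OF LIMSEQ_inverse_real_of_nat] by simp
  have m: "\<phi>s k \<in> borel_measurable borel" "partial_deriv (\<phi>s k) i \<in> borel_measurable borel"
    "\<psi> k \<in> borel_measurable borel" "partial_deriv (\<psi> k) i \<in> borel_measurable borel" for k i
    using test_fun_measurable[OF t] test_fun_measurable[OF test_fun_partial_deriv[OF t]] smooth_measurable[OF \<psi>(1)] smooth_measurable[OF smooth_on_partial_deriv[OF \<psi>(1)]] by auto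
  have "L2lim ?N (\<lambda>k x. \<phi>s k x - \<psi> k x) (\<lambda>x. 0)"
    by (rule L2lim_squeeze[OF e0]) (use a m in \<open>auto intro: less_imp_le\<close>)
  from L2lim_add[OF _ this lim(1)] have 1: "L2lim ?N \<phi>s w" by simp
  have "L2lim ?N (\<lambda>k x. partial_deriv (\<phi>s k) i x - partial_deriv (\<psi> k) i x) (\<lambda>x. 0)" for i
    by (rule L2lim_squeeze[OF e0]) (use b m in \<open>auto intro: less_imp_le\<close>)
  then have 2: "L2lim ?N (\<lambda>k. partial_deriv (\<phi>s k) i) (\<lambda>x. W x $ i)" for i
    using L2lim_add[OF _ _ lim(2)[of i], of "\<lambda>k x. partial_deriv (\<phi>s k) i x - partial_deriv (\<psi> k) i x" "\<lambda>x. 0"] by simp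
  show ?thesis unfolding zero_trace_def using wp t 1 2 by blast
qed

subsection \<open>Comparison of the Cauchy data\<close>

text \<open>One for |x|^2 <= 2, a neighbourhood of the closed unit ball that leaves room for points
  of \<open>N1\<close>, and zero for |x|^2 >= 3, hence near the outer sphere.\<close>

definition chi :: "real^'n \<Rightarrow> real" where
  "chi x = step (3 - x \<bullet> x)"

lemma smooth_on_chi: "smooth_on UNIV chi"
  unfolding chi_def[abs_def] by (intro smooth_on_step smooth_on_diff smooth_on_const smooth_on_inner_self) auto

lemma chi_eq_1: "x \<bullet> x \<le> 2 \<Longrightarrow> chi x = 1"
  by (simp add: chi_def step_eq_1)

lemma chi_eq_0: "3 \<le> x \<bullet> x \<Longrightarrow> chi x = 0"
  by (simp add: chi_def step_eq_0)

lemma abs_chi_le: "\<bar>chi x\<bar> \<le> 1" "\<bar>1 - chi x\<bar> \<le> 1"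
  unfolding chi_def using step_nonneg[of "3 - x \<bullet> x"] step_le_1[of "3 - x \<bullet> x"] by auto

lemma inner_self_le: "norm x \<le> r \<Longrightarrow> x \<bullet> x \<le> r\<^sup>2"
  by (metis norm_ge_zero power2_norm_eq_inner power_mono)

lemma test_fun_chi:
  fixes \<Phi> :: "real^'n \<Rightarrow> real"
  assumes "smooth_on UNIV \<Phi>" shows "test_fun (ball 0 2) (\<lambda>x. chi x * \<Phi> x)"
proof (rule test_funI)
  let ?K = "{x :: real^'n. x \<bullet> x \<le> 3}"
  have sub: "norm x < 2" if "x \<in> ?K" for x :: "real^'n"
  proof -
    have "(norm x)\<^sup>2 < 2\<^sup>2" using that by (simp add: power2_norm_eq_inner)
    then show ?thesis by (rule power_less_imp_less_base) simp
  qed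
  show "smooth_on UNIV (\<lambda>x. chi x * \<Phi> x)" by (intro smooth_on_mult smooth_on_chi assms) simp
  have "closed ?K" by (intro closed_Collect_le continuous_intros)
  moreover have "bounded ?K" unfolding bounded_iff using sub by (intro exI[of _ 2]) (auto intro: less_imp_le)
  ultimately show "compact ?K" by (simp add: compact_eq_bounded_closed)
  show "?K \<subseteq> ball 0 2" using sub by auto
  show "chi x * \<Phi> x = 0" if "x \<notin> ?K" for x using that by (simp add: chi_eq_0)
qed

lemma smooth_on_UNIV_punctured:
  fixes f :: "real^'n \<Rightarrow> real"
  assumes "smooth_on (- {0}) f" "0 < r" "\<And>x. norm x < r \<Longrightarrow> f x = 0"
  shows "smooth_on UNIV f"
proof -
  have "smooth_on (ball 0 r) f"
    by (rule smooth_on_cong_open[OF open_ball smooth_on_const[of _ 0]]) (use assms(3) in auto)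
  then have "smooth_on (- {0} \<union> ball 0 r) f" using assms(1) by (intro smooth_on_Un) auto
  moreover have "- {0} \<union> ball 0 r = (UNIV :: (real^'n) set)" using assms(2) by auto
  ultimately show ?thesis by simp
qed

text \<open>The factor vanishes on the unit ball and so removes the singularity of \<open>F1\<close>
  at the origin.\<close>

lemma smooth_on_chi_compose_F1:
  fixes f :: "real^'n \<Rightarrow> real"
  assumes "smooth_on UNIV f" shows "smooth_on UNIV (\<lambda>x. (1 - chi x) * f (F1 x))"
proof (rule smooth_on_UNIV_punctured)
  have o: "open (- {0 :: real^'n})" by auto
  show "smooth_on (- {0}) (\<lambda>x. (1 - chi x) * f (F1 x))"
    by (intro smooth_on_mult smooth_on_diff smooth_on_const o smooth_on_subset[OF smooth_on_chi] smooth_on_compose_F1 assms) auto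
  show "(1 - chi x) * f (F1 x) = 0" if "norm x < 1" for x
    using inner_self_le[of x 1] that by (simp add: chi_eq_1)
qed simp

text \<open>\<open>F1\<close> maps the punctured ball of radius 1/2 to norms at most 5/4, and 25/16
  < 2, so the composition vanishes near the origin.\<close>

lemma smooth_on_zero_compose_F1:
  fixes f :: "real^'n \<Rightarrow> real"
  assumes "smooth_on UNIV f" "\<And>x. x \<bullet> x \<le> 2 \<Longrightarrow> f x = 0" shows "smooth_on UNIV (\<lambda>x. f (F1 x))"
proof (rule smooth_on_UNIV_punctured)
  have o: "open (- {0 :: real^'n})" by auto
  show "smooth_on (- {0}) (\<lambda>x. f (F1 x))" by (intro o smooth_on_compose_F1 assms) auto
  show "f (F1 x) = 0" if "norm x < 1/2" for x
  proof (cases "x = 0")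
    case False
    then have "norm (F1 x) \<le> 5/4" using that by (simp add: norm_F1)
    from inner_self_le[OF this] show ?thesis by (intro assms(2)) (simp add: power2_eq_square)
  qed (simp add: assms(2))
qed simp

lemma F1_sphere: "norm x = 2 \<Longrightarrow> F1 x = x"
  by (subst F1_eq) auto

lemma L2lim_N0_ball:
  assumes "L2lim N0 fs f" shows "L2lim (ball 0 2) fs (f :: real^'n \<Rightarrow> real)"
proof -
  have "(\<integral>\<^sup>+x. ennreal ((fs k x - f x)\<^sup>2) * indicator (ball 0 2) x \<partial>lborel)
     = (\<integral>\<^sup>+x. ennreal ((fs k x - f x)\<^sup>2) * indicator N0 x \<partial>lborel)" for k
  proof (rule nn_integral_cong_AE)
    have "AE x in (lborel :: (real^'n) measure). x \<noteq> 0" by (rule AE_lborel_singleton)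
    then show "AE x in lborel. ennreal ((fs k x - f x)\<^sup>2) * indicator (ball 0 2) x = ennreal ((fs k x - f x)\<^sup>2) * indicator N0 x"
      by eventually_elim (auto simp: indicator_def N0_iff)
  qed
  then show ?thesis using assms by (simp add: L2lim_def)
qed

text \<open>Smooth approximants us of \<open>u\<close> and vs of \<open>v\<close> give us - chi vs -
  (1 - chi) (us o F1), which tends to u - v because v = u o F1, and vanishes at the outer sphere
  because \<open>F1\<close> fixes it and \<open>chi\<close> is zero there. Near the origin
  \<open>chi\<close> replaces us o F1, whose gradient \<open>DF\<close> would make unbounded, by
  vs.\<close>

lemma zero_trace_difference:
  fixes u v :: "real^'n \<Rightarrow> real"
  assumes wu: "weak_pair (ball 0 2) u G" and iu: "integrable lborel u"
    and wv: "weak_pair (ball 0 2) v H" and iv: "integrable lborel v"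
    and rel: "AE x in lborel. x \<in> N0 \<longrightarrow> v x = u (F1 x)"
    and relG: "AE x in lborel. x \<in> N0 \<longrightarrow> H x = DF x (G (F1 x))"
  shows "zero_trace (ball 0 2) (\<lambda>x. u x + (- 1) * v x) (\<lambda>x. G x + (- 1) *\<^sub>R H x)"
proof -
  let ?N = "ball 0 2 :: (real^'n) set"
  have [measurable]: "u \<in> borel_measurable borel" "v \<in> borel_measurable borel" "G \<in> borel_measurable borel" "H \<in> borel_measurable borel"
    "(\<lambda>x. G x $ i) \<in> borel_measurable borel" "(\<lambda>x. H x $ i) \<in> borel_measurable borel" for i
    using weak_pairD(1,2)[OF wu] weak_pairD(1,2)[OF wv] sqint_norm(2)[OF weak_pairD(2)[OF wu]] sqint_norm(2)[OF weak_pairD(2)[OF wv]]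
    by (auto simp: sqint_def)
  obtain us where us: "\<And>k. smooth_on UNIV (us k)" "L2lim UNIV us u"
     "\<And>i. L2lim ?N (\<lambda>k. partial_deriv (us k) i) (\<lambda>x. G x $ i)" using weak_pair_density[OF wu iu] by blast
  obtain vs where vs: "\<And>k. smooth_on UNIV (vs k)" "L2lim UNIV vs v"
     "\<And>i. L2lim ?N (\<lambda>k. partial_deriv (vs k) i) (\<lambda>x. H x $ i)" using weak_pair_density[OF wv iv] by blast
  have usN: "L2lim ?N us u" and vsN: "L2lim ?N vs v"
    using L2lim_subset[OF us(2) subset_UNIV] L2lim_subset[OF vs(2) subset_UNIV] by auto
  have chim[measurable]: "chi \<in> borel_measurable (borel :: (real^'n) measure)" by (rule smooth_measurable[OF smooth_on_chi])
  have cb: "comp_bound (N0 :: (real^'n) set) F1 (2 * 2 ^ (CARD('n) - 1))" by (rule comp_bound_F1) auto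
  have usF: "L2lim N0 (\<lambda>k x. us k (F1 x)) (\<lambda>x. u (F1 x))" by (rule comp_bound_L2lim[OF cb usN])
  have dusF: "L2lim N0 (\<lambda>k x. partial_deriv (us k) j (F1 x)) (\<lambda>x. G (F1 x) $ j)" for j
    by (rule comp_bound_L2lim[OF cb us(3)])
  define \<psi> where "\<psi> k x = us k x - chi x * vs k x - (1 - chi x) * us k (F1 x)" for k x
  have s\<psi>: "smooth_on UNIV (\<psi> k)" for k
    unfolding \<psi>_def by (intro smooth_on_diff smooth_on_mult[OF _ smooth_on_chi] smooth_on_chi_compose_F1 us(1) vs(1)) auto
  have z: "\<psi> k x = 0" if "norm x = 2" for k x
  proof -
    have "x \<bullet> x = 4" using that by (simp add: power2_norm_eq_inner[symmetric])
    then show ?thesis using F1_sphere[OF that] by (simp add: \<psi>_def chi_eq_0)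
  qed
  have l1: "L2lim ?N (\<lambda>k x. chi x * vs k x) (\<lambda>x. chi x * v x)"
    by (rule L2lim_mult[OF _ chim vsN, of 1]) (simp_all add: abs_chi_le)
  have l2: "L2lim ?N (\<lambda>k x. (1 - chi x) * us k (F1 x)) (\<lambda>x. (1 - chi x) * u (F1 x))"
    by (rule L2lim_N0_ball, rule L2lim_mult[OF _ _ usF, of _ 1]) (simp_all add: abs_chi_le)
  have lim: "L2lim ?N \<psi> (\<lambda>x. u x + (- 1) * v x)"
  proof (rule L2lim_cong)
    show "L2lim ?N (\<lambda>k x. us k x - chi x * vs k x - (1 - chi x) * us k (F1 x)) (\<lambda>x. u x - chi x * v x - (1 - chi x) * u (F1 x))"
      by (rule L2lim_diff[OF _ L2lim_diff[OF _ usN l1] l2]) simp_all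
    show "\<psi> k \<in> borel_measurable borel" for k by (rule smooth_measurable[OF s\<psi>])
    have "AE x in (lborel :: (real^'n) measure). x \<noteq> 0" by (rule AE_lborel_singleton)
    with rel show "AE x in lborel. x \<in> ?N \<longrightarrow> u x + (- 1) * v x = u x - chi x * v x - (1 - chi x) * u (F1 x)"
      by eventually_elim (auto simp: N0_iff algebra_simps)
  qed (auto simp: \<psi>_def)
  have limG: "L2lim ?N (\<lambda>k. partial_deriv (\<psi> k) i) (\<lambda>x. (G x + (- 1) *\<^sub>R H x) $ i)" for i
  proof -
    let ?c = "partial_deriv chi i :: real^'n \<Rightarrow> real"
    \<comment> \<open>Derivative of \<open>F1\<close> weighted with 1 - chi. The weight vanishes for
      |x| <= 1, and beyond that 3/|x| <= 3 bounds the entries, so multiplication by them preserves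
      L2 limits.\<close>
    define m where "m j x = (1 - chi x) * (DF x (axis i 1) $ j)" for j and x :: "real^'n"
    have [measurable]: "m j \<in> borel_measurable borel" for j
    proof -
      have "(\<lambda>x :: real^'n. DF x (axis i 1)) \<in> borel_measurable borel"
        by (rule DF_apply_measurable) simp_all
      then have "(\<lambda>x :: real^'n. DF x (axis i 1) \<bullet> axis j 1) \<in> borel_measurable borel"
        by (rule borel_measurable_inner) simp
      then have "(\<lambda>x :: real^'n. DF x (axis i 1) $ j) \<in> borel_measurable borel" by (simp add: inner_axis)
      from borel_measurable_times[OF borel_measurable_diff[OF borel_measurable_const chim] this]
      show ?thesis unfolding m_def[abs_def] .
    qed
    have [measurable]: "?c \<in> borel_measurable borel" by (rule smooth_measurable[OF smooth_on_partial_deriv[OF smooth_on_chi]])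
    obtain Bc where Bc: "\<And>x. norm x \<le> 2 \<Longrightarrow> \<bar>?c x\<bar> \<le> Bc" using smooth_on_bounded_cball[OF smooth_on_partial_deriv[OF smooth_on_chi]] by blast
    have mb: "\<bar>m j x\<bar> \<le> 3" if x: "x \<in> N0" for j x
    proof (cases "norm x \<le> 1")
      case True
      then show ?thesis using inner_self_le[OF True] by (simp add: m_def chi_eq_1)
    next
      case False
      have "\<bar>DF x (axis i 1) $ j\<bar> \<le> norm (DF x (axis i 1))" by (rule component_le_norm_cart)
      also have "\<dots> \<le> 3 / norm x * norm (axis i (1::real) :: real^'n)" by (rule norm_DF_le) (use x in \<open>auto simp: N0_iff\<close>)
      also have "\<dots> \<le> 3" using False by (simp add: divide_le_eq)
      finally have "\<bar>1 - chi x\<bar> * \<bar>DF x (axis i 1) $ j\<bar> \<le> 1 * 3" by (intro mult_mono abs_chi_le) auto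
      then show ?thesis by (simp add: m_def abs_mult)
    qed
    have a1: "L2lim ?N (\<lambda>k x. chi x * partial_deriv (vs k) i x) (\<lambda>x. chi x * H x $ i)"
      by (rule L2lim_mult[OF _ chim vs(3), of 1]) (simp_all add: abs_chi_le)
    have a2: "L2lim ?N (\<lambda>k x. ?c x * vs k x) (\<lambda>x. ?c x * v x)"
      by (rule L2lim_mult[OF _ _ vsN, of _ Bc]) (use Bc in simp_all)
    have a3: "L2lim ?N (\<lambda>k x. \<Sum>j\<in>UNIV. m j x * partial_deriv (us k) j (F1 x)) (\<lambda>x. \<Sum>j\<in>UNIV. m j x * G (F1 x) $ j)"
      by (rule L2lim_N0_ball, rule L2lim_sum, simp, rule L2lim_mult[OF _ _ dusF, of _ 3]) (simp_all add: mb)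
    have a4: "L2lim ?N (\<lambda>k x. ?c x * us k (F1 x)) (\<lambda>x. ?c x * u (F1 x))"
      by (rule L2lim_N0_ball, rule L2lim_mult[OF _ _ usF, of _ Bc]) (use Bc in \<open>simp_all add: N0_iff\<close>)
    have tot: "L2lim ?N (\<lambda>k x. partial_deriv (us k) i x - (chi x * partial_deriv (vs k) i x + ?c x * vs k x)
          - ((\<Sum>j\<in>UNIV. m j x * partial_deriv (us k) j (F1 x)) - ?c x * us k (F1 x)))
        (\<lambda>x. G x $ i - (chi x * H x $ i + ?c x * v x) - ((\<Sum>j\<in>UNIV. m j x * G (F1 x) $ j) - ?c x * u (F1 x)))"
      by (intro L2lim_diff L2lim_add us(3) a1 a2 a3 a4) auto
    have lin: "(\<Sum>j\<in>UNIV. m j x * g $ j) = (1 - chi x) * DF x g $ i" for x g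
    proof -
      have "DF x g $ i = g \<bullet> DF x (axis i 1)" by (simp add: inner_DF[symmetric] inner_axis)
      then show ?thesis by (simp add: m_def inner_vec_def sum_distrib_left mult.assoc mult.commute mult.left_commute)
    qed
    have dchi: "chi differentiable (at x)" for x :: "real^'n" by (rule smooth_on_differentiable[OF smooth_on_chi UNIV_I])
    have d1: "partial_deriv (\<lambda>x. (1 - chi x) * us k (F1 x)) i x
        = (\<Sum>j\<in>UNIV. m j x * partial_deriv (us k) j (F1 x)) - ?c x * us k (F1 x)" if "x \<in> ?N" for k x
    proof (cases "norm x < 1")
      case True
      have zz: "chi y = 1" if "y \<in> ball 0 1" for y :: "real^'n" using inner_self_le[of y 1] that by (intro chi_eq_1) auto
      have x1: "x \<in> ball 0 1" using True by simp
      have "partial_deriv (\<lambda>x. (1 - chi x) * us k (F1 x)) i x = 0"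
        by (rule partial_deriv_zero_open[OF open_ball x1]) (simp add: zz)
      moreover have "?c x = 0"
        using partial_deriv_cong_open[OF open_ball x1, of "\<lambda>_. 1" chi i] zz by simp
      ultimately show ?thesis using zz[OF x1] by (simp add: m_def)
    next
      case False
      then have x: "x \<noteq> 0" by auto
      have dus: "us k differentiable (at (F1 x))" by (rule smooth_on_differentiable[OF us(1) UNIV_I])
      have dF: "(\<lambda>x. us k (F1 x)) differentiable (at x)"
        using has_derivative_compose[OF F1_has_derivative[OF x] has_derivative_grad[OF dus]] differentiable_def by blast
      have "partial_deriv (\<lambda>x. (1 - chi x) * us k (F1 x)) i x
         = (1 - chi x) * partial_deriv (\<lambda>x. us k (F1 x)) i x + partial_deriv (\<lambda>x. 1 - chi x) i x * us k (F1 x)"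
        by (rule partial_deriv_mult[OF _ dF]) (use dchi in auto)
      also have "partial_deriv (\<lambda>x. 1 - chi x) i x = - ?c x"
        using partial_deriv_diff[of "\<lambda>_. 1" x chi i] dchi by simp
      also have "partial_deriv (\<lambda>x. us k (F1 x)) i x = DF x (grad (us k) (F1 x)) $ i"
        using grad_compose_F1[OF x dus] grad_component by metis
      finally show ?thesis using lin[of x "grad (us k) (F1 x)"] by simp
    qed
    show ?thesis
    proof (rule L2lim_cong[OF tot])
      show "partial_deriv (\<psi> k) i \<in> borel_measurable borel" for k by (rule smooth_measurable[OF smooth_on_partial_deriv[OF s\<psi>]])
      show "(\<lambda>x. (G x + (- 1) *\<^sub>R H x) $ i) \<in> borel_measurable borel" by simp
      show "partial_deriv (\<psi> k) i x = partial_deriv (us k) i x - (chi x * partial_deriv (vs k) i x + ?c x * vs k x)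
          - ((\<Sum>j\<in>UNIV. m j x * partial_deriv (us k) j (F1 x)) - ?c x * us k (F1 x))" if x: "x \<in> ?N" for k x
      proof -
        have du: "us k differentiable (at x)" by (rule smooth_on_differentiable[OF us(1) UNIV_I])
        have dv: "vs k differentiable (at x)" by (rule smooth_on_differentiable[OF vs(1) UNIV_I])
        have dcv: "(\<lambda>x. chi x * vs k x) differentiable (at x)" by (rule differentiable_mult[OF dchi dv])
        have dq: "(\<lambda>x. (1 - chi x) * us k (F1 x)) differentiable (at x)"
          by (rule smooth_on_differentiable[OF smooth_on_chi_compose_F1[OF us(1)] UNIV_I])
        have "partial_deriv (\<psi> k) i x = partial_deriv (\<lambda>x. us k x - chi x * vs k x) i x - partial_deriv (\<lambda>x. (1 - chi x) * us k (F1 x)) i x"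
          unfolding \<psi>_def by (rule partial_deriv_diff[OF differentiable_diff[OF du dcv] dq])
        also have "partial_deriv (\<lambda>x. us k x - chi x * vs k x) i x = partial_deriv (us k) i x - partial_deriv (\<lambda>x. chi x * vs k x) i x"
          by (rule partial_deriv_diff[OF du dcv])
        also have "partial_deriv (\<lambda>x. chi x * vs k x) i x = chi x * partial_deriv (vs k) i x + ?c x * vs k x"
          by (rule partial_deriv_mult[OF dchi dv])
        finally show ?thesis by (simp only: d1[OF x])
      qed
      have "AE x in (lborel :: (real^'n) measure). x \<noteq> 0" by (rule AE_lborel_singleton)
      with rel relG show "AE x in lborel. x \<in> ?N \<longrightarrow> (G x + (- 1) *\<^sub>R H x) $ i = G x $ i - (chi x * H x $ i + ?c x * v x)
          - ((\<Sum>j\<in>UNIV. m j x * G (F1 x) $ j) - ?c x * u (F1 x))"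
        unfolding lin by eventually_elim (auto simp: N0_iff algebra_simps)
    qed
  qed
  show ?thesis by (rule zero_trace_approx[OF weak_pair_add_cmult[OF wu wv] s\<psi> z lim limG])
qed

lemma integrable_inner_grad_smooth:
  fixes H :: "real^'n \<Rightarrow> real^'n"
  assumes H: "\<And>i. sqint (\<lambda>x. H x $ i)" and H0: "\<And>x. x \<notin> ball 0 2 \<Longrightarrow> H x = 0" and f: "smooth_on UNIV f"
  shows "sqint (\<lambda>x. (indicator (ball 0 2) x *\<^sub>R grad f x) $ i)" "integrable lborel (\<lambda>x. H x \<bullet> grad f x)"
proof -
  have s: "sqint (\<lambda>x. indicator (ball 0 2) x * partial_deriv f i x)" for i
  proof -
    obtain B where "\<And>x. norm x \<le> 2 \<Longrightarrow> \<bar>partial_deriv f i x\<bar> \<le> B" using smooth_on_bounded_cball[OF smooth_on_partial_deriv[OF f]] by blast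
    then show ?thesis by (intro sqint_bounded_indicator smooth_measurable smooth_on_partial_deriv f) auto
  qed
  then show "sqint (\<lambda>x. (indicator (ball 0 2) x *\<^sub>R grad f x) $ i)" by simp
  have "integrable lborel (\<lambda>x. \<Sum>i\<in>UNIV. H x $ i * (indicator (ball 0 2) x * partial_deriv f i x))"
    by (intro Bochner_Integration.integrable_sum sqint_mult_integrable H s)
  moreover have "(\<Sum>i\<in>UNIV. H x $ i * (indicator (ball 0 2) x * partial_deriv f i x)) = H x \<bullet> grad f x" for x
    using H0[of x] by (cases "x \<in> ball 0 2") (simp_all add: inner_vec_def)
  ultimately show "integrable lborel (\<lambda>x. H x \<bullet> grad f x)" by simp
qed

lemma grad_diff:
  "f differentiable (at x) \<Longrightarrow> g differentiable (at x) \<Longrightarrow> grad (\<lambda>x. f x - g x) x = grad f x - grad g x"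
  by (simp add: vec_eq_iff partial_deriv_diff)

lemma grad_add:
  "f differentiable (at x) \<Longrightarrow> g differentiable (at x) \<Longrightarrow> grad (\<lambda>x. f x + g x) x = grad f x + grad g x"
  by (simp add: vec_eq_iff partial_deriv_add)

text \<open>Split \<Phi> into chi \<Phi> and (1 - chi) \<Phi>. The former is a test function and
  pairs to zero with both solutions. The latter, call it Q, has its gradient in the ball supported
  in \<open>N1\<close>, where the energy identity turns its pairing into that of \<open>H\<close>
  with the gradient of Q o F1.\<close>

lemma neumann_datum_eq:
  fixes u v :: "real^'n \<Rightarrow> real" and a :: "real^'n \<Rightarrow> real^'n^'n"
  assumes dim: "CARD('n) \<ge> 3"
    and G: "\<And>i. sqint (\<lambda>x. G x $ i)" and uG: "AE x in lborel. x \<in> ball 0 2 \<longrightarrow> wgrad (ball 0 2) u x = G x"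
    and H: "\<And>i. sqint (\<lambda>x. H x $ i)" and vH: "AE x in lborel. x \<in> ball 0 2 \<longrightarrow> wgrad (ball 0 2) v x = H x"
    and H0: "\<And>x. x \<notin> ball 0 2 \<Longrightarrow> H x = 0"
    and relG: "AE x in lborel. x \<in> N0 \<longrightarrow> H x = DF x (G (F1 x))"
    and sol: "weak_sol (ball 0 2) (sigma_tilde a) u"
    and harm: "\<And>\<phi>. test_fun (ball 0 2) \<phi> \<Longrightarrow> (\<integral>x. H x \<bullet> grad \<phi> x \<partial>lborel) = 0"
  shows "neumann_datum (ball 0 2) (sigma_tilde a) u = neumann_datum (ball 0 2) (\<lambda>x. mat 1) v"
proof
  fix \<Phi> :: "real^'n \<Rightarrow> real"
  let ?N = "ball 0 2 :: (real^'n) set"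
  show "neumann_datum ?N (sigma_tilde a) u \<Phi> = neumann_datum ?N (\<lambda>x. mat 1) v \<Phi>"
  proof (cases "smooth_on UNIV \<Phi>")
    case \<Phi>: True
    let ?P = "\<lambda>x. chi x * \<Phi> x" and ?Q = "\<lambda>x. (1 - chi x) * \<Phi> x"
    have tP: "test_fun ?N ?P" by (rule test_fun_chi[OF \<Phi>])
    have sQ: "smooth_on UNIV ?Q" by (intro smooth_on_mult smooth_on_diff smooth_on_const smooth_on_chi \<Phi>) auto
    have Q0: "?Q x = 0" if "x \<bullet> x \<le> 2" for x using that by (simp add: chi_eq_1)
    have sQF: "smooth_on UNIV (\<lambda>x. ?Q (F1 x))" by (rule smooth_on_zero_compose_F1[OF sQ Q0])
    have gPQ: "grad \<Phi> x = grad ?P x + grad ?Q x" for x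
    proof -
      have "grad (\<lambda>x. ?P x + ?Q x) x = grad ?P x + grad ?Q x"
        by (rule grad_add[OF smooth_on_differentiable[OF test_fun_smooth[OF tP] UNIV_I] smooth_on_differentiable[OF sQ UNIV_I]])
      moreover have "(\<lambda>x. ?P x + ?Q x) = \<Phi>" by (simp add: fun_eq_iff algebra_simps)
      ultimately show ?thesis by simp
    qed
    have gQ0: "grad ?Q x = 0" if "norm x \<le> 1" for x
    proof -
      have o: "open {x :: real^'n. x \<bullet> x < 2}" by (intro open_Collect_less continuous_intros)
      have "partial_deriv ?Q i x = 0" for i
        by (rule partial_deriv_zero_open[OF o]) (use inner_self_le[OF that] Q0 in auto)
      then show ?thesis by (simp add: vec_eq_iff)
    qed
    \<comment> \<open>Restricted to the ball to be square integrable; \<Phi> is smooth on the whole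
      space without decay.\<close>
    define V where "V x = indicator ?N x *\<^sub>R grad ?Q x" for x
    have sV: "sqint (\<lambda>x. V x $ i)" for i unfolding V_def by (rule integrable_inner_grad_smooth(1)[OF H H0 sQ])
    have [measurable]: "G \<in> borel_measurable borel" "H \<in> borel_measurable borel" "V \<in> borel_measurable borel"
      using sqint_norm(2)[OF G] sqint_norm(2)[OF H] sqint_norm(2)[OF sV] by auto
    have [measurable]: "grad f \<in> borel_measurable borel" if "smooth_on UNIV f" for f :: "real^'n \<Rightarrow> real"
      by (rule borel_measurable_euclidean_space[THEN iffD2])
         (auto simp: Basis_vec_def inner_axis intro!: smooth_measurable smooth_on_partial_deriv that)
    let ?S = "\<lambda>f x. (sigma_tilde a x *v wgrad ?N u x) \<bullet> grad f x"
    let ?g = "\<lambda>x. indicator N1 x * (Sv x (G x) \<bullet> V x)"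
    have gm: "?g \<in> borel_measurable borel" by measurable
    have eqQ: "AE x in lborel. x \<in> ?N \<longrightarrow> ?S ?Q x = ?g x"
      using uG
    proof eventually_elim
      case (elim x)
      show ?case
      proof (cases "x \<in> N1")
        case True
        then show ?thesis using elim by (simp add: sigma_tilde_N1 V_def)
      next
        case False
        then have "x \<in> ?N \<Longrightarrow> norm x \<le> 1" by (simp add: N1_iff)
        then show ?thesis using False gQ0 by simp
      qed
    qed
    have ig: "integrable lborel ?g" by (rule integrable_Sv[OF dim G sV])
    have iN: "indicator ?N x * ?g x = ?g x" for x by (auto simp: indicator_def N1_iff)
    have intQ: "set_integrable lebesgue ?N (?S ?Q)"
      using set_lebesgue_transfer(2)[OF _ gm eqQ] ig by (simp add: iN)
    have valQ: "(LINT x:?N|lebesgue. ?S ?Q x) = (\<integral>x. ?g x \<partial>lborel)"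
      using set_lebesgue_transfer(3)[OF _ gm eqQ] by (simp only: iN) simp
    have intP: "set_integrable lebesgue ?N (?S ?P)" and valP: "(LINT x:?N|lebesgue. ?S ?P x) = 0"
      using sol tP by (auto simp: weak_sol_def)
    have "neumann_datum ?N (sigma_tilde a) u \<Phi> = (LINT x:?N|lebesgue. ?S ?P x + ?S ?Q x)"
      using \<Phi> by (simp add: neumann_datum_def gPQ inner_add_right)
    also have "\<dots> = (\<integral>x. ?g x \<partial>lborel)"
      using set_integral_add(2)[OF intP intQ] valP valQ by simp
    also have "\<dots> = (\<integral>x. indicator N0 x * (DF x (G (F1 x)) \<bullet> DF x (V (F1 x))) \<partial>lborel)"
      by (rule energy_identity(2)[symmetric]) measurable
    also have "\<dots> = (\<integral>x. H x \<bullet> grad (\<lambda>x. ?Q (F1 x)) x \<partial>lborel)"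
    proof (rule integral_cong_AE)
      show "(\<lambda>x. indicator N0 x * (DF x (G (F1 x)) \<bullet> DF x (V (F1 x)))) \<in> borel_measurable lborel" by measurable
      have "grad (\<lambda>x. ?Q (F1 x)) \<in> borel_measurable borel"
        by (rule borel_measurable_euclidean_space[THEN iffD2])
           (auto simp: Basis_vec_def inner_axis intro!: smooth_measurable smooth_on_partial_deriv sQF)
      then show "(\<lambda>x. H x \<bullet> grad (\<lambda>x. ?Q (F1 x)) x) \<in> borel_measurable lborel" by simp
      have "AE x in (lborel :: (real^'n) measure). x \<noteq> 0" by (rule AE_lborel_singleton)
      with relG show "AE x in lborel. indicator N0 x * (DF x (G (F1 x)) \<bullet> DF x (V (F1 x))) = H x \<bullet> grad (\<lambda>x. ?Q (F1 x)) x"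
      proof eventually_elim
        case (elim x)
        show ?case
        proof (cases "x \<in> N0")
          case True
          have "F1 x \<in> ?N" using F1_in_N1[OF True] by (simp add: N1_iff)
          then have "DF x (V (F1 x)) = grad (\<lambda>x. ?Q (F1 x)) x"
            using grad_compose_F1[OF elim(2) smooth_on_differentiable[OF sQ UNIV_I]] by (simp add: V_def)
          then show ?thesis using elim True by simp
        next
          case False
          then have "x \<notin> ?N" using elim by (simp add: N0_iff)
          then show ?thesis using H0 False by simp
        qed
      qed
    qed
    also have "\<dots> = (\<integral>x. H x \<bullet> grad ?Q x \<partial>lborel)"
    proof -
      \<comment> \<open>\<open>F1\<close> fixes the outer sphere, so this difference vanishes there
        and pairs to zero with the harmonic field.\<close>
      let ?\<zeta> = "\<lambda>x. ?Q (F1 x) - ?Q x"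
      have s\<zeta>: "smooth_on UNIV ?\<zeta>" by (intro smooth_on_diff sQF sQ) simp
      have "(\<integral>x. H x \<bullet> grad ?\<zeta> x \<partial>lborel) = 0"
        by (rule harmonic_zero_boundary[OF H H0 harm s\<zeta>]) (simp_all add: F1_sphere)
      moreover have "H x \<bullet> grad ?\<zeta> x = H x \<bullet> grad (\<lambda>x. ?Q (F1 x)) x - H x \<bullet> grad ?Q x" for x
        by (subst grad_diff[OF smooth_on_differentiable[OF sQF UNIV_I] smooth_on_differentiable[OF sQ UNIV_I]]) (rule inner_diff_right)
      ultimately have "(\<integral>x. H x \<bullet> grad (\<lambda>x. ?Q (F1 x)) x - H x \<bullet> grad ?Q x \<partial>lborel) = 0" by simp
      then have "(\<integral>x. H x \<bullet> grad (\<lambda>x. ?Q (F1 x)) x \<partial>lborel) - (\<integral>x. H x \<bullet> grad ?Q x \<partial>lborel) = 0"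
        by (subst Bochner_Integration.integral_diff[symmetric, OF integrable_inner_grad_smooth(2)[OF H H0 sQF] integrable_inner_grad_smooth(2)[OF H H0 sQ]])
      then show ?thesis by (rule eq_iff_diff_eq_0[THEN iffD2])
    qed
    also have "\<dots> = (\<integral>x. H x \<bullet> grad ?P x + H x \<bullet> grad ?Q x \<partial>lborel)"
      by (subst Bochner_Integration.integral_add[OF integrable_inner_grad_smooth(2)[OF H H0 test_fun_smooth[OF tP]] integrable_inner_grad_smooth(2)[OF H H0 sQ]])
         (simp_all add: harm[OF tP])
    also have "\<dots> = (\<integral>x. indicator ?N x * (H x \<bullet> grad \<Phi> x) \<partial>lborel)"
      using H0 by (intro Bochner_Integration.integral_cong) (auto simp: gPQ inner_add_right indicator_def)
    also have "\<dots> = (LINT x:?N|lebesgue. (mat 1 *v wgrad ?N v x) \<bullet> grad \<Phi> x)"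
    proof (rule set_lebesgue_transfer(3)[symmetric])
      show "(\<lambda>x. H x \<bullet> grad \<Phi> x) \<in> borel_measurable borel"
        using \<open>\<And>f. smooth_on UNIV f \<Longrightarrow> grad f \<in> borel_measurable borel\<close>[OF \<Phi>] by measurable
      show "AE x in lborel. x \<in> ?N \<longrightarrow> (mat 1 *v wgrad ?N v x) \<bullet> grad \<Phi> x = H x \<bullet> grad \<Phi> x"
        using vH by eventually_elim auto
    qed simp
    also have "\<dots> = neumann_datum ?N (\<lambda>x. mat 1) v \<Phi>" using \<Phi> by (simp add: neumann_datum_def)
    finally show ?thesis .
  qed (simp add: neumann_datum_def)
qed

lemma cauchy_data_match:
  fixes u v :: "real^'n \<Rightarrow> real" and a :: "real^'n \<Rightarrow> real^'n^'n"
  assumes dim: "CARD('n) \<ge> 3"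
    and u: "weak_sol (ball 0 2) (sigma_tilde a) u"
    and u0: "weak_pair (ball 0 2) u0 G" "integrable lborel u0" "AE x in lborel. x \<in> ball 0 2 \<longrightarrow> u x = u0 x"
    and v0: "weak_pair (ball 0 2) v0 H" "integrable lborel v0" "AE x in lborel. x \<in> ball 0 2 \<longrightarrow> v x = v0 x"
    and H0: "\<And>x. x \<notin> ball 0 2 \<Longrightarrow> H x = 0"
    and rel: "AE x in lborel. x \<in> N0 \<longrightarrow> v0 x = u0 (F1 x)"
    and relG: "AE x in lborel. x \<in> N0 \<longrightarrow> H x = DF x (G (F1 x))"
    and harm: "\<And>\<phi>. test_fun (ball 0 2) \<phi> \<Longrightarrow> (\<integral>x. H x \<bullet> grad \<phi> x \<partial>lborel) = 0"
  shows "dirichlet_datum (ball 0 2) u = dirichlet_datum (ball 0 2) v"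
    and "neumann_datum (ball 0 2) (sigma_tilde a) u = neumann_datum (ball 0 2) (\<lambda>x. mat 1) v"
proof -
  have "AE x in lborel. x \<in> ball 0 2 \<longrightarrow> u x - v x = u0 x + (- 1) * v0 x"
    using u0(3) v0(3) by eventually_elim auto
  then have "H1_0 (ball 0 2) (\<lambda>x. u x - v x)"
    unfolding H1_0_iff_zero_trace[OF open_ball] using zero_trace_difference[OF u0(1,2) v0(1,2) rel relG] by blast
  then show "dirichlet_datum (ball 0 2) u = dirichlet_datum (ball 0 2) v"
    by (rule dirichlet_datum_eqI[OF open_ball])
  show "neumann_datum (ball 0 2) (sigma_tilde a) u = neumann_datum (ball 0 2) (\<lambda>x. mat 1) v"
    by (rule neumann_datum_eq[OF dim weak_pairD(2)[OF u0(1)] wgrad_eq_AE[OF open_ball u0(1,3)]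
          weak_pairD(2)[OF v0(1)] wgrad_eq_AE[OF open_ball v0(1,3)] H0 relG u harm])
qed

lemma sqint_integrable_zero_outside:
  fixes u :: "real^'n \<Rightarrow> real"
  assumes "sqint u" "\<And>x. x \<notin> ball 0 2 \<Longrightarrow> u x = 0" shows "integrable lborel u"
proof -
  have "integrable lborel (\<lambda>x. indicator (ball 0 2) x * u x)" by (rule sqint_integrable_bounded[OF assms(1)]) auto
  moreover have "indicator (ball 0 2) x * u x = u x" for x using assms(2)[of x] by (auto simp: indicator_def)
  ultimately show ?thesis by simp
qed

text \<open>Reduces \<open>weak_sol\<close> to Borel integrands: S \<phi> is the energy density
  against \<phi>, set to zero outside the ball. It serves the Laplace equation and the transplanted
  solution, whose density is carried by \<open>N1\<close>.\<close>

lemma weak_sol_iff: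
  fixes u :: "real^'n \<Rightarrow> real"
  assumes wp: "weak_pair (ball 0 2) u0 G" and u: "AE x in lborel. x \<in> ball 0 2 \<longrightarrow> u x = u0 x"
    and S: "\<And>\<phi>. test_fun (ball 0 2) \<phi> \<Longrightarrow> S \<phi> \<in> borel_measurable borel"
    and eq: "\<And>\<phi> x. test_fun (ball 0 2) \<phi> \<Longrightarrow> x \<in> ball 0 2 \<Longrightarrow> (\<sigma> x *v G x) \<bullet> grad \<phi> x = S \<phi> x"
    and z: "\<And>\<phi> x. test_fun (ball 0 2) \<phi> \<Longrightarrow> x \<notin> ball 0 2 \<Longrightarrow> S \<phi> x = 0"
  shows "weak_sol (ball 0 2) \<sigma> u \<longleftrightarrow> (\<forall>\<phi>. test_fun (ball 0 2) \<phi> \<longrightarrow> integrable lborel (S \<phi>) \<and> (\<integral>x. S \<phi> x \<partial>lborel) = 0)"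
proof -
  have h1: "H1 (ball 0 2) u" by (rule weak_pair_imp_H1(1)[OF _ wp u]) simp
  have "set_integrable lebesgue (ball 0 2) (\<lambda>x. (\<sigma> x *v wgrad (ball 0 2) u x) \<bullet> grad \<phi> x) \<longleftrightarrow> integrable lborel (S \<phi>)"
    "(LINT x:ball 0 2|lebesgue. (\<sigma> x *v wgrad (ball 0 2) u x) \<bullet> grad \<phi> x) = (\<integral>x. S \<phi> x \<partial>lborel)"
    if \<phi>: "test_fun (ball 0 2) \<phi>" for \<phi>
  proof -
    have ae: "AE x in lborel. x \<in> ball 0 2 \<longrightarrow> (\<sigma> x *v wgrad (ball 0 2) u x) \<bullet> grad \<phi> x = S \<phi> x"
      using wgrad_eq_AE[OF open_ball wp u] by eventually_elim (simp add: eq[OF \<phi>])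
    have i: "(\<lambda>x. indicator (ball 0 2) x * S \<phi> x) = S \<phi>" using z[OF \<phi>] by (auto simp: indicator_def fun_eq_iff)
    show "set_integrable lebesgue (ball 0 2) (\<lambda>x. (\<sigma> x *v wgrad (ball 0 2) u x) \<bullet> grad \<phi> x) \<longleftrightarrow> integrable lborel (S \<phi>)"
      using set_lebesgue_transfer(2)[OF _ S[OF \<phi>] ae] unfolding i by simp
    show "(LINT x:ball 0 2|lebesgue. (\<sigma> x *v wgrad (ball 0 2) u x) \<bullet> grad \<phi> x) = (\<integral>x. S \<phi> x \<partial>lborel)"
      using set_lebesgue_transfer(3)[OF _ S[OF \<phi>] ae] unfolding fun_cong[OF i] by simp
  qed
  with h1 show ?thesis unfolding weak_sol_def by simp
qed

lemma weak_sol_laplace_iff: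
  fixes v :: "real^'n \<Rightarrow> real"
  assumes wp: "weak_pair (ball 0 2) v0 H" and v: "AE x in lborel. x \<in> ball 0 2 \<longrightarrow> v x = v0 x"
    and H0: "\<And>x. x \<notin> ball 0 2 \<Longrightarrow> H x = 0"
  shows "weak_sol (ball 0 2) (\<lambda>x. mat 1) v \<longleftrightarrow> (\<forall>\<phi>. test_fun (ball 0 2) \<phi> \<longrightarrow> (\<integral>x. H x \<bullet> grad \<phi> x \<partial>lborel) = 0)"
proof -
  have "weak_sol (ball 0 2) (\<lambda>x. mat 1) v \<longleftrightarrow> (\<forall>\<phi>. test_fun (ball 0 2) \<phi> \<longrightarrow>
     integrable lborel (\<lambda>x. H x \<bullet> grad \<phi> x) \<and> (\<integral>x. H x \<bullet> grad \<phi> x \<partial>lborel) = 0)"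
  proof (rule weak_sol_iff[OF wp v])
    fix \<phi> :: "real^'n \<Rightarrow> real" assume "test_fun (ball 0 2) \<phi>"
    from integral_inner_grad(2)[OF weak_pairD(2)[OF wp] this]
    show "(\<lambda>x. H x \<bullet> grad \<phi> x) \<in> borel_measurable borel" by auto
  qed (simp_all add: H0)
  then show ?thesis using integral_inner_grad(2)[OF weak_pairD(2)[OF wp]] by blast
qed

section \<open>The two inclusions between the Cauchy data sets\<close>

text \<open>Harmonicity of the pull-back comes from testing the equation with functions supported in
  \<open>N1\<close>, where the conductivity is \<open>Sv\<close>; gradients of such functions vanish
  elsewhere in the ball.\<close>

lemma cauchy_data_subset_laplace:
  fixes a :: "real^'n \<Rightarrow> real^'n^'n"
  assumes dim: "CARD('n) \<ge> 3"
  shows "cauchy_data (ball 0 2) (sigma_tilde a) \<subseteq> cauchy_data (ball 0 2) (\<lambda>x. mat 1)"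
proof
  fix d assume "d \<in> cauchy_data (ball 0 2) (sigma_tilde a)"
  then obtain u where d: "d = (dirichlet_datum (ball 0 2) u, neumann_datum (ball 0 2) (sigma_tilde a) u)"
    and u: "weak_sol (ball 0 2) (sigma_tilde a) u" by (auto simp: cauchy_data_def)
  have Nb: "(ball 0 2 :: (real^'n) set) \<in> sets borel" by simp
  have h1: "H1 (ball 0 2) u" using u by (simp add: weak_sol_def)
  obtain u0 G where wp: "weak_pair (ball 0 2) u0 G" and z: "\<And>x. x \<notin> ball 0 2 \<Longrightarrow> u0 x = 0"
    and uu: "AE x in lborel. x \<in> ball 0 2 \<longrightarrow> u x = u0 x" and wG: "AE x in lborel. x \<in> ball 0 2 \<longrightarrow> wgrad (ball 0 2) u x = G x"
    by (rule H1_representative[OF Nb h1]) (rule that)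
  have iu: "integrable lborel u0" by (rule sqint_integrable_zero_outside[OF weak_pairD(1)[OF wp] z])
  have [measurable]: "G \<in> borel_measurable borel" by (rule sqint_norm(2)[OF weak_pairD(2)[OF wp]])
  have sol: "(\<integral>y. indicator N1 y * (Sv y (G y) \<bullet> grad \<phi> y) \<partial>lborel) = 0" if \<phi>: "test_fun N1 \<phi>" for \<phi>
  proof -
    have t: "test_fun (ball 0 2) \<phi>" by (rule test_fun_mono[OF \<phi>]) (auto simp: N1_iff)
    have gm: "grad \<phi> \<in> borel_measurable borel"
      by (rule sqint_norm(2)) (simp add: test_fun_sqint[OF test_fun_partial_deriv[OF \<phi>]])
    obtain K where K: "compact K" "K \<subseteq> N1" "\<And>x. x \<notin> K \<Longrightarrow> \<phi> x = 0" using \<phi> by (rule test_funE) blast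
    have g0: "grad \<phi> x = 0" if "x \<notin> N1" for x
    proof -
      have "partial_deriv \<phi> i x = 0" for i
        by (rule partial_deriv_zero_open[of "- K"]) (use K that compact_imp_closed in auto)
      then show ?thesis by (simp add: vec_eq_iff)
    qed
    have ae: "AE x in lborel. x \<in> ball 0 2 \<longrightarrow> (sigma_tilde a x *v wgrad (ball 0 2) u x) \<bullet> grad \<phi> x = indicator N1 x * (Sv x (G x) \<bullet> grad \<phi> x)"
      using wG
    proof eventually_elim
      case (elim x)
      then show ?case using g0[of x] by (cases "x \<in> N1") (auto simp: sigma_tilde_N1)
    qed
    have "(\<integral>y. indicator N1 y * (Sv y (G y) \<bullet> grad \<phi> y) \<partial>lborel) = (\<integral>y. indicator (ball 0 2) y * (indicator N1 y * (Sv y (G y) \<bullet> grad \<phi> y)) \<partial>lborel)"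
      by (intro Bochner_Integration.integral_cong) (auto simp: indicator_def N1_iff)
    also have "\<dots> = (LINT x:ball 0 2|lebesgue. (sigma_tilde a x *v wgrad (ball 0 2) u x) \<bullet> grad \<phi> x)"
      by (rule set_lebesgue_transfer(3)[OF Nb _ ae, symmetric]) (use gm in measurable)
    also have "\<dots> = 0" using u t by (simp add: weak_sol_def)
    finally show ?thesis .
  qed
  \<comment> \<open>The indicator sets the pull-back to zero outside the ball and at the origin, a
    null set.\<close>
  let ?v = "\<lambda>x. indicator N0 x * u0 (F1 x)" and ?H = "\<lambda>x. indicator N0 x *\<^sub>R DF x (G (F1 x))"
  have wv: "weak_pair (ball 0 2) ?v ?H" by (rule weak_pair_pull_back[OF dim wp iu])
  have harm: "(\<integral>x. ?H x \<bullet> grad \<phi> x \<partial>lborel) = 0" if "test_fun (ball 0 2) \<phi>" for \<phi>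
    by (rule harmonic_pull_back[OF dim wp iu sol that])
  have H0: "?H x = 0" if "x \<notin> ball 0 2" for x using that by (simp add: N0_iff)
  have iv: "integrable lborel ?v"
    by (rule sqint_integrable_zero_outside[OF weak_pairD(1)[OF wv]]) (simp add: N0_iff)
  have "weak_sol (ball 0 2) (\<lambda>x. mat 1) ?v"
    using weak_sol_laplace_iff[OF wv _ H0, of ?v] harm by simp
  moreover have "d = (dirichlet_datum (ball 0 2) ?v, neumann_datum (ball 0 2) (\<lambda>x. mat 1) ?v)"
    unfolding d using cauchy_data_match[OF dim u wp iu uu wv iv _ H0 _ _ harm, of ?v] by simp
  ultimately show "d \<in> cauchy_data (ball 0 2) (\<lambda>x. mat 1)" unfolding cauchy_data_def by blast
qed

lemma laplace_subset_cauchy_data: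
  fixes a :: "real^'n \<Rightarrow> real^'n^'n"
  assumes dim: "CARD('n) \<ge> 3"
  shows "cauchy_data (ball 0 2) (\<lambda>x. mat 1) \<subseteq> cauchy_data (ball 0 2) (sigma_tilde a)"
proof
  let ?N = "ball 0 2 :: (real^'n) set"
  fix d assume "d \<in> cauchy_data ?N (\<lambda>x. mat 1)"
  then obtain v where d: "d = (dirichlet_datum ?N v, neumann_datum ?N (\<lambda>x. mat 1) v)"
    and v: "weak_sol ?N (\<lambda>x. mat 1) v" by (auto simp: cauchy_data_def)
  have Nb: "?N \<in> sets borel" by simp
  have h1: "H1 ?N v" using v by (simp add: weak_sol_def)
  obtain v0 H0 where wp0: "weak_pair ?N v0 H0" and z0: "\<And>x. x \<notin> ?N \<Longrightarrow> v0 x = 0" "\<And>x. x \<notin> ?N \<Longrightarrow> H0 x = 0"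
    and vv: "AE x in lborel. x \<in> ?N \<longrightarrow> v x = v0 x"
    by (rule H1_representative[OF Nb h1]) (rule that)
  have iv0: "integrable lborel v0" by (rule sqint_integrable_zero_outside[OF weak_pairD(1)[OF wp0] z0(1)])
  have harm0: "(\<integral>x. H0 x \<bullet> grad \<phi> x \<partial>lborel) = 0" if "test_fun ?N \<phi>" for \<phi>
    using v that weak_sol_laplace_iff[OF wp0 vv z0(2)] by blast
  obtain h where h: "smooth_on UNIV h" and vh: "AE x in lborel. x \<in> ball 0 1 \<longrightarrow> v0 x = h x"
    by (rule weyl[OF wp0 iv0 harm0])
  have [measurable]: "v0 \<in> borel_measurable borel" "H0 \<in> borel_measurable borel" "h \<in> borel_measurable borel" "(\<lambda>x. H0 x $ i) \<in> borel_measurable borel"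
    "partial_deriv h i \<in> borel_measurable borel" for i
    using weak_pairD(1,2)[OF wp0] sqint_norm(2)[OF weak_pairD(2)[OF wp0]] smooth_measurable[OF h] smooth_measurable[OF smooth_on_partial_deriv[OF h]]
    by (auto simp: sqint_def)
  \<comment> \<open>The classical gradient of \<open>h\<close> is a weak gradient on the unit ball,
    so uniqueness identifies \<open>H0\<close> with it there.\<close>
  have wph: "weak_pair (ball 0 1) (\<lambda>x. indicator (ball 0 1) x * h x) (\<lambda>x. indicator (ball 0 1) x *\<^sub>R grad h x)"
    unfolding weak_pair_def
  proof (intro conjI allI impI)
    obtain B where "\<And>x. norm x \<le> 1 \<Longrightarrow> \<bar>h x\<bar> \<le> B" using smooth_on_bounded_cball[OF h] by blast
    then show "sqint (\<lambda>x. indicator (ball 0 1) x * h x)" by (intro sqint_bounded_indicator) auto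
    show "sqint (\<lambda>x. (indicator (ball 0 1) x *\<^sub>R grad h x) $ i)" for i
    proof -
      obtain B where "\<And>x. norm x \<le> 1 \<Longrightarrow> \<bar>partial_deriv h i x\<bar> \<le> B" using smooth_on_bounded_cball[OF smooth_on_partial_deriv[OF h]] by blast
      then have "sqint (\<lambda>x. indicator (ball 0 1) x * partial_deriv h i x)" by (intro sqint_bounded_indicator) auto
      then show ?thesis by simp
    qed
    fix \<phi> :: "real^'n \<Rightarrow> real" and i assume \<phi>: "test_fun (ball 0 1) \<phi>"
    obtain K where K: "K \<subseteq> ball 0 1" "\<And>x. x \<notin> K \<Longrightarrow> \<phi> x = 0" using \<phi> by (rule test_funE) blast
    obtain K' where K': "K' \<subseteq> ball 0 1" "\<And>x. x \<notin> K' \<Longrightarrow> partial_deriv \<phi> i x = 0" using test_fun_partial_deriv[OF \<phi>] by (rule test_funE) blast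
    have "(\<integral>x. (indicator (ball 0 1) x * h x) * partial_deriv \<phi> i x \<partial>lborel) = (\<integral>x. h x * partial_deriv \<phi> i x \<partial>lborel)"
    proof (rule Bochner_Integration.integral_cong[OF refl])
      show "(indicator (ball 0 1) x * h x) * partial_deriv \<phi> i x = h x * partial_deriv \<phi> i x" for x
        by (cases "x \<in> K'") (use K' in \<open>auto simp: indicator_def\<close>)
    qed
    also have "\<dots> = - (\<integral>x. partial_deriv h i x * \<phi> x \<partial>lborel)" by (rule integral_by_parts[OF h test_fun_mono[OF \<phi> subset_UNIV]])
    also have "(\<integral>x. partial_deriv h i x * \<phi> x \<partial>lborel) = (\<integral>x. (indicator (ball 0 1) x *\<^sub>R grad h x) $ i * \<phi> x \<partial>lborel)"
    proof (rule Bochner_Integration.integral_cong[OF refl])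
      show "partial_deriv h i x * \<phi> x = (indicator (ball 0 1) x *\<^sub>R grad h x) $ i * \<phi> x" for x
        by (cases "x \<in> K") (use K in \<open>auto simp: indicator_def grad_def\<close>)
    qed
    finally show "(\<integral>x. (indicator (ball 0 1) x * h x) * partial_deriv \<phi> i x \<partial>lborel) = - (\<integral>x. (indicator (ball 0 1) x *\<^sub>R grad h x) $ i * \<phi> x \<partial>lborel)" .
  qed
  have wp01: "weak_pair (ball 0 1) v0 H0"
    unfolding weak_pair_def
  proof (intro conjI allI impI)
    fix \<phi> :: "real^'n \<Rightarrow> real" and i assume "test_fun (ball 0 1) \<phi>"
    then have "test_fun ?N \<phi>" by (rule test_fun_mono) auto
    then show "(\<integral>x. v0 x * partial_deriv \<phi> i x \<partial>lborel) = - (\<integral>x. H0 x $ i * \<phi> x \<partial>lborel)" by (rule weak_pairD(3)[OF wp0])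
  qed (rule weak_pairD(1)[OF wp0] weak_pairD(2)[OF wp0])+
  have Hh: "AE x in lborel. x \<in> ball 0 1 \<longrightarrow> H0 x = grad h x"
  proof -
    have "AE x in lborel. x \<in> ball 0 1 \<longrightarrow> v0 x = indicator (ball 0 1) x * h x" using vh by eventually_elim auto
    from weak_pair_unique[OF open_ball wp01 wph this] show ?thesis by eventually_elim auto
  qed
  \<comment> \<open>The transplant evaluates at the single point 0, so the representative must equal
    \<open>h\<close> at every point of the unit ball, not merely almost everywhere.\<close>
  define w where "w x = (if norm x < 1 then h x else v0 x)" for x
  define W where "W x = (if norm x < 1 then grad h x else H0 x)" for x
  have w0: "AE x in lborel. w x = v0 x" using vh by eventually_elim (auto simp: w_def)
  have W0: "AE x in lborel. W x = H0 x" using Hh by eventually_elim (auto simp: W_def)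
  have [measurable]: "w \<in> borel_measurable borel" "(\<lambda>x. W x $ i) \<in> borel_measurable borel" for i
  proof -
    show "w \<in> borel_measurable borel" unfolding w_def[abs_def] by measurable
    have "(\<lambda>x. W x $ i) = (\<lambda>x. if norm x < 1 then partial_deriv h i x else H0 x $ i)" by (auto simp: W_def)
    then show "(\<lambda>x. W x $ i) \<in> borel_measurable borel" by simp
  qed
  have wp: "weak_pair ?N w W"
    unfolding weak_pair_def
  proof (intro conjI allI impI)
    show sw: "sqint w" by (rule sqint_bound[OF weak_pairD(1)[OF wp0], of _ 1]) (use w0 in \<open>auto elim!: eventually_mono\<close>)
    show sW: "sqint (\<lambda>x. W x $ i)" for i
      by (rule sqint_bound[OF weak_pairD(2)[OF wp0], of _ 1]) (use W0 in \<open>auto elim!: eventually_mono\<close>)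
    fix \<phi> :: "real^'n \<Rightarrow> real" and i assume \<phi>: "test_fun ?N \<phi>"
    have [measurable]: "\<phi> \<in> borel_measurable borel" "partial_deriv \<phi> i \<in> borel_measurable borel"
      using test_fun_measurable[OF \<phi>] test_fun_measurable[OF test_fun_partial_deriv[OF \<phi>]] by auto
    have "(\<integral>x. w x * partial_deriv \<phi> i x \<partial>lborel) = (\<integral>x. v0 x * partial_deriv \<phi> i x \<partial>lborel)"
      by (rule integral_cong_AE) (use w0 in \<open>auto elim!: eventually_mono\<close>)
    also have "\<dots> = - (\<integral>x. H0 x $ i * \<phi> x \<partial>lborel)" by (rule weak_pairD(3)[OF wp0 \<phi>])
    also have "(\<integral>x. H0 x $ i * \<phi> x \<partial>lborel) = (\<integral>x. W x $ i * \<phi> x \<partial>lborel)"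
      by (rule integral_cong_AE) (use W0 in \<open>auto elim!: eventually_mono\<close>)
    finally show "(\<integral>x. w x * partial_deriv \<phi> i x \<partial>lborel) = - (\<integral>x. W x $ i * \<phi> x \<partial>lborel)" .
  qed
  have iw: "integrable lborel w"
    by (rule sqint_integrable_zero_outside[OF weak_pairD(1)[OF wp]]) (simp add: w_def z0)
  have WN: "W x = 0" if "x \<notin> ?N" for x using that by (simp add: W_def z0)
  have Wm[measurable]: "W \<in> borel_measurable borel" by (rule sqint_norm(2)[OF weak_pairD(2)[OF wp]])
  have harm: "(\<integral>x. W x \<bullet> grad \<phi> x \<partial>lborel) = 0" if \<phi>: "test_fun ?N \<phi>" for \<phi>
  proof -
    have [measurable]: "grad \<phi> \<in> borel_measurable borel"
      by (rule sqint_norm(2)) (simp add: test_fun_sqint[OF test_fun_partial_deriv[OF \<phi>]])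
    have "(\<integral>x. W x \<bullet> grad \<phi> x \<partial>lborel) = (\<integral>x. H0 x \<bullet> grad \<phi> x \<partial>lborel)"
      by (rule integral_cong_AE) (use W0 in \<open>auto elim!: eventually_mono\<close>)
    then show ?thesis using harm0[OF \<phi>] by simp
  qed
  have wh: "w x = h x" "W x = grad h x" if "norm x < 1" for x using that by (auto simp: w_def W_def)
  let ?u = "push_fun w" and ?G = "push_grad W"
  have wpu: "weak_pair ?N ?u ?G" by (rule weak_pair_push[OF wp iw h wh])
  have iu: "integrable lborel ?u"
    by (rule sqint_integrable_zero_outside[OF weak_pairD(1)[OF wpu]]) (simp add: push_fun_def)
  have "weak_sol ?N (sigma_tilde a) ?u \<longleftrightarrow> (\<forall>\<phi>. test_fun ?N \<phi> \<longrightarrow>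
     integrable lborel (\<lambda>x. indicator N1 x * (Sv x (?G x) \<bullet> grad \<phi> x)) \<and> (\<integral>x. indicator N1 x * (Sv x (?G x) \<bullet> grad \<phi> x) \<partial>lborel) = 0)"
  proof (rule weak_sol_iff[OF wpu])
    fix \<phi> :: "real^'n \<Rightarrow> real" assume \<phi>: "test_fun ?N \<phi>"
    have [measurable]: "grad \<phi> \<in> borel_measurable borel"
      by (rule sqint_norm(2)) (simp add: test_fun_sqint[OF test_fun_partial_deriv[OF \<phi>]])
    show "(\<lambda>x. indicator N1 x * (Sv x (?G x) \<bullet> grad \<phi> x)) \<in> borel_measurable borel" by measurable
    show "(sigma_tilde a x *v ?G x) \<bullet> grad \<phi> x = indicator N1 x * (Sv x (?G x) \<bullet> grad \<phi> x)" for x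
      by (cases "x \<in> N1") (auto simp: sigma_tilde_N1 push_grad_def)
    show "x \<notin> ?N \<Longrightarrow> indicator N1 x * (Sv x (?G x) \<bullet> grad \<phi> x) = 0" for x by (simp add: N1_iff)
  qed simp
  moreover have "integrable lborel (\<lambda>x. indicator N1 x * (Sv x (?G x) \<bullet> grad \<phi> x))"
    "(\<integral>x. indicator N1 x * (Sv x (?G x) \<bullet> grad \<phi> x) \<partial>lborel) = 0" if \<phi>: "test_fun ?N \<phi>" for \<phi>
  proof -
    show "integrable lborel (\<lambda>x. indicator N1 x * (Sv x (?G x) \<bullet> grad \<phi> x))"
      by (rule integrable_Sv[OF dim weak_pairD(2)[OF wpu]]) (simp add: test_fun_sqint[OF test_fun_partial_deriv[OF \<phi>]])
    show "(\<integral>x. indicator N1 x * (Sv x (?G x) \<bullet> grad \<phi> x) \<partial>lborel) = 0"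
      by (rule push_solution[OF dim weak_pairD(2)[OF wp] weak_pairD(2)[OF wpu] harm \<phi>])
  qed
  ultimately have sol: "weak_sol ?N (sigma_tilde a) ?u" by blast
  have vw: "AE x in lborel. x \<in> ?N \<longrightarrow> v x = w x" using vv w0 by eventually_elim auto
  have rel: "AE x in lborel. x \<in> N0 \<longrightarrow> w x = ?u (F1 x)"
  proof (rule AE_I2, rule impI)
    fix x :: "real^'n" assume x: "x \<in> N0"
    then show "w x = ?u (F1 x)" using F1_in_N1[OF x] Fi_F1[of x] by (auto simp: push_fun_def N1_iff N0_iff)
  qed
  have relG: "AE x in lborel. x \<in> N0 \<longrightarrow> W x = DF x (?G (F1 x))" by (simp add: DF_push_grad)
  have "d = (dirichlet_datum ?N ?u, neumann_datum ?N (sigma_tilde a) ?u)"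
    unfolding d using cauchy_data_match[OF dim sol wpu iu _ wp iw vw WN rel relG harm] by simp
  with sol show "d \<in> cauchy_data ?N (sigma_tilde a)" unfolding cauchy_data_def by blast
qed

theorem theorem1:
  fixes a :: "real^'n \<Rightarrow> real^'n^'n"
  assumes dim: "CARD('n) \<ge> 3"
    and a_smooth: "\<exists>U. open U \<and> cball 0 1 \<subseteq> U \<and> (\<forall>j k. smooth_on U (\<lambda>x. a x $ j $ k))"
    and a_sym: "\<forall>x\<in>cball 0 1. transpose (a x) = a x"
    and a_bounds: "\<exists>c C. 0 < c \<and> 0 < C \<and> (\<forall>x\<in>cball 0 1. \<forall>\<xi>.
                     c * (norm \<xi>)\<^sup>2 \<le> \<xi> \<bullet> (a x *v \<xi>) \<and> \<xi> \<bullet> (a x *v \<xi>) \<le> C * (norm \<xi>)\<^sup>2)"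
  shows "cauchy_data (ball 0 2) (sigma_tilde a) = cauchy_data (ball 0 2) (\<lambda>x. mat 1)"
  using cauchy_data_subset_laplace[OF dim] laplace_subset_cauchy_data[OF dim] by (rule subset_antisym)

end
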